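(* Let $d\ge 2$, let $X=\Gamma\backslash G/K$ be a $d$-dimensional connected complete hyperbolic manifold of finite volume, and let $Y=\Gamma'\backslash G'/K'\subset X$ be a compact totally geodesic special cycle of codimension $1$ (all as described in the context), with fixed hyperbolic measure $dy$. For normalized Maass forms $\phi$ on $X$ with Laplace eigenvalue $\lambda$ and $\psi$ on $Y$ with Laplace eigenvalue $\mu$, write $\lambda=\left(\frac{d-1}{2}\right)^2-\tau^2$, $\mu=\left(\frac{d-2}{2}\right)^2-\tau'^2$; when $\lambda,\mu$ are large, $\tau,\tau'$ are purely imaginary. Let $P_Y(\phi,\psi)=\int_Y\phi(y)\psi(y)\,dy$. Then the following hold, where all constants may depend on $X,Y$ but not on $\phi,\psi$. (1) For every $D>0$ there exist $R,A>0$ (depending on $D$) such that, for all normalized Maass forms $\phi,\psi$ with $\tau,\tau'$ purely imaginary, $|\tau|,|\tau'|\ge R$ and $\big||\tau|-|\tau'|\big|<D$, $$|P_Y(\phi,\psi)|\le A\,|\tau|^{\frac d2-\frac34}.$$ (2) There exist $R,A>0$ such that, for all normalized Maass forms $\phi,\psi$ with $\tau,\tau'$ purely imaginary, $|\tau|,|\tau'|\ge R$, and $|\tau|-|\tau'|\ge R$, $$|P_Y(\phi,\psi)|\le A\,\frac{|\tau|^{\frac12}\,|\tau'|^{\frac{d-2}{2}}}{\big(|\tau|^2-|\tau'|^2\big)^{\frac14}}.$$ (3) For every $C>1$ there exist $R,A>0$ (depending on $C$) such that, for all normalized Maass forms $\phi,\psi$ with $\tau,\tau'$ purely imaginary, $|\tau|,|\tau'|\ge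 R$, $|\tau'|-|\tau|\ge R$ and $|\tau|<|\tau'|<C|\tau|$, $$|P_Y(\phi,\psi)|\le A\,\frac{|\tau|^{\frac12}\,|\tau'|^{\frac{d-2}{2}}}{\big(|\tau'|^2-|\tau|^2\big)^{\frac14}}\; e^{-\frac{\pi}{2}(|\tau'|-|\tau|)}.$$
   Context: Setting. $G=O(1,d)$, $K=\{\mathrm{diag}(\pm1,k): k\in O(d)\}$ is a maximal compact subgroup, so $G/K$ is hyperbolic $d$-space, and $\Gamma\subset G$ is a torsion-free lattice. $X=\Gamma\backslash G/K$; it is not assumed compact or orientable. Special cycle. $G'=\{\mathrm{diag}(g_1,g_2)\in G: g_1\in O(1,d-1),\ g_2=\pm1\}$, $K'=K\cap G'$, $\Gamma'=\Gamma\cap G'$. It is assumed that $\Gamma'$ is a uniform (cocompact) lattice in $G'$ and that the natural map $\Gamma'\backslash G'/K'\to\Gamma\backslash G/K$ is an embedding whose image is a totally geodesic submanifold of $X$; $Y$ is this image, identified with $\Gamma'\backslash G'/K'$. It is a compact hyperbolic manifold of dimension $d-1$ with $\pi_1(Y)\cong\Gamma'$ (for $d=2$ it is a closed geodesic). Maass forms. A Maass form on $X$ (resp. $Y$) is a square-integrable eigenfunction of the (nonnegative) hyperbolic Laplacian on $X$ (resp. $Y$); it is normalized if its $L^2$-norm is $1$. Maass forms are smooth, so the integral $P_Y(\phi,\psi)$ over the compact $Y$ converges. *)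

theory Defs
  imports "HOL-Analysis.Analysis" "HOL-Algebra.Coset"
begin

section \<open>The Lorentz group and its subgroups\<close>

text \<open>
  Coordinates on Minkowski space of signature \<open>(1, d)\<close> are indexed by \<open>'d option\<close>, where
  \<open>CARD('d) = d\<close>: \<open>None\<close> is the time coordinate and \<open>Some a\<close> are the spatial ones.
\<close>

type_synonym 'd lmat = "real ^ 'd option ^ 'd option"

definition minkowski :: "'d::finite lmat" where
  "minkowski = (\<chi> i j. if i = j then (if i = None then 1 else - 1) else 0)"

definition O1 :: "'d::finite lmat set" where
  "O1 = {g. transpose g ** minkowski ** g = minkowski}"

definition time_diag :: "real \<Rightarrow> real ^ 'd ^ 'd \<Rightarrow> 'd::finite lmat" where
  "time_diag e k = (\<chi> i j. case (i, j) of
       (None, None) \<Rightarrow> e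
     | (Some a, Some b) \<Rightarrow> k $ a $ b
     | _ \<Rightarrow> 0)"

definition K1 :: "'d::finite lmat set" where
  "K1 = {time_diag e k | e k. (e = 1 \<or> e = - 1) \<and> orthogonal_matrix k}"

text \<open>
  For \<open>'d = 'n option\<close> the index \<open>Some None\<close> is the last spatial coordinate of signature
  \<open>(1, d)\<close>; dropping it leaves \<open>None\<close> (time) and \<open>Some (Some a)\<close>, which \<open>drop_last\<close> identifies
  with the index set \<open>'n option\<close> of signature \<open>(1, d - 1)\<close>.
\<close>

definition drop_last :: "'n option option \<Rightarrow> 'n option" where
  "drop_last i = (case i of None \<Rightarrow> None | Some a \<Rightarrow> a)"

definition block_diag :: "'n::finite lmat \<Rightarrow> real \<Rightarrow> 'n option lmat" where
  "block_diag g e = (\<chi> i j.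
     if i = Some None \<or> j = Some None then (if i = j then e else 0)
     else g $ drop_last i $ drop_last j)"

definition cycle_group :: "'n::finite option lmat set" where
  "cycle_group = {block_diag g e | g e. g \<in> O1 \<and> (e = 1 \<or> e = - 1)}"


section \<open>Lattices\<close>

definition matrix_group :: "(real ^ 'i::finite ^ 'i) set \<Rightarrow> (real ^ 'i ^ 'i) monoid" where
  "matrix_group G = \<lparr>carrier = G, monoid.mult = (**), one = mat 1\<rparr>"

definition torsion_free :: "('a, 'b) monoid_scheme \<Rightarrow> 'a set \<Rightarrow> bool" where
  "torsion_free G H \<longleftrightarrow> (\<forall>x\<in>H. \<forall>n::nat. n > 0 \<longrightarrow> x [^]\<^bsub>G\<^esub> n = \<one>\<^bsub>G\<^esub> \<longrightarrow> x = \<one>\<^bsub>G\<^esub>)"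

text \<open>All groups considered here are unimodular, so Haar measure is taken to be two-sided.\<close>

definition haar_measure :: "(real ^ 'i::finite ^ 'i) set \<Rightarrow> (real ^ 'i ^ 'i) measure \<Rightarrow> bool" where
  "haar_measure G M \<longleftrightarrow>
     sets M = sets (restrict_space borel G) \<and>
     emeasure M G \<noteq> 0 \<and>
     (\<forall>C. compact C \<and> C \<subseteq> G \<longrightarrow> emeasure M C < \<infinity>) \<and>
     (\<forall>g\<in>G. \<forall>A\<in>sets M. emeasure M ((\<lambda>x. g ** x) ` A) = emeasure M A \<and>
                           emeasure M ((\<lambda>x. x ** g) ` A) = emeasure M A)"

definition lattice_in :: "(real ^ 'i::finite ^ 'i) set \<Rightarrow> (real ^ 'i ^ 'i) set \<Rightarrow> bool" where
  "lattice_in G \<Gamma> \<longleftrightarrow>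
     subgroup \<Gamma> (matrix_group G) \<and> discrete \<Gamma> \<and>
     (\<exists>M F. haar_measure G M \<and> F \<in> sets M \<and> \<Gamma> <#>\<^bsub>matrix_group G\<^esub> F = G \<and> emeasure M F < \<infinity>)"

definition uniform_lattice_in :: "(real ^ 'i::finite ^ 'i) set \<Rightarrow> (real ^ 'i ^ 'i) set \<Rightarrow> bool" where
  "uniform_lattice_in G \<Gamma> \<longleftrightarrow>
     lattice_in G \<Gamma> \<and> (\<exists>C. compact C \<and> C \<subseteq> G \<and> \<Gamma> <#>\<^bsub>matrix_group G\<^esub> C = G)"


section \<open>Double coset spaces\<close>

definition dcoset ::
  "(real ^ 'i::finite ^ 'i) set \<Rightarrow> (real ^ 'i ^ 'i) set \<Rightarrow> real ^ 'i ^ 'i \<Rightarrow> (real ^ 'i ^ 'i) set" where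
  "dcoset \<Gamma> K g = (\<Gamma> #>\<^bsub>matrix_group UNIV\<^esub> g) <#>\<^bsub>matrix_group UNIV\<^esub> K"

definition dcoset_topology ::
  "(real ^ 'i::finite ^ 'i) set \<Rightarrow> (real ^ 'i ^ 'i) set \<Rightarrow> (real ^ 'i ^ 'i) set
     \<Rightarrow> (real ^ 'i ^ 'i) set topology" where
  "dcoset_topology \<Gamma> G K = topology (\<lambda>U. U \<subseteq> dcoset \<Gamma> K ` G \<and>
     openin (top_of_set G) {g \<in> G. dcoset \<Gamma> K g \<in> U})"

lemma openin_dcoset_topology:
  "openin (dcoset_topology \<Gamma> G K) U \<longleftrightarrow>
     U \<subseteq> dcoset \<Gamma> K ` G \<and> openin (top_of_set G) {g \<in> G. dcoset \<Gamma> K g \<in> U}"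
proof -
  let ?P = "\<lambda>U. U \<subseteq> dcoset \<Gamma> K ` G \<and> openin (top_of_set G) {g \<in> G. dcoset \<Gamma> K g \<in> U}"
  have "istopology ?P"
    unfolding istopology_def
  proof (intro conjI allI impI)
    fix S T assume S: "?P S" and T: "?P T"
    then show "S \<inter> T \<subseteq> dcoset \<Gamma> K ` G" by blast
    have "{g \<in> G. dcoset \<Gamma> K g \<in> S \<inter> T} = {g \<in> G. dcoset \<Gamma> K g \<in> S} \<inter> {g \<in> G. dcoset \<Gamma> K g \<in> T}"
      by blast
    with S T show "openin (top_of_set G) {g \<in> G. dcoset \<Gamma> K g \<in> S \<inter> T}"
      by (simp add: openin_Int)
  next
    fix \<K> assume *: "\<forall>U\<in>\<K>. ?P U"
    then show "\<Union>\<K> \<subseteq> dcoset \<Gamma> K ` G" by blast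
    have "{g \<in> G. dcoset \<Gamma> K g \<in> \<Union>\<K>} = (\<Union>U\<in>\<K>. {g \<in> G. dcoset \<Gamma> K g \<in> U})"
      by blast
    moreover have "openin (top_of_set G) (\<Union>U\<in>\<K>. {g \<in> G. dcoset \<Gamma> K g \<in> U})"
      using * by (intro openin_Union) auto
    ultimately show "openin (top_of_set G) {g \<in> G. dcoset \<Gamma> K g \<in> \<Union>\<K>}"
      by simp
  qed
  then show ?thesis
    unfolding dcoset_topology_def by simp
qed


section \<open>Hyperbolic space and its quotients\<close>

text \<open>
  \<open>boost v\<close> is the symmetric positive definite element of \<open>O(1, d)\<close> whose first column is the point
  \<open>(sqrt (1 + |v|^2), v)\<close> of the upper sheet of the hyperboloid. By the Cartan decomposition,
  \<open>v \<mapsto> boost v ** K1\<close> is a global chart of hyperbolic space \<open>O(1, d) / K\<close>, in which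
  the hyperbolic measure (curvature \<open>-1\<close>) has density \<open>1 / sqrt (1 + |v|^2)\<close>.
\<close>

definition boost :: "real ^ 'd \<Rightarrow> 'd::finite lmat" where
  "boost v = (let c = sqrt (1 + (norm v)\<^sup>2) in \<chi> i j. case (i, j) of
       (None, None) \<Rightarrow> c
     | (None, Some b) \<Rightarrow> v $ b
     | (Some a, None) \<Rightarrow> v $ a
     | (Some a, Some b) \<Rightarrow> (if a = b then 1 else 0) + v $ a * v $ b / (1 + c))"

definition hyperbolic_measure :: "(real ^ 'd::finite) measure" where
  "hyperbolic_measure = density lborel (\<lambda>v. ennreal (1 / sqrt (1 + (norm v)\<^sup>2)))"

text \<open>
  A quotient of hyperbolic \<open>d\<close>-space is presented by a right \<open>K1\<close>-invariant projection
  \<open>p\<close> from \<open>O(1, d)\<close> onto it.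
\<close>

definition X_proj :: "'d::finite lmat set \<Rightarrow> 'd lmat \<Rightarrow> 'd lmat set" where
  "X_proj \<Gamma> g = dcoset \<Gamma> K1 g"

definition Y_proj :: "'n::finite option lmat set \<Rightarrow> 'n lmat \<Rightarrow> 'n option lmat set" where
  "Y_proj \<Gamma> g = dcoset (\<Gamma> \<inter> cycle_group) (K1 \<inter> cycle_group) (block_diag g 1)"

text \<open>The natural map sends the double coset of \<open>g \<in> cycle_group\<close> to \<open>\<Gamma> g K1\<close>.\<close>

definition natural_map :: "'n::finite option lmat set \<Rightarrow> 'n option lmat set \<Rightarrow> 'n option lmat set" where
  "natural_map \<Gamma> y = (\<Gamma> <#>\<^bsub>matrix_group UNIV\<^esub> y) <#>\<^bsub>matrix_group UNIV\<^esub> K1"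

text \<open>
  The measure induced by hyperbolic measure on the quotient by a discrete group acting freely: the
  volume of \<open>A\<close> is the largest volume of a Borel set which projects injectively into \<open>A\<close>, and it is
  attained by the part over \<open>A\<close> of any Borel fundamental domain.
\<close>

definition quotient_measure :: "('d::finite lmat \<Rightarrow> 'x) \<Rightarrow> 'x measure" where
  "quotient_measure p = measure_of (range (p \<circ> boost))
     {A. A \<subseteq> range (p \<circ> boost) \<and> (p \<circ> boost) -` A \<in> sets borel}
     (\<lambda>A. SUP B \<in> {B \<in> sets borel. inj_on (p \<circ> boost) B \<and> (p \<circ> boost) ` B \<subseteq> A}.
        emeasure hyperbolic_measure B)"

lemma
  fixes p :: "'d::finite lmat \<Rightarrow> 'x"
  defines "q \<equiv> p \<circ> boost"
  shows space_quotient_measure: "space (quotient_measure p) = range q"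
    and sets_quotient_measure:
      "sets (quotient_measure p) = {A. A \<subseteq> range q \<and> q -` A \<in> sets borel}"
    and emeasure_quotient_measure:
      "A \<subseteq> range q \<Longrightarrow> q -` A \<in> sets borel \<Longrightarrow> emeasure (quotient_measure p) A =
         (SUP B \<in> {B \<in> sets borel. inj_on q B \<and> q ` B \<subseteq> A}. emeasure hyperbolic_measure B)"
proof -
  let ?S = "{A. A \<subseteq> range q \<and> q -` A \<in> sets borel}"
  let ?F = "\<lambda>A. {B \<in> sets borel. inj_on q B \<and> q ` B \<subseteq> A}"
  let ?h = "hyperbolic_measure :: (real ^ 'd) measure"
  let ?m = "\<lambda>A. SUP B \<in> ?F A. emeasure ?h B"
  have sh: "sets ?h = sets borel"
    by (simp add: hyperbolic_measure_def)
  have sa: "sigma_algebra (range q) ?S"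
    unfolding sigma_algebra_iff2
  proof (intro conjI allI impI ballI)
    fix A assume A: "A \<in> ?S"
    have "q -` (range q - A) = UNIV - q -` A" by auto
    with A show "range q - A \<in> ?S" by auto
  next
    fix A :: "nat \<Rightarrow> 'x set" assume A: "range A \<subseteq> ?S"
    then have "q -` (\<Union>i. A i) \<in> sets borel"
      unfolding vimage_UN by (intro sets.countable_UN) auto
    with A show "(\<Union>i. A i) \<in> ?S" by auto
  qed auto
  have qm: "quotient_measure p = measure_of (range q) ?S ?m"
    unfolding quotient_measure_def q_def by simp
  show sp: "space (quotient_measure p) = range q"
    unfolding qm by (rule space_measure_of) auto
  show st: "sets (quotient_measure p) = ?S"
    unfolding qm using sa by (simp add: sigma_algebra.sets_measure_of_eq)
  have two: "?m A + ?m B \<le> ?m (A \<union> B)" if "A \<inter> B = {}" for A B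
  proof -
    have ne: "?F A \<noteq> {}" "?F B \<noteq> {}" by (auto intro!: exI[of _ "{}"])
    have "emeasure ?h U + emeasure ?h V \<le> ?m (A \<union> B)" if "U \<in> ?F A" "V \<in> ?F B" for U V
    proof -
      have "U \<inter> V = {}" using that \<open>A \<inter> B = {}\<close> by auto
      then have "emeasure ?h U + emeasure ?h V = emeasure ?h (U \<union> V)"
        using that sh by (intro plus_emeasure) auto
      also have "U \<union> V \<in> ?F (A \<union> B)"
        using that \<open>A \<inter> B = {}\<close> by (auto simp: inj_on_Un)
      then have "emeasure ?h (U \<union> V) \<le> ?m (A \<union> B)" by (rule SUP_upper)
      finally show ?thesis .
    qed
    then have "(SUP V\<in>?F B. emeasure ?h U + emeasure ?h V) \<le> ?m (A \<union> B)" if "U \<in> ?F A" for U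
      by (rule SUP_least[OF _]) (rule that)
    then have "emeasure ?h U + ?m B \<le> ?m (A \<union> B)" if "U \<in> ?F A" for U
      unfolding ennreal_SUP_add_right[OF ne(2)] by this (rule that)
    then have "(SUP U\<in>?F A. emeasure ?h U + ?m B) \<le> ?m (A \<union> B)"
      by (rule SUP_least)
    then show ?thesis
      unfolding ennreal_SUP_add_left[OF ne(1)] .
  qed
  have mono: "?m A \<le> ?m B" if "A \<subseteq> B" for A B
    using that by (intro SUP_subset_mono) auto
  have fin: "(\<Sum>i<n. ?m (A i)) \<le> ?m (\<Union>i<n. A i)"
    if dj: "disjoint_family A" for A :: "nat \<Rightarrow> 'x set" and n
  proof (induction n)
    case 0
    show ?case by (simp only: lessThan_0 sum.empty zero_le)
  next
    case (Suc n)
    have "A i \<inter> A n = {}" if "i < n" for i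
      using dj that by (intro disjoint_family_onD[of A UNIV]) auto
    then have d: "(\<Union>i<n. A i) \<inter> A n = {}" by blast
    have "(\<Sum>i<Suc n. ?m (A i)) \<le> ?m (\<Union>i<n. A i) + ?m (A n)"
      unfolding sum.lessThan_Suc by (rule add_right_mono) (rule Suc)
    also have "\<dots> \<le> ?m ((\<Union>i<n. A i) \<union> A n)" by (rule two) (rule d)
    also have "(\<Union>i<n. A i) \<union> A n = (\<Union>i<Suc n. A i)" by (simp add: lessThan_Suc Un_commute)
    finally show ?case .
  qed
  have ca: "countably_additive ?S ?m"
    unfolding countably_additive_def
  proof (intro allI impI)
    fix A :: "nat \<Rightarrow> 'x set"
    assume A: "range A \<subseteq> ?S" and dj: "disjoint_family A"
    have le: "(\<Sum>i. ?m (A i)) \<le> ?m (\<Union>i. A i)"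
    proof (rule suminf_le_const[OF summableI])
      show "(\<Sum>i<n. ?m (A i)) \<le> ?m (\<Union>i. A i)" for n
        by (rule order_trans[OF fin[OF dj] mono]) (rule UN_mono, rule subset_UNIV, rule subset_refl)
    qed
    have ge: "?m (\<Union>i. A i) \<le> (\<Sum>i. ?m (A i))"
    proof (rule SUP_least)
      fix B assume B: "B \<in> ?F (\<Union>i. A i)"
      define C where "C = (\<lambda>i. B \<inter> q -` A i)"
      have C: "C i \<in> ?F (A i)" for i
      proof -
        have "q -` A i \<in> sets borel" using A by blast
        moreover have "inj_on q (C i)" using B by (simp add: C_def inj_on_Int)
        moreover have "q ` C i \<subseteq> A i" by (auto simp: C_def)
        ultimately show ?thesis using B by (simp add: C_def sets.Int)
      qed
      have djC: "disjoint_family C"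
        using dj unfolding disjoint_family_on_def C_def by blast
      have "q ` B \<subseteq> (\<Union>i. A i)" using B by simp
      then have BC: "B = (\<Union>i. C i)" unfolding C_def by blast
      have "range C \<subseteq> sets ?h" using C sh by auto
      then have "emeasure ?h B = (\<Sum>i. emeasure ?h (C i))"
        unfolding BC using djC by (rule suminf_emeasure[symmetric])
      also have "\<dots> \<le> (\<Sum>i. ?m (A i))"
        by (rule suminf_le[OF _ summableI summableI]) (rule SUP_upper[OF C])
      finally show "emeasure ?h B \<le> (\<Sum>i. ?m (A i))" .
    qed
    show "(\<Sum>i. ?m (A i)) = ?m (\<Union>i. A i)"
      by (rule antisym[OF le ge])
  qed
  have "?m {} \<le> 0"
    by (rule SUP_least) simp
  then have pos: "positive ?S ?m"
    unfolding positive_def by (simp only: le_zero_eq)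
  show "emeasure (quotient_measure p) A = ?m A" if "A \<subseteq> range q" "q -` A \<in> sets borel"
  proof (rule emeasure_measure_of[OF qm])
    show "?S \<subseteq> Pow (range q)" by blast
    show "A \<in> sets (quotient_measure p)" unfolding st using that by blast
    show "positive (sets (quotient_measure p)) ?m" unfolding st by (rule pos)
    show "countably_additive (sets (quotient_measure p)) ?m" unfolding st by (rule ca)
  qed
qed

text \<open>
  The curves \<open>t \<mapsto> g ** boost (sinh t *\<^sub>R axis a 1)\<close>, for \<open>a\<close> ranging over the spatial coordinates,
  project to geodesics of unit speed through \<open>g K1\<close> with orthonormal initial velocities;
  \<open>boost (sinh t *\<^sub>R axis a 1)\<close> is the one-parameter group of boosts in direction \<open>a\<close>.
\<close>

definition laplacian :: "('d::finite lmat \<Rightarrow> complex) \<Rightarrow> 'd lmat \<Rightarrow> complex" where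
  "laplacian f g = - (\<Sum>a\<in>UNIV. vector_derivative
     (\<lambda>s. vector_derivative (\<lambda>t. f (g ** boost (sinh t *\<^sub>R axis a 1))) (at s)) (at 0))"


section \<open>Maass forms\<close>

primrec differentiable_upto :: "nat \<Rightarrow> ('a::real_normed_vector \<Rightarrow> 'b::real_normed_vector) \<Rightarrow> bool" where
  "differentiable_upto 0 f \<longleftrightarrow> continuous_on UNIV f"
| "differentiable_upto (Suc k) f \<longleftrightarrow> (\<forall>x. f differentiable at x) \<and>
     (\<forall>v. differentiable_upto k (\<lambda>x. frechet_derivative f (at x) v))"

definition smooth :: "('a::real_normed_vector \<Rightarrow> 'b::real_normed_vector) \<Rightarrow> bool" where
  "smooth f \<longleftrightarrow> (\<forall>k. differentiable_upto k f)"

definition maass_form :: "('d::finite lmat \<Rightarrow> 'x) \<Rightarrow> complex \<Rightarrow> ('x \<Rightarrow> complex) \<Rightarrow> bool" where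
  "maass_form p ev \<phi> \<longleftrightarrow>
     smooth (\<lambda>v. \<phi> (p (boost v))) \<and>
     integrable (quotient_measure p) (\<lambda>x. (cmod (\<phi> x))\<^sup>2) \<and>
     (\<forall>g\<in>O1. laplacian (\<lambda>h. \<phi> (p h)) g = ev * \<phi> (p g))"

definition L2_norm :: "'x measure \<Rightarrow> ('x \<Rightarrow> complex) \<Rightarrow> real" where
  "L2_norm M \<phi> = sqrt (LINT x|M. (cmod (\<phi> x))\<^sup>2)"

definition normalized_maass_form :: "('d::finite lmat \<Rightarrow> 'x) \<Rightarrow> complex \<Rightarrow> ('x \<Rightarrow> complex) \<Rightarrow> bool" where
  "normalized_maass_form p ev \<phi> \<longleftrightarrow> maass_form p ev \<phi> \<and> L2_norm (quotient_measure p) \<phi> = 1"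

definition period :: "'n::finite option lmat set \<Rightarrow> ('n option lmat set \<Rightarrow> complex)
     \<Rightarrow> ('n option lmat set \<Rightarrow> complex) \<Rightarrow> complex" where
  "period \<Gamma> \<phi> \<psi> = (LINT y|quotient_measure (Y_proj \<Gamma>). \<phi> (natural_map \<Gamma> y) * \<psi> y)"

end

theory Submission
  imports Defs
begin

text \<open>
  Let \<open>n = d - 1\<close>, \<open>r = |\<tau>|\<close>, \<open>s = |\<tau>'|\<close>. In Fermi coordinates \<open>(w, t)\<close> along the
  totally geodesic hyperplane covering \<open>Y\<close>, average \<open>\<phi>\<close> over \<open>\<plusminus>t\<close>; this makes it invariant under the
  full stabilizer \<open>\<Gamma>'\<close>, also where that exchanges the two sides. Pairing the average with \<open>\<psi>\<close>
  over \<open>Y\<close> gives a function \<open>U(t)\<close> with \<open>U(0) = P_Y(\<phi>, \<psi>)\<close> and \<open>U'(0) = 0\<close>. Separation of variables and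
  self-adjointness of the Laplacian of \<open>Y\<close> show that \<open>V = cosh(t)^(n/2) U\<close> satisfies
  \<open>V'' = ((s^2 + 1/4) sech(t)^2 - r^2) V\<close>. As a tube around the hyperplane over a fundamental domain
  covers \<open>X\<close> with bounded multiplicity, Cauchy--Schwarz bounds the integral of \<open>V^2\<close> over \<open>[0, T]\<close>
  by a constant. It remains to bound that integral from below by \<open>V(0)^2\<close>: with
  \<open>p^2 = |(s^2 + 1/4) sech(t)^2 - r^2|\<close>, the adiabatic invariant \<open>p V^2 + V'^2 / p\<close> is almost constant
  in the oscillatory zone, while for \<open>s > r\<close> the solution first grows through a barrier, by a factor
  of about \<open>exp(\<pi> (s - r) / 2)\<close>.

  Self-adjointness is obtained without Stokes' theorem: the average over a small ball is a
  symmetric operator on the quotient, by unfolding, and it approximates the Laplacian to second order.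
\<close>

section \<open>The reduced radial equation\<close>

text \<open>All that is known of the profile is its mass on a bounded interval, so everything rests
  on lower bounds for that mass which are uniform in both parameters. The obstacle is the turning
  point, where \<open>sech(t)^2 = r^2 / (s^2 + 1/4)\<close>: there \<open>p\<close> vanishes and
  adiabatic invariance fails. A window on the Airy scale is cut out around it, with
  \<open>p \<ge> p1\<close> outside and length at most a constant over \<open>p1\<close>; a Gronwall
  bound with frozen \<open>p1\<close> crosses it at bounded cost. The barrier integral up to the
  turning point is elementary, exactly \<open>pi / 2 * (sqrt (s^2 + 1/4) - r)\<close>, and fixes the
  exponential rate. The condition \<open>s < C * r\<close> keeps the turning point at bounded
  distance from the cycle, so one tube length serves all forms. The profile yields powers that do
  not depend on the dimension: \<open>|\<tau>|^(1/4)\<close> in the transition range and no power of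
  \<open>|\<tau>'|\<close> in the other two. The powers with \<open>d\<close> in the statement enter
  at the very end, through factors that are at least 1. The manifold \<open>X\<close> may be
  non-compact. It is never cut into a fundamental domain: its measure is a supremum over injective
  sets, which is already the inequality that the tube estimate needs.\<close>

lemma nondecreasing_if_deriv_nonneg:
  fixes f :: "real \<Rightarrow> real"
  assumes "a \<le> b" and "\<And>x. a \<le> x \<Longrightarrow> x \<le> b \<Longrightarrow> (f has_real_derivative f' x) (at x)"
    and "\<And>x. a \<le> x \<Longrightarrow> x \<le> b \<Longrightarrow> f' x \<ge> 0"
  shows "f a \<le> f b"
  using DERIV_nonneg_imp_nondecreasing[of a b f] assms by blast

section \<open>Action, WKB growth and Gronwall bounds for second-order equations\<close>

definition adiabatic :: "real \<Rightarrow> real \<Rightarrow> real \<Rightarrow> real" where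
  "adiabatic p v w = p * v\<^sup>2 + w\<^sup>2 / p"

lemma adiabatic_nonneg: "p > 0 \<Longrightarrow> adiabatic p v w \<ge> 0"
  by (simp add: adiabatic_def)

lemma abs_mult_le_adiabatic:
  assumes "p > 0"
  shows "\<bar>v * w\<bar> \<le> adiabatic p v w / 2"
proof -
  have 1: "0 \<le> (p * v - w)\<^sup>2 / p" "0 \<le> (p * v + w)\<^sup>2 / p"
    using assms by simp_all
  have 2: "(p * v - w)\<^sup>2 / p = adiabatic p v w - 2 * (v * w)"
    using assms by (simp add: adiabatic_def power2_eq_square field_simps)
  have 3: "(p * v + w)\<^sup>2 / p = adiabatic p v w + 2 * (v * w)"
    using assms by (simp add: adiabatic_def power2_eq_square field_simps)
  show ?thesis
    using 1 2 3 by linarith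
qed

text \<open>Along \<open>v'' = - p^2 v\<close> with \<open>p' = g * p^2\<close>, the action
  \<open>adiabatic p v w\<close> (twice the energy over the frequency) has derivative
  \<open>- g\<close> times that of \<open>v * w\<close>. Adding \<open>g * v * w\<close> leaves the
  single term \<open>g' * v * w\<close>, so only the variation of \<open>g\<close>, controlled by
  \<open>H\<close>, matters and not its effect summed over many oscillations. The factor 5 is
  \<open>3 * (5/4) / (3/4)\<close>.\<close>

lemma adiabatic_invariance:
  fixes v w p g H g' H' :: "real \<Rightarrow> real"
  assumes le: "t1 \<le> t2"
    and v: "\<And>t. t1 \<le> t \<Longrightarrow> t \<le> t2 \<Longrightarrow> (v has_real_derivative w t) (at t)"
    and w: "\<And>t. t1 \<le> t \<Longrightarrow> t \<le> t2 \<Longrightarrow> (w has_real_derivative - (p t)\<^sup>2 * v t) (at t)"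
    and p: "\<And>t. t1 \<le> t \<Longrightarrow> t \<le> t2 \<Longrightarrow> p t > 0"
    and dp: "\<And>t. t1 \<le> t \<Longrightarrow> t \<le> t2 \<Longrightarrow> (p has_real_derivative g t * (p t)\<^sup>2) (at t)"
    and dg: "\<And>t. t1 \<le> t \<Longrightarrow> t \<le> t2 \<Longrightarrow> (g has_real_derivative g' t) (at t)"
    and dH: "\<And>t. t1 \<le> t \<Longrightarrow> t \<le> t2 \<Longrightarrow> (H has_real_derivative H' t) (at t)"
    and g: "\<And>t. t1 \<le> t \<Longrightarrow> t \<le> t2 \<Longrightarrow> \<bar>g t\<bar> \<le> 1 / 2"
    and g': "\<And>t. t1 \<le> t \<Longrightarrow> t \<le> t2 \<Longrightarrow> \<bar>g' t\<bar> \<le> H' t"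
    and H: "H t2 - H t1 \<le> 1"
  shows "adiabatic (p t1) (v t1) (w t1) \<le> 5 * adiabatic (p t2) (v t2) (w t2)"
    and "adiabatic (p t2) (v t2) (w t2) \<le> 5 * adiabatic (p t1) (v t1) (w t1)"
proof -
  define F where "F t = adiabatic (p t) (v t) (w t)" for t
  define F2 where "F2 t = F t + g t * v t * w t" for t
  have F2b: "3/4 * F t \<le> F2 t \<and> F2 t \<le> 5/4 * F t \<and> \<bar>v t * w t\<bar> \<le> F t / 2 \<and> F t \<ge> 0"
    if "t1 \<le> t" "t \<le> t2" for t
  proof -
    have vw: "\<bar>v t * w t\<bar> \<le> F t / 2"
      unfolding F_def by (rule abs_mult_le_adiabatic) (use p that in auto)
    have "\<bar>g t * (v t * w t)\<bar> \<le> (1/2) * (F t / 2)"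
      unfolding abs_mult using g[OF that] vw by (intro mult_mono) (auto simp: abs_mult)
    moreover have "F t \<ge> 0"
      unfolding F_def by (rule adiabatic_nonneg) (use p that in auto)
    ultimately show ?thesis
      using vw unfolding F2_def by (auto simp: mult.assoc abs_le_iff)
  qed
  have dF2: "(F2 has_real_derivative g' t * (v t * w t)) (at t)" if "t1 \<le> t" "t \<le> t2" for t
    unfolding F2_def F_def adiabatic_def
    using p[OF that] by (auto intro!: derivative_eq_intros v[OF that] w[OF that] dp[OF that] dg[OF that] simp: field_simps power2_eq_square)
  have F2': "\<bar>g' t * (v t * w t)\<bar> \<le> H' t * F2 t" if "t1 \<le> t" "t \<le> t2" for t
  proof -
    have "\<bar>g' t * (v t * w t)\<bar> \<le> H' t * (F t / 2)"
      unfolding abs_mult using g'[OF that] F2b[OF that]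
      by (intro mult_mono) (auto simp: abs_mult intro: order_trans[OF abs_ge_zero])
    also have "\<dots> \<le> H' t * F2 t"
      using F2b[OF that] order_trans[OF abs_ge_zero g'[OF that]] by (intro mult_left_mono) auto
    finally show ?thesis .
  qed
  have up: "F2 t1 * exp (H t1) \<le> F2 t2 * exp (H t2)"
  proof (rule nondecreasing_if_deriv_nonneg[OF le])
    fix t assume t: "t1 \<le> t" "t \<le> t2"
    show "((\<lambda>t. F2 t * exp (H t)) has_real_derivative
      (g' t * (v t * w t) + H' t * F2 t) * exp (H t)) (at t)"
      by (rule derivative_eq_intros dF2[OF t] dH[OF t] refl)+ (simp add: algebra_simps)
    show "(g' t * (v t * w t) + H' t * F2 t) * exp (H t) \<ge> 0"
      using F2'[OF t] by (intro mult_nonneg_nonneg) (auto simp: abs_le_iff)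
  qed
  have down: "- (F2 t1 * exp (- H t1)) \<le> - (F2 t2 * exp (- H t2))"
  proof (rule nondecreasing_if_deriv_nonneg[OF le])
    fix t assume t: "t1 \<le> t" "t \<le> t2"
    show "((\<lambda>t. - (F2 t * exp (- H t))) has_real_derivative
      (H' t * F2 t - g' t * (v t * w t)) * exp (- H t)) (at t)"
      by (rule derivative_eq_intros dF2[OF t] dH[OF t] refl)+ (simp add: algebra_simps)
    show "(H' t * F2 t - g' t * (v t * w t)) * exp (- H t) \<ge> 0"
      using F2'[OF t] by (intro mult_nonneg_nonneg) (auto simp: abs_le_iff)
  qed
  have e: "exp (H t2 - H t1) \<le> 3"
    using H exp_le order_trans exp_le_cancel_iff by blast
  have b1: "3/4 * F t1 \<le> F2 t1" "F2 t1 \<le> 5/4 * F t1" "0 \<le> F t1"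
    using F2b[of t1] le by auto
  have b2: "3/4 * F t2 \<le> F2 t2" "F2 t2 \<le> 5/4 * F t2" "0 \<le> F t2"
    using F2b[of t2] le by auto
  have "F2 t1 \<le> F2 t2 * exp (H t2 - H t1)"
    using up by (simp add: exp_diff field_simps)
  also have "\<dots> \<le> F2 t2 * 3" using e b2 by (intro mult_left_mono) auto
  finally show "adiabatic (p t1) (v t1) (w t1) \<le> 5 * adiabatic (p t2) (v t2) (w t2)"
    using b1 b2 unfolding F_def by linarith
  have "F2 t2 \<le> F2 t1 * exp (H t2 - H t1)"
    using down by (simp add: exp_diff exp_minus field_simps)
  also have "\<dots> \<le> F2 t1 * 3" using e b1 by (intro mult_left_mono) auto
  finally show "adiabatic (p t2) (v t2) (w t2) \<le> 5 * adiabatic (p t1) (v t1) (w t1)"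
    using b1 b2 unfolding F_def by linarith
qed

text \<open>On average half of the energy is potential: \<open>v^2\<close> equals
  \<open>adiabatic / (2 * p)\<close> up to the derivative of \<open>A = v * w / (2 * p^2)\<close>
  and an error of order \<open>g / p\<close>. Both corrections carry one more power of
  \<open>1 / r\<close> than the main term, so for \<open>r \<ge> 200 + 100 * K\<close> they use up
  at most half of \<open>m / (2 * r)\<close>.\<close>

lemma oscillation_mass:
  fixes v w p g :: "real \<Rightarrow> real"
  assumes v: "\<And>t. a \<le> t \<Longrightarrow> t \<le> a + 1 \<Longrightarrow> (v has_real_derivative w t) (at t)"
    and w: "\<And>t. a \<le> t \<Longrightarrow> t \<le> a + 1 \<Longrightarrow> (w has_real_derivative - (p t)\<^sup>2 * v t) (at t)"
    and p: "\<And>t. a \<le> t \<Longrightarrow> t \<le> a + 1 \<Longrightarrow> r / 2 \<le> p t \<and> p t \<le> r"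
    and dp: "\<And>t. a \<le> t \<Longrightarrow> t \<le> a + 1 \<Longrightarrow> (p has_real_derivative g t * (p t)\<^sup>2) (at t)"
    and g: "\<And>t. a \<le> t \<Longrightarrow> t \<le> a + 1 \<Longrightarrow> \<bar>g t\<bar> \<le> K / r"
    and F: "\<And>t. a \<le> t \<Longrightarrow> t \<le> a + 1 \<Longrightarrow> m \<le> adiabatic (p t) (v t) (w t) \<and> adiabatic (p t) (v t) (w t) \<le> 25 * m"
    and r: "r > 0" "r \<ge> 200 + 100 * K"
  shows "m / (4 * r) \<le> integral {a..a+1} (\<lambda>t. (v t)\<^sup>2)"
proof -
  define A where "A t = v t * w t / (2 * (p t)\<^sup>2)" for t
  define A' where "A' t = ((w t)\<^sup>2 - (p t)\<^sup>2 * (v t)\<^sup>2) / (2 * (p t)\<^sup>2) - v t * w t * g t / p t" for t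
  have p0: "p t > 0" if "a \<le> t" "t \<le> a + 1" for t
    using p[OF that] r by linarith
  have dA: "(A has_real_derivative A' t) (at t)" if "a \<le> t" "t \<le> a + 1" for t
    unfolding A_def A'_def
    using p0[OF that] by (auto intro!: derivative_eq_intros v[OF that] w[OF that] dp[OF that] simp: field_simps power2_eq_square)
  have m: "m \<ge> 0"
    using F[of a] adiabatic_nonneg[OF p0[of a], of "v a" "w a"] by auto
  have vw: "\<bar>v t * w t\<bar> \<le> 25 * m / 2" if "a \<le> t" "t \<le> a + 1" for t
    using abs_mult_le_adiabatic[OF p0[OF that], of "v t" "w t"] F[OF that] by linarith
  have Ab: "\<bar>A t\<bar> \<le> 25 * m / r\<^sup>2" if "a \<le> t" "t \<le> a + 1" for t
  proof -
    have p2: "r\<^sup>2 / 4 \<le> (p t)\<^sup>2"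
      using power_mono[of "r/2" "p t" 2] p[OF that] r by (simp add: power_divide)
    have "\<bar>A t\<bar> \<le> (25 * m / 2) / (2 * (p t)\<^sup>2)"
      unfolding A_def abs_divide using vw[OF that] p0[OF that] by (intro frac_le) auto
    also have "\<dots> \<le> (25 * m / 2) / (2 * (r\<^sup>2 / 4))"
      using p2 r m by (intro divide_left_mono) (auto intro!: mult_pos_pos p0[OF that] zero_less_power)
    finally show ?thesis by (simp add: field_simps)
  qed
  have low: "m / (2 * r) - 25 * K * m / r\<^sup>2 \<le> (v t)\<^sup>2 + A' t" if "a \<le> t" "t \<le> a + 1" for t
  proof -
    have pp: "0 < p t" "p t \<le> r" "r / 2 \<le> p t" using p0[OF that] p[OF that] by auto
    have "(v t)\<^sup>2 + A' t = adiabatic (p t) (v t) (w t) / (2 * p t) - v t * w t * g t / p t"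
      unfolding A'_def adiabatic_def using pp by (simp add: field_simps power2_eq_square)
    moreover have "m / (2 * r) \<le> adiabatic (p t) (v t) (w t) / (2 * p t)"
      using F[OF that] pp m by (intro frac_le) auto
    moreover have "v t * w t * g t / p t \<le> (25 * m / 2) * (K / r) / (r / 2)"
      apply (rule order_trans[OF abs_ge_self])
      unfolding abs_divide abs_mult[of "v t * w t"] using vw[OF that] g[OF that] pp r m
      by (intro frac_le mult_mono mult_nonneg_nonneg) (auto intro: order_trans[OF abs_ge_zero])
    moreover have "(25 * m / 2) * (K / r) / (r / 2) = 25 * K * m / r\<^sup>2"
      by (simp add: power2_eq_square)
    ultimately show ?thesis by linarith
  qed
  have cv: "continuous_on {a..a+1} v"
    by (rule DERIV_continuous_on[of _ _ w]) (auto intro!: has_field_derivative_at_within[OF v])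
  have i1: "((\<lambda>t. (v t)\<^sup>2) has_integral integral {a..a+1} (\<lambda>t. (v t)\<^sup>2)) {a..a+1}"
    by (intro integrable_integral integrable_continuous_real continuous_intros cv)
  have i2: "(A' has_integral (A (a+1) - A a)) {a..a+1}"
    by (rule fundamental_theorem_of_calculus, simp,
        simp only: has_real_derivative_iff_has_vector_derivative[symmetric])
      (rule has_field_derivative_at_within, rule dA, simp_all)
  have i3: "((\<lambda>t. m / (2 * r) - 25 * K * m / r\<^sup>2) has_integral (m / (2 * r) - 25 * K * m / r\<^sup>2)) {a..a+1}"
    using has_integral_const_real[of "m / (2 * r) - 25 * K * m / r\<^sup>2" a "a+1"] by simp
  have "m / (2 * r) - 25 * K * m / r\<^sup>2 \<le> integral {a..a+1} (\<lambda>t. (v t)\<^sup>2) + (A (a+1) - A a)"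
    by (rule has_integral_le[OF i3 has_integral_add[OF i1 i2]]) (use low in auto)
  moreover have "A (a+1) - A a \<le> 50 * m / r\<^sup>2"
    using Ab[of a] Ab[of "a+1"] by (auto simp: abs_le_iff)
  moreover have "(50 + 25 * K) * m / r\<^sup>2 \<le> m / (4 * r)"
  proof -
    have "(200 + 100 * K) * m \<le> r * m" using r m by (intro mult_right_mono) auto
    then have "(200 + 100 * K) * m / (4 * r\<^sup>2) \<le> r * m / (4 * r\<^sup>2)"
      by (rule divide_right_mono) simp
    then show ?thesis using r by (simp add: field_simps power2_eq_square)
  qed
  moreover have "m / (2 * r) = m / (4 * r) + m / (4 * r)" by simp
  moreover have "(50 + 25 * K) * m / r\<^sup>2 = 50 * m / r\<^sup>2 + 25 * K * m / r\<^sup>2"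
    by (simp add: add_divide_distrib distrib_right)
  ultimately show ?thesis
    by linarith
qed

text \<open>\<open>p * v + w\<close> and \<open>p * v - w\<close> are the growing and the decaying
  WKB component, coupled through \<open>g * p / 2\<close>. The correction \<open>g / 4\<close> in
  \<open>Y\<close> cancels the coupling in the growing equation to first order and leaves terms in
  \<open>g'\<close> and \<open>g^2\<close>. Dividing \<open>Y^2\<close> by
  \<open>p * exp (2 * S)\<close> removes the WKB growth, \<open>exp (- g)\<close> absorbs the
  \<open>g'\<close> term because \<open>g' \<le> 0\<close>, and the \<open>g^2\<close> term has the
  right sign.\<close>

lemma wkb_growth:
  fixes v w p g S g' :: "real \<Rightarrow> real"
  assumes le: "0 \<le> t1"
    and v: "\<And>t. 0 \<le> t \<Longrightarrow> t \<le> t1 \<Longrightarrow> (v has_real_derivative w t) (at t)"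
    and w: "\<And>t. 0 \<le> t \<Longrightarrow> t \<le> t1 \<Longrightarrow> (w has_real_derivative (p t)\<^sup>2 * v t) (at t)"
    and v0: "v 0 > 0" and w0: "w 0 = 0"
    and p: "\<And>t. 0 \<le> t \<Longrightarrow> t \<le> t1 \<Longrightarrow> p t > 0"
    and dp: "\<And>t. 0 \<le> t \<Longrightarrow> t \<le> t1 \<Longrightarrow> (p has_real_derivative g t * (p t)\<^sup>2) (at t)"
    and dg: "\<And>t. 0 \<le> t \<Longrightarrow> t \<le> t1 \<Longrightarrow> (g has_real_derivative g' t) (at t)"
    and dS: "\<And>t. 0 \<le> t \<Longrightarrow> t \<le> t1 \<Longrightarrow> (S has_real_derivative p t) (at t)"
    and g: "\<And>t. 0 \<le> t \<Longrightarrow> t \<le> t1 \<Longrightarrow> \<bar>g t\<bar> \<le> 1 / 2"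
    and g': "\<And>t. 0 \<le> t \<Longrightarrow> t \<le> t1 \<Longrightarrow> g' t \<le> 0"
    and g0: "g 0 = 0" and S0: "S 0 = 0"
  shows "p 0 * (v 0)\<^sup>2 * exp (2 * S t1) \<le> 9 * adiabatic (p t1) (v t1) (w t1)"
proof -
  \<comment> \<open>The solution starts in the cone \<open>v > 0\<close>, \<open>w \<ge> 0\<close>
    and stays there: first \<open>v * w\<close>, then \<open>v^2\<close> is nondecreasing, so
    \<open>v\<close> cannot reach 0.\<close>
  have vw: "v t * w t \<ge> 0" if "0 \<le> t" "t \<le> t1" for t
  proof -
    have "v 0 * w 0 \<le> v t * w t"
    proof (rule nondecreasing_if_deriv_nonneg[OF that(1)])
      fix x assume x: "0 \<le> x" "x \<le> t"
      show "((\<lambda>t. v t * w t) has_real_derivative (w x)\<^sup>2 + (p x * v x)\<^sup>2) (at x)"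
        using x that by (auto intro!: derivative_eq_intros v w simp: power2_eq_square)
    qed auto
    then show ?thesis using w0 by simp
  qed
  have vge: "(v t)\<^sup>2 \<ge> (v 0)\<^sup>2" if "0 \<le> t" "t \<le> t1" for t
  proof (rule nondecreasing_if_deriv_nonneg[OF that(1)])
    fix x assume x: "0 \<le> x" "x \<le> t"
    show "((\<lambda>t. (v t)\<^sup>2) has_real_derivative 2 * (v x * w x)) (at x)"
      by (rule derivative_eq_intros v refl)+ (use x that in \<open>auto\<close>)
    show "2 * (v x * w x) \<ge> 0" using vw[of x] x that by auto
  qed
  have vpos: "v t > 0" if "0 \<le> t" "t \<le> t1" for t
  proof (rule ccontr)
    assume "\<not> v t > 0"
    have "\<exists>x\<ge>0. x \<le> t \<and> v x = 0"
    proof (rule IVT2)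
      show "v t \<le> 0" "0 \<le> v 0" "0 \<le> t" using \<open>\<not> v t > 0\<close> v0 that by auto
      show "\<forall>x. 0 \<le> x \<and> x \<le> t \<longrightarrow> isCont v x"
        using v that DERIV_isCont by (meson order_trans)
    qed
    then obtain x where "0 \<le> x" "x \<le> t" "v x = 0" by blast
    then show False using vge[of x] that v0 by auto
  qed
  have wpos: "w t \<ge> 0" if "0 \<le> t" "t \<le> t1" for t
    using vw[OF that] vpos[OF that] by (simp add: zero_le_mult_iff)
  define Y where "Y t = (p t * v t + w t) + g t / 4 * (p t * v t - w t)" for t
  define Y' where "Y' t = (p t + g t * p t / 2) * Y t + g' t * (p t * v t - w t) / 4
      + (g t)\<^sup>2 * p t * (p t * v t + w t) / 8" for t
  have dY: "(Y has_real_derivative Y' t) (at t)" if "0 \<le> t" "t \<le> t1" for t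
    unfolding Y_def Y'_def
    by (auto intro!: derivative_eq_intros v[OF that] w[OF that] dp[OF that] dg[OF that] simp: field_simps power2_eq_square)
  have Yb: "Y t \<ge> (p t * v t + w t) / 2 \<and> Y t \<le> 9/8 * (p t * v t + w t)
     \<and> \<bar>p t * v t - w t\<bar> \<le> p t * v t + w t" if "0 \<le> t" "t \<le> t1" for t
  proof -
    have W: "\<bar>p t * v t - w t\<bar> \<le> p t * v t + w t"
      using p[OF that] vpos[OF that] wpos[OF that] by (auto simp: abs_le_iff)
    have "\<bar>g t / 4 * (p t * v t - w t)\<bar> \<le> (1/2) / 4 * (p t * v t + w t)"
      unfolding abs_mult using W g[OF that] by (intro mult_mono) auto
    moreover have "p t * v t + w t \<ge> 0" using W by linarith
    ultimately show ?thesis using W unfolding Y_def by (auto simp: abs_le_iff)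
  qed
  define E where "E t = Y t ^ 2 / p t * exp (- (2 * S t + g t))" for t
  have "E 0 \<le> E t1"
  proof (rule nondecreasing_if_deriv_nonneg[OF le])
    fix t assume t: "0 \<le> t" "t \<le> t1"
    have Y0: "Y t \<ge> 0" using Yb[OF t] by linarith
    define D where "D = 2 * Y' t - (2 * p t + g t * p t + g' t) * Y t"
    show "(E has_real_derivative Y t / p t * D * exp (- (2 * S t + g t))) (at t)"
      unfolding E_def D_def
      using p[OF t] by (auto intro!: derivative_eq_intros dY[OF t] dp[OF t] dg[OF t] dS[OF t] simp: field_simps power2_eq_square)
    have "g' t * (p t * v t - w t) / 4 \<ge> g' t * Y t / 2"
    proof -
      have "p t * v t - w t \<le> 2 * Y t" using Yb[OF t] by (auto simp: abs_le_iff)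
      then have "g' t * (2 * Y t) \<le> g' t * (p t * v t - w t)"
        using g'[OF t] by (rule mult_left_mono_neg)
      then show ?thesis by (simp add: algebra_simps)
    qed
    moreover have "(g t)\<^sup>2 * p t * (p t * v t + w t) / 8 \<ge> 0"
      using p[OF t] Yb[OF t] by (intro divide_nonneg_nonneg mult_nonneg_nonneg) auto
    moreover have "D = 2 * (g' t * (p t * v t - w t) / 4 - g' t * Y t / 2
        + (g t)\<^sup>2 * p t * (p t * v t + w t) / 8)"
      unfolding D_def Y'_def by (simp add: field_simps)
    moreover have "\<lbrakk>y \<le> x; 0 \<le> z; D = 2 * (x - y + z)\<rbrakk> \<Longrightarrow> 0 \<le> D" for x y z :: real
      by simp
    ultimately have "D \<ge> 0"
      by blast
    then show "Y t / p t * D * exp (- (2 * S t + g t)) \<ge> 0"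
      using Y0 p[OF t] by simp
  qed
  moreover have "E 0 = p 0 * (v 0)\<^sup>2"
    using p[of 0] le by (simp add: E_def Y_def g0 S0 w0 power2_eq_square)
  \<comment> \<open>The 9 is \<open>3 * 3\<close>: one factor from \<open>2 * 81/64 \<le> 3\<close>,
    where \<open>9/8\<close> bounds \<open>Y\<close> by \<open>p * v + w\<close>, the other from
    \<open>exp (- g)\<close>.\<close>
  moreover have "E t1 \<le> 9 * adiabatic (p t1) (v t1) (w t1) * exp (- (2 * S t1))"
  proof -
    let ?p = "p t1" and ?v = "v t1" and ?w = "w t1"
    have t: "0 \<le> t1" "t1 \<le> t1" using le by auto
    have "(Y t1)\<^sup>2 \<le> (9/8 * (?p * ?v + ?w))\<^sup>2"
      using Yb[OF t] by (intro power_mono) auto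
    also have "\<dots> \<le> 3 * ((?p * ?v)\<^sup>2 + ?w\<^sup>2)"
    proof -
      have "(?p * ?v + ?w)\<^sup>2 \<le> 2 * ((?p * ?v)\<^sup>2 + ?w\<^sup>2)"
        using zero_le_power2[of "?p * ?v - ?w"] by (simp add: power2_sum power2_diff)
      moreover have "0 \<le> (?p * ?v)\<^sup>2 + ?w\<^sup>2" by simp
      moreover have "(9/8 * X)\<^sup>2 = 81/64 * X\<^sup>2" for X :: real
        by (simp add: power2_eq_square)
      moreover have "\<lbrakk>X \<le> 2 * Y; 0 \<le> Y; Z = 81/64 * X\<rbrakk> \<Longrightarrow> Z \<le> 3 * Y" for X Y Z :: real
        by linarith
      ultimately show ?thesis by blast
    qed
    also have "\<dots> = 3 * (adiabatic ?p ?v ?w * ?p)"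
      using p[OF t] by (simp add: adiabatic_def field_simps power2_eq_square)
    finally have "(Y t1)\<^sup>2 / ?p \<le> 3 * adiabatic ?p ?v ?w"
      using p[OF t] by (simp add: field_simps)
    moreover have "exp (- g t1) \<le> 3"
    proof -
      have "- g t1 \<le> 1" using g[OF t] by (auto simp: abs_le_iff)
      then show ?thesis using exp_le order_trans exp_le_cancel_iff by blast
    qed
    ultimately have "(Y t1)\<^sup>2 / ?p * exp (- g t1) \<le> 3 * adiabatic ?p ?v ?w * 3"
      using adiabatic_nonneg[OF p[OF t]] by (intro mult_mono) auto
    then have "(Y t1)\<^sup>2 / ?p * exp (- g t1) * exp (- (2 * S t1)) \<le> 3 * adiabatic ?p ?v ?w * 3 * exp (- (2 * S t1))"
      by (rule mult_right_mono) simp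
    then show ?thesis by (simp add: E_def exp_diff exp_minus field_simps)
  qed
  ultimately have "p 0 * (v 0)\<^sup>2 \<le> 9 * adiabatic (p t1) (v t1) (w t1) * exp (- (2 * S t1))"
    by linarith
  then have "p 0 * (v 0)\<^sup>2 * exp (2 * S t1) \<le> 9 * adiabatic (p t1) (v t1) (w t1) * exp (- (2 * S t1)) * exp (2 * S t1)"
    by (rule mult_right_mono) simp
  then show ?thesis by (simp add: mult.assoc exp_add[symmetric])
qed

text \<open>With \<open>p\<close> frozen at a bound for the true frequency, the action changes at
  relative rate at most \<open>2 * p\<close>. Nothing is assumed on the sign of \<open>Q\<close>, so
  the estimate survives a zero of \<open>Q\<close>; it serves across the turning point, where no WKB
  form is available.\<close>

lemma gronwall_adiabatic:
  fixes v w Q :: "real \<Rightarrow> real"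
  assumes le: "t1 \<le> t2" and p: "p > 0"
    and v: "\<And>t. t1 \<le> t \<Longrightarrow> t \<le> t2 \<Longrightarrow> (v has_real_derivative w t) (at t)"
    and w: "\<And>t. t1 \<le> t \<Longrightarrow> t \<le> t2 \<Longrightarrow> (w has_real_derivative Q t * v t) (at t)"
    and Q: "\<And>t. t1 \<le> t \<Longrightarrow> t \<le> t2 \<Longrightarrow> \<bar>Q t\<bar> \<le> p\<^sup>2"
  shows "adiabatic p (v t1) (w t1) \<le> adiabatic p (v t2) (w t2) * exp (2 * p * (t2 - t1))"
proof -
  define E where "E t = adiabatic p (v t) (w t) * exp (2 * p * t)" for t
  have "E t1 \<le> E t2"
  proof (rule nondecreasing_if_deriv_nonneg[OF le])
    fix t assume t: "t1 \<le> t" "t \<le> t2"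
    define D where "D = 2 * p * v t * w t + 2 * Q t * v t * w t / p + 2 * p * adiabatic p (v t) (w t)"
    show "(E has_real_derivative D * exp (2 * p * t)) (at t)"
      unfolding E_def D_def adiabatic_def
      using p by (auto intro!: derivative_eq_intros v[OF t] w[OF t] simp: field_simps power2_eq_square)
    have vw: "\<bar>v t * w t\<bar> \<le> adiabatic p (v t) (w t) / 2" by (rule abs_mult_le_adiabatic[OF p])
    have "\<bar>Q t * (v t * w t)\<bar> \<le> p\<^sup>2 * (adiabatic p (v t) (w t) / 2)"
      unfolding abs_mult[of "Q t"] using Q[OF t] vw by (intro mult_mono) auto
    then have 1: "2 * (Q t * (v t * w t)) / p \<ge> - (p * adiabatic p (v t) (w t))"
      using p by (simp add: field_simps power2_eq_square abs_le_iff)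
    have "\<bar>p * (v t * w t)\<bar> \<le> p * (adiabatic p (v t) (w t) / 2)"
      unfolding abs_mult[of p] using p vw by (intro mult_mono) auto
    then have 2: "2 * (p * (v t * w t)) \<ge> - (p * adiabatic p (v t) (w t))"
      by (simp add: abs_le_iff)
    have "D \<ge> 0" using 1 2 unfolding D_def by (simp add: mult.assoc)
    then show "D * exp (2 * p * t) \<ge> 0" by simp
  qed
  then have "adiabatic p (v t1) (w t1) \<le> adiabatic p (v t2) (w t2) * (exp (2 * p * t2) / exp (2 * p * t1))"
    unfolding E_def by (simp add: field_simps)
  then show ?thesis by (simp add: exp_diff[symmetric] right_diff_distrib)
qed


text \<open>Writing the potential in \<open>tanh\<close> lets one formula cover both signs:
  \<open>c0 = r^2 - c1\<close> with \<open>c1 = s^2 + 1/4\<close> where the solution oscillates, and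
  both constants negated inside the barrier. The functions \<open>g\<close> and \<open>g'\<close>
  are the ones that the adiabatic and WKB estimates ask for.\<close>

lemma phase_speed_derivs:
  fixes c0 c1 :: real
  defines "p \<equiv> \<lambda>t. sqrt (c0 + c1 * (tanh t)\<^sup>2)"
  defines "g \<equiv> \<lambda>t. c1 * tanh t * (1 - (tanh t)\<^sup>2) / (p t) ^ 3"
  assumes "c0 + c1 * (tanh t)\<^sup>2 > 0"
  shows "(p has_real_derivative g t * (p t)\<^sup>2) (at t)"
    and "(g has_real_derivative c1 * (1 - (tanh t)\<^sup>2) * (c0 - 2 * c1 * (tanh t)\<^sup>2 - 3 * c0 * (tanh t)\<^sup>2) / (p t) ^ 5) (at t)"
proof -
  let ?x = "tanh t"
  have p0: "p t > 0" using assms by simp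
  have p2: "(p t)\<^sup>2 = c0 + c1 * ?x\<^sup>2" using assms by simp
  have "(p has_real_derivative c1 * ?x * (1 - ?x\<^sup>2) / p t) (at t)"
    unfolding p_def using assms(3) by (auto intro!: derivative_eq_intros simp: field_simps)
  moreover have eq: "g t * (p t)\<^sup>2 = c1 * ?x * (1 - ?x\<^sup>2) / p t"
    unfolding g_def using p0 by (simp add: field_simps power2_eq_square power3_eq_cube)
  ultimately show dp: "(p has_real_derivative g t * (p t)\<^sup>2) (at t)" by simp
  have quot: "(A * P ^ 3 - B * (3 * P\<^sup>2 * (E / P))) / (P ^ 3 * P ^ 3) = (A * P\<^sup>2 - B * (3 * E)) / P ^ 5"
    if "P > 0" for A B E P :: real
    using that by (simp add: field_simps eval_nat_numeral)
  define D where "D = (c1 * (1 - 3 * ?x\<^sup>2) * (1 - ?x\<^sup>2) * (p t) ^ 3 - c1 * ?x * (1 - ?x\<^sup>2) * (3 * (p t)\<^sup>2 * (g t * (p t)\<^sup>2))) / ((p t) ^ 3 * (p t) ^ 3)"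
  have 1: "(g has_real_derivative D) (at t)"
    unfolding g_def D_def using p0
    by (auto intro!: derivative_eq_intros dp[unfolded g_def] simp: algebra_simps power2_eq_square)
  have "D = (c1 * (1 - 3 * ?x\<^sup>2) * (1 - ?x\<^sup>2) * (p t) ^ 2 - c1 * ?x * (1 - ?x\<^sup>2) * (3 * (c1 * ?x * (1 - ?x\<^sup>2)))) / (p t) ^ 5"
    unfolding D_def eq using quot[OF p0] by (simp only: )
  also have "\<dots> = c1 * (1 - ?x\<^sup>2) * (c0 - 2 * c1 * ?x\<^sup>2 - 3 * c0 * ?x\<^sup>2) / (p t) ^ 5"
    unfolding p2 by (rule arg_cong2[where f="(/)"]) (simp_all add: power2_eq_square algebra_simps)
  finally show "(g has_real_derivative c1 * (1 - ?x\<^sup>2) * (c0 - 2 * c1 * ?x\<^sup>2 - 3 * c0 * ?x\<^sup>2) / (p t) ^ 5) (at t)"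
    using 1 by simp
qed

lemma tanh_artanh_real:
  fixes x :: real
  assumes "-1 < x" "x < 1"
  shows "tanh (artanh x) = x"
proof -
  have "exp (- 2 * artanh x) = (1 - x) / (1 + x)"
    using assms by (simp add: artanh_def exp_minus)
  then show ?thesis
    using assms unfolding tanh_real_altdef by (simp only:) (simp add: field_simps)
qed

lemma tanh_square_mono: "0 \<le> s \<Longrightarrow> s \<le> t \<Longrightarrow> (tanh s)\<^sup>2 \<le> (tanh (t::real))\<^sup>2"
  by (rule power_mono) auto

lemma tanh_square_lt_1: "(tanh (t::real))\<^sup>2 < 1"
  using tanh_real_bounds[of t] by (simp add: abs_square_less_1 abs_less_iff)

text \<open>Transports the action from \<open>t1\<close> to the unit interval after \<open>a\<close>
  and converts it into mass there. On that interval \<open>p\<close> lies between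
  \<open>r / 2\<close> and \<open>r\<close>, so the loss is 5 for the transport times
  \<open>4 * r\<close> for the conversion, however small \<open>p\<close> is at
  \<open>t1\<close>.\<close>

lemma oscillatory_zone:
  fixes v w H H' p g :: "real \<Rightarrow> real" and c0 c1 r K :: real
  assumes p_def: "p = (\<lambda>t. sqrt (c0 + c1 * (tanh t)\<^sup>2))"
    and g_def: "g = (\<lambda>t. c1 * tanh t * (1 - (tanh t)\<^sup>2) / (p t) ^ 3)"
    and v: "\<And>t. (v has_real_derivative w t) (at t)"
    and w: "\<And>t. (w has_real_derivative (c1 * (1 - (tanh t)\<^sup>2) - r\<^sup>2) * v t) (at t)"
    and c: "c0 + c1 = r\<^sup>2" "c1 > 0" "8 * c1 \<le> K * r\<^sup>2"
    and t1: "0 \<le> t1" "t1 \<le> a"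
    and pos: "c0 + c1 * (tanh t1)\<^sup>2 > 0"
    and a: "r\<^sup>2 \<le> 4 * (c0 + c1 * (tanh a)\<^sup>2)"
    and dH: "\<And>t. t1 \<le> t \<Longrightarrow> t \<le> a + 1 \<Longrightarrow> (H has_real_derivative H' t) (at t)"
    and g: "\<And>t. t1 \<le> t \<Longrightarrow> t \<le> a + 1 \<Longrightarrow> \<bar>g t\<bar> \<le> 1 / 2"
    and g': "\<And>t. t1 \<le> t \<Longrightarrow> t \<le> a + 1 \<Longrightarrow>
      \<bar>c1 * (1 - (tanh t)\<^sup>2) * (c0 - 2 * c1 * (tanh t)\<^sup>2 - 3 * c0 * (tanh t)\<^sup>2) / (p t) ^ 5\<bar> \<le> H' t"
    and H: "H (a + 1) - H t1 \<le> 1"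
    and r: "r > 0" "r \<ge> 200 + 100 * K"
  shows "adiabatic (p t1) (v t1) (w t1) \<le> 20 * r * integral {a..a+1} (\<lambda>t. (v t)\<^sup>2)"
proof -
  let ?g' = "\<lambda>t. c1 * (1 - (tanh t)\<^sup>2) * (c0 - 2 * c1 * (tanh t)\<^sup>2 - 3 * c0 * (tanh t)\<^sup>2) / (p t) ^ 5"
  have mono: "c0 + c1 * (tanh s)\<^sup>2 \<le> c0 + c1 * (tanh t)\<^sup>2" if "0 \<le> s" "s \<le> t" for s t
    using c tanh_square_mono[OF that] by simp
  have pos': "c0 + c1 * (tanh t)\<^sup>2 > 0" if "t1 \<le> t" for t
    using mono[OF t1(1) that] pos by linarith
  have p0: "p t > 0" and p2: "(p t)\<^sup>2 = c0 + c1 * (tanh t)\<^sup>2" if "t1 \<le> t" for t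
    using pos'[OF that] by (simp_all add: p_def)
  have w': "(w has_real_derivative - (p t)\<^sup>2 * v t) (at t)" if "t1 \<le> t" for t
  proof -
    have "c1 * (1 - (tanh t)\<^sup>2) - r\<^sup>2 = - (p t)\<^sup>2"
      unfolding p2[OF that] c(1)[symmetric] by (simp add: algebra_simps)
    then show ?thesis using w[of t] by simp
  qed
  have dp: "(p has_real_derivative g t * (p t)\<^sup>2) (at t)" and dg: "(g has_real_derivative ?g' t) (at t)"
    if "t1 \<le> t" for t
    using phase_speed_derivs[OF pos'[OF that]] unfolding p_def g_def by blast+
  let ?F = "\<lambda>t. adiabatic (p t) (v t) (w t)"
  have Hm: "H x \<le> H y" if "t1 \<le> x" "x \<le> y" "y \<le> a + 1" for x y
    by (rule nondecreasing_if_deriv_nonneg[where f' = H', OF that(2) dH])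
      (use that order_trans[OF abs_ge_zero g'] in auto)
  have ad: "?F t1 \<le> 5 * ?F t" "?F t \<le> 5 * ?F t1" if t: "t1 \<le> t" "t \<le> a + 1" for t
  proof -
    have "H t - H t1 \<le> 1" using Hm[of t "a+1"] t H by auto
    note * = adiabatic_invariance[where v = v and w = w and p = p and g = g and g' = "?g'" and H = H and H' = H' and ?t1.0 = t1 and ?t2.0 = t,
        OF t(1) v w' p0 dp dg dH g g' this]
    show "?F t1 \<le> 5 * ?F t" by (rule *(1)) (use t in auto)
    show "?F t \<le> 5 * ?F t1" by (rule *(2)) (use t in auto)
  qed
  have pr: "r / 2 \<le> p t \<and> p t \<le> r" if "a \<le> t" for t
  proof -
    have "(r / 2)\<^sup>2 \<le> (p t)\<^sup>2"
      using a mono[of a t] that t1 p2[of t] by (simp add: power_divide)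
    moreover have "(p t)\<^sup>2 \<le> r\<^sup>2"
      using p2[of t] that t1 tanh_square_lt_1[of t] c by (simp flip: c(1))
    ultimately show ?thesis using p0[of t] t1 that r by (auto intro: power2_le_imp_le)
  qed
  have gK: "\<bar>g t\<bar> \<le> K / r" if "a \<le> t" for t
  proof -
    have t: "0 \<le> tanh t" "tanh t \<le> 1" "(tanh t)\<^sup>2 \<le> 1"
      using t1 that tanh_real_lt_1[of t] tanh_square_lt_1[of t] by auto
    have "\<bar>g t\<bar> = c1 * (tanh t * (1 - (tanh t)\<^sup>2)) / (p t) ^ 3"
      unfolding g_def using t c p0[of t] t1 that by simp
    also have "\<dots> \<le> c1 * (1 * 1) / (r / 2) ^ 3"
      using t c pr[OF that] r by (intro frac_le mult_left_mono mult_mono power_mono) auto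
    also have "\<dots> \<le> K / r" using c(3) r by (simp add: field_simps power2_eq_square power3_eq_cube)
    finally show ?thesis .
  qed
  \<comment> \<open>Here \<open>m\<close> is a fifth of the initial action. Two-sided invariance
    puts the action between \<open>m\<close> and \<open>25 * m\<close>, which is the source of the
    25 in \<open>oscillation_mass\<close>.\<close>
  have "?F t1 / 5 / (4 * r) \<le> integral {a..a+1} (\<lambda>t. (v t)\<^sup>2)"
    by (rule oscillation_mass[where v = v and w = w and p = p and g = g and K = K, OF v w' _ dp gK])
      (use pr r t1 ad in \<open>auto simp: field_simps\<close>)
  then show ?thesis using r by (simp add: field_simps)
qed

section \<open>Lower mass bounds in the three ranges of the parameters\<close>

lemma mass_transition:
  fixes D :: real
  assumes "D > 0"
  shows "\<exists>R\<ge>1. \<exists>A>0. \<forall>r s v w. r \<ge> R \<longrightarrow> s \<ge> R \<longrightarrow> \<bar>r - s\<bar> < D \<longrightarrow>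
    (\<forall>t. (v has_real_derivative w t) (at t)) \<longrightarrow>
    (\<forall>t. (w has_real_derivative ((s\<^sup>2 + 1/4) * (1 - (tanh t)\<^sup>2) - r\<^sup>2) * v t) (at t)) \<longrightarrow> w 0 = 0 \<longrightarrow>
    (v 0)\<^sup>2 \<le> A * sqrt r * integral {0..1} (\<lambda>t. (v t)\<^sup>2)"
proof -
  \<comment> \<open>\<open>B * r\<close> is to dominate the potential on the window below:
    \<open>3 * D * r\<close> for \<open>s^2 - r^2\<close>, \<open>5 * r\<close> for the
    \<open>tanh\<close> term and 1/4, with room to spare.\<close>
  define B where "B = 4 * D + 20 + D\<^sup>2"
  define M where "M = sqrt (2 * B)"
  have B: "B \<ge> 20" using assms unfolding B_def by simp
  then have M1: "M \<ge> 1" unfolding M_def by (intro real_le_rsqrt) simp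
  have "(v 0)\<^sup>2 \<le> 32 * M * sqrt r * integral {0..1} (\<lambda>t. (v t)\<^sup>2)"
    if r: "r \<ge> max 1 D" and s: "s \<ge> max 1 D" and rs: "\<bar>r - s\<bar> < D"
      and v: "\<And>t. (v has_real_derivative w t) (at t)"
      and w: "\<And>t. (w has_real_derivative ((s\<^sup>2 + 1/4) * (1 - (tanh t)\<^sup>2) - r\<^sup>2) * v t) (at t)"
      and w0: "w 0 = 0" for r s v w
  proof -
    \<comment> \<open>A time so short that the solution hardly moves:
      \<open>\<delta>^2 * (2 * B * r) = 1\<close>, so integrating
      \<open>|v''| \<le> B * r * |v|\<close> twice changes \<open>v\<close> by at most half of its
      maximum. The length of order \<open>r^(-1/2)\<close> is what produces \<open>sqrt r\<close> in
      the bound.\<close>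
    define \<delta> where "\<delta> = 1 / (M * sqrt r)"
    have r1: "sqrt r \<ge> 1" using r by simp
    then have "M * sqrt r \<ge> 1 * 1" using M1 by (intro mult_mono) auto
    then have d: "0 < \<delta>" "\<delta> \<le> 1" unfolding \<delta>_def by auto
    have d2: "\<delta>\<^sup>2 * (2 * B * r) = 1"
      unfolding \<delta>_def using B r by (simp add: M_def power_divide power_mult_distrib)
    let ?Q = "\<lambda>t. (s\<^sup>2 + 1/4) * (1 - (tanh t)\<^sup>2) - r\<^sup>2"
    have tanhle: "(tanh t)\<^sup>2 \<le> t\<^sup>2" if "0 \<le> t" for t :: real
    proof -
      have "t - tanh t \<ge> 0 - tanh 0"
        by (rule nondecreasing_if_deriv_nonneg[OF that, where f' = "\<lambda>t. (tanh t)\<^sup>2"])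
          (auto intro!: derivative_eq_intros)
      then show ?thesis using that by (intro power_mono) auto
    qed
    have Q: "\<bar>?Q t\<bar> \<le> B * r" if t: "0 \<le> t" "t \<le> \<delta>" for t
    proof -
      have s2: "s \<le> 2 * r" using rs r by (auto simp: abs_less_iff)
      then have ss: "s\<^sup>2 + 1/4 \<le> 5 * r\<^sup>2"
      proof -
        have "s\<^sup>2 \<le> (2 * r)\<^sup>2" using s2 s by (intro power_mono) auto
        moreover have "1 \<le> r\<^sup>2" using r by simp
        ultimately show ?thesis by (simp add: power_mult_distrib)
      qed
      have "t\<^sup>2 * (2 * B * r) \<le> \<delta>\<^sup>2 * (2 * B * r)"
        using t B r by (intro mult_right_mono power_mono) auto
      moreover have "t\<^sup>2 * (2 * B * r) = B * (2 * (t\<^sup>2 * r))" by simp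
      moreover have "20 * (2 * (t\<^sup>2 * r)) \<le> B * (2 * (t\<^sup>2 * r))"
        using B r by (intro mult_right_mono) auto
      ultimately have "40 * (t\<^sup>2 * r) \<le> 1"
        using d2 by linarith
      moreover have "(s\<^sup>2 + 1/4) * (tanh t)\<^sup>2 \<le> (5 * r\<^sup>2) * t\<^sup>2"
        using ss tanhle[OF t(1)] by (intro mult_mono) auto
      moreover have "(5 * r\<^sup>2) * t\<^sup>2 = 5 * r * (t\<^sup>2 * r)" by (simp add: power2_eq_square)
      moreover have "5 * r * (t\<^sup>2 * r) \<le> 5 * r * 1"
        using calculation(1) r by (intro mult_left_mono) auto
      ultimately have 1: "(s\<^sup>2 + 1/4) * (tanh t)\<^sup>2 \<le> 5 * r" by linarith
      have "\<bar>s\<^sup>2 - r\<^sup>2\<bar> = \<bar>s - r\<bar> * (s + r)"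
        using r s by (simp add: power2_eq_square square_diff_square_factored abs_mult)
      also have "\<dots> \<le> D * (3 * r)" using rs s2 r s by (intro mult_mono) auto
      finally have 2: "\<bar>s\<^sup>2 - r\<^sup>2\<bar> \<le> 3 * D * r" by simp
      have 3: "?Q t = (s\<^sup>2 - r\<^sup>2) + 1/4 - (s\<^sup>2 + 1/4) * (tanh t)\<^sup>2" by (simp add: algebra_simps)
      have 4: "0 \<le> (s\<^sup>2 + 1/4) * (tanh t)\<^sup>2" by simp
      have "\<bar>?Q t\<bar> \<le> 3 * D * r + 1/4 + 5 * r"
        unfolding 3 using 1 2 4 by linarith
      also have "\<dots> \<le> B * r"
      proof -
        have "1/4 \<le> r" using r by simp
        moreover have "B * r = 4 * D * r + 20 * r + D\<^sup>2 * r" by (simp add: B_def algebra_simps)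
        moreover have "0 \<le> D * r" "0 \<le> D\<^sup>2 * r" using assms r by auto
        ultimately show ?thesis by linarith
      qed
      finally show ?thesis .
    qed
    have cv: "continuous_on {a..b} v" for a b
      by (rule DERIV_continuous_on[of _ _ w]) (auto intro!: has_field_derivative_at_within[OF v])
    obtain t0 where t0: "t0 \<in> {0..\<delta>}" "\<And>t. t \<in> {0..\<delta>} \<Longrightarrow> \<bar>v t\<bar> \<le> \<bar>v t0\<bar>"
    proof -
      have "continuous_on {0..\<delta>} (\<lambda>t. \<bar>v t\<bar>)" by (intro continuous_intros cv)
      then show ?thesis
        using continuous_attains_sup[of "{0..\<delta>}" "\<lambda>t. \<bar>v t\<bar>"] that d by auto
    qed
    define m where "m = \<bar>v t0\<bar>"
    have m: "\<bar>v t\<bar> \<le> m" if "0 \<le> t" "t \<le> \<delta>" for t using t0 that by (simp add: m_def)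
    have w1: "\<bar>w t\<bar> \<le> B * r * m * \<delta>" if t: "0 \<le> t" "t \<le> \<delta>" for t
    proof -
      have "norm (w t - w 0) \<le> (B * r * m) * norm (t - 0)"
      proof (rule field_differentiable_bound[where S = "{0..\<delta>}" and f' = "\<lambda>t. ?Q t * v t"])
        show "norm (?Q z * v z) \<le> B * r * m" if "z \<in> {0..\<delta>}" for z
          using Q[of z] m[of z] that unfolding real_norm_def abs_mult
          by (intro mult_mono) (auto intro: order_trans[OF abs_ge_zero])
      qed (use t d in \<open>auto intro!: has_field_derivative_at_within[OF w]\<close>)
      also have "\<dots> \<le> (B * r * m) * \<delta>"
        using t B r m[of 0] d by (intro mult_left_mono) (auto intro!: mult_nonneg_nonneg)
      finally show ?thesis using w0 by simp
    qed
    have v1: "\<bar>v t - v 0\<bar> \<le> m / 2" if t: "0 \<le> t" "t \<le> \<delta>" for t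
    proof -
      have "norm (v t - v 0) \<le> (B * r * m * \<delta>) * norm (t - 0)"
      proof (rule field_differentiable_bound[where S = "{0..\<delta>}" and f' = w])
      qed (use t d w1 in \<open>auto intro!: has_field_derivative_at_within[OF v]\<close>)
      also have "\<dots> \<le> (B * r * m * \<delta>) * \<delta>"
        using t B r m[of 0] d by (intro mult_left_mono) (auto intro!: mult_nonneg_nonneg)
      also have "\<dots> = (\<delta>\<^sup>2 * (2 * B * r)) * m / 2" by (simp add: power2_eq_square)
      finally show ?thesis unfolding d2 by simp
    qed
    have "m \<le> \<bar>v 0\<bar> + m / 2"
      using v1[of t0] t0(1) unfolding m_def atLeastAtMost_iff by linarith
    then have m2: "m \<le> 2 * \<bar>v 0\<bar>" by simp
    \<comment> \<open>On the first half of the window the change is at most \<open>m / 4\<close>,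
      hence at most half of the initial size, and \<open>v\<close> keeps at least a quarter of
      it.\<close>
    have "\<bar>v t - v 0\<bar> \<le> 3/4 * \<bar>v 0\<bar>" if t: "0 \<le> t" "t \<le> \<delta>/2" for t
    proof -
      have "norm (v t - v 0) \<le> (B * r * m * \<delta>) * norm (t - 0)"
      proof (rule field_differentiable_bound[where S = "{0..\<delta>}" and f' = w])
      qed (use t d w1 in \<open>auto intro!: has_field_derivative_at_within[OF v]\<close>)
      also have "\<dots> \<le> (B * r * m * \<delta>) * (\<delta>/2)"
        using t B r m[of 0] d by (intro mult_left_mono) (auto intro!: mult_nonneg_nonneg)
      also have "\<dots> = (\<delta>\<^sup>2 * (2 * B * r)) * m / 4" by (simp add: power2_eq_square)
      finally show ?thesis unfolding d2 using m2 by simp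
    qed
    note near = this
    have "(\<bar>v 0\<bar> / 4) \<le> \<bar>v t\<bar>" if "0 \<le> t" "t \<le> \<delta>/2" for t
      using near[OF that] by linarith
    then have low: "(v 0)\<^sup>2 / 16 \<le> (v t)\<^sup>2" if "0 \<le> t" "t \<le> \<delta>/2" for t
      using power_mono[of "\<bar>v 0\<bar> / 4" "\<bar>v t\<bar>" 2] that by (simp add: power_divide)
    have "(v 0)\<^sup>2 / 16 * (\<delta>/2) = integral {0..\<delta>/2} (\<lambda>t. (v 0)\<^sup>2 / 16)" using d by simp
    also have "\<dots> \<le> integral {0..\<delta>/2} (\<lambda>t. (v t)\<^sup>2)"
      by (intro integral_le integrable_continuous_real continuous_intros cv) (use low in auto)
    also have "\<dots> \<le> integral {0..1} (\<lambda>t. (v t)\<^sup>2)"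
      using d by (intro integral_subset_le integrable_continuous_real continuous_intros cv) auto
    finally have "(v 0)\<^sup>2 * \<delta> \<le> 32 * integral {0..1} (\<lambda>t. (v t)\<^sup>2)" by simp
    then have "(v 0)\<^sup>2 * \<delta> * (M * sqrt r) \<le> 32 * integral {0..1} (\<lambda>t. (v t)\<^sup>2) * (M * sqrt r)"
      using M1 r by (intro mult_right_mono) auto
    moreover have "\<delta> * (M * sqrt r) = 1" using d M1 r unfolding \<delta>_def by simp
    ultimately show ?thesis by (simp add: mult.assoc)  (simp add: mult_ac)
  qed
  then show ?thesis
    using M1 by (intro exI[of _ "max 1 D"] exI[of _ "32 * M"] conjI) auto
qed

text \<open>For \<open>s\<close> well below \<open>r\<close> the potential is negative for all
  \<open>t\<close>, so a single oscillatory zone starts at \<open>t = 0\<close>, with frequency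
  \<open>sqrt (r^2 - s^2 - 1/4)\<close> and action \<open>p 0 * (v 0)^2\<close>. The gap
  \<open>r - s \<ge> 1000\<close> makes \<open>g\<close> and its variation small from the
  start.\<close>

lemma mass_oscillating:
  "\<exists>R\<ge>1. \<exists>A>0. \<forall>r s v w. r \<ge> R \<longrightarrow> s \<ge> R \<longrightarrow> r - s \<ge> R \<longrightarrow>
    (\<forall>t. (v has_real_derivative w t) (at t)) \<longrightarrow>
    (\<forall>t. (w has_real_derivative ((s\<^sup>2 + 1/4) * (1 - (tanh t)\<^sup>2) - r\<^sup>2) * v t) (at t)) \<longrightarrow> w 0 = 0 \<longrightarrow>
    sqrt (r\<^sup>2 - s\<^sup>2) * (v 0)\<^sup>2 \<le> A * r * integral {0..2} (\<lambda>t. (v t)\<^sup>2)"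
proof -
  have "sqrt (r\<^sup>2 - s\<^sup>2) * (v 0)\<^sup>2 \<le> 40 * r * integral {0..2} (\<lambda>t. (v t)\<^sup>2)"
    if r: "r \<ge> 1000" and s: "s \<ge> 1000" and rs: "r - s \<ge> 1000"
      and v: "\<And>t. (v has_real_derivative w t) (at t)"
      and w: "\<And>t. (w has_real_derivative ((s\<^sup>2 + 1/4) * (1 - (tanh t)\<^sup>2) - r\<^sup>2) * v t) (at t)"
      and w0: "w 0 = 0" for r s v w
  proof -
    define c1 where "c1 = s\<^sup>2 + 1/4"
    define a where "a = r\<^sup>2 - c1"
    define p where "p = (\<lambda>t. sqrt (a + c1 * (tanh t)\<^sup>2))"
    have "(r - s) * (r + s) \<ge> 1000 * (2 * s)" using r s rs by (intro mult_mono) auto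
    then have rs2: "r\<^sup>2 - s\<^sup>2 \<ge> 2000 * s" by (simp add: power2_eq_square algebra_simps)
    then have a: "a \<ge> 1000 * s" "a > 0" "r\<^sup>2 - s\<^sup>2 \<le> 4 * a" using s by (auto simp: a_def c1_def)
    have c1: "c1 > 0" by (simp add: c1_def add_nonneg_pos)
    define \<sigma> where "\<sigma> = sqrt c1"
    have sg: "\<sigma> > 0" "\<sigma>\<^sup>2 = c1" using c1 by (auto simp: \<sigma>_def)
    have "\<sigma> \<le> 2 * s" unfolding \<sigma>_def c1_def using s mult_mono[of 1 s 1 s] by (intro real_le_lsqrt) (auto simp: power2_eq_square)
    then have sa: "100 * \<sigma> \<le> a" using a s by linarith
    have Q: "a + c1 * (tanh t)\<^sup>2 > 0" for t :: real using a c1 by (intro add_pos_nonneg) auto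
    have p0: "p t > 0" and p2: "(p t)\<^sup>2 = a + c1 * (tanh t)\<^sup>2" for t using Q[of t] by (auto simp: p_def)
    have sx: "\<sigma> * \<bar>tanh t\<bar> \<le> p t" for t
      unfolding p_def using a sg by (intro real_le_rsqrt) (auto simp: power_mult_distrib)
    \<comment> \<open>\<open>H'\<close> majorises \<open>|g'|\<close> because the bracket in
      \<open>g'\<close> is at most \<open>3 * p^2\<close>. Its primitive is explicit, as
      \<open>tanh / p\<close> has derivative \<open>a * (1 - tanh^2) / p^3\<close>, and stays below
      \<open>3 * \<sigma> / a\<close>.\<close>
    define H where "H = (\<lambda>t. 3 * c1 / a * (tanh t / p t))"
    define H' where "H' = (\<lambda>t. 3 * c1 * (1 - (tanh t)\<^sup>2) / p t ^ 3)"
    have dp: "(p has_real_derivative c1 * tanh t * (1 - (tanh t)\<^sup>2) / p t ^ 3 * (p t)\<^sup>2) (at t)" for t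
      using phase_speed_derivs(1)[OF Q[of t]] unfolding p_def .
    have dH: "(H has_real_derivative H' t) (at t)" for t
    proof -
      have "(H has_real_derivative 3 * c1 / a * (((1 - (tanh t)\<^sup>2) * p t -
          tanh t * (c1 * tanh t * (1 - (tanh t)\<^sup>2) / p t ^ 3 * (p t)\<^sup>2)) / (p t * p t))) (at t)"
        unfolding H_def using p0[of t]
        by (intro DERIV_cmult DERIV_divide dp) (auto intro!: derivative_eq_intros)
      moreover have "((1 - (tanh t)\<^sup>2) * p t - tanh t * (c1 * tanh t * (1 - (tanh t)\<^sup>2) / p t ^ 3 * (p t)\<^sup>2)) / (p t * p t)
        = (1 - (tanh t)\<^sup>2) * ((p t)\<^sup>2 - c1 * (tanh t)\<^sup>2) / p t ^ 3"
        using p0[of t] by (simp add: field_simps eval_nat_numeral)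
      ultimately have "(H has_real_derivative 3 * c1 / a * ((1 - (tanh t)\<^sup>2) * ((p t)\<^sup>2 - c1 * (tanh t)\<^sup>2) / p t ^ 3)) (at t)"
        by (simp only:)
      moreover have "3 * c1 / a * ((1 - (tanh t)\<^sup>2) * ((p t)\<^sup>2 - c1 * (tanh t)\<^sup>2) / p t ^ 3) = H' t"
        using a unfolding H'_def p2 by simp
      ultimately show ?thesis by (simp only:)
    qed
    have x1: "(tanh t)\<^sup>2 \<le> 1" for t :: real using tanh_square_lt_1[of t] by simp
    have "adiabatic (p 0) (v 0) (w 0) \<le> 20 * r * integral {1..1+1} (\<lambda>t. (v t)\<^sup>2)"
    proof (rule oscillatory_zone[where H = H and H' = H' and K = 8, OF p_def refl])
      show "(w has_real_derivative (c1 * (1 - (tanh t)\<^sup>2) - r\<^sup>2) * v t) (at t)" for t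
        using w unfolding c1_def .
      show "a + c1 = r\<^sup>2" by (simp add: a_def)
      show "8 * c1 \<le> 8 * r\<^sup>2" using a by (simp add: a_def)
      show "r\<^sup>2 \<le> 4 * (a + c1 * (tanh 1)\<^sup>2)"
      proof -
        have "tanh (1::real) \<ge> 1/2"
        proof -
          have "exp (2::real) \<ge> 3" using exp_ge_add_one_self[of "2::real"] by simp
          then have "exp (- 2::real) \<le> 1/3" by (simp add: exp_minus field_simps)
          moreover have "exp (- 2::real) > 0" by simp
          moreover have "1/2 \<le> (1 - u) / (1 + u)" if "u \<le> 1/3" "u > 0" for u :: real
            using that by (simp add: field_simps)
          ultimately have "1/2 \<le> (1 - exp (- 2)) / (1 + exp (- 2 :: real))" by blast
          then show ?thesis unfolding tanh_real_altdef by (simp only: mult_1_right)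
        qed
        then have "(tanh (1::real))\<^sup>2 \<ge> (1/2)\<^sup>2" by (intro power_mono) auto
        then have "c1 * (tanh 1)\<^sup>2 \<ge> c1 * (1/4)" using c1 by (intro mult_left_mono) (auto simp: power_divide)
        then show ?thesis using a by (simp add: a_def)
      qed
      show "\<bar>c1 * tanh t * (1 - (tanh t)\<^sup>2) / p t ^ 3\<bar> \<le> 1 / 2" for t
      proof -
        have "\<bar>c1 * tanh t * (1 - (tanh t)\<^sup>2) / p t ^ 3\<bar> = \<sigma> * (\<sigma> * \<bar>tanh t\<bar>) * (1 - (tanh t)\<^sup>2) / p t ^ 3"
          using c1 p0[of t] x1[of t] unfolding sg(2)[symmetric] by (simp add: abs_mult power2_eq_square)
        also have "\<dots> \<le> \<sigma> * p t * 1 / p t ^ 3"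
          using sg sx[of t] p0[of t] x1[of t] by (intro divide_right_mono mult_mono) auto
        also have "\<dots> = \<sigma> / (p t)\<^sup>2" using p0[of t] by (simp add: eval_nat_numeral)
        also have "\<dots> \<le> \<sigma> / a" unfolding p2 using a c1 sg Q[of t] by (intro divide_left_mono) auto
        also have "\<dots> \<le> 1 / 2" using sa a sg by (simp add: field_simps)
        finally show ?thesis .
      qed
      show "\<bar>c1 * (1 - (tanh t)\<^sup>2) * (a - 2 * c1 * (tanh t)\<^sup>2 - 3 * a * (tanh t)\<^sup>2) / p t ^ 5\<bar> \<le> H' t" for t
      proof -
        have "a * (tanh t)\<^sup>2 \<le> a" "0 \<le> a * (tanh t)\<^sup>2" "0 \<le> c1 * (tanh t)\<^sup>2" using a x1[of t] c1 by auto
        then have *: "\<bar>a - 2 * c1 * (tanh t)\<^sup>2 - 3 * a * (tanh t)\<^sup>2\<bar> \<le> 3 * (p t)\<^sup>2"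
        proof -
          have "\<bar>a - 2 * z - 3 * y\<bar> \<le> 3 * (a + z)" if "y \<le> a" "0 \<le> y" "0 \<le> z" for y z
            using that a(2) by (auto simp: abs_le_iff)
          from this[OF \<open>a * (tanh t)\<^sup>2 \<le> a\<close> \<open>0 \<le> a * (tanh t)\<^sup>2\<close> \<open>0 \<le> c1 * (tanh t)\<^sup>2\<close>]
          show ?thesis unfolding p2 by (simp only: mult.assoc)
        qed
        have "\<bar>c1 * (1 - (tanh t)\<^sup>2) * (a - 2 * c1 * (tanh t)\<^sup>2 - 3 * a * (tanh t)\<^sup>2) / p t ^ 5\<bar>
          = c1 * (1 - (tanh t)\<^sup>2) * \<bar>a - 2 * c1 * (tanh t)\<^sup>2 - 3 * a * (tanh t)\<^sup>2\<bar> / p t ^ 5"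
          using c1 x1[of t] p0[of t] by (simp add: abs_mult)
        also have "\<dots> \<le> c1 * (1 - (tanh t)\<^sup>2) * (3 * (p t)\<^sup>2) / p t ^ 5"
          using * c1 x1[of t] p0[of t] by (intro divide_right_mono mult_left_mono) auto
        also have "\<dots> = H' t" unfolding H'_def using p0[of t] by (simp add: eval_nat_numeral)
        finally show ?thesis .
      qed
      show "H (1 + 1) - H 0 \<le> 1"
      proof -
        have "c1 * tanh 2 \<le> \<sigma> * p 2"
          using sx[of 2] sg(1) unfolding sg(2)[symmetric] by (simp add: power2_eq_square)
        then have "H 2 \<le> 3 * \<sigma> / a" unfolding H_def using p0[of 2] a by (simp add: field_simps)
        also have "\<dots> \<le> 1" using sa a by simp
        finally show ?thesis by (simp add: H_def)
      qed
    qed (use a c1 r v dH in auto)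
    also have "adiabatic (p 0) (v 0) (w 0) = sqrt a * (v 0)\<^sup>2" by (simp add: adiabatic_def w0 p_def)
    finally have 1: "sqrt a * (v 0)\<^sup>2 \<le> 20 * r * integral {1..2} (\<lambda>t. (v t)\<^sup>2)" by simp
    have cv: "continuous_on {a..b} v" for a b
      by (rule DERIV_continuous_on[of _ _ w]) (auto intro!: has_field_derivative_at_within[OF v])
    have 2: "integral {1..2} (\<lambda>t. (v t)\<^sup>2) \<le> integral {0..2} (\<lambda>t. (v t)\<^sup>2)"
      by (intro integral_subset_le integrable_continuous_real continuous_intros cv) auto
    have "sqrt (r\<^sup>2 - s\<^sup>2) \<le> sqrt (4 * a)" using a by (simp only: real_sqrt_le_iff)
    then have "sqrt (r\<^sup>2 - s\<^sup>2) * (v 0)\<^sup>2 \<le> 2 * sqrt a * (v 0)\<^sup>2"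
      by (intro mult_right_mono) (auto simp: real_sqrt_mult)
    also have "\<dots> \<le> 2 * (20 * r * integral {1..2} (\<lambda>t. (v t)\<^sup>2))" using 1 by simp
    also have "\<dots> \<le> 2 * (20 * r * integral {0..2} (\<lambda>t. (v t)\<^sup>2))" using 2 r by simp
    finally show ?thesis by simp
  qed
  then show ?thesis
    by (intro exI[of _ 1000] exI[of _ 40] conjI) auto
qed

text \<open>Growth inside the barrier, a bounded loss around the turning point, oscillation beyond
  it. The length \<open>T\<close> depends on \<open>C\<close> alone, since \<open>s < C * r\<close>
  keeps \<open>tanh\<close> at the turning point away from 1.\<close>

lemma mass_tunnelling:
  fixes C :: real
  assumes "C > 1"
  shows "\<exists>R\<ge>1. \<exists>A>0. \<exists>T>0. \<forall>r s v w. r \<ge> R \<longrightarrow> s \<ge> R \<longrightarrow> s - r \<ge> R \<longrightarrow> s < C * r \<longrightarrow>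
    (\<forall>t. (v has_real_derivative w t) (at t)) \<longrightarrow>
    (\<forall>t. (w has_real_derivative ((s\<^sup>2 + 1/4) * (1 - (tanh t)\<^sup>2) - r\<^sup>2) * v t) (at t)) \<longrightarrow> w 0 = 0 \<longrightarrow>
    sqrt (s\<^sup>2 - r\<^sup>2) * (v 0)\<^sup>2 * exp (pi * (s - r)) \<le> A * r * integral {0..T} (\<lambda>t. (v t)\<^sup>2)"
proof -
  \<comment> \<open>From \<open>s < C * r\<close> follows \<open>c1 \<le> 2 * C^2 * r^2\<close>, so
    \<open>1 - tanh^2 = r^2 / c1\<close> is at least \<open>2 * c\<close> at the turning point. Half
    of this is reserved for the window, which leaves \<open>1 - tanh^2 \<ge> c\<close> up to its
    right end.\<close>
  define c where "c = 1 / (4 * C\<^sup>2)"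
  have c: "0 < c" "c < 1/4" using assms by (auto simp: c_def field_simps)
  define a where "a = artanh (sqrt (1 - c))"
  have sc: "0 < sqrt (1 - c)" "sqrt (1 - c) < 1" using c by auto
  have ta: "tanh a = sqrt (1 - c)" unfolding a_def using sc by (intro tanh_artanh_real) linarith+
  then have ta2: "(tanh a)\<^sup>2 = 1 - c" and a0: "a > 0" using c sc tanh_real_pos_iff[of a] by auto
  \<comment> \<open>1000 makes the barrier wide, the second entry is the threshold of
    \<open>oscillatory_zone\<close> with \<open>K = 16 * C^2\<close>, and the third makes the window
    narrow enough for \<open>p1^2 \<le> c * c1\<close>.\<close>
  define R where "R = max 1000 (max (200 + 100 * (16 * C\<^sup>2)) (4 / c\<^sup>2))"
  \<comment> \<open>180 is \<open>9 * 20\<close>, from growth and oscillation; \<open>24 / c\<close>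
    is twice the \<open>4 / c\<close> lost before the turning point plus the Gronwall exponent
    \<open>2 * 8 / c\<close>.\<close>
  define A where "A = 180 * exp (24 / c)"
  have main: "sqrt (s\<^sup>2 - r\<^sup>2) * (v 0)\<^sup>2 * exp (pi * (s - r)) \<le> A * r * integral {0..a+1} (\<lambda>t. (v t)\<^sup>2)"
    if r: "r \<ge> R" and s: "s \<ge> R" and sr: "s - r \<ge> R" and sC: "s < C * r"
      and v: "\<And>t. (v has_real_derivative w t) (at t)"
      and w: "\<And>t. (w has_real_derivative ((s\<^sup>2 + 1/4) * (1 - (tanh t)\<^sup>2) - r\<^sup>2) * v t) (at t)"
      and w0: "w 0 = 0" and v0: "v 0 > 0" for r s and v w :: "real \<Rightarrow> real"
  proof -
    have R: "R \<ge> 1000" "R \<ge> 200 + 100 * (16 * C\<^sup>2)" "R \<ge> 4 / c\<^sup>2" unfolding R_def by auto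
    have r0: "r \<ge> 1000" and s0: "s \<ge> 1000" and sr0: "s - r \<ge> 1000" using r s sr R by auto
    define c1 where "c1 = s\<^sup>2 + 1/4"
    define b where "b = c1 - r\<^sup>2"
    define \<sigma> where "\<sigma> = sqrt c1"
    define k where "k = sqrt b"
    have "1000 * (s + r) \<le> (s - r) * (s + r)" using sr0 s0 r0 by (intro mult_right_mono) auto
    then have "s\<^sup>2 - r\<^sup>2 \<ge> 1000 * s" using r0 by (simp add: power2_eq_square algebra_simps)
    then have b: "b \<ge> 1000 * s" "b > 0" "s\<^sup>2 - r\<^sup>2 \<le> b" using s0 by (auto simp: b_def c1_def)
    have c1: "c1 > 0" by (simp add: c1_def add_nonneg_pos)
    have sg: "\<sigma> > 0" "\<sigma>\<^sup>2 = c1" using c1 by (auto simp: \<sigma>_def)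
    have k: "k > 0" "k\<^sup>2 = b" using b by (auto simp: k_def)
    have ssg: "s \<le> \<sigma>" unfolding \<sigma>_def c1_def by (intro real_le_rsqrt) simp
    have sg2s: "\<sigma> \<le> 2 * s" unfolding \<sigma>_def c1_def using s0 mult_mono[of 1 s 1 s]
      by (intro real_le_lsqrt) (auto simp: power2_eq_square)
    have ksg: "k < \<sigma>" unfolding k_def \<sigma>_def b_def using r0 by simp
    have sgb: "400 * \<sigma> \<le> b" using b sg2s by linarith
    \<comment> \<open>The Airy scale. In the barrier \<open>|g| \<le> \<sigma> * k / p^3\<close>, so
      \<open>p \<ge> p1\<close> gives \<open>|g| \<le> 1/4\<close> there; on the far side the same
      \<open>p1\<close> gives 1/2.\<close>
    define p1 where "p1 = root 3 (4 * \<sigma> * k)"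
    have p1: "p1 > 0" "p1 ^ 3 = 4 * \<sigma> * k" using sg k by (auto simp: p1_def)
    have p1b: "p1\<^sup>2 < b"
    proof -
      have "p1 ^ 3 < k ^ 3"
        unfolding p1 using sgb sg k(1) by (simp add: k(2)[symmetric] eval_nat_numeral)
      then have "p1 < k" using k by (metis power_less_imp_less_base less_imp_le)
      then show ?thesis unfolding k(2)[symmetric] using p1 by (intro power_strict_mono) auto
    qed
    \<comment> \<open>Compare cubes: \<open>p1^3 \<le> 4 * \<sigma>^2\<close>, and \<open>R\<close>
      provides \<open>4 \<le> \<sigma> * c^2\<close>.\<close>
    have p1c: "p1\<^sup>2 \<le> c * c1"
    proof -
      have "4 / c\<^sup>2 \<le> \<sigma>" using R s ssg by linarith
      then have "4 \<le> \<sigma> * c\<^sup>2" using c by (simp add: field_simps)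
      then have "\<sigma>\<^sup>2 * 4 \<le> \<sigma>\<^sup>2 * (\<sigma> * c\<^sup>2)" by (intro mult_left_mono) auto
      moreover have "p1 ^ 3 \<le> \<sigma>\<^sup>2 * 4" unfolding p1 using ksg sg(1) mult_left_mono[of k \<sigma> \<sigma>] by (simp add: power2_eq_square)
      moreover have "\<sigma>\<^sup>2 * (\<sigma> * c\<^sup>2) \<le> (sqrt c * \<sigma>) ^ 3"
      proof -
        have "sqrt c ^ 4 \<le> sqrt c ^ 3" using c by (intro power_decreasing) auto
        moreover have "sqrt c ^ 4 = c\<^sup>2" using c by (simp add: eval_nat_numeral)
        ultimately have "\<sigma> ^ 3 * c\<^sup>2 \<le> \<sigma> ^ 3 * sqrt c ^ 3" using sg by (intro mult_left_mono) auto
        then show ?thesis by (simp add: power_mult_distrib eval_nat_numeral mult_ac)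
      qed
      ultimately have "p1 ^ 3 \<le> (sqrt c * \<sigma>) ^ 3" by linarith
      then have "p1 \<le> sqrt c * \<sigma>"
        using power_le_imp_le_base[of p1 2 "sqrt c * \<sigma>"] c sg by (simp add: numeral_3_eq_3)
      then have "p1\<^sup>2 \<le> (sqrt c * \<sigma>)\<^sup>2" using p1 by (intro power_mono) auto
      then show ?thesis using c sg by (simp add: power_mult_distrib)
    qed
    have c1r: "c1 \<le> 2 * C\<^sup>2 * r\<^sup>2"
    proof -
      have "s\<^sup>2 \<le> (C * r)\<^sup>2" using sC s0 by (intro power_mono) auto
      moreover have "1 / 4 \<le> s\<^sup>2" using s0 mult_mono[of 1 s 1 s] by (simp add: power2_eq_square)
      ultimately show ?thesis unfolding c1_def power_mult_distrib by linarith
    qed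
    have cc1: "c * c1 \<le> r\<^sup>2 / 2"
      using c1r assms unfolding c_def by (simp add: field_simps)
    have bc: "b \<le> (1 - 2 * c) * c1"
      using c1r assms unfolding b_def c_def by (simp add: field_simps)
    \<comment> \<open>\<open>x1\<close> and \<open>x2\<close> are \<open>tanh\<close> at the two
      ends of the window, where the squared phase speed equals \<open>p1^2\<close> on the barrier
      side and on the oscillatory side; the turning point itself has
      \<open>tanh = k / \<sigma>\<close>.\<close>
    define x1 where "x1 = sqrt ((b - p1\<^sup>2) / c1)"
    define x2 where "x2 = sqrt ((b + p1\<^sup>2) / c1)"
    have x1: "x1\<^sup>2 = (b - p1\<^sup>2) / c1" "x1 > 0" using p1b c1 by (auto simp: x1_def)
    have x2: "x2\<^sup>2 = (b + p1\<^sup>2) / c1" "x2 > 0" using b c1 by (auto simp: x2_def add_pos_nonneg)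
    have bp: "b + p1\<^sup>2 \<le> (1 - c) * c1" using bc p1c by (simp add: algebra_simps)
    have x12: "x1 < x2" unfolding x1_def x2_def using c1 p1 by (simp add: divide_strict_right_mono)
    have x2c: "x2\<^sup>2 \<le> 1 - c" unfolding x2 using bp c1 by (simp add: field_simps)
    then have x21: "x2 < 1" using c x2 by (smt (verit) one_le_power)
    define t1 where "t1 = artanh x1"
    define t2 where "t2 = artanh x2"
    define t0 where "t0 = arsinh (k / r)"
    have t1: "tanh t1 = x1" unfolding t1_def using x1 x12 x21 by (intro tanh_artanh_real) auto
    have t2: "tanh t2 = x2" unfolding t2_def using x2 x21 by (intro tanh_artanh_real) auto
    have t1p: "t1 > 0" and t12: "t1 < t2" using t1 t2 x1 x12 tanh_real_pos_iff[of t1] tanh_real_less_iff[of t1 t2] by auto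
    have t2a: "t2 \<le> a"
    proof -
      have "x2 \<le> sqrt (1 - c)" using x2c by (rule real_le_rsqrt)
      then have "tanh t2 \<le> tanh a" using t2 ta by simp
      then show ?thesis by simp
    qed
    have sh0: "sinh t0 = k / r" by (simp add: t0_def)
    have ch0: "cosh t0 = \<sigma> / r"
    proof -
      have "(cosh t0)\<^sup>2 = (\<sigma> / r)\<^sup>2"
        unfolding cosh_square_eq sh0 using k sg r0 by (simp add: power_divide field_simps b_def)
      then show ?thesis using sg r0 by (simp add: power2_eq_iff_nonneg)
    qed
    have th0: "tanh t0 = k / \<sigma>" unfolding tanh_def sh0 ch0 using r0 sg by simp
    have x1t0: "x1 < k / \<sigma>" and x2t0: "k / \<sigma> < x2"
      unfolding x1_def x2_def k_def \<sigma>_def using p1 c1 by (auto simp: divide_strict_right_mono simp flip: real_sqrt_divide)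
    have t10: "t1 < t0" using x1t0 th0 t1 tanh_real_less_iff[of t1 t0] by simp
    have t02: "t0 < t2" using x2t0 th0 t2 tanh_real_less_iff[of t0 t2] by simp
    \<comment> \<open>The slope of \<open>tanh\<close> is at least \<open>c\<close> up to
      \<open>t2\<close>, so lengths in \<open>t\<close> can be read off from differences of
      \<open>tanh\<close>.\<close>
    have tanh_gap: "(t - u) * c \<le> tanh t - tanh u" if "0 \<le> u" "u \<le> t" "t \<le> t2" for t u
    proof -
      have "tanh u - u * c \<le> tanh t - t * c"
      proof (rule nondecreasing_if_deriv_nonneg[OF that(2), where f' = "\<lambda>y. 1 - (tanh y)\<^sup>2 - c"])
        fix y assume "u \<le> y" "y \<le> t"
        show "((\<lambda>x. tanh x - x * c) has_real_derivative 1 - (tanh y)\<^sup>2 - c) (at y)"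
          by (auto intro!: derivative_eq_intros)
        have "(tanh y)\<^sup>2 \<le> (tanh t2)\<^sup>2" using that \<open>u \<le> y\<close> \<open>y \<le> t\<close> by (intro tanh_square_mono) auto
        then show "1 - (tanh y)\<^sup>2 - c \<ge> 0" using x2c t2 by simp
      qed
      then show ?thesis by (simp add: algebra_simps)
    qed
    have cancel': "X * c * k \<le> Z / \<sigma>" if "X * c * (k / \<sigma>) \<le> Z / c1" for X Z :: real
    proof -
      have "X * c * (k / \<sigma>) * \<sigma> \<le> Z / c1 * \<sigma>" using that sg(1) by (intro mult_right_mono) auto
      then show ?thesis using sg(1) by (simp add: sg(2)[symmetric] power2_eq_square)
    qed
    have cancel: "X * p1 \<le> m / c" if "X * c * k * p1 \<le> m * k" for X m :: real
    proof -
      have "(X * p1 * c) * k \<le> m * k" using that by (simp add: mult_ac)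
      then have "X * p1 * c \<le> m" using k by (simp only: mult_le_cancel_right_pos)
      then show ?thesis using c by (simp add: pos_le_divide_eq)
    qed
    \<comment> \<open>the growth zone, up to the Airy scale around the turning point \<open>t0\<close>\<close>
    define p where "p = (\<lambda>t. sqrt (b + (- c1) * (tanh t)\<^sup>2))"
    define g where "g = (\<lambda>t. - c1 * tanh t * (1 - (tanh t)\<^sup>2) / p t ^ 3)"
    define g' where "g' = (\<lambda>t. - c1 * (1 - (tanh t)\<^sup>2) * (b - 2 * (- c1) * (tanh t)\<^sup>2 - 3 * b * (tanh t)\<^sup>2) / p t ^ 5)"
    \<comment> \<open>A closed form for the primitive of \<open>p\<close>. Since
      \<open>k^2 + r^2 = \<sigma>^2\<close>, both arcsines reach \<open>pi / 2\<close> at the same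
      point \<open>t0\<close>, which gives the barrier action
      \<open>pi / 2 * (\<sigma> - r)\<close>.\<close>
    define S where "S = (\<lambda>t. \<sigma> * arcsin (\<sigma> * tanh t / k) - r * arcsin (r * sinh t / k))"
    have q1: "p1\<^sup>2 \<le> b - c1 * (tanh t)\<^sup>2" if "0 \<le> t" "t \<le> t1" for t
    proof -
      have "c1 * (tanh t)\<^sup>2 \<le> c1 * (tanh t1)\<^sup>2" using that c1 by (intro mult_left_mono tanh_square_mono) auto
      also have "\<dots> = b - p1\<^sup>2" using c1 by (simp add: t1 x1)
      finally show ?thesis by simp
    qed
    have q0: "b - c1 * (tanh t)\<^sup>2 > 0" if "0 \<le> t" "t < t0" for t
    proof -
      have "c1 * (tanh t)\<^sup>2 < c1 * (tanh t0)\<^sup>2" using that c1 by (intro mult_strict_left_mono power_strict_mono) auto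
      also have "\<dots> = b" using c1 sg k by (simp add: th0 power_divide)
      finally show ?thesis by simp
    qed
    have pp: "p1 \<le> p t" if "0 \<le> t" "t \<le> t1" for t
      unfolding p_def using q1[OF that] by (intro real_le_rsqrt) simp
    have pt1: "p t1 = p1" unfolding p_def t1 using x1 c1 p1 by simp
    have dS: "(S has_real_derivative p t) (at t)" if t: "0 \<le> t" "t < t0" for t
    proof -
      have pos: "p t > 0" and p2: "(p t)\<^sup>2 = b - c1 * (tanh t)\<^sup>2" using q0[OF t] by (auto simp: p_def)
      have e1: "sqrt (1 - (\<sigma> * tanh t / k)\<^sup>2) = p t / k"
      proof (rule real_sqrt_unique)
        show "(p t / k)\<^sup>2 = 1 - (\<sigma> * tanh t / k)\<^sup>2"
          unfolding power_divide power_mult_distrib p2 sg k using b by (simp add: field_simps)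
      qed (use pos k in simp)
      have th: "(tanh t)\<^sup>2 * (cosh t)\<^sup>2 = (sinh t)\<^sup>2" by (simp add: tanh_def power_divide)
      have e2: "sqrt (1 - (r * sinh t / k)\<^sup>2) = p t * cosh t / k"
      proof (rule real_sqrt_unique)
        have "(p t)\<^sup>2 * (cosh t)\<^sup>2 = b * (cosh t)\<^sup>2 - c1 * (sinh t)\<^sup>2"
          unfolding p2 using th by (simp add: algebra_simps)
        also have "\<dots> = b - r\<^sup>2 * (sinh t)\<^sup>2"
          unfolding cosh_square_eq by (simp add: b_def algebra_simps)
        finally show "(p t * cosh t / k)\<^sup>2 = 1 - (r * sinh t / k)\<^sup>2"
          unfolding power_divide power_mult_distrib k using b by (simp add: field_simps)
      qed (use pos k in simp)
      have sq1: "- 1 < x \<and> x < 1" if "1 - x\<^sup>2 > 0" for x :: real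
        using that abs_square_less_1[of x] by (auto simp: abs_less_iff)
      have "1 - (\<sigma> * tanh t / k)\<^sup>2 > 0" using e1 pos k by (metis divide_pos_pos real_sqrt_gt_0_iff)
      then have l1: "- 1 < \<sigma> * tanh t / k" "\<sigma> * tanh t / k < 1" "k \<noteq> 0"
        using sq1 k by auto
      have "1 - (r * sinh t / k)\<^sup>2 > 0" using e2 pos k by (metis divide_pos_pos mult_pos_pos cosh_real_pos real_sqrt_gt_0_iff)
      then have l2: "- 1 < r * sinh t / k" "r * sinh t / k < 1"
        using sq1 by auto
      have d1: "((\<lambda>t. arcsin (\<sigma> * tanh t / k)) has_real_derivative inverse (p t / k) * (\<sigma> * (1 - (tanh t)\<^sup>2) / k)) (at t)"
        unfolding e1[symmetric]
        by (rule DERIV_chain2[OF DERIV_arcsin]) (use l1 in \<open>auto intro!: derivative_eq_intros\<close>)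
      have d2: "((\<lambda>t. arcsin (r * sinh t / k)) has_real_derivative inverse (p t * cosh t / k) * (r * cosh t / k)) (at t)"
        unfolding e2[symmetric]
        by (rule DERIV_chain2[OF DERIV_arcsin]) (use l1 l2 in \<open>auto intro!: derivative_eq_intros\<close>)
      have "(S has_real_derivative \<sigma> * (inverse (p t / k) * (\<sigma> * (1 - (tanh t)\<^sup>2) / k))
         - r * (inverse (p t * cosh t / k) * (r * cosh t / k))) (at t)"
        unfolding S_def by (intro DERIV_diff DERIV_cmult d1 d2)
      moreover have "\<sigma> * (inverse (p t / k) * (\<sigma> * (1 - (tanh t)\<^sup>2) / k))
         - r * (inverse (p t * cosh t / k) * (r * cosh t / k)) = (\<sigma>\<^sup>2 * (1 - (tanh t)\<^sup>2) - r\<^sup>2) / p t"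
        using pos k by (simp add: field_simps power2_eq_square)
      moreover have "\<sigma>\<^sup>2 * (1 - (tanh t)\<^sup>2) - r\<^sup>2 = (p t)\<^sup>2"
        unfolding p2 sg by (simp add: b_def algebra_simps)
      ultimately show ?thesis using pos by (simp add: power2_eq_square)
    qed
    have St0: "S t0 = pi / 2 * (\<sigma> - r)"
      unfolding S_def th0 sh0 using sg k r0 by (simp add: algebra_simps)
    \<comment> \<open>Stopping at \<open>t1\<close> instead of \<open>t0\<close> costs at most
      \<open>p1 * (t0 - t1)\<close>, which is bounded on the Airy scale because \<open>p\<close>
      decreases towards \<open>t0\<close>.\<close>
    have St1: "S t1 \<ge> pi / 2 * (s - r) - 4 / c"
    proof -
      have cont: "continuous_on {t1..t0} S"
        unfolding S_def
      proof (intro continuous_intros)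
        show "\<forall>t\<in>{t1..t0}. - 1 \<le> \<sigma> * tanh t / k \<and> \<sigma> * tanh t / k \<le> 1"
        proof
          fix t assume t: "t \<in> {t1..t0}"
          then have "0 \<le> tanh t" "tanh t \<le> k / \<sigma>" using t1p th0 tanh_real_le_iff[of t t0] by auto
          then have "0 \<le> \<sigma> * tanh t / k" "\<sigma> * tanh t / k \<le> 1" using sg k by (auto simp: field_simps)
          then show "- 1 \<le> \<sigma> * tanh t / k \<and> \<sigma> * tanh t / k \<le> 1" by linarith
        qed
        show "\<forall>t\<in>{t1..t0}. - 1 \<le> r * sinh t / k \<and> r * sinh t / k \<le> 1"
        proof
          fix t assume t: "t \<in> {t1..t0}"
          then have "0 \<le> sinh t" "sinh t \<le> k / r" using t1p sh0 sinh_real_le_iff[of t t0] by auto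
          then have "0 \<le> r * sinh t / k" "r * sinh t / k \<le> 1" using r0 k by (auto simp: field_simps)
          then show "- 1 \<le> r * sinh t / k \<and> r * sinh t / k \<le> 1" by linarith
        qed
      qed (use k in auto)
      obtain x where x: "t1 < x" "x < t0" "S t0 - S t1 = p x * (t0 - t1)"
      proof (rule mvt[OF t10 cont, of "\<lambda>x y. p x * y"])
        show "(S has_derivative (\<lambda>y. p x * y)) (at x)" if "t1 < x" "x < t0" for x
          using dS[of x] that t1p by (simp add: has_field_derivative_def)
      qed (use that in auto)
      have "p x \<le> p t1" unfolding p_def using x t1p c1 tanh_square_mono[of t1 x] by simp
      then have "S t0 - S t1 \<le> (t0 - t1) * p1" unfolding x(3) pt1[symmetric] mult.commute[of "p x"] using t10 by (intro mult_left_mono) auto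
      \<comment> \<open>Difference of squares: \<open>(k / \<sigma>)^2 - x1^2 = p1^2 / c1\<close>,
        so up to \<open>1 / c\<close> the length is \<open>p1^2 / (\<sigma> * k)\<close>, that is
        \<open>4 / p1\<close>.\<close>
      moreover have "(t0 - t1) * p1 \<le> 4 / c"
      proof -
        have "(t0 - t1) * c \<le> k / \<sigma> - x1" using tanh_gap[of t1 t0] t1p t10 t02 th0 t1 by auto
        moreover have "(k / \<sigma> - x1) * (k / \<sigma>) \<le> (k / \<sigma> - x1) * (k / \<sigma> + x1)"
          using x1t0 x1 by (intro mult_left_mono) auto
        moreover have "(k / \<sigma> - x1) * (k / \<sigma> + x1) = (k / \<sigma>)\<^sup>2 - x1\<^sup>2" by (simp add: power2_eq_square algebra_simps)
        moreover have "(k / \<sigma>)\<^sup>2 - x1\<^sup>2 = p1\<^sup>2 / c1" using c1 by (simp add: x1 power_divide k sg diff_divide_distrib)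
        moreover have "(t0 - t1) * c * (k / \<sigma>) \<le> (k / \<sigma> - x1) * (k / \<sigma>)"
          using calculation(1) k sg by (intro mult_right_mono) auto
        ultimately have "(t0 - t1) * c * (k / \<sigma>) \<le> p1\<^sup>2 / c1" by linarith
        then have "(t0 - t1) * c * k \<le> p1\<^sup>2 / \<sigma>"
          by (rule cancel')
        then have "(t0 - t1) * c * k * p1 \<le> p1\<^sup>2 / \<sigma> * p1" using p1 by (intro mult_right_mono) auto
        also have "\<dots> = 4 * k" using p1(2) sg(1) by (simp add: field_simps eval_nat_numeral)
        finally show ?thesis by (rule cancel)
      qed
      moreover have "pi / 2 * (s - r) \<le> S t0" unfolding St0 using ssg by simp
      ultimately show ?thesis by linarith
    qed
    have w': "(w has_real_derivative (p t)\<^sup>2 * v t) (at t)" if "0 \<le> t" "t \<le> t1" for t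
    proof -
      have "(p t)\<^sup>2 = b - c1 * (tanh t)\<^sup>2" using q0[of t] that t10 by (simp add: p_def)
      also have "\<dots> = c1 * (1 - (tanh t)\<^sup>2) - r\<^sup>2" by (simp add: b_def algebra_simps)
      finally show ?thesis using w[of t] unfolding c1_def by simp
    qed
    have 1: "p 0 * (v 0)\<^sup>2 * exp (2 * S t1) \<le> 9 * adiabatic (p t1) (v t1) (w t1)"
    proof (rule wkb_growth[where g = g and g' = g'])
      fix t assume t: "0 \<le> t" "t \<le> t1"
      have pos: "p t > 0" using pp[OF t] p1 by linarith
      have q: "b + (- c1) * (tanh t)\<^sup>2 > 0" using q0[of t] t t10 by simp
      show "p t > 0" by fact
      show "(p has_real_derivative g t * (p t)\<^sup>2) (at t)" "(g has_real_derivative g' t) (at t)"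
        using phase_speed_derivs[OF q] unfolding p_def g_def g'_def by auto
      show "\<bar>g t\<bar> \<le> 1 / 2"
      proof -
        have "tanh t \<le> k / \<sigma>" using th0 t t10 tanh_real_le_iff[of t t0] by auto
        moreover have tt: "0 \<le> tanh t" "(tanh t)\<^sup>2 \<le> 1" using t tanh_square_lt_1[of t] by auto
        ultimately have "c1 * (tanh t * (1 - (tanh t)\<^sup>2)) \<le> c1 * (k / \<sigma> * 1)"
          using c1 k sg by (intro mult_left_mono mult_mono) auto
        also have "\<dots> = \<sigma> * k" using sg(1) by (simp add: sg(2)[symmetric] power2_eq_square)
        finally have "c1 * (tanh t * (1 - (tanh t)\<^sup>2)) \<le> \<sigma> * k" .
        moreover have "\<bar>g t\<bar> = c1 * (tanh t * (1 - (tanh t)\<^sup>2)) / p t ^ 3"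
          unfolding g_def using pos c1 tt by (simp add: abs_mult)
        moreover have "p1 ^ 3 \<le> p t ^ 3" using pp[OF t] p1 by (intro power_mono) auto
        ultimately have "\<bar>g t\<bar> \<le> (\<sigma> * k) / p1 ^ 3"
          using p1(1) pos sg(1) k(1) c1 tt by (auto intro!: frac_le)
        also have "\<dots> \<le> 1 / 2" unfolding p1(2) using sg k by simp
        finally show ?thesis .
      qed
      \<comment> \<open>Because \<open>b \<le> c1\<close>, the bracket is at least
        \<open>b * (1 - tanh^2)\<close>.\<close>
      show "g' t \<le> 0"
      proof -
        have "b * (tanh t)\<^sup>2 \<le> c1 * (tanh t)\<^sup>2" by (intro mult_right_mono) (auto simp: b_def)
        moreover have "b * (tanh t)\<^sup>2 \<le> b * 1" using tanh_square_lt_1[of t] b by (intro mult_left_mono) auto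
        ultimately have "0 \<le> b - 2 * (- c1) * (tanh t)\<^sup>2 - 3 * b * (tanh t)\<^sup>2" by simp
        then have "0 \<le> c1 * (1 - (tanh t)\<^sup>2) * (b - 2 * (- c1) * (tanh t)\<^sup>2 - 3 * b * (tanh t)\<^sup>2) / p t ^ 5"
          using c1 pos tanh_square_lt_1[of t] by (intro divide_nonneg_nonneg mult_nonneg_nonneg) auto
        then show ?thesis unfolding g'_def by simp
      qed
    qed (use t1p t10 v w' v0 w0 dS in \<open>auto simp: g_def S_def\<close>)
    \<comment> \<open>the turning point zone\<close>
    have p12: "p1 * (t2 - t1) \<le> 8 / c"
    proof -
      have "(t2 - t1) * c \<le> x2 - x1" using tanh_gap[of t1 t2] t1p t12 t1 t2 by auto
      then have "(t2 - t1) * c * (k / \<sigma>) \<le> (x2 - x1) * (x2 + x1)"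
        using k sg x2t0 x12 x1 c t12 by (intro mult_mono) auto
      also have "\<dots> = x2\<^sup>2 - x1\<^sup>2" by (simp add: power2_eq_square algebra_simps)
      also have "\<dots> = 2 * p1\<^sup>2 / c1" using c1 by (simp add: x1 x2 field_simps)
      finally have "(t2 - t1) * c * k \<le> 2 * p1\<^sup>2 / \<sigma>" by (rule cancel')
      then have "(t2 - t1) * c * k * p1 \<le> 2 * p1\<^sup>2 / \<sigma> * p1" using p1 by (intro mult_right_mono) auto
      also have "\<dots> = 8 * k" using p1(2) sg(1) by (simp add: field_simps eval_nat_numeral)
      finally have "(t2 - t1) * p1 \<le> 8 / c" by (rule cancel)
      then show ?thesis by (simp add: mult.commute)
    qed
    have 2: "adiabatic p1 (v t1) (w t1) \<le> adiabatic p1 (v t2) (w t2) * exp (2 * p1 * (t2 - t1))"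
    proof (rule gronwall_adiabatic[where Q = "\<lambda>t. c1 * (1 - (tanh t)\<^sup>2) - r\<^sup>2"])
      fix t assume t: "t1 \<le> t" "t \<le> t2"
      have "c1 * (tanh t1)\<^sup>2 \<le> c1 * (tanh t)\<^sup>2" "c1 * (tanh t)\<^sup>2 \<le> c1 * (tanh t2)\<^sup>2"
        using t c1 t1p by (auto intro!: mult_left_mono tanh_square_mono)
      moreover have "c1 * (tanh t1)\<^sup>2 = b - p1\<^sup>2" "c1 * (tanh t2)\<^sup>2 = b + p1\<^sup>2"
        using c1 by (simp_all add: t1 x1 t2 x2)
      moreover have "c1 * (1 - (tanh t)\<^sup>2) - r\<^sup>2 = b - c1 * (tanh t)\<^sup>2" by (simp add: b_def algebra_simps)
      ultimately show "\<bar>c1 * (1 - (tanh t)\<^sup>2) - r\<^sup>2\<bar> \<le> p1\<^sup>2" by (intro abs_leI) linarith+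
    qed (use t12 p1 v w in \<open>auto simp: c1_def\<close>)
    \<comment> \<open>the oscillatory zone\<close>
    define P where "P = (\<lambda>t. sqrt (- b + c1 * (tanh t)\<^sup>2))"
    define G where "G = (\<lambda>t. c1 * tanh t * (1 - (tanh t)\<^sup>2) / P t ^ 3)"
    define G' where "G' = (\<lambda>t. c1 * (1 - (tanh t)\<^sup>2) * (- b - 2 * c1 * (tanh t)\<^sup>2 - 3 * (- b) * (tanh t)\<^sup>2) / P t ^ 5)"
    have Q: "p1\<^sup>2 \<le> - b + c1 * (tanh t)\<^sup>2" if "t2 \<le> t" for t
    proof -
      have "c1 * (tanh t2)\<^sup>2 \<le> c1 * (tanh t)\<^sup>2" using that c1 t12 t1p by (intro mult_left_mono tanh_square_mono) auto
      moreover have "c1 * (tanh t2)\<^sup>2 = b + p1\<^sup>2" using c1 by (simp add: t2 x2)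
      ultimately show ?thesis by simp
    qed
    have Q0: "0 < - b + c1 * (tanh t)\<^sup>2" if "t2 \<le> t" for t
      using Q[OF that] zero_less_power[OF p1(1), of 2] by linarith
    have PP: "p1 \<le> P t" if "t2 \<le> t" for t
      unfolding P_def using Q[OF that] by (intro real_le_rsqrt) simp
    have Pt2: "P t2 = p1" unfolding P_def t2 using x2 c1 p1 by simp
    have dG: "(G has_real_derivative G' t) (at t)" if "t2 \<le> t" for t
      using phase_speed_derivs(2)[OF Q0[OF that]] unfolding G_def G'_def P_def .
    \<comment> \<open>Monotonicity of \<open>G\<close> makes \<open>- G\<close> an admissible
      \<open>H\<close>; its increase is then at most \<open>G t2 \<le> 1/2\<close>.\<close>
    have G'neg: "G' t \<le> 0" if "t2 \<le> t" for t
    proof -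
      have "b * (tanh t)\<^sup>2 \<le> c1 * (tanh t)\<^sup>2" by (intro mult_right_mono) (auto simp: b_def)
      moreover have "b * (tanh t)\<^sup>2 \<le> b * 1" using tanh_square_lt_1[of t] b by (intro mult_left_mono) auto
      ultimately have "0 \<le> - (- b - 2 * c1 * (tanh t)\<^sup>2 - 3 * (- b) * (tanh t)\<^sup>2)" by simp
      then have "0 \<le> c1 * (1 - (tanh t)\<^sup>2) * (- (- b - 2 * c1 * (tanh t)\<^sup>2 - 3 * (- b) * (tanh t)\<^sup>2)) / P t ^ 5"
        using c1 PP[OF that] p1 tanh_square_lt_1[of t] by (intro divide_nonneg_nonneg mult_nonneg_nonneg) auto
      then show ?thesis unfolding G'_def by (simp only: mult_minus_right minus_divide_left[symmetric] neg_0_le_iff_le)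
    qed
    have Gpos: "0 \<le> G t" if "t2 \<le> t" for t
      unfolding G_def using that t12 t1p c1 PP[OF that] p1 tanh_square_lt_1[of t]
      by (intro divide_nonneg_nonneg mult_nonneg_nonneg) auto
    \<comment> \<open>The 4 in \<open>p1^3 = 4 * \<sigma> * k\<close> pays off here:
      \<open>p1^2 < b\<close> gives \<open>x2 * \<sigma> \<le> 2 * k\<close>, and the quotient is at
      most 1/2.\<close>
    have Gt2: "G t2 \<le> 1 / 2"
    proof -
      have "x2 * \<sigma> \<le> 2 * k"
      proof (rule power2_le_imp_le)
        show "(x2 * \<sigma>)\<^sup>2 \<le> (2 * k)\<^sup>2"
          unfolding power_mult_distrib k x2 sg using c1 b p1b by simp
      qed (use k in simp)
      have "G t2 \<le> c1 * x2 * 1 / p1 ^ 3"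
        unfolding G_def t2 Pt2 using c1 x2(2) p1(1) by (intro divide_right_mono mult_left_mono) auto
      also have "\<dots> = (x2 * \<sigma>) / (4 * k)"
        unfolding p1 using sg(1) by (simp add: sg(2)[symmetric] power2_eq_square)
      also have "\<dots> \<le> (2 * k) / (4 * k)" using \<open>x2 * \<sigma> \<le> 2 * k\<close> k by (intro divide_right_mono) auto
      finally show ?thesis using k by simp
    qed
    have Gmono: "G t \<le> G t2" if "t2 \<le> t" for t
    proof -
      have "- G t2 \<le> - G t"
        by (rule nondecreasing_if_deriv_nonneg[OF that, where f' = "\<lambda>t. - G' t"])
          (use dG G'neg in \<open>auto intro!: derivative_eq_intros\<close>)
      then show ?thesis by simp
    qed
    have "adiabatic (P t2) (v t2) (w t2) \<le> 20 * r * integral {a..a+1} (\<lambda>t. (v t)\<^sup>2)"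
    proof (rule oscillatory_zone[where H = "\<lambda>t. - G t" and H' = "\<lambda>t. - G' t" and K = "16 * C\<^sup>2", OF P_def refl])
      show "(w has_real_derivative (c1 * (1 - (tanh t)\<^sup>2) - r\<^sup>2) * v t) (at t)" for t
        using w unfolding c1_def .
      show "- b + c1 = r\<^sup>2" by (simp add: b_def)
      show "8 * c1 \<le> 16 * C\<^sup>2 * r\<^sup>2" using c1r by simp
      show "r\<^sup>2 \<le> 4 * (- b + c1 * (tanh a)\<^sup>2)"
      proof -
        have "- b + c1 * (tanh a)\<^sup>2 = r\<^sup>2 - c * c1" unfolding ta2 by (simp add: b_def algebra_simps)
        moreover have "X \<le> 4 * (X - Y)" if "Y \<le> X / 2" "0 \<le> X" for X Y :: real
          using that by simp
        ultimately show ?thesis using cc1 zero_le_power2 by metis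
      qed
      show "\<bar>c1 * tanh t * (1 - (tanh t)\<^sup>2) / P t ^ 3\<bar> \<le> 1 / 2" if "t2 \<le> t" for t
        using Gpos[OF that] order_trans[OF Gmono[OF that] Gt2] unfolding G_def by (simp only: abs_of_nonneg)
      show "\<bar>c1 * (1 - (tanh t)\<^sup>2) * (- b - 2 * c1 * (tanh t)\<^sup>2 - 3 * - b * (tanh t)\<^sup>2) / P t ^ 5\<bar> \<le> - G' t"
        if "t2 \<le> t" for t
        using G'neg[OF that] unfolding G'_def by (simp only: abs_of_nonpos order_refl)
      show "- G (a + 1) - - G t2 \<le> 1"
        using Gpos[of "a+1"] Gt2 t2a by auto
      show "((\<lambda>t. - G t) has_real_derivative - G' t) (at t)" if "t2 \<le> t" for t
        using dG[OF that] by (rule DERIV_minus)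
    qed (use r0 r R v t12 t1p t2a c1 Q0[of t2] in auto)
    then have 3: "adiabatic p1 (v t2) (w t2) \<le> 20 * r * integral {a..a+1} (\<lambda>t. (v t)\<^sup>2)"
      unfolding Pt2 .
    have cv: "continuous_on {a..b} v" for a b
      by (rule DERIV_continuous_on[of _ _ w]) (auto intro!: has_field_derivative_at_within[OF v])
    have 4: "integral {a..a+1} (\<lambda>t. (v t)\<^sup>2) \<le> integral {0..a+1} (\<lambda>t. (v t)\<^sup>2)"
      using a0 by (intro integral_subset_le integrable_continuous_real continuous_intros cv) auto
    have "sqrt (s\<^sup>2 - r\<^sup>2) \<le> p 0" unfolding p_def using b by simp
    then have "sqrt (s\<^sup>2 - r\<^sup>2) * (v 0)\<^sup>2 * exp (pi * (s - r)) \<le> p 0 * (v 0)\<^sup>2 * exp (2 * S t1 + 8 / c)"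
      using St1 b by (intro mult_mono) (auto simp: p_def)
    also have "\<dots> = p 0 * (v 0)\<^sup>2 * exp (2 * S t1) * exp (8 / c)" by (simp add: exp_add)
    also have "\<dots> \<le> 9 * adiabatic p1 (v t1) (w t1) * exp (8 / c)"
      using 1 unfolding pt1 by (rule mult_right_mono) simp
    also have "\<dots> \<le> 9 * (adiabatic p1 (v t2) (w t2) * exp (16 / c)) * exp (8 / c)"
    proof -
      have "exp (2 * p1 * (t2 - t1)) \<le> exp (16 / c)" using p12 by simp
      then have "adiabatic p1 (v t2) (w t2) * exp (2 * p1 * (t2 - t1)) \<le> adiabatic p1 (v t2) (w t2) * exp (16 / c)"
        by (rule mult_left_mono) (rule adiabatic_nonneg[OF p1(1)])
      then show ?thesis using 2 by (intro mult_right_mono) auto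
    qed
    also have "\<dots> = 9 * exp (24 / c) * adiabatic p1 (v t2) (w t2)"
      by (simp add: mult.assoc exp_add[symmetric] add_divide_distrib[symmetric])
    also have "\<dots> \<le> 9 * exp (24 / c) * (20 * r * integral {0..a+1} (\<lambda>t. (v t)\<^sup>2))"
    proof (rule mult_left_mono)
      show "adiabatic p1 (v t2) (w t2) \<le> 20 * r * integral {0..a+1} (\<lambda>t. (v t)\<^sup>2)"
        using 3 mult_left_mono[OF 4, of "20 * r"] r0 by linarith
    qed simp
    finally show ?thesis by (simp add: A_def)
  qed
  have "sqrt (s\<^sup>2 - r\<^sup>2) * (v 0)\<^sup>2 * exp (pi * (s - r)) \<le> A * r * integral {0..a+1} (\<lambda>t. (v t)\<^sup>2)"
    if r: "r \<ge> R" "s \<ge> R" "s - r \<ge> R" "s < C * r"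
      and v: "\<And>t. (v has_real_derivative w t) (at t)"
      and w: "\<And>t. (w has_real_derivative ((s\<^sup>2 + 1/4) * (1 - (tanh t)\<^sup>2) - r\<^sup>2) * v t) (at t)"
      and w0: "w 0 = 0" for r s and v w :: "real \<Rightarrow> real"
  proof -
    \<comment> \<open>The WKB argument needs a positive initial value; the equation is linear, so
      the sign of the solution may be reversed.\<close>
    consider "v 0 > 0" | "v 0 = 0" | "- v 0 > 0" by linarith
    then show ?thesis
    proof cases
      case 1
      show ?thesis by (rule main[OF r v w w0 1])
    next
      case 2
      have "0 \<le> integral {0..a+1} (\<lambda>t. (v t)\<^sup>2)" by (cases "(\<lambda>t. (v t)\<^sup>2) integrable_on {0..a+1}") (auto intro: integral_nonneg simp: not_integrable_integral)
      then show ?thesis using 2 r by (auto simp: A_def R_def)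
    next
      case 3
      have "sqrt (s\<^sup>2 - r\<^sup>2) * (- v 0)\<^sup>2 * exp (pi * (s - r)) \<le> A * r * integral {0..a+1} (\<lambda>t. (- v t)\<^sup>2)"
        by (rule main[OF r, where w = "\<lambda>t. - w t"]) (use v w w0 3 in \<open>auto intro!: derivative_eq_intros\<close>)
      then show ?thesis by simp
    qed
  qed
  moreover have "R \<ge> 1" "A > 0" "a + 1 > 0" using a0 by (auto simp: R_def A_def)
  ultimately show ?thesis by blast
qed

section \<open>The Lorentz group acting on hyperbolic space\<close>

lemma sum_UNIV_option:
  fixes f :: "'a::finite option \<Rightarrow> 'b::comm_monoid_add"
  shows "(\<Sum>i\<in>UNIV. f i) = f None + (\<Sum>a\<in>UNIV. f (Some a))"
  unfolding UNIV_option_conv by (subst sum.insert) (auto simp: sum.reindex)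

lemma sgn_cases_real: "(x::real) \<noteq> 0 \<Longrightarrow> sgn x = 1 \<or> sgn x = - 1"
  by (auto simp: sgn_if)

definition space_part :: "real ^ 'd option \<Rightarrow> real ^ 'd::finite" where
  "space_part x = (\<chi> a. x $ Some a)"

text \<open>The first column of \<open>boost v\<close>: the point of the upper sheet of the
  hyperboloid whose spatial part is \<open>v\<close>.\<close>

definition pt :: "real ^ 'd \<Rightarrow> real ^ 'd::finite option" where
  "pt v = (\<chi> i. case i of None \<Rightarrow> sqrt (1 + (norm v)\<^sup>2) | Some a \<Rightarrow> v $ a)"

definition mdot :: "real ^ 'd::finite option \<Rightarrow> real ^ 'd option \<Rightarrow> real" where
  "mdot x y = x $ None * y $ None - space_part x \<bullet> space_part y"

text \<open>The action on \<open>O(1, d) / K\<close> in the chart \<open>v\<close>. A Lorentz matrix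
  may exchange the two sheets, and the sign brings the image back to the upper one; this is
  consistent because \<open>K\<close> contains minus the identity.\<close>

definition act :: "'d::finite lmat \<Rightarrow> real ^ 'd \<Rightarrow> real ^ 'd" where
  "act g v = sgn ((g *v pt v) $ None) *\<^sub>R space_part (g *v pt v)"

definition time_sign :: "'d::finite lmat \<Rightarrow> real" where
  "time_sign g = sgn ((g *v pt 0) $ None)"

definition lorentz_inv :: "'d::finite lmat \<Rightarrow> 'd lmat" where
  "lorentz_inv g = minkowski ** transpose g ** minkowski"

lemma space_part_nth [simp]: "space_part x $ a = x $ Some a"
  by (simp add: space_part_def)

lemma pt_nth [simp]: "pt v $ None = sqrt (1 + (norm v)\<^sup>2)" "pt v $ Some a = v $ a"
  by (simp_all add: pt_def)

lemma space_part_pt [simp]: "space_part (pt v) = v"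
  by (simp add: vec_eq_iff)

lemma space_part_scaleR [simp]: "space_part (c *\<^sub>R x) = c *\<^sub>R space_part x"
  by (simp add: vec_eq_iff)

lemma vec_option_eqI:
  fixes x y :: "'a ^ 'd::finite option"
  assumes "x $ None = y $ None" "\<And>a. x $ Some a = y $ Some a"
  shows "x = y"
  unfolding vec_eq_iff using assms by (metis option.exhaust)

lemma inner_option: "(x :: real ^ 'd::finite option) \<bullet> y = x $ None * y $ None + space_part x \<bullet> space_part y"
  by (simp add: inner_vec_def sum_UNIV_option)

lemma mdot_scaleR [simp]: "mdot (c *\<^sub>R x) y = c * mdot x y" "mdot x (c *\<^sub>R y) = c * mdot x y"
  by (simp_all add: mdot_def algebra_simps)

lemma mdot_commute: "mdot x y = mdot y x"
  by (simp add: mdot_def inner_commute mult.commute)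

lemma minkowski_mult: "(minkowski *v y) $ i = (if i = None then y $ i else - y $ i)"
  by (simp add: minkowski_def matrix_vector_mult_def if_distrib[of "\<lambda>x. x * _"] cong: if_cong)

lemma mdot_minkowski: "mdot x y = x \<bullet> (minkowski *v y)"
proof -
  have "space_part (minkowski *v y) = - space_part y"
    by (simp add: vec_eq_iff minkowski_mult)
  then show ?thesis by (simp add: inner_option mdot_def minkowski_mult)
qed

lemma minkowski_minkowski: "minkowski ** minkowski = mat 1"
  by (simp add: matrix_eq matrix_vector_mul_assoc[symmetric] vec_eq_iff minkowski_mult)

lemma inner_matrix_vector_transpose:
  fixes A :: "real ^ 'n ^ 'm"
  shows "(A *v x) \<bullet> y = x \<bullet> (transpose A *v y)"
  by (metis dot_lmul_matrix vector_transpose_matrix)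

lemma O1_iff: "g \<in> O1 \<longleftrightarrow> (\<forall>x y. mdot (g *v x) (g *v y) = mdot x y)"
proof -
  have 1: "mdot (g *v x) (g *v y) = x \<bullet> ((transpose g ** minkowski ** g) *v y)" for x y
    by (simp add: mdot_minkowski inner_matrix_vector_transpose matrix_vector_mul_assoc[symmetric])
  show ?thesis
  proof
    assume "g \<in> O1"
    then have *: "transpose g ** minkowski ** g = minkowski" by (simp add: O1_def)
    show "\<forall>x y. mdot (g *v x) (g *v y) = mdot x y"
      by (simp only: 1 *) (simp only: mdot_minkowski simp_thms)
  next
    assume "\<forall>x y. mdot (g *v x) (g *v y) = mdot x y"
    then have "x \<bullet> ((transpose g ** minkowski ** g) *v y) = x \<bullet> (minkowski *v y)" for x y
      by (simp only: 1[symmetric] mdot_minkowski[symmetric])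
    then have "(transpose g ** minkowski ** g) *v y = minkowski *v y" for y
      by (meson vector_eq_ldot)
    then show "g \<in> O1" unfolding O1_def by (simp only: matrix_eq mem_Collect_eq) simp
  qed
qed

lemma mdot_O1: "g \<in> O1 \<Longrightarrow> mdot (g *v x) (g *v y) = mdot x y"
  using O1_iff by blast

lemma mat_1_in_O1: "mat 1 \<in> O1"
  by (simp add: O1_iff)

lemma mult_in_O1: "g \<in> O1 \<Longrightarrow> h \<in> O1 \<Longrightarrow> g ** h \<in> O1"
  by (simp add: O1_iff matrix_vector_mul_assoc[symmetric])

lemma lorentz_inv_left:
  assumes "g \<in> O1"
  shows "lorentz_inv g ** g = mat 1"
proof -
  have "lorentz_inv g ** g = minkowski ** (transpose g ** minkowski ** g)"
    by (simp add: lorentz_inv_def matrix_mul_assoc)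
  then show ?thesis using assms by (simp add: O1_def minkowski_minkowski)
qed

lemma lorentz_inv_right: "g \<in> O1 \<Longrightarrow> g ** lorentz_inv g = mat 1"
  using lorentz_inv_left matrix_left_right_inverse by blast

lemma lorentz_inv_in_O1:
  assumes "g \<in> O1"
  shows "lorentz_inv g \<in> O1"
  unfolding O1_iff
proof (intro allI)
  fix x y
  have "mdot (lorentz_inv g *v x) (lorentz_inv g *v y)
      = mdot (g *v (lorentz_inv g *v x)) (g *v (lorentz_inv g *v y))"
    by (simp add: mdot_O1[OF assms])
  then show "mdot (lorentz_inv g *v x) (lorentz_inv g *v y) = mdot x y"
    by (simp add: matrix_vector_mul_assoc lorentz_inv_right[OF assms])
qed

section \<open>The action on the upper sheet of the hyperboloid\<close>

lemma mdot_pt_self: "mdot (pt v) (pt v) = 1"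
  by (simp add: mdot_def dot_square_norm flip: power2_eq_square)

lemma mdot_pt_pos: "mdot (pt v) (pt w) > 0"
proof -
  have "v \<bullet> w \<le> norm v * norm w" by (rule norm_cauchy_schwarz)
  also have "\<dots> < sqrt (1 + (norm v)\<^sup>2) * sqrt (1 + (norm w)\<^sup>2)"
    by (intro mult_strict_mono') (auto intro: real_less_rsqrt)
  finally show ?thesis by (simp add: mdot_def)
qed

lemma unit_timelike_eq:
  assumes "mdot x x = 1"
  shows "x = sgn (x $ None) *\<^sub>R pt (sgn (x $ None) *\<^sub>R space_part x)" and "x $ None \<noteq> 0"
proof -
  have x0: "(x $ None)\<^sup>2 = 1 + (norm (space_part x))\<^sup>2"
    using assms by (simp add: mdot_def dot_square_norm power2_eq_square)
  then show n0: "x $ None \<noteq> 0" by (metis add_pos_nonneg less_irrefl zero_less_one zero_le_power2 zero_power2)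
  have s: "sgn (x $ None) * sgn (x $ None) = 1" using n0 by (auto simp: sgn_if)
  have "sqrt (1 + (norm (space_part x))\<^sup>2) = \<bar>x $ None\<bar>"
    unfolding x0[symmetric] by simp
  moreover have "norm (sgn (x $ None) *\<^sub>R space_part x) = norm (space_part x)"
    using n0 by (simp add: abs_sgn_eq)
  ultimately show "x = sgn (x $ None) *\<^sub>R pt (sgn (x $ None) *\<^sub>R space_part x)"
    using s by (intro vec_option_eqI) (auto simp: sgn_mult_abs mult.assoc[symmetric])
qed

lemma mult_pt_ex:
  assumes "g \<in> O1"
  shows "g *v pt v = sgn ((g *v pt v) $ None) *\<^sub>R pt (act g v)" "(g *v pt v) $ None \<noteq> 0"
proof -
  have m: "mdot (g *v pt v) (g *v pt v) = 1"
    by (simp add: mdot_O1[OF assms] mdot_pt_self)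
  show "g *v pt v = sgn ((g *v pt v) $ None) *\<^sub>R pt (act g v)" "(g *v pt v) $ None \<noteq> 0"
    using unit_timelike_eq[OF m] by (simp_all add: act_def)
qed

lemma time_sign_cases:
  assumes "g \<in> O1" shows "time_sign g = 1 \<or> time_sign g = - 1"
  unfolding time_sign_def using mult_pt_ex(2)[OF assms] sgn_cases_real by blast

text \<open>The sign of the time coordinate is the same at all points of the sheet: two points of
  one sheet have positive Minkowski product by the reversed Cauchy-Schwarz inequality, and
  \<open>g\<close> preserves the product.\<close>

lemma mult_pt:
  assumes "g \<in> O1"
  shows "g *v pt v = time_sign g *\<^sub>R pt (act g v)"
proof -
  let ?e = "sgn ((g *v pt v) $ None)" and ?f = "time_sign g"
  have "0 < mdot (g *v pt v) (g *v pt 0)"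
    by (simp add: mdot_O1[OF assms] mdot_pt_pos)
  then have "0 < ?e * (?f * mdot (pt (act g v)) (pt (act g 0)))"
    by (subst (asm) (1 2) mult_pt_ex(1)[OF assms]) (simp add: time_sign_def mult.left_commute)
  then have "0 < ?e * ?f"
    using mdot_pt_pos[of "act g v" "act g 0"] by (simp add: mult.assoc[symmetric] zero_less_mult_iff)
  then have "?e = ?f"
    using sgn_cases_real[OF mult_pt_ex(2)[OF assms, of v]] time_sign_cases[OF assms] by auto
  then show ?thesis using mult_pt_ex(1)[OF assms, of v] by simp
qed

lemma act_eqI:
  assumes "g *v pt v = e *\<^sub>R pt w" "e = 1 \<or> e = - 1"
  shows "act g v = w"
proof -
  have "0 < sqrt (1 + (norm w)\<^sup>2)" by (simp add: add_pos_nonneg)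
  then show ?thesis using assms(2) unfolding act_def assms(1) by (auto simp: sgn_if)
qed

lemma pt_scaleR_eq:
  assumes "e *\<^sub>R pt v = f *\<^sub>R pt w" "e = 1 \<or> e = - 1" "f = 1 \<or> f = - 1"
  shows "e = f \<and> v = w"
proof -
  have "(e *\<^sub>R pt v) $ None = (f *\<^sub>R pt w) $ None" by (simp only: assms(1))
  then have "e * pt v $ None = f * pt w $ None" by (simp only: vector_scaleR_component real_scaleR_def)
  moreover have "pt v $ None > 0" "pt w $ None > 0" by (simp_all add: add_pos_nonneg)
  moreover have "x * a = y * b \<Longrightarrow> a > 0 \<Longrightarrow> b > 0 \<Longrightarrow> x = 1 \<or> x = - 1 \<Longrightarrow> y = 1 \<or> y = - 1 \<Longrightarrow> x = y"
    for x y a b :: real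
    by auto
  ultimately have "e = f" using assms(2,3) by blast
  then have "pt v = pt w" using assms by auto
  then show ?thesis using \<open>e = f\<close> by (metis space_part_pt)
qed

lemma time_sign_eqI:
  assumes "g \<in> O1" "g *v pt v = e *\<^sub>R pt w" "e = 1 \<or> e = - 1"
  shows "time_sign g = e"
  using pt_scaleR_eq[of "time_sign g" "act g v" e w] assms time_sign_cases[OF assms(1)] mult_pt[OF assms(1)]
  by metis

lemma act_mat_1 [simp]: "act (mat 1) v = v"
  by (rule act_eqI[of _ _ 1]) auto

lemma act_mult:
  assumes "g \<in> O1" "h \<in> O1"
  shows "act (g ** h) v = act g (act h v)"
proof (rule act_eqI)
  show "(g ** h) *v pt v = (time_sign h * time_sign g) *\<^sub>R pt (act g (act h v))"
    by (simp add: matrix_vector_mul_assoc[symmetric] mult_pt assms matrix_vector_mult_scaleR)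
  show "time_sign h * time_sign g = 1 \<or> time_sign h * time_sign g = - 1"
    using time_sign_cases assms by (metis mult_minus1 mult_minus1_right mult_1 minus_minus)
qed

lemma act_lorentz_inv [simp]:
  assumes "g \<in> O1"
  shows "act (lorentz_inv g) (act g v) = v" "act g (act (lorentz_inv g) v) = v"
  using act_mult[OF lorentz_inv_in_O1[OF assms] assms, of v] act_mult[OF assms lorentz_inv_in_O1[OF assms], of v]
    lorentz_inv_left[OF assms] lorentz_inv_right[OF assms] by auto

lemma mdot_act:
  assumes "g \<in> O1"
  shows "mdot (pt (act g v)) (pt (act g w)) = mdot (pt v) (pt w)"
proof -
  have "mdot (g *v pt v) (g *v pt w) = time_sign g * (time_sign g * mdot (pt (act g v)) (pt (act g w)))"
    by (simp add: mult_pt[OF assms])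
  then show ?thesis
    using time_sign_cases[OF assms] by (auto simp: mdot_O1[OF assms])
qed

lemma continuous_on_pt: "continuous_on S pt"
proof -
  have "continuous_on S (\<lambda>v. pt v $ i)" for i :: "'a option"
    by (cases i) (auto intro!: continuous_intros)
  then have "continuous_on S (\<lambda>v. \<chi> i. pt v $ i)"
    by (rule continuous_on_vec_lambda)
  then show ?thesis by simp
qed

lemma continuous_on_space_part: "continuous_on S space_part"
  unfolding space_part_def by (intro continuous_on_vec_lambda continuous_intros)

lemma continuous_on_act:
  assumes "g \<in> O1"
  shows "continuous_on S (act g)"
proof -
  have "act g v = time_sign g *\<^sub>R space_part (g *v pt v)" for v
    using mult_pt[OF assms, of v] time_sign_cases[OF assms] by auto
  then have "act g = (\<lambda>v. time_sign g *\<^sub>R space_part (g *v pt v))" by blast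
  moreover have "continuous_on S (\<lambda>v. g *v pt v)"
    by (rule continuous_on_compose2[OF matrix_vector_mult_linear_continuous_on continuous_on_pt subset_UNIV])
  then have "continuous_on S (\<lambda>v. space_part (g *v pt v))"
    by (rule continuous_on_compose2[OF continuous_on_space_part _ subset_UNIV])
  then have "continuous_on S (\<lambda>v. time_sign g *\<^sub>R space_part (g *v pt v))"
    by (rule continuous_on_scaleR[OF continuous_on_const])
  ultimately show ?thesis by simp
qed

section \<open>Boosts and the Cartan decomposition\<close>

lemma boost_nth:
  "boost v $ None $ None = sqrt (1 + (norm v)\<^sup>2)"
  "boost v $ None $ Some b = v $ b"
  "boost v $ Some a $ None = v $ a"
  "boost v $ Some a $ Some b = (if a = b then 1 else 0) + v $ a * v $ b / (1 + sqrt (1 + (norm v)\<^sup>2))"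
  by (simp_all add: boost_def Let_def)

lemma boost_mult_time: "(boost v *v x) $ None = sqrt (1 + (norm v)\<^sup>2) * x $ None + v \<bullet> space_part x"
  by (simp add: matrix_vector_mult_def sum_UNIV_option boost_nth inner_vec_def)

lemma boost_mult_space:
  "space_part (boost v *v x) = x $ None *\<^sub>R v + space_part x
     + ((v \<bullet> space_part x) / (1 + sqrt (1 + (norm v)\<^sup>2))) *\<^sub>R v"
proof -
  let ?k = "1 + sqrt (1 + (norm v)\<^sup>2)"
  have "(boost v *v x) $ Some a = v $ a * x $ None
      + (\<Sum>b\<in>UNIV. (if b = a then x $ Some b else 0) + v $ a / ?k * (v $ b * x $ Some b))" for a
    unfolding matrix_vector_mult_def by (auto simp: sum_UNIV_option boost_nth algebra_simps intro!: sum.cong)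
  then show ?thesis
    by (simp add: vec_eq_iff sum.distrib sum_distrib_left sum_distrib_right sum_divide_distrib inner_vec_def mult_ac)
qed

text \<open>With \<open>c = sqrt (1 + |v|^2)\<close> and \<open>k = 1 / (1 + c)\<close>, invariance
  of the form reduces to the two identities \<open>|v|^2 * k = c - 1\<close> and
  \<open>2 * k + |v|^2 * k^2 = 1\<close>, both consequences of
  \<open>c^2 = 1 + |v|^2\<close>.\<close>

lemma boost_in_O1: "boost v \<in> O1"
  unfolding O1_iff
proof (intro allI)
  fix x y :: "real ^ 'a option"
  define c where "c = sqrt (1 + (norm v)\<^sup>2)"
  define k where "k = 1 / (1 + c)"
  define p where "p = v \<bullet> space_part x"
  define q where "q = v \<bullet> space_part y"
  have c: "c \<ge> 1" "c * c = 1 + v \<bullet> v" by (auto simp: c_def dot_square_norm)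
  have nk: "(v \<bullet> v) * k = c - 1"
  proof -
    have "v \<bullet> v = (c - 1) * (1 + c)" using c by (simp add: algebra_simps)
    then show ?thesis using c by (simp add: k_def)
  qed
  have kk: "2 * k + (v \<bullet> v) * k * k = 1"
  proof -
    have "2 * k + (v \<bullet> v) * k * k = (1 + c) * k" unfolding nk by (simp add: algebra_simps)
    then show ?thesis using c by (simp add: k_def)
  qed
  have tx: "(boost v *v x) $ None = c * x $ None + p" "(boost v *v y) $ None = c * y $ None + q"
    by (simp_all add: boost_mult_time c_def p_def q_def)
  have sx: "space_part (boost v *v x) = (x $ None + p * k) *\<^sub>R v + space_part x"
    "space_part (boost v *v y) = (y $ None + q * k) *\<^sub>R v + space_part y"
    by (simp_all add: boost_mult_space c_def p_def q_def k_def algebra_simps)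
  have "mdot (boost v *v x) (boost v *v y) = (c * x $ None + p) * (c * y $ None + q)
     - ((x $ None + p * k) * (y $ None + q * k) * (v \<bullet> v) + (x $ None + p * k) * q + (y $ None + q * k) * p
        + space_part x \<bullet> space_part y)"
    unfolding mdot_def tx sx by (simp add: inner_add_left inner_add_right p_def q_def inner_commute algebra_simps)
  also have "\<dots> = x $ None * y $ None * (c * c - v \<bullet> v) + (x $ None * q + y $ None * p) * (c - 1 - (v \<bullet> v) * k)
     + p * q * (1 - (2 * k + (v \<bullet> v) * k * k)) - space_part x \<bullet> space_part y"
    by (simp add: algebra_simps)
  also have "\<dots> = mdot x y" unfolding kk unfolding nk by (simp add: c mdot_def)
  finally show "mdot (boost v *v x) (boost v *v y) = mdot x y" .
qed

lemma boost_mult_pt_0: "boost v *v pt 0 = pt v"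
proof (rule vec_option_eqI)
  have "space_part (boost v *v pt 0) = space_part (pt v)" by (simp add: boost_mult_space)
  then show "(boost v *v pt 0) $ Some a = pt v $ Some a" for a by (metis space_part_nth)
qed (simp add: boost_mult_time)

lemma act_boost_0 [simp]: "act (boost v) 0 = v"
  by (rule act_eqI[of _ _ 1]) (auto simp: boost_mult_pt_0)

lemma time_sign_boost [simp]: "time_sign (boost v) = 1"
  by (rule time_sign_eqI[of _ 0 _ v]) (auto simp: boost_mult_pt_0 boost_in_O1)

lemma pt_0_axis: "pt 0 = axis None 1"
  by (rule vec_option_eqI) (auto simp: axis_def)

lemma time_diag_mult:
  "(time_diag e k *v x) $ None = e * x $ None" "space_part (time_diag e k *v x) = k *v space_part x"
  by (simp_all add: vec_eq_iff matrix_vector_mult_def sum_UNIV_option time_diag_def)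

text \<open>A Lorentz matrix that fixes the origin has first column plus or minus the time vector.
  Invariance of the form then clears the first row, and what remains is a Euclidean isometry on the
  spatial block.\<close>

lemma K1_eq: "K1 = {g \<in> O1. act g 0 = 0}"
proof (intro equalityI subsetI)
  fix g assume "g \<in> K1"
  then obtain e k where g: "g = time_diag e k" "e = 1 \<or> e = - 1" "orthogonal_matrix k"
    by (auto simp: K1_def)
  have "(k *v x) \<bullet> (k *v y) = x \<bullet> y" for x y
    using g(3) unfolding inner_matrix_vector_transpose matrix_vector_mul_assoc orthogonal_matrix by simp
  then have "g \<in> O1"
    using g(2) by (auto simp: O1_iff g(1) mdot_def time_diag_mult)
  moreover have "g *v pt 0 = e *\<^sub>R pt 0"
  proof -
    have "space_part (g *v pt 0) = space_part (e *\<^sub>R pt 0)" unfolding g(1) time_diag_mult by simp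
    then have "(g *v pt 0) $ Some a = (e *\<^sub>R pt 0) $ Some a" for a by (metis space_part_nth)
    moreover have "(g *v pt 0) $ None = (e *\<^sub>R pt 0) $ None" unfolding g(1) time_diag_mult by simp
    ultimately show ?thesis by (intro vec_option_eqI)
  qed
  ultimately show "g \<in> {g \<in> O1. act g 0 = 0}" using act_eqI[OF _ g(2)] by blast
next
  fix g :: "'a lmat" assume "g \<in> {g \<in> O1. act g 0 = 0}"
  then have g: "g \<in> O1" "act g 0 = 0" by auto
  define e where "e = time_sign g"
  have e: "e = 1 \<or> e = - 1" unfolding e_def by (rule time_sign_cases[OF g(1)])
  have g0: "g *v pt 0 = e *\<^sub>R pt 0" using mult_pt[OF g(1), of 0] g(2) by (simp add: e_def)
  have col: "g $ i $ None = (if i = None then e else 0)" for i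
  proof -
    have "g $ i $ None = (g *v pt 0) $ i"
      unfolding pt_0_axis by (simp add: matrix_vector_mul_component inner_axis)
    then show ?thesis unfolding g0 by (cases i) auto
  qed
  have row: "g $ None $ Some b = 0" for b
  proof -
    have "mdot (g *v axis (Some b) 1) (g *v pt 0) = mdot (axis (Some b) 1) (pt 0)" by (rule mdot_O1[OF g(1)])
    moreover have "mdot x (pt 0) = x $ None" for x :: "real ^ 'a option" by (simp add: mdot_def)
    moreover have "(g *v axis (Some b) 1) $ None = g $ None $ Some b"
      by (simp add: matrix_vector_mul_component inner_axis)
    ultimately show ?thesis using e unfolding g0 by (auto simp: axis_def)
  qed
  define k where "k = (\<chi> a b. g $ Some a $ Some b)"
  have gk: "g = time_diag e k"
    unfolding vec_eq_iff
  proof (intro allI)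
    fix i j show "g $ i $ j = time_diag e k $ i $ j"
      using col[of i] row by (cases i; cases j) (auto simp: time_diag_def k_def)
  qed
  have "x \<bullet> ((transpose k ** k) *v y) = x \<bullet> y" for x y
  proof -
    define X where "X = (\<chi> i. case i of None \<Rightarrow> 0 | Some a \<Rightarrow> x $ a)"
    define Y where "Y = (\<chi> i. case i of None \<Rightarrow> 0 | Some a \<Rightarrow> y $ a)"
    have XY: "X $ None = 0" "Y $ None = 0" "space_part X = x" "space_part Y = y"
      by (auto simp: X_def Y_def vec_eq_iff)
    have "mdot (g *v X) (g *v Y) = mdot X Y" by (rule mdot_O1[OF g(1)])
    then have "(k *v x) \<bullet> (k *v y) = x \<bullet> y"
      unfolding gk mdot_def time_diag_mult XY by simp
    then show ?thesis unfolding inner_matrix_vector_transpose matrix_vector_mul_assoc .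
  qed
  then have "(transpose k ** k) *v y = y" for y by (meson vector_eq_ldot)
  then have "transpose k ** k = mat 1" unfolding matrix_eq by simp
  then have "orthogonal_matrix k" by (simp add: orthogonal_matrix)
  then show "g \<in> K1" using gk e by (auto simp: K1_def)
qed

lemma mat_1_in_K1: "mat 1 \<in> K1"
  by (simp add: K1_eq mat_1_in_O1)

lemma K1_subset_O1: "k \<in> K1 \<Longrightarrow> k \<in> O1"
  by (simp add: K1_eq)

lemma mult_in_K1: "g \<in> K1 \<Longrightarrow> h \<in> K1 \<Longrightarrow> g ** h \<in> K1"
  by (auto simp: K1_eq mult_in_O1 act_mult)

lemma lorentz_inv_in_K1: "g \<in> K1 \<Longrightarrow> lorentz_inv g \<in> K1"
  using act_lorentz_inv(1)[of g 0] by (auto simp: K1_eq lorentz_inv_in_O1)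

text \<open>Undoing the boost to \<open>act g 0\<close> leaves an element that fixes the origin,
  hence lies in \<open>K1\<close>.\<close>

lemma cartan:
  assumes "g \<in> O1"
  shows "\<exists>k\<in>K1. g = boost (act g 0) ** k"
proof
  let ?b = "boost (act g 0)"
  show "lorentz_inv ?b ** g \<in> K1"
    using act_lorentz_inv(1)[OF boost_in_O1, of "act g 0" 0] assms
    by (simp add: K1_eq mult_in_O1 lorentz_inv_in_O1 boost_in_O1 act_mult)
  show "g = ?b ** (lorentz_inv ?b ** g)"
    by (simp add: matrix_mul_assoc lorentz_inv_right[OF boost_in_O1])
qed

section \<open>Fermi coordinates along the cycle\<close>

definition cons_vec :: "real \<Rightarrow> real ^ 'n \<Rightarrow> real ^ 'n::finite option" where
  "cons_vec x w = (\<chi> i. case i of None \<Rightarrow> x | Some a \<Rightarrow> w $ a)"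

lemma cons_vec_nth [simp]: "cons_vec x w $ None = x" "cons_vec x w $ Some a = w $ a"
  by (simp_all add: cons_vec_def)

lemma norm_cons_vec: "(norm (cons_vec x w))\<^sup>2 = x\<^sup>2 + (norm w)\<^sup>2"
  unfolding norm_eq_sqrt_inner inner_option
  by (simp add: space_part_def cons_vec_def power2_eq_square)

text \<open>Points of Minkowski space of signature \<open>(1, d)\<close> whose last spatial coordinate is \<open>t\<close>.\<close>

definition snoc_vec :: "real ^ 'n option \<Rightarrow> real \<Rightarrow> real ^ 'n::finite option option" where
  "snoc_vec y t = (\<chi> i. case i of None \<Rightarrow> y $ None | Some j \<Rightarrow> (case j of None \<Rightarrow> t | Some a \<Rightarrow> y $ Some a))"

lemma snoc_vec_nth [simp]:
  "snoc_vec y t $ None = y $ None" "snoc_vec y t $ Some None = t" "snoc_vec y t $ Some (Some a) = y $ Some a"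
  by (simp_all add: snoc_vec_def)

lemma snoc_vec_surj: "\<exists>y t. x = snoc_vec y t"
proof (intro exI vec_option_eqI)
  let ?y = "\<chi> i. case i of None \<Rightarrow> x $ None | Some a \<Rightarrow> x $ Some (Some a)"
  show "x $ None = snoc_vec ?y (x $ Some None) $ None" by simp
  show "x $ Some a = snoc_vec ?y (x $ Some None) $ Some a" for a by (cases a) auto
qed

lemma snoc_vec_scaleR: "c *\<^sub>R snoc_vec y t = snoc_vec (c *\<^sub>R y) (c * t)"
  by (rule vec_option_eqI) (auto simp: snoc_vec_def split: option.split)

lemma block_diag_mult: "block_diag g e *v snoc_vec y t = snoc_vec (g *v y) (e * t)"
proof (rule vec_option_eqI)
  show "(block_diag g e *v snoc_vec y t) $ None = snoc_vec (g *v y) (e * t) $ None"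
    by (simp add: matrix_vector_mult_def sum_UNIV_option block_diag_def drop_last_def)
  show "(block_diag g e *v snoc_vec y t) $ Some a = snoc_vec (g *v y) (e * t) $ Some a" for a
    by (cases a) (simp_all add: matrix_vector_mult_def sum_UNIV_option block_diag_def drop_last_def)
qed

lemma mdot_snoc_vec: "mdot (snoc_vec y t) (snoc_vec z u) = mdot y z - t * u"
  by (simp add: mdot_def inner_option[of "space_part (snoc_vec y t)"] ) (simp add: inner_vec_def)

lemma block_diag_in_O1:
  assumes "g \<in> O1" "e = 1 \<or> e = - 1"
  shows "block_diag g e \<in> O1"
  unfolding O1_iff
proof (intro allI)
  fix x y :: "real ^ 'a option option"
  obtain x' t y' u where "x = snoc_vec x' t" "y = snoc_vec y' u" using snoc_vec_surj by metis
  then show "mdot (block_diag g e *v x) (block_diag g e *v y) = mdot x y"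
    using assms(2) by (auto simp: block_diag_mult mdot_snoc_vec mdot_O1[OF assms(1)])
qed

lemma block_diag_mult_block_diag: "block_diag g e ** block_diag h f = block_diag (g ** h) (e * f)"
  unfolding matrix_eq
proof
  fix x :: "real ^ 'a option option"
  obtain y t where "x = snoc_vec y t" using snoc_vec_surj by blast
  then show "(block_diag g e ** block_diag h f) *v x = block_diag (g ** h) (e * f) *v x"
    by (simp add: matrix_vector_mul_assoc[symmetric] block_diag_mult mult.assoc)
qed

lemma block_diag_mat_1: "block_diag (mat 1) 1 = mat 1"
  unfolding matrix_eq
proof
  fix x :: "real ^ 'a option option"
  obtain y t where "x = snoc_vec y t" using snoc_vec_surj by blast
  then show "block_diag (mat 1) 1 *v x = mat 1 *v x" by (simp add: block_diag_mult)
qed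

lemma block_diag_inject:
  assumes "block_diag g e = block_diag h f"
  shows "g = h \<and> e = f"
proof
  have "snoc_vec (g *v y) (e * t) = snoc_vec (h *v y) (f * t)" for y t
    unfolding block_diag_mult[symmetric] assms ..
  then have *: "snoc_vec (g *v y) (e * t) $ i = snoc_vec (h *v y) (f * t) $ i" for y t i by simp
  have "(g *v y) $ j = (h *v y) $ j" for y j
    using *[of y 0 None] *[of y 0 "Some (Some a)" for a] by (cases j) auto
  then show "g = h" unfolding matrix_eq vec_eq_iff by blast
  show "e = f" using *[of 0 1 "Some None"] by simp
qed

text \<open>The point at signed distance \<open>t\<close> on the geodesic that leaves the hyperplane
  with last coordinate 0 perpendicularly at its point \<open>w\<close>. Index \<open>None\<close> of
  the spatial vector is the last coordinate.\<close>

definition fermi :: "real ^ 'n \<Rightarrow> real \<Rightarrow> real ^ 'n::finite option" where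
  "fermi w t = cons_vec (sinh t) (cosh t *\<^sub>R w)"

lemma pt_fermi: "pt (fermi w t) = snoc_vec (cosh t *\<^sub>R pt w) (sinh t)"
proof (rule vec_option_eqI)
  have "1 + (norm (fermi w t))\<^sup>2 = (cosh t)\<^sup>2 * (1 + (norm w)\<^sup>2)"
    unfolding fermi_def norm_cons_vec by (simp add: cosh_square_eq power_mult_distrib algebra_simps)
  then show "pt (fermi w t) $ None = snoc_vec (cosh t *\<^sub>R pt w) (sinh t) $ None"
    by (simp add: real_sqrt_mult)
  show "pt (fermi w t) $ Some a = snoc_vec (cosh t *\<^sub>R pt w) (sinh t) $ Some a" for a
    by (cases a) (auto simp: fermi_def)
qed

lemma block_diag_mult_pt_fermi:
  assumes "h \<in> O1" "e = 1 \<or> e = - 1"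
  shows "block_diag h e *v pt (fermi w t) = time_sign h *\<^sub>R pt (fermi (act h w) (time_sign h * e * t))"
proof -
  let ?s = "time_sign h"
  have 1: "?s * (?s * x) = x" for x using time_sign_cases[OF assms(1)] by auto
  have 2: "sinh (?s * e * t) = ?s * e * sinh t" "cosh (?s * e * t) = cosh t"
    using time_sign_cases[OF assms(1)] assms(2) by auto
  have "block_diag h e *v pt (fermi w t) = snoc_vec (cosh t *\<^sub>R (?s *\<^sub>R pt (act h w))) (e * sinh t)"
    by (simp only: pt_fermi block_diag_mult matrix_vector_mult_scaleR mult_pt[OF assms(1)])
  also have "\<dots> = snoc_vec (?s *\<^sub>R (cosh t *\<^sub>R pt (act h w))) (?s * (?s * (e * sinh t)))"
    by (simp only: 1 scaleR_left_commute)
  also have "\<dots> = ?s *\<^sub>R pt (fermi (act h w) (?s * e * t))"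
    by (simp only: pt_fermi 2 snoc_vec_scaleR) (simp only: mult.assoc)
  finally show ?thesis .
qed

text \<open>The sheet correction also acts on the last coordinate, so the two sides of the
  hyperplane are exchanged according to the product \<open>time_sign h * e\<close> and not to
  \<open>e\<close> alone.\<close>

lemma act_block_diag_fermi:
  assumes "h \<in> O1" "e = 1 \<or> e = - 1"
  shows "act (block_diag h e) (fermi w t) = fermi (act h w) (time_sign h * e * t)"
  using act_eqI[OF block_diag_mult_pt_fermi[OF assms] time_sign_cases[OF assms(1)]] .

lemma fermi_0_0: "fermi 0 0 = 0"
  by (rule vec_option_eqI) (auto simp: fermi_def)

section \<open>Invariance of the hyperbolic measure\<close>

lemma Basis_vec_real: "(Basis :: (real ^ 'n::finite) set) = range (\<lambda>i. axis i 1)"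
  by (auto simp: Basis_vec_def)

lemma prod_Basis_vec:
  fixes z :: "real ^ 'n::finite"
  shows "(\<Prod>b\<in>Basis. z \<bullet> b) = (\<Prod>i\<in>UNIV. z $ i)"
  unfolding Basis_vec_real
  by (subst prod.reindex) (auto simp: inj_on_def axis_eq_axis inner_axis)

lemma cons_vec_borel [measurable]: "(\<lambda>(x, w :: real ^ 'n::finite). cons_vec x w) \<in> borel_measurable borel"
proof (rule borel_measurable_continuous_onI)
  have "continuous_on UNIV (\<lambda>p. cons_vec (fst p) (snd p) $ i)" for i :: "'n option"
    by (cases i) (auto intro!: continuous_intros)
  then have "continuous_on UNIV (\<lambda>p :: real \<times> (real ^ 'n). \<chi> i. cons_vec (fst p) (snd p) $ i)"
    by (rule continuous_on_vec_lambda)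
  then show "continuous_on UNIV (\<lambda>(x, w :: real ^ 'n). cons_vec x w)"
    by (simp add: case_prod_beta)
qed

lemma box_Pair:
  fixes a c :: "'a::euclidean_space" and b d :: "'b::euclidean_space"
  shows "box (a, b) (c, d) = box a c \<times> box b d"
  by (auto simp: box_def Basis_prod_def inner_Pair_0 ball_Un)

lemma lborel_cons_vec: "(lborel :: (real ^ 'n::finite option) measure) = distr lborel borel (\<lambda>(x, w). cons_vec x w)"
proof (rule lborel_eqI)
  fix l u :: "real ^ 'n option"
  assume lu: "\<And>b. b \<in> Basis \<Longrightarrow> l \<bullet> b \<le> u \<bullet> b"
  then have lu': "l $ i \<le> u $ i" for i
    using lu[of "axis i 1"] by (auto simp: inner_axis Basis_vec_real)
  have eq: "(\<lambda>(x, w). cons_vec x w) -` box l u = box (l $ None, space_part l) (u $ None, space_part u)"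
  proof (intro equalityI subsetI)
    fix p assume "p \<in> (\<lambda>(x, w). cons_vec x w) -` box l u"
    then have *: "l $ i < cons_vec (fst p) (snd p) $ i \<and> cons_vec (fst p) (snd p) $ i < u $ i" for i
      by (auto simp: mem_box_cart case_prod_beta)
    have "l $ None < fst p \<and> fst p < u $ None" using *[of None] by simp
    moreover have "l $ Some a < snd p $ a \<and> snd p $ a < u $ Some a" for a using *[of "Some a"] by simp
    ultimately show "p \<in> box (l $ None, space_part l) (u $ None, space_part u)"
      by (cases p) (auto simp: box_Pair mem_box_cart)
  next
    fix p assume p: "p \<in> box (l $ None, space_part l) (u $ None, space_part u)"
    have "l $ i < cons_vec (fst p) (snd p) $ i \<and> cons_vec (fst p) (snd p) $ i < u $ i" for i
      using p by (cases p; cases i) (auto simp: box_Pair mem_box_cart)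
    then show "p \<in> (\<lambda>(x, w). cons_vec x w) -` box l u" by (auto simp: mem_box_cart case_prod_beta)
  qed
  have "emeasure (distr lborel borel (\<lambda>(x, w). cons_vec x w)) (box l u)
      = emeasure lborel (box (l $ None, space_part l) (u $ None, space_part u))"
    by (subst emeasure_distr) (auto simp: eq)
  also have "\<dots> = emeasure lborel (box (l $ None) (u $ None)) * emeasure lborel (box (space_part l) (space_part u))"
    unfolding box_Pair lborel_prod[symmetric] by (rule lborel.emeasure_pair_measure_Times) auto
  also have "\<dots> = ennreal (u $ None - l $ None) * ennreal (\<Prod>b\<in>Basis. (space_part u - space_part l) \<bullet> b)"
    using lu' by (subst emeasure_lborel_box) (auto simp: Basis_vec_real inner_axis)
  also have "\<dots> = ennreal ((u $ None - l $ None) * (\<Prod>a\<in>UNIV. u $ Some a - l $ Some a))"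
    using lu' unfolding prod_Basis_vec by (subst ennreal_mult) (auto intro!: prod_nonneg)
  also have "(u $ None - l $ None) * (\<Prod>a\<in>UNIV. u $ Some a - l $ Some a) = (\<Prod>i\<in>UNIV. (u - l) $ i)"
    unfolding UNIV_option_conv by (subst prod.insert) (auto simp: prod.reindex)
  also have "\<dots> = (\<Prod>b\<in>Basis. (u - l) \<bullet> b)" by (simp only: prod_Basis_vec)
  finally show "emeasure (distr lborel borel (\<lambda>(x, w). cons_vec x w)) (box l u) = ennreal (\<Prod>b\<in>Basis. (u - l) \<bullet> b)" .
qed simp

lemma nn_integral_lborel_option:
  fixes H :: "real ^ 'n::finite option \<Rightarrow> ennreal"
  assumes [measurable]: "H \<in> borel_measurable borel"
  shows "(\<integral>\<^sup>+z. H z \<partial>lborel) = (\<integral>\<^sup>+x. \<integral>\<^sup>+w. H (cons_vec x w) \<partial>lborel \<partial>lborel)"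
proof -
  have m: "(\<lambda>p. H (case p of (x, w) \<Rightarrow> cons_vec x w)) \<in> borel_measurable (lborel \<Otimes>\<^sub>M lborel)"
    unfolding lborel_prod by (rule measurable_compose[OF _ assms]) simp
  have "(\<integral>\<^sup>+z. H z \<partial>lborel) = (\<integral>\<^sup>+p. H (case p of (x, w) \<Rightarrow> cons_vec x w) \<partial>lborel)"
    by (subst lborel_cons_vec) (simp add: nn_integral_distr)
  also have "\<dots> = (\<integral>\<^sup>+x. \<integral>\<^sup>+w. H (cons_vec x w) \<partial>lborel \<partial>lborel)"
    unfolding lborel_prod[symmetric] using lborel.nn_integral_fst[OF m] by simp
  finally show ?thesis .
qed

lemma nn_integral_lborel_scale:
  fixes f :: "real ^ 'n::finite \<Rightarrow> ennreal"
  assumes [measurable]: "f \<in> borel_measurable borel" and c: "c > 0"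
  shows "(\<integral>\<^sup>+w. f w \<partial>lborel) = ennreal (c ^ CARD('n)) * (\<integral>\<^sup>+w. f (c *\<^sub>R w) \<partial>lborel)"
  using c by (subst lborel_affine[of c 0])
    (simp_all add: nn_integral_density nn_integral_distr nn_integral_cmult)

lemma nn_integral_hyperbolic:
  fixes f :: "real ^ 'n::finite \<Rightarrow> ennreal"
  assumes "f \<in> borel_measurable borel"
  shows "(\<integral>\<^sup>+v. f v \<partial>hyperbolic_measure) = (\<integral>\<^sup>+v. f v * ennreal (1 / sqrt (1 + (norm v)\<^sup>2)) \<partial>lborel)"
  unfolding hyperbolic_measure_def using assms
  by (subst nn_integral_density) (auto simp: mult.commute)

lemma sets_hyperbolic [simp, measurable_cong]: "sets hyperbolic_measure = sets borel"
  by (simp add: hyperbolic_measure_def)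

lemma space_hyperbolic [simp]: "space hyperbolic_measure = UNIV"
  by (simp add: hyperbolic_measure_def)

section \<open>Linear changes of variables for Lebesgue measure\<close>

lemma nn_integral_lborel_shear:
  fixes f :: "real ^ 'n::finite \<Rightarrow> ennreal"
  assumes f [measurable]: "f \<in> borel_measurable borel" and mn: "m \<noteq> n"
  shows "(\<integral>\<^sup>+x. f (x + (c * x $ n) *\<^sub>R axis m 1) \<partial>lborel) = (\<integral>\<^sup>+x. f x \<partial>lborel)"
proof -
  interpret product_sigma_finite "\<lambda>_ :: real ^ 'n. lborel :: real measure" by standard
  let ?b = "axis m 1 :: real ^ 'n" and ?e = "axis n 1 :: real ^ 'n"
  let ?B = "Basis - {?b}"
  let ?S = "\<lambda>y :: real ^ 'n \<Rightarrow> real. \<Sum>b\<in>Basis. y b *\<^sub>R b"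
  have bB: "?b \<in> Basis" "?e \<in> Basis" by (auto simp: Basis_vec_real)
  have ne: "?e \<noteq> ?b" using mn by (simp add: axis_eq_axis)
  have ins: "Basis = insert ?b ?B" using bB by auto
  have split: "(\<integral>\<^sup>+x. F x \<partial>lborel) = (\<integral>\<^sup>+y. \<integral>\<^sup>+z. F (?S (y(?b := z))) \<partial>lborel \<partial>(\<Pi>\<^sub>M b\<in>?B. lborel))"
    if [measurable]: "F \<in> borel_measurable borel" for F :: "real ^ 'n \<Rightarrow> ennreal"
  proof -
    have m: "(\<lambda>y. F (?S y)) \<in> borel_measurable (\<Pi>\<^sub>M b\<in>insert ?b ?B. lborel)"
      unfolding ins[symmetric] by measurable
    have "(\<integral>\<^sup>+x. F x \<partial>lborel) = (\<integral>\<^sup>+y. F (?S y) \<partial>(\<Pi>\<^sub>M b\<in>Basis. lborel))"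
      by (subst lborel_eq) (subst nn_integral_distr, measurable)
    also have "\<dots> = (\<integral>\<^sup>+y. F (?S y) \<partial>(\<Pi>\<^sub>M b\<in>insert ?b ?B. lborel))" using ins by simp
    also have "\<dots> = (\<integral>\<^sup>+y. \<integral>\<^sup>+z. F (?S (y(?b := z))) \<partial>lborel \<partial>(\<Pi>\<^sub>M b\<in>?B. lborel))"
      using m by (intro product_nn_integral_insert) auto
    finally show ?thesis .
  qed
  have S: "?S (y(?b := z)) = z *\<^sub>R ?b + (\<Sum>b\<in>?B. y b *\<^sub>R b)" for y z
    by (subst ins, subst sum.insert) (auto intro!: sum.cong)
  have "?S y $ n = y ?e" for y
  proof -
    have "?S y \<bullet> ?e = y ?e" using bB by (simp add: inner_sum_left_Basis)
    then show ?thesis by (simp add: inner_axis)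
  qed
  then have Sn: "?S (y(?b := z)) $ n = y ?e" for y z using ne by simp
  have "(\<integral>\<^sup>+x. f (x + (c * x $ n) *\<^sub>R ?b) \<partial>lborel)
      = (\<integral>\<^sup>+y. \<integral>\<^sup>+z. f (?S (y(?b := z)) + (c * ?S (y(?b := z)) $ n) *\<^sub>R ?b) \<partial>lborel \<partial>(\<Pi>\<^sub>M b\<in>?B. lborel))"
  proof (rule split)
    have "(\<lambda>x :: real ^ 'n. x + (c * x $ n) *\<^sub>R ?b) \<in> borel_measurable borel"
      by (intro borel_measurable_continuous_onI continuous_intros)
    then show "(\<lambda>x. f (x + (c * x $ n) *\<^sub>R ?b)) \<in> borel_measurable borel"
      by (rule measurable_compose) (rule f)
  qed
  also have "\<dots> = (\<integral>\<^sup>+y. \<integral>\<^sup>+z. f (?S (y(?b := z))) \<partial>lborel \<partial>(\<Pi>\<^sub>M b\<in>?B. lborel))"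
  proof (rule nn_integral_cong)
    fix y
    let ?h = "\<lambda>z. f (z *\<^sub>R ?b + (\<Sum>b\<in>?B. y b *\<^sub>R b))"
    have "?h \<in> borel_measurable borel"
      by (rule measurable_compose[OF _ f]) (intro borel_measurable_continuous_onI continuous_intros)
    then have "(\<integral>\<^sup>+z. ?h z \<partial>lborel) = (\<integral>\<^sup>+z. ?h (c * y ?e + 1 * z) \<partial>lborel)"
      by (subst nn_integral_real_affine[where c = 1 and t = "c * y ?e"]) auto
    then show "(\<integral>\<^sup>+z. f (?S (y(?b := z)) + (c * ?S (y(?b := z)) $ n) *\<^sub>R ?b) \<partial>lborel)
      = (\<integral>\<^sup>+z. f (?S (y(?b := z))) \<partial>lborel)"
      unfolding Sn unfolding S by (simp add: algebra_simps)
  qed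
  also have "\<dots> = (\<integral>\<^sup>+x. f x \<partial>lborel)" by (rule split[symmetric]) (rule f)
  finally show ?thesis .
qed

lemma nn_integral_lborel_permute:
  fixes f :: "real ^ 'n::finite \<Rightarrow> ennreal"
  assumes f [measurable]: "f \<in> borel_measurable borel" and p: "p permutes (UNIV :: 'n set)"
  shows "(\<integral>\<^sup>+x. f (\<chi> i. x $ p i) \<partial>lborel) = (\<integral>\<^sup>+x. f x \<partial>lborel)"
proof -
  have [measurable]: "(\<lambda>x :: real ^ 'n. \<chi> i. x $ p i) \<in> borel_measurable borel"
    by (intro borel_measurable_continuous_onI continuous_on_vec_lambda continuous_intros)
  have "(lborel :: (real ^ 'n) measure) = distr lborel borel (\<lambda>x. \<chi> i. x $ p i)"
  proof (rule lborel_eqI)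
    fix l u :: "real ^ 'n" assume lu: "\<And>b. b \<in> Basis \<Longrightarrow> l \<bullet> b \<le> u \<bullet> b"
    then have lu': "l $ i \<le> u $ i" for i
      using lu[of "axis i 1"] by (auto simp: inner_axis Basis_vec_real)
    let ?q = "inv_into UNIV p"
    have pq: "p (?q i) = i" "?q (p i) = i" for i using p by (auto simp: permutes_inverses)
    have "(\<lambda>x. \<chi> i. x $ p i) -` box l u = box (\<chi> i. l $ ?q i) (\<chi> i. u $ ?q i)"
      unfolding set_eq_iff by (auto simp: mem_box_cart) (metis pq)+
    then have "emeasure (distr lborel borel (\<lambda>x. \<chi> i. x $ p i)) (box l u) = emeasure lborel (box (\<chi> i. l $ ?q i) (\<chi> i. u $ ?q i))"
      by (subst emeasure_distr) auto
    also have "\<dots> = ennreal (\<Prod>b\<in>Basis. ((\<chi> i. u $ ?q i) - (\<chi> i. l $ ?q i)) \<bullet> b)"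
      using lu' by (intro emeasure_lborel_box) (auto simp: Basis_vec_real inner_axis)
    also have "(\<Prod>b\<in>Basis. ((\<chi> i. u $ ?q i) - (\<chi> i. l $ ?q i)) \<bullet> b) = (\<Prod>i\<in>UNIV. (u - l) $ ?q i)"
      unfolding prod_Basis_vec by simp
    also have "\<dots> = (\<Prod>i\<in>UNIV. (u - l) $ i)"
      using prod.permute[OF permutes_inv[OF p], of "\<lambda>i. (u - l) $ i"] by (simp add: o_def)
    finally show "emeasure (distr lborel borel (\<lambda>x. \<chi> i. x $ p i)) (box l u) = ennreal (\<Prod>b\<in>Basis. (u - l) \<bullet> b)"
      unfolding prod_Basis_vec .
  qed simp
  then have "(\<integral>\<^sup>+x. f x \<partial>lborel) = (\<integral>\<^sup>+x. f x \<partial>distr lborel borel (\<lambda>x. \<chi> i. x $ p i))" by simp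
  also have "\<dots> = (\<integral>\<^sup>+x. f (\<chi> i. x $ p i) \<partial>lborel)" by (rule nn_integral_distr) auto
  finally show ?thesis ..
qed

text \<open>
  The change of variables theorem of the library for linear maps asks for a well-ordered index type,
  which \<open>'n option\<close> is not.
\<close>

lemma nn_integral_lborel_matrix:
  fixes A :: "real ^ 'n::finite ^ 'n"
  shows "det A \<noteq> 0 \<longrightarrow> (\<forall>f\<in>borel_measurable borel.
    (\<integral>\<^sup>+x. f x \<partial>lborel) = ennreal \<bar>det A\<bar> * (\<integral>\<^sup>+x. f (A *v x) \<partial>lborel))"
\<comment> \<open>The generators: products, matrices with a zero row (vacuous, the determinant
  vanishes), diagonal matrices, transpositions of columns, and shears.\<close>
proof (induction A rule: induct_matrix_elementary)
  case (1 A B)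
  show ?case
  proof (intro impI ballI)
    fix f :: "real ^ 'n \<Rightarrow> ennreal" assume d: "det (A ** B) \<noteq> 0" and f: "f \<in> borel_measurable borel"
    have "(\<lambda>x. A *v x) \<in> borel_measurable borel"
      by (intro borel_measurable_continuous_onI matrix_vector_mult_linear_continuous_on)
    then have fA: "(\<lambda>x. f (A *v x)) \<in> borel_measurable borel" by (rule measurable_compose) (rule f)
    have "det A \<noteq> 0" "det B \<noteq> 0" using d by (auto simp: det_mul)
    then have "(\<integral>\<^sup>+x. f x \<partial>lborel) = ennreal \<bar>det A\<bar> * (\<integral>\<^sup>+x. f (A *v x) \<partial>lborel)"
      "(\<integral>\<^sup>+x. f (A *v x) \<partial>lborel) = ennreal \<bar>det B\<bar> * (\<integral>\<^sup>+x. f (A *v (B *v x)) \<partial>lborel)"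
      using 1 f fA by blast+
    then show "(\<integral>\<^sup>+x. f x \<partial>lborel) = ennreal \<bar>det (A ** B)\<bar> * (\<integral>\<^sup>+x. f ((A ** B) *v x) \<partial>lborel)"
      by (simp only: det_mul abs_mult ennreal_mult matrix_vector_mul_assoc mult.assoc abs_ge_zero)
  qed
next
  case (2 A i)
  then show ?case by (simp add: det_zero_row(1))
next
  case (3 A)
  show ?case
  proof (intro impI ballI)
    fix f :: "real ^ 'n \<Rightarrow> ennreal" assume d: "det A \<noteq> 0" and f [measurable]: "f \<in> borel_measurable borel"
    have det: "det A = (\<Prod>i\<in>UNIV. A $ i $ i)" by (rule det_diagonal) (rule 3)
    define c where "c b = (\<Sum>i\<in>UNIV. A $ i $ i * b $ i)" for b :: "real ^ 'n"
    have c: "c (axis i 1) = A $ i $ i" for i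
      unfolding c_def axis_def by (simp add: if_distrib[of "\<lambda>x. _ * x"] cong: if_cong)
    have nz: "A $ i $ i \<noteq> 0" for i using d by (simp add: det)
    have T: "0 + (\<Sum>j\<in>Basis. (c j * (x \<bullet> j)) *\<^sub>R j) = A *v x" for x
    proof -
      have "(\<Sum>j\<in>Basis. (c j * (x \<bullet> j)) *\<^sub>R j) = (\<Sum>i\<in>UNIV. (A $ i $ i * x $ i) *\<^sub>R axis i 1)"
        unfolding Basis_vec_real by (subst sum.reindex) (auto simp: inj_on_def axis_eq_axis c inner_axis)
      also have "\<dots> = A *v x"
      proof (rule vec_eq_iff[THEN iffD2], rule allI)
        fix k
        have "(A *v x) $ k = (\<Sum>j\<in>UNIV. A $ k $ j * x $ j)" by (simp add: matrix_vector_mult_def)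
        also have "\<dots> = (\<Sum>j\<in>UNIV. if j = k then A $ k $ k * x $ k else 0)"
          by (rule sum.cong[OF refl]) (use 3[of k] in auto)
        finally have "(A *v x) $ k = A $ k $ k * x $ k" by simp
        moreover have "((A $ i $ i * x $ i) *\<^sub>R axis i 1) $ k = (if i = k then A $ k $ k * x $ k else 0)" for i
          by (simp add: axis_def)
        ultimately show "(\<Sum>i\<in>UNIV. (A $ i $ i * x $ i) *\<^sub>R axis i 1) $ k = (A *v x) $ k"
          by (simp only: sum_component) simp
      qed
      finally show ?thesis by simp
    qed
    have "lborel = density (distr lborel borel (\<lambda>x. 0 + (\<Sum>j\<in>Basis. (c j * (x \<bullet> j)) *\<^sub>R j))) (\<lambda>_. (\<Prod>j\<in>Basis. \<bar>c j\<bar>))"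
      by (rule lborel_affine_euclidean) (auto simp: Basis_vec_real c nz)
    moreover have "(\<Prod>j\<in>Basis. \<bar>c j\<bar>) = \<bar>det A\<bar>"
      unfolding Basis_vec_real by (subst prod.reindex) (auto simp: inj_on_def axis_eq_axis c det abs_prod)
    ultimately have L: "lborel = density (distr lborel borel (\<lambda>x. A *v x)) (\<lambda>_. \<bar>det A\<bar>)" unfolding T by simp
    have [measurable]: "(\<lambda>x. A *v x) \<in> borel_measurable borel"
      by (intro borel_measurable_continuous_onI matrix_vector_mult_linear_continuous_on)
    show "(\<integral>\<^sup>+x. f x \<partial>lborel) = ennreal \<bar>det A\<bar> * (\<integral>\<^sup>+x. f (A *v x) \<partial>lborel)"
      by (subst L) (simp add: nn_integral_density nn_integral_distr nn_integral_cmult)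
  qed
next
  case (4 m n)
  let ?A = "(\<chi> i j. mat 1 $ i $ Transposition.transpose m n j) :: real ^ 'n ^ 'n"
  let ?p = "Transposition.transpose m n"
  have p: "?p permutes (UNIV :: 'n set)" by (rule permutes_swap_id) auto
  have "(?A *v x) $ i = x $ ?p i" for x i
  proof -
    have pp: "i = ?p j \<longleftrightarrow> j = ?p i" for j by (metis transpose_involutory)
    have "(?A *v x) $ i = (\<Sum>j\<in>UNIV. mat 1 $ i $ ?p j * x $ j)"
      by (simp add: matrix_vector_mult_def)
    also have "\<dots> = (\<Sum>j\<in>UNIV. if j = ?p i then x $ j else 0)"
      by (rule sum.cong[OF refl]) (simp add: mat_def pp)
    finally show ?thesis by simp
  qed
  then have Ax: "?A *v x = (\<chi> i. x $ ?p i)" for x by (simp add: vec_eq_iff)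
  have "\<bar>det ?A\<bar> = 1"
    using det_permute_columns[OF p, of "mat 1 :: real ^ 'n ^ 'n"] 4
    by (simp add: sign_swap_id abs_mult)
  then show ?case using nn_integral_lborel_permute[OF _ p] by (simp add: Ax)
next
  case (5 m n c)
  let ?A = "(\<chi> i j. if i = m \<and> j = n then c else of_bool (i = j)) :: real ^ 'n ^ 'n"
  have "(?A *v x) $ i = (x + (c * x $ n) *\<^sub>R axis m 1) $ i" for x i
  proof -
    have "(?A *v x) $ i = (\<Sum>j\<in>UNIV. (if i = m \<and> j = n then c else of_bool (i = j)) * x $ j)"
      by (simp add: matrix_vector_mult_def)
    also have "\<dots> = (\<Sum>j\<in>UNIV. (if j = i then x $ i else 0) + (if j = n then (if i = m then c * x $ n else 0) else 0))"
      by (rule sum.cong[OF refl]) (use 5 in auto)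
    finally show ?thesis by (simp add: sum.distrib axis_def)
  qed
  then have Ax: "?A *v x = x + (c * x $ n) *\<^sub>R axis m 1" for x by (simp add: vec_eq_iff)
  have "?A = (\<chi> k. if k = m then row m (mat 1) + c *s row n (mat 1) else row k (mat 1))"
    using 5 by (auto simp: vec_eq_iff row_def mat_def)
  then have "det ?A = 1" using det_row_operation[OF 5, of "mat 1" c] by simp
  then show ?case using nn_integral_lborel_shear[OF _ 5, of _ c] by (simp add: Ax)
qed

lemma distr_lborel_unimodular:
  fixes A :: "real ^ 'n::finite ^ 'n"
  assumes A: "\<bar>det A\<bar> = 1"
  shows "distr lborel borel (\<lambda>x. A *v x) = lborel"
proof (rule measure_eqI)
  fix S assume "S \<in> sets (distr lborel borel (\<lambda>x. A *v x))"
  then have S: "S \<in> sets borel" by simp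
  have mA [measurable]: "(\<lambda>x. A *v x) \<in> borel_measurable borel"
    by (intro borel_measurable_continuous_onI matrix_vector_mult_linear_continuous_on)
  have "emeasure (distr lborel borel (\<lambda>x. A *v x)) S = (\<integral>\<^sup>+x. indicator S x \<partial>distr lborel borel (\<lambda>x. A *v x))"
    using S by simp
  also have "\<dots> = (\<integral>\<^sup>+x. indicator S (A *v x) \<partial>lborel)"
    by (rule nn_integral_distr) (use S in auto)
  also have "\<dots> = (\<integral>\<^sup>+x. indicator S x \<partial>lborel)"
  proof -
    have "det A \<noteq> 0" using A by auto
    moreover have "indicator S \<in> borel_measurable borel" using S by simp
    ultimately have "(\<integral>\<^sup>+x. indicator S x \<partial>lborel) = ennreal \<bar>det A\<bar> * (\<integral>\<^sup>+x. indicator S (A *v x) \<partial>lborel)"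
      using nn_integral_lborel_matrix by blast
    then show ?thesis by (simp only: A ennreal_1 mult_1)
  qed
  finally show "emeasure (distr lborel borel (\<lambda>x. A *v x)) S = emeasure lborel S" using S by simp
qed simp

lemma O1_det: assumes "g \<in> O1" shows "\<bar>det g\<bar> = 1"
proof -
  have J: "det (minkowski :: 'a lmat) * det (minkowski :: 'a lmat) = 1"
    using arg_cong[OF minkowski_minkowski, of det] by (simp add: det_mul)
  have "det (transpose g ** minkowski ** g) = det (minkowski :: 'a lmat)"
    using assms by (simp add: O1_def)
  then have "det g * det g * det (minkowski :: 'a lmat) = det (minkowski :: 'a lmat)"
    by (simp add: det_mul mult_ac)
  then have "(det g)\<^sup>2 = 1" using J by (auto simp: power2_eq_square)
  then show ?thesis by (auto simp: power2_eq_1_iff)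
qed

text \<open>
  The part of the solid light cone over \<open>A\<close> between the hyperboloids of radius 1 and 2. Its Lebesgue
  measure is a fixed multiple of the hyperbolic measure of \<open>A\<close>, so that the invariance of hyperbolic
  measure reduces to unimodularity.
\<close>

definition cone_shell :: "(real ^ 'd::finite) set \<Rightarrow> (real ^ 'd option) set" where
  "cone_shell A = {x. x $ None > 0 \<and> 1 \<le> mdot x x \<and> mdot x x \<le> 4 \<and> (1 / sqrt (mdot x x)) *\<^sub>R space_part x \<in> A}"

lemma cone_shell_iff: "x \<in> cone_shell A \<longleftrightarrow> (\<exists>s\<in>{1..2}. \<exists>v\<in>A. x = s *\<^sub>R pt v)"
proof
  assume x: "x \<in> cone_shell A"
  define s where "s = sqrt (mdot x x)"
  have s: "s * s = mdot x x" "1 \<le> s" "s \<le> 2"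
    using x by (auto simp: cone_shell_def s_def intro: real_le_lsqrt)
  have "mdot x x \<noteq> 0" using x by (auto simp: cone_shell_def)
  then have m1: "mdot ((1/s) *\<^sub>R x) ((1/s) *\<^sub>R x) = 1" using s by (simp add: field_simps)
  have "sgn (((1/s) *\<^sub>R x) $ None) = 1" using x s by (auto simp: cone_shell_def sgn_if)
  then have "(1/s) *\<^sub>R x = pt (space_part ((1/s) *\<^sub>R x))" using unit_timelike_eq(1)[OF m1] by simp
  then have "s *\<^sub>R ((1/s) *\<^sub>R x) = s *\<^sub>R pt ((1/s) *\<^sub>R space_part x)" by simp
  then have "x = s *\<^sub>R pt ((1/s) *\<^sub>R space_part x)" using s by simp
  moreover have "(1/s) *\<^sub>R space_part x \<in> A" using x by (simp add: cone_shell_def s_def)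
  ultimately show "\<exists>s\<in>{1..2}. \<exists>v\<in>A. x = s *\<^sub>R pt v" using s by (intro bexI[of _ s]) auto
next
  assume "\<exists>s\<in>{1..2}. \<exists>v\<in>A. x = s *\<^sub>R pt v"
  then obtain s v where s: "1 \<le> s" "s \<le> 2" "v \<in> A" "x = s *\<^sub>R pt v" by auto
  have "s\<^sup>2 \<le> 2\<^sup>2" using s by (intro power_mono) auto
  moreover have "mdot x x = s\<^sup>2" using s by (simp add: mdot_pt_self power2_eq_square)
  ultimately show "x \<in> cone_shell A"
    using s by (auto simp: cone_shell_def add_pos_nonneg)
qed

text \<open>Polar coordinates in the light cone: substitute \<open>x = sqrt (s^2 + |w|^2)\<close>
  for the time coordinate at fixed \<open>w\<close>, exchange the integrals, and rescale
  \<open>w = s * v\<close>. The Jacobian splits into \<open>s^d\<close> and the hyperbolic density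
  at \<open>v\<close>.\<close>

lemma emeasure_cone_shell:
  fixes A :: "(real ^ 'd::finite) set"
  assumes [measurable]: "A \<in> sets borel"
  shows "cone_shell A \<in> sets borel"
    and "emeasure lborel (cone_shell A) =
      (\<integral>\<^sup>+s. ennreal (s ^ CARD('d)) * indicator {1..2} s \<partial>lborel) * emeasure hyperbolic_measure A"
proof -
  have [measurable]: "(space_part :: _ \<Rightarrow> real ^ 'd) \<in> borel_measurable borel"
    by (intro borel_measurable_continuous_onI continuous_on_space_part)
  have [measurable]: "(\<lambda>x :: real ^ 'd option. x $ None) \<in> borel_measurable borel"
    by (intro borel_measurable_continuous_onI continuous_intros)
  have [measurable]: "(\<lambda>x :: real ^ 'd option. mdot x x) \<in> borel_measurable borel"
    unfolding mdot_def by measurable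
  show W [measurable]: "cone_shell A \<in> sets borel"
    unfolding cone_shell_def by measurable
  let ?g = "\<lambda>w s. sqrt (s\<^sup>2 + (norm (w :: real ^ 'd))\<^sup>2)"
  let ?f = "\<lambda>w x. indicator A ((1 / sqrt (x\<^sup>2 - (norm w)\<^sup>2)) *\<^sub>R w) :: ennreal"
  have ind: "indicator (cone_shell A) (cons_vec x w) = (?f w x * indicator {?g w 1..?g w 2} x :: ennreal)" for x w
  proof -
    have sp: "space_part (cons_vec x w) = w" by (simp add: vec_eq_iff)
    have m: "mdot (cons_vec x w) (cons_vec x w) = x\<^sup>2 - (norm w)\<^sup>2"
      unfolding mdot_def sp dot_square_norm by (simp add: power2_eq_square)
    have "0 < ?g w 1" by (simp add: add_pos_nonneg)
    moreover have "?g w 1 \<le> x \<longleftrightarrow> 0 < x \<and> 1 \<le> x\<^sup>2 - (norm w)\<^sup>2"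
    proof
      assume l: "?g w 1 \<le> x"
      then have "(?g w 1)\<^sup>2 \<le> x\<^sup>2" by (intro power_mono) auto
      then show "0 < x \<and> 1 \<le> x\<^sup>2 - (norm w)\<^sup>2" using less_le_trans[OF \<open>0 < ?g w 1\<close> l] by simp
    qed (auto intro!: real_le_lsqrt)
    moreover have "x \<le> ?g w 2 \<longleftrightarrow> x\<^sup>2 - (norm w)\<^sup>2 \<le> 4" if "0 < x"
    proof
      assume l: "x \<le> ?g w 2"
      then have "x\<^sup>2 \<le> (?g w 2)\<^sup>2" using that by (intro power_mono) auto
      then show "x\<^sup>2 - (norm w)\<^sup>2 \<le> 4" by simp
    qed (auto intro!: real_le_rsqrt)
    ultimately have "cons_vec x w \<in> cone_shell A \<longleftrightarrow>
       x \<in> {?g w 1..?g w 2} \<and> (1 / sqrt (x\<^sup>2 - (norm w)\<^sup>2)) *\<^sub>R w \<in> A"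
      unfolding cone_shell_def mem_Collect_eq m sp by auto
    then show ?thesis by (auto simp: indicator_def)
  qed
  have subst: "(\<integral>\<^sup>+x. ?f w x * indicator {?g w 1..?g w 2} x \<partial>lborel)
     = (\<integral>\<^sup>+s. ?f w (?g w s) * ennreal (s / ?g w s) * indicator {1..2} s \<partial>lborel)" for w
  proof (rule nn_integral_substitution_aux[where g = "?g w" and a = 1 and b = 2])
    have pos: "0 < s\<^sup>2 + (norm w)\<^sup>2" if "s \<in> {1..2}" for s :: real using that by (intro add_pos_nonneg) auto
    show "(?g w has_real_derivative s / ?g w s) (at s)" if "s \<in> {1..2}" for s
      using pos[OF that] by (auto intro!: derivative_eq_intros simp: field_simps)
    show "continuous_on {1..2} (\<lambda>s. s / ?g w s)"
      using pos by (intro continuous_intros) fastforce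
  qed auto
  have f2: "?f w (?g w s) = indicator A ((1 / s) *\<^sub>R w)" if "s \<in> {1..2}" for w s
    using that by (simp add: add_pos_nonneg)
  have "emeasure lborel (cone_shell A) = (\<integral>\<^sup>+z. indicator (cone_shell A) z \<partial>lborel)" by simp
  also have "\<dots> = (\<integral>\<^sup>+x. \<integral>\<^sup>+w. indicator (cone_shell A) (cons_vec x w) \<partial>lborel \<partial>lborel)"
    by (rule nn_integral_lborel_option) simp
  also have "\<dots> = (\<integral>\<^sup>+w. \<integral>\<^sup>+x. indicator (cone_shell A) (cons_vec x w) \<partial>lborel \<partial>lborel)"
  proof (rule lborel_pair.Fubini')
    have "(\<lambda>p. indicator (cone_shell A) (case p of (x, w) \<Rightarrow> cons_vec x w) :: ennreal) \<in> borel_measurable (lborel \<Otimes>\<^sub>M lborel)"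
      unfolding lborel_prod by (rule measurable_compose[of _ _ borel]) simp_all
    then have "(\<lambda>(w, x). indicator (cone_shell A) (case (x, w) of (x, w) \<Rightarrow> cons_vec x w) :: ennreal) \<in> borel_measurable (lborel \<Otimes>\<^sub>M lborel)"
      by (rule measurable_pair_swap)
    then show "(\<lambda>(w, x). indicator (cone_shell A) (cons_vec x w) :: ennreal) \<in> borel_measurable (lborel \<Otimes>\<^sub>M lborel)"
      by simp
  qed
  also have "\<dots> = (\<integral>\<^sup>+w. \<integral>\<^sup>+s. indicator A ((1 / s) *\<^sub>R w) * ennreal (s / ?g w s) * indicator {1..2} s \<partial>lborel \<partial>lborel)"
    unfolding ind subst by (intro nn_integral_cong) (auto simp: f2 indicator_def)
  also have "\<dots> = (\<integral>\<^sup>+s. \<integral>\<^sup>+w. indicator A ((1 / s) *\<^sub>R w) * ennreal (s / ?g w s) * indicator {1..2} s \<partial>lborel \<partial>lborel)"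
    by (rule lborel_pair.Fubini') measurable
  also have "\<dots> = (\<integral>\<^sup>+s. ennreal (s ^ CARD('d)) * indicator {1..2} s * emeasure hyperbolic_measure A \<partial>lborel)"
  proof (rule nn_integral_cong)
    fix s :: real
    show "(\<integral>\<^sup>+w. indicator A ((1 / s) *\<^sub>R w) * ennreal (s / ?g w s) * indicator {1..2} s \<partial>lborel)
      = ennreal (s ^ CARD('d)) * indicator {1..2} s * emeasure hyperbolic_measure A"
    proof (cases "s \<in> {1..2}")
      case True
      then have s: "s > 0" by simp
      have g: "s / ?g (s *\<^sub>R v) s = 1 / sqrt (1 + (norm v)\<^sup>2)" for v
      proof -
        have "s\<^sup>2 + (norm (s *\<^sub>R v))\<^sup>2 = s\<^sup>2 * (1 + (norm v)\<^sup>2)" by (simp add: power_mult_distrib algebra_simps)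
        then show ?thesis using s by (simp add: real_sqrt_mult)
      qed
      have "(\<integral>\<^sup>+w. indicator A ((1 / s) *\<^sub>R w) * ennreal (s / ?g w s) \<partial>lborel)
        = ennreal (s ^ CARD('d)) * (\<integral>\<^sup>+v. indicator A ((1 / s) *\<^sub>R (s *\<^sub>R v)) * ennreal (s / ?g (s *\<^sub>R v) s) \<partial>lborel)"
        by (rule nn_integral_lborel_scale[OF _ s]) measurable
      also have "\<dots> = ennreal (s ^ CARD('d)) * (\<integral>\<^sup>+v. indicator A v \<partial>hyperbolic_measure)"
      proof -
        have sc: "(1 / s) *\<^sub>R (s *\<^sub>R v) = v" for v :: "real ^ 'd" using s by simp
        show ?thesis unfolding sc g by (subst nn_integral_hyperbolic) auto
      qed
      finally show ?thesis using True by simp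
    qed simp
  qed
  also have "\<dots> = (\<integral>\<^sup>+s. ennreal (s ^ CARD('d)) * indicator {1..2} s \<partial>lborel) * emeasure hyperbolic_measure A"
    by (rule nn_integral_multc) measurable
  finally show "emeasure lborel (cone_shell A) = \<dots>" .
qed

lemma act_measurable [measurable]:
  assumes "g \<in> O1" shows "act g \<in> borel_measurable borel"
  by (intro borel_measurable_continuous_onI continuous_on_act assms)

text \<open>After multiplication by \<open>time_sign g\<close> the matrix maps the cone shell over
  the preimage of \<open>A\<close> onto the shell over \<open>A\<close>, and its determinant has
  absolute value 1. The radial factor \<open>K\<close> is positive and finite, so it
  cancels.\<close>

lemma distr_hyperbolic_act:
  fixes g :: "'d::finite lmat"
  assumes g: "g \<in> O1"
  shows "distr hyperbolic_measure borel (act g) = hyperbolic_measure"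
proof (rule measure_eqI)
  fix A assume "A \<in> sets (distr hyperbolic_measure borel (act g))"
  then have A: "A \<in> sets borel" by simp
  then have A': "act g -` A \<in> sets borel" using measurable_sets[OF act_measurable[OF g]] by auto
  define K where "K = (\<integral>\<^sup>+s. ennreal (s ^ CARD('d)) * indicator {1..2::real} s \<partial>lborel)"
  have "K \<ge> (\<integral>\<^sup>+s. indicator {1..2::real} s \<partial>lborel)"
    unfolding K_def by (intro nn_integral_mono) (auto simp: indicator_def)
  then have K1: "K \<noteq> 0" by auto
  have "K \<le> (\<integral>\<^sup>+s. ennreal (2 ^ CARD('d)) * indicator {1..2::real} s \<partial>lborel)"
    unfolding K_def by (intro nn_integral_mono) (auto simp: indicator_def intro!: ennreal_leI power_mono)
  also have "\<dots> < \<infinity>" by (subst nn_integral_cmult) (auto simp: ennreal_mult_less_top)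
  finally have K2: "K \<noteq> \<infinity>" by auto
  define h where "h = time_sign g *\<^sub>R g"
  have e: "time_sign g * time_sign g = 1" using time_sign_cases[OF g] by auto
  have hmul: "h *v x = time_sign g *\<^sub>R (g *v x)" for x by (simp add: h_def scaleR_matrix_vector_assoc)
  have hO: "h \<in> O1" unfolding O1_iff hmul by (simp add: mdot_O1[OF g] mult.assoc[symmetric] e)
  have hpt: "h *v pt v = pt (act g v)" for v unfolding hmul mult_pt[OF g] by (simp add: e)
  have gi: "act g (act (lorentz_inv g) v) = v" for v by (simp add: g)
  have "(\<lambda>x. h *v x) -` cone_shell A = cone_shell (act g -` A)"
  proof (intro equalityI subsetI)
    fix x assume "x \<in> cone_shell (act g -` A)"
    then obtain s v where s: "s \<in> {1..2}" "act g v \<in> A" "x = s *\<^sub>R pt v" unfolding cone_shell_iff by auto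
    then have "h *v x = s *\<^sub>R pt (act g v)" by (simp add: matrix_vector_mult_scaleR hpt)
    then show "x \<in> (\<lambda>x. h *v x) -` cone_shell A" using s unfolding vimage_eq cone_shell_iff by blast
  next
    fix x assume "x \<in> (\<lambda>x. h *v x) -` cone_shell A"
    then obtain s u where s: "s \<in> {1..2}" "u \<in> A" "h *v x = s *\<^sub>R pt u" unfolding vimage_eq cone_shell_iff by auto
    have "lorentz_inv h *v (h *v x) = lorentz_inv h *v (s *\<^sub>R pt (act g (act (lorentz_inv g) u)))"
      unfolding gi s(3) ..
    also have "\<dots> = s *\<^sub>R (lorentz_inv h *v (h *v pt (act (lorentz_inv g) u)))"
      by (simp add: matrix_vector_mult_scaleR hpt)
    finally have "x = s *\<^sub>R pt (act (lorentz_inv g) u)"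
      by (simp add: matrix_vector_mul_assoc lorentz_inv_left[OF hO])
    then show "x \<in> cone_shell (act g -` A)" using s gi unfolding vimage_eq cone_shell_iff by (intro bexI[of _ s] bexI[of _ "act (lorentz_inv g) u"]) auto
  qed
  then have "K * emeasure hyperbolic_measure (act g -` A) = emeasure lborel ((\<lambda>x. h *v x) -` cone_shell A)"
    unfolding K_def emeasure_cone_shell(2)[OF A', symmetric] by simp
  also have "\<dots> = emeasure (distr lborel borel (\<lambda>x. h *v x)) (cone_shell A)"
    by (subst emeasure_distr) (auto intro!: emeasure_cone_shell(1)[OF A] borel_measurable_continuous_onI matrix_vector_mult_linear_continuous_on)
  also have "\<dots> = K * emeasure hyperbolic_measure A"
    unfolding distr_lborel_unimodular[OF O1_det[OF hO]] K_def by (rule emeasure_cone_shell(2)[OF A])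
  finally have "emeasure hyperbolic_measure (act g -` A) = emeasure hyperbolic_measure A"
    using K1 K2 by (simp add: ennreal_mult_cancel_left)
  then show "emeasure (distr hyperbolic_measure borel (act g)) A = emeasure hyperbolic_measure A"
    using A g by (subst emeasure_distr) auto
qed simp

section \<open>Hyperbolic measure in Fermi coordinates\<close>

lemma continuous_on_fermi: "continuous_on S (\<lambda>p. fermi (fst p) (snd p))"
proof -
  have "continuous_on S (\<lambda>p. fermi (fst p) (snd p) $ i)" for i :: "'a option"
    by (cases i) (auto simp: fermi_def intro!: continuous_intros)
  then have "continuous_on S (\<lambda>p. \<chi> i. fermi (fst p) (snd p) $ i)" by (rule continuous_on_vec_lambda)
  then show ?thesis by simp
qed

text \<open>Slice by the last coordinate \<open>x = sinh t\<close> and rescale the others by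
  \<open>cosh t\<close>. The scaling contributes \<open>cosh t ^ n\<close>, while the
  \<open>cosh t\<close> of the substitution and the \<open>1 / cosh t\<close> left in the density
  cancel.\<close>

lemma nn_integral_fermi:
  fixes f :: "real ^ 'n::finite option \<Rightarrow> ennreal"
  assumes f [measurable]: "f \<in> borel_measurable borel" and T: "T > 0"
  shows "(\<integral>\<^sup>+z. f z * indicator {z. \<bar>z $ None\<bar> \<le> sinh T} z \<partial>hyperbolic_measure)
    = (\<integral>\<^sup>+t. (\<integral>\<^sup>+w. f (fermi w t) \<partial>hyperbolic_measure) * ennreal (cosh t ^ CARD('n)) * indicator {- T..T} t \<partial>lborel)"
proof -
  have [measurable]: "(\<lambda>x :: real ^ 'n option. x $ None) \<in> borel_measurable borel"
    by (intro borel_measurable_continuous_onI continuous_intros)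
  have mf [measurable]: "(\<lambda>p. f (cons_vec (fst p) (snd p))) \<in> borel_measurable (lborel \<Otimes>\<^sub>M lborel)"
    unfolding lborel_prod using measurable_compose[OF cons_vec_borel f] by (simp add: case_prod_beta)
  define h where "h x = (\<integral>\<^sup>+w. f (cons_vec x w) * ennreal (1 / sqrt (1 + x\<^sup>2 + (norm w)\<^sup>2)) \<partial>lborel)" for x
  have hm [measurable]: "h \<in> borel_measurable borel"
  proof -
    have "(\<lambda>x. \<integral>\<^sup>+w. (case (x, w) of (x, w) \<Rightarrow> f (cons_vec (fst (x, w)) (snd (x, w))) * ennreal (1 / sqrt (1 + x\<^sup>2 + (norm w)\<^sup>2))) \<partial>lborel) \<in> borel_measurable lborel"
      by (rule lborel.borel_measurable_nn_integral_fst) measurable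
    then show ?thesis by (simp add: h_def[abs_def])
  qed
  have "(\<integral>\<^sup>+z. f z * indicator {z. \<bar>z $ None\<bar> \<le> sinh T} z \<partial>hyperbolic_measure)
    = (\<integral>\<^sup>+z. f z * indicator {z. \<bar>z $ None\<bar> \<le> sinh T} z * ennreal (1 / sqrt (1 + (norm z)\<^sup>2)) \<partial>lborel)"
    by (rule nn_integral_hyperbolic) measurable
  also have "\<dots> = (\<integral>\<^sup>+x. \<integral>\<^sup>+w. f (cons_vec x w) * indicator {z. \<bar>z $ None\<bar> \<le> sinh T} (cons_vec x w)
        * ennreal (1 / sqrt (1 + (norm (cons_vec x w))\<^sup>2)) \<partial>lborel \<partial>lborel)"
    by (rule nn_integral_lborel_option) measurable
  also have "\<dots> = (\<integral>\<^sup>+x. h x * indicator {sinh (- T)..sinh T} x \<partial>lborel)"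
  proof (rule nn_integral_cong)
    fix x :: real
    have "(\<lambda>w. f (cons_vec x w)) \<in> borel_measurable borel" for x
      using measurable_Pair2[OF mf, of x] by simp
    then show "(\<integral>\<^sup>+w. f (cons_vec x w) * indicator {z. \<bar>z $ None\<bar> \<le> sinh T} (cons_vec x w)
        * ennreal (1 / sqrt (1 + (norm (cons_vec x w))\<^sup>2)) \<partial>lborel) = h x * indicator {sinh (- T)..sinh T} x"
      unfolding h_def by (subst nn_integral_multc[symmetric])
        (auto simp: norm_cons_vec add.assoc indicator_def abs_le_iff intro!: nn_integral_cong)
  qed
  also have "\<dots> = (\<integral>\<^sup>+t. h (sinh t) * ennreal (cosh t) * indicator {- T..T} t \<partial>lborel)"
    by (rule nn_integral_substitution_aux) (use T in \<open>auto intro!: derivative_eq_intros continuous_intros\<close>)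
  also have "\<dots> = (\<integral>\<^sup>+t. (\<integral>\<^sup>+w. f (fermi w t) \<partial>hyperbolic_measure) * ennreal (cosh t ^ CARD('n)) * indicator {- T..T} t \<partial>lborel)"
  proof (rule nn_integral_cong)
    fix t :: real
    have [measurable]: "(\<lambda>w. f (cons_vec x w)) \<in> borel_measurable borel" for x
      using measurable_Pair2[OF mf, of x] by simp
    have [measurable]: "(\<lambda>w. f (fermi w t)) \<in> borel_measurable borel"
      unfolding fermi_def by (rule measurable_compose[of _ _ borel "\<lambda>w. f (cons_vec (sinh t) w)"]) auto
    have "h (sinh t) = ennreal (cosh t ^ CARD('n)) * (\<integral>\<^sup>+v. f (cons_vec (sinh t) (cosh t *\<^sub>R v))
        * ennreal (1 / sqrt (1 + (sinh t)\<^sup>2 + (norm (cosh t *\<^sub>R v))\<^sup>2)) \<partial>lborel)"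
      unfolding h_def by (rule nn_integral_lborel_scale) auto
    also have "(\<integral>\<^sup>+v. f (cons_vec (sinh t) (cosh t *\<^sub>R v)) * ennreal (1 / sqrt (1 + (sinh t)\<^sup>2 + (norm (cosh t *\<^sub>R v))\<^sup>2)) \<partial>lborel)
      = (\<integral>\<^sup>+v. f (fermi v t) * ennreal (1 / sqrt (1 + (norm v)\<^sup>2)) * ennreal (1 / cosh t) \<partial>lborel)"
    proof (rule nn_integral_cong)
      fix v :: "real ^ 'n"
      have "1 + (sinh t)\<^sup>2 + (norm (cosh t *\<^sub>R v))\<^sup>2 = (cosh t)\<^sup>2 * (1 + (norm v)\<^sup>2)"
        by (simp add: cosh_square_eq power_mult_distrib algebra_simps)
      then have "1 / sqrt (1 + (sinh t)\<^sup>2 + (norm (cosh t *\<^sub>R v))\<^sup>2) = 1 / sqrt (1 + (norm v)\<^sup>2) * (1 / cosh t)"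
        by (simp add: real_sqrt_mult)
      then have *: "ennreal (1 / sqrt (1 + (sinh t)\<^sup>2 + (norm (cosh t *\<^sub>R v))\<^sup>2))
          = ennreal (1 / sqrt (1 + (norm v)\<^sup>2)) * ennreal (1 / cosh t)"
        by (simp only:) (rule ennreal_mult, simp_all)
      then show "f (cons_vec (sinh t) (cosh t *\<^sub>R v)) * ennreal (1 / sqrt (1 + (sinh t)\<^sup>2 + (norm (cosh t *\<^sub>R v))\<^sup>2))
        = f (fermi v t) * ennreal (1 / sqrt (1 + (norm v)\<^sup>2)) * ennreal (1 / cosh t)"
        by (simp only: * fermi_def mult.assoc)
    qed
    also have "\<dots> = (\<integral>\<^sup>+v. f (fermi v t) \<partial>hyperbolic_measure) * ennreal (1 / cosh t)"
      by (subst nn_integral_multc) (auto simp: nn_integral_hyperbolic)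
    finally have "h (sinh t) * ennreal (cosh t) = (\<integral>\<^sup>+v. f (fermi v t) \<partial>hyperbolic_measure) * ennreal (cosh t ^ CARD('n))
        * (ennreal (1 / cosh t) * ennreal (cosh t))"
      by (simp only: mult_ac)
    also have "ennreal (1 / cosh t) * ennreal (cosh t) = 1"
      by (subst ennreal_mult[symmetric]) auto
    finally show "h (sinh t) * ennreal (cosh t) * indicator {- T..T} t
      = (\<integral>\<^sup>+w. f (fermi w t) \<partial>hyperbolic_measure) * ennreal (cosh t ^ CARD('n)) * indicator {- T..T} t"
      by simp
  qed
  finally show ?thesis .
qed

lemma emeasure_hyperbolic_bounded:
  fixes B :: "(real ^ 'd::finite) set"
  assumes "bounded B" "B \<in> sets borel"
  shows "emeasure hyperbolic_measure B < \<infinity>"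
proof -
  have "emeasure hyperbolic_measure B = (\<integral>\<^sup>+v. indicator B v * ennreal (1 / sqrt (1 + (norm v)\<^sup>2)) \<partial>lborel)"
    using assms nn_integral_hyperbolic[of "indicator B"] by simp
  also have "\<dots> \<le> (\<integral>\<^sup>+v. indicator B v \<partial>lborel)"
  proof (rule nn_integral_mono)
    fix v :: "real ^ 'd"
    have "1 \<le> sqrt (1 + (norm v)\<^sup>2)" by simp
    then have "1 / sqrt (1 + (norm v)\<^sup>2) \<le> 1" using frac_le[of 1 1 1 "sqrt (1 + (norm v)\<^sup>2)"] by simp
    then have "ennreal (1 / sqrt (1 + (norm v)\<^sup>2)) \<le> 1" by (metis ennreal_1 ennreal_leI)
    then show "indicator B v * ennreal (1 / sqrt (1 + (norm v)\<^sup>2)) \<le> indicator B v"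
      by (auto simp: indicator_def)
  qed
  also have "\<dots> = emeasure lborel B" using assms by simp
  also have "\<dots> < \<infinity>" using assms(1) emeasure_bounded_finite by auto
  finally show ?thesis .
qed

section \<open>Discrete groups of isometries\<close>

lemma matrix_mult_entry_bound:
  fixes A B :: "real ^ 'n::finite ^ 'n"
  assumes "\<And>i j. \<bar>A $ i $ j\<bar> \<le> a" "\<And>i j. \<bar>B $ i $ j\<bar> \<le> b"
  shows "\<bar>(A ** B) $ i $ j\<bar> \<le> real CARD('n) * (a * b)"
proof -
  have "\<bar>A $ i $ k * B $ k $ j\<bar> \<le> a * b" for k
    unfolding abs_mult using assms by (intro mult_mono) (auto intro: order_trans[OF abs_ge_zero])
  then have "(\<Sum>k\<in>UNIV. \<bar>A $ i $ k * B $ k $ j\<bar>) \<le> (\<Sum>k\<in>(UNIV::'n set). a * b)"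
    by (intro sum_mono) auto
  then show ?thesis
    unfolding matrix_matrix_mult_def by (auto intro: order_trans[OF sum_abs])
qed

lemma matrix_norm_le_entries:
  fixes A :: "real ^ 'n::finite ^ 'n"
  assumes "\<And>i j. \<bar>A $ i $ j\<bar> \<le> a"
  shows "norm A \<le> real CARD('n) * (real CARD('n) * a)"
proof -
  have "norm (A $ i) \<le> real CARD('n) * a" for i
    using norm_le_l1_cart[of "A $ i"] sum_mono[of UNIV "\<lambda>j. \<bar>A $ i $ j\<bar>" "\<lambda>_. a"] assms by auto
  then have "L2_set (\<lambda>i. norm (A $ i)) UNIV \<le> (\<Sum>i\<in>(UNIV::'n set). real CARD('n) * a)"
    by (intro order_trans[OF L2_set_le_sum] sum_mono) auto
  then show ?thesis unfolding norm_vec_def by simp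
qed

lemma matrix_entry_le_norm: "\<bar>(A :: real ^ 'n::finite ^ 'm::finite) $ i $ j\<bar> \<le> norm A"
  by (rule order_trans[OF component_le_norm_cart Finite_Cartesian_Product.norm_nth_le])

lemma boost_entry_bound:
  assumes "norm v \<le> \<rho>"
  shows "\<bar>boost v $ i $ j\<bar> \<le> 2 + \<rho> + \<rho>\<^sup>2"
proof -
  have r: "0 \<le> \<rho>" "(norm v)\<^sup>2 \<le> \<rho>\<^sup>2" using assms by (auto intro: order_trans[OF norm_ge_zero] power_mono)
  have c: "\<bar>v $ a\<bar> \<le> \<rho>" for a using component_le_norm_cart[of v a] assms by simp
  have s: "sqrt (1 + (norm v)\<^sup>2) \<le> 1 + norm v" by (intro real_le_lsqrt) (auto simp: power2_eq_square algebra_simps)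
  have q: "\<bar>(if a = b then 1 else 0) + v $ a * v $ b / (1 + sqrt (1 + (norm v)\<^sup>2))\<bar> \<le> 1 + \<rho>\<^sup>2" for a b
  proof -
    have k: "1 \<le> 1 + sqrt (1 + (norm v)\<^sup>2)" by simp
    have "\<bar>v $ a * v $ b / (1 + sqrt (1 + (norm v)\<^sup>2))\<bar> \<le> \<rho> * \<rho> / 1"
      unfolding abs_divide abs_mult using k c r by (intro frac_le mult_mono) auto
    then show ?thesis by (auto simp: power2_eq_square)
  qed
  show ?thesis
  proof (cases i; cases j)
    show ?thesis if "i = None" "j = None" using s assms that by (simp add: boost_nth) (use s assms r(1) zero_le_power2[of \<rho>] in linarith)
    show ?thesis if "i = None" "j = Some b" for b using that by (simp add: boost_nth) (use c[of b] r(1) zero_le_power2[of \<rho>] in linarith)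
    show ?thesis if "i = Some a" "j = None" for a using that by (simp add: boost_nth) (use c[of a] r(1) zero_le_power2[of \<rho>] in linarith)
    show ?thesis if "i = Some a" "j = Some b" for a b using that by (simp only: boost_nth) (use q[of a b] r(1) zero_le_power2[of \<rho>] in linarith)
  qed
qed

lemma lorentz_inv_entry: "\<bar>lorentz_inv g $ i $ j\<bar> = \<bar>g $ j $ i\<bar>"
proof -
  have 1: "(minkowski ** A) $ i $ j = (if i = None then A $ i $ j else - A $ i $ j)" for A :: "'a lmat" and i j
  proof -
    have "(minkowski ** A) $ i $ j = (minkowski *v (\<chi> k. A $ k $ j)) $ i"
      by (simp add: matrix_matrix_mult_def matrix_vector_mult_def)
    then show ?thesis by (simp add: minkowski_mult)
  qed
  have 2: "(A ** minkowski) $ i $ j = (if j = None then A $ i $ j else - A $ i $ j)" for A :: "'a lmat" and i j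
  proof -
    have "(A ** minkowski) $ i $ j = (\<Sum>k\<in>UNIV. if k = j then A $ i $ j * (if j = None then 1 else - 1) else 0)"
      unfolding matrix_matrix_mult_def vec_lambda_beta by (rule sum.cong[OF refl]) (auto simp: minkowski_def)
    then show ?thesis by simp
  qed
  show ?thesis unfolding lorentz_inv_def 1 2 by (simp add: transpose_def)
qed

lemma K1_entry_bound:
  assumes "k \<in> K1"
  shows "\<bar>k $ i $ j\<bar> \<le> 1"
proof -
  obtain e h where k: "k = time_diag e h" "e = 1 \<or> e = - 1" "orthogonal_matrix h"
    using assms by (auto simp: K1_def)
  have "norm (h *v axis b 1) = 1" for b
  proof -
    have "(h *v axis b 1) \<bullet> (h *v axis b 1) = 1"
      using k(3) unfolding inner_matrix_vector_transpose matrix_vector_mul_assoc orthogonal_matrix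
      by (simp add: inner_axis_axis)
    then show ?thesis by (simp add: norm_eq_sqrt_inner)
  qed
  then have "\<bar>h $ a $ b\<bar> \<le> 1" for a b
    using component_le_norm_cart[of "h *v axis b 1" a] by (simp add: matrix_vector_mul_component inner_axis)
  then show ?thesis using k(2) by (cases i; cases j) (auto simp: k(1) time_diag_def)
qed

text \<open>In \<open>g = boost (act g v) ** k ** lorentz_inv (boost v)\<close> the middle factor is
  compact and the outer ones are boosts of size at most \<open>\<rho>\<close>. Hence matrices that
  move some point of a ball into the ball form a bounded set, the key to proper
  discontinuity.\<close>

lemma act_bounded_entries:
  fixes g :: "'d::finite lmat"
  assumes g: "g \<in> O1" and "norm v \<le> \<rho>" "norm (act g v) \<le> \<rho>"
  shows "\<bar>g $ i $ j\<bar> \<le> real CARD('d option) * ((real CARD('d option) * ((2 + \<rho> + \<rho>\<^sup>2) * 1)) * (2 + \<rho> + \<rho>\<^sup>2))"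
proof -
  obtain k where k: "k \<in> K1" "g ** boost v = boost (act g v) ** k"
    using cartan[OF mult_in_O1[OF g boost_in_O1[of v]]] by (auto simp: act_mult g boost_in_O1)
  have "g = (boost (act g v) ** k) ** lorentz_inv (boost v)"
    unfolding k(2)[symmetric] matrix_mul_assoc[symmetric] lorentz_inv_right[OF boost_in_O1] by simp
  moreover have "\<bar>((boost (act g v) ** k) ** lorentz_inv (boost v)) $ i $ j\<bar> \<le>
     real CARD('d option) * ((real CARD('d option) * ((2 + \<rho> + \<rho>\<^sup>2) * 1)) * (2 + \<rho> + \<rho>\<^sup>2))"
    using assms k(1) by (intro matrix_mult_entry_bound)
      (auto simp only: lorentz_inv_entry intro!: boost_entry_bound K1_entry_bound)
  ultimately show ?thesis by simp
qed

text \<open>Infinitely many elements with bounded entries accumulate, and two distinct ones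
  \<open>g\<close>, \<open>h\<close> close together give an element
  \<open>lorentz_inv g ** h\<close> near the identity but different from it. The bound on the
  entries of \<open>g\<close> makes this uniform, and isolation of the identity is
  contradicted.\<close>

lemma finite_discrete_bounded:
  fixes \<Gamma> :: "'d::finite lmat set"
  assumes sub: "\<Gamma> \<subseteq> O1" and disc: "discrete \<Gamma>" and one: "mat 1 \<in> \<Gamma>"
    and mult: "\<And>g h. g \<in> \<Gamma> \<Longrightarrow> h \<in> \<Gamma> \<Longrightarrow> g ** h \<in> \<Gamma>" and inv: "\<And>g. g \<in> \<Gamma> \<Longrightarrow> lorentz_inv g \<in> \<Gamma>"
  shows "finite {g \<in> \<Gamma>. \<forall>i j. \<bar>g $ i $ j\<bar> \<le> M}" (is "finite ?S")
proof (rule ccontr)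
  assume inf: "infinite ?S"
  let ?N = "real CARD('d option)"
  have "?S \<subseteq> cball 0 (?N * (?N * M))"
  proof
    fix x assume "x \<in> ?S"
    then have "norm x \<le> ?N * (?N * M)" by (intro matrix_norm_le_entries) auto
    then show "x \<in> cball 0 (?N * (?N * M))" by (simp only: mem_cball dist_0_norm)
  qed
  then obtain x where x: "x islimpt ?S"
    using Heine_Borel_imp_Bolzano_Weierstrass[OF compact_cball inf] by blast
  obtain T where T: "open T" "T \<inter> \<Gamma> = {mat 1}"
    using disc one unfolding discrete_def isolated_in_def by blast
  have "mat 1 \<in> T" using T(2) by auto
  obtain \<delta> where \<delta>: "\<delta> > 0" "ball (mat 1) \<delta> \<subseteq> T"
    by (rule openE[OF T(1) \<open>mat 1 \<in> T\<close>])
  define L where "L = ?N * (?N * (?N * (M * 1)))"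
  have M0: "M \<ge> 0"
  proof -
    obtain g where "g \<in> ?S" using infinite_imp_nonempty[OF inf] by blast
    then have "\<bar>g $ None $ None\<bar> \<le> M" by blast
    then show ?thesis by linarith
  qed
  then have L0: "L \<ge> 0" by (simp add: L_def)
  \<comment> \<open>Two points of \<open>ball x e\<close> differ by less than \<open>2 * e\<close>,
    and multiplication by \<open>lorentz_inv g\<close> costs at most the factor
    \<open>L\<close>.\<close>
  define e where "e = \<delta> / (2 * (L + 1))"
  have e: "e > 0" using \<delta> L0 by (simp add: e_def)
  have inf2: "infinite (?S \<inter> ball x e)" using x e islimpt_eq_infinite_ball by blast
  then obtain g where g: "g \<in> ?S \<inter> ball x e" using infinite_imp_nonempty by blast
  have "infinite (?S \<inter> ball x e - {g})" using inf2 by simp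
  then obtain h where h: "h \<in> ?S \<inter> ball x e - {g}" using infinite_imp_nonempty by blast
  have gh: "g \<in> ?S" "h \<in> ?S" "g \<noteq> h" "dist x g < e" "dist x h < e" using g h by auto
  have gO: "g \<in> O1" using gh sub by auto
  define d where "d = norm (h - g)"
  have "dist g h < 2 * e" using gh dist_triangle_half_r[of x g "2*e" h] by simp
  then have d: "0 \<le> d" "d < 2 * e" by (auto simp: d_def dist_norm norm_minus_commute)
  have "lorentz_inv g ** (h - g) = lorentz_inv g ** h - lorentz_inv g ** g"
    by (simp add: vec_eq_iff matrix_matrix_mult_def right_diff_distrib sum_subtractf)
  then have "norm (lorentz_inv g ** h - mat 1) = norm (lorentz_inv g ** (h - g))"
    using lorentz_inv_left[OF gO] by simp
  also have "\<dots> \<le> ?N * (?N * (?N * (M * d)))"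
  proof (intro matrix_norm_le_entries matrix_mult_entry_bound)
    show "\<bar>lorentz_inv g $ i $ j\<bar> \<le> M" for i j using gh by (simp add: lorentz_inv_entry)
    show "\<bar>(h - g) $ i $ j\<bar> \<le> d" for i j unfolding d_def by (rule matrix_entry_le_norm)
  qed
  also have "\<dots> = L * d" by (simp add: L_def)
  also have "\<dots> \<le> L * (2 * e)" using d L0 by (intro mult_left_mono) auto
  also have "\<dots> < \<delta>" using \<delta> L0 by (simp add: e_def field_simps)
  finally have "norm (lorentz_inv g ** h - mat 1) < \<delta>" .
  then have "dist (mat 1) (lorentz_inv g ** h) < \<delta>" by (simp only: dist_norm norm_minus_commute)
  moreover have "lorentz_inv g ** h \<in> \<Gamma>" using gh mult inv by auto
  ultimately have eq: "lorentz_inv g ** h = mat 1" using T \<delta> by auto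
  have "h = g ** (lorentz_inv g ** h)" by (simp add: matrix_mul_assoc lorentz_inv_right[OF gO])
  then show False using gh(3) unfolding eq by simp
qed

section \<open>Free and properly discontinuous actions, and the measure on their quotients\<close>

locale free_proper_action =
  fixes \<Lambda> :: "'d::finite lmat set"
  assumes sub: "\<Lambda> \<subseteq> O1" and one: "mat 1 \<in> \<Lambda>"
    and mult: "g \<in> \<Lambda> \<Longrightarrow> h \<in> \<Lambda> \<Longrightarrow> g ** h \<in> \<Lambda>"
    and inv: "g \<in> \<Lambda> \<Longrightarrow> lorentz_inv g \<in> \<Lambda>"
    and free: "g \<in> \<Lambda> \<Longrightarrow> act g v = v \<Longrightarrow> g = mat 1"
    and proper: "finite {g \<in> \<Lambda>. \<exists>v\<in>cball 0 \<rho>. act g v \<in> cball 0 \<rho>}"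
begin

lemma O1: "g \<in> \<Lambda> \<Longrightarrow> g \<in> O1"
  using sub by auto

lemma countable: "countable \<Lambda>"
proof -
  have "\<Lambda> \<subseteq> (\<Union>n::nat. {g \<in> \<Lambda>. \<exists>v\<in>cball 0 (real n). act g v \<in> cball 0 (real n)})"
  proof
    fix g assume g: "g \<in> \<Lambda>"
    obtain n :: nat where "norm (act g 0) \<le> real n" using real_arch_simple by blast
    then show "g \<in> (\<Union>n::nat. {g \<in> \<Lambda>. \<exists>v\<in>cball 0 (real n). act g v \<in> cball 0 (real n)})"
      using g by (intro UN_I[of n]) (auto intro!: bexI[of _ 0])
  qed
  moreover have "countable (\<Union>n::nat. {g \<in> \<Lambda>. \<exists>v\<in>cball 0 (real n). act g v \<in> cball 0 (real n)})"
    using proper by (intro countable_UN) (auto intro: countable_finite)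
  ultimately show ?thesis by (rule countable_subset)
qed

lemma act_eq_imp_eq:
  assumes "g \<in> \<Lambda>" "h \<in> \<Lambda>" "act g v = act h v"
  shows "g = h"
proof -
  have "act (lorentz_inv h ** g) v = v"
    using assms by (simp add: act_mult lorentz_inv_in_O1 O1)
  then have "lorentz_inv h ** g = mat 1" using assms mult inv free by blast
  then have "h ** (lorentz_inv h ** g) = h" by simp
  then show ?thesis using assms by (simp add: matrix_mul_assoc lorentz_inv_right O1)
qed

text \<open>Only the finitely many non-trivial elements that carry some point of a larger ball into
  that ball can interfere. Each moves \<open>v0\<close> by a positive distance, and continuity
  provides a radius for each.\<close>

lemma local_injective:
  "\<exists>r>0. \<forall>v\<in>ball v0 r. \<forall>g\<in>\<Lambda>. act g v \<in> ball v0 r \<longrightarrow> g = mat 1"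
proof -
  define \<rho> where "\<rho> = norm v0 + 1"
  define I where "I = {g \<in> \<Lambda>. \<exists>v\<in>cball 0 \<rho>. act g v \<in> cball 0 \<rho>} - {mat 1}"
  have fI: "finite I" unfolding I_def using proper by auto
  have "\<exists>r>0. \<forall>v\<in>ball v0 r. act g v \<notin> ball v0 r" if "g \<in> I" for g
  proof -
    have g: "g \<in> \<Lambda>" "g \<noteq> mat 1" using that by (auto simp: I_def)
    define d where "d = dist (act g v0) v0"
    have d: "d > 0" using free[OF g(1), of v0] g(2) by (auto simp: d_def)
    have "continuous (at v0) (act g)"
      using continuous_on_act[OF O1[OF g(1)], of UNIV] by (simp add: continuous_on_eq_continuous_at)
    then obtain r where r: "r > 0" "\<And>v. dist v v0 < r \<Longrightarrow> dist (act g v) (act g v0) < d / 2"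
      using d unfolding continuous_at_eps_delta by (metis half_gt_zero)
    have "act g v \<notin> ball v0 (min r (d/2))" if "v \<in> ball v0 (min r (d/2))" for v
    proof
      assume "act g v \<in> ball v0 (min r (d / 2))"
      then have "dist v0 (act g v) < d / 2" by simp
      moreover have "dist (act g v) (act g v0) < d / 2" using r(2)[of v] that by (simp add: dist_commute)
      ultimately have "dist v0 (act g v0) < d" using dist_triangle_half_r by (metis dist_commute)
      then show False by (simp add: d_def dist_commute)
    qed
    then show ?thesis using r d by (intro exI[of _ "min r (d/2)"]) auto
  qed
  then obtain r where r: "\<And>g. g \<in> I \<Longrightarrow> r g > 0" "\<And>g v. g \<in> I \<Longrightarrow> v \<in> ball v0 (r g) \<Longrightarrow> act g v \<notin> ball v0 (r g)"
    by metis
  define R where "R = Min (insert 1 (r ` I))"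
  have R: "R > 0" "R \<le> 1" "\<And>g. g \<in> I \<Longrightarrow> R \<le> r g" using fI r(1) by (auto simp: R_def)
  have "g = mat 1" if v: "v \<in> ball v0 R" and g: "g \<in> \<Lambda>" and gv: "act g v \<in> ball v0 R" for v g
  proof (rule ccontr)
    assume "g \<noteq> mat 1"
    have "w \<in> cball 0 \<rho>" if "w \<in> ball v0 R" for w
      using that R norm_triangle_sub[of w v0] by (auto simp: \<rho>_def dist_norm norm_minus_commute)
    then have "v \<in> cball 0 \<rho>" "act g v \<in> cball 0 \<rho>" using v gv by blast+
    then have "g \<in> I" using g \<open>g \<noteq> mat 1\<close> unfolding I_def by blast
    moreover have "v \<in> ball v0 (r g)" using v R(3)[OF \<open>g \<in> I\<close>] by auto
    ultimately have "act g v \<notin> ball v0 (r g)" using r(2) by blast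
    then show False using gv R(3)[OF \<open>g \<in> I\<close>] by auto
  qed
  then show ?thesis using R by blast
qed

end

text \<open>The type of the quotient is left open, so that \<open>X_proj\<close> and
  \<open>Y_proj\<close>, whose double cosets come from different groups, are both instances. All
  that counts is that the fibres in the boost chart are the orbits.\<close>

locale quotient_by_action = free_proper_action \<Lambda> for \<Lambda> :: "'d::finite lmat set" +
  fixes p :: "'d lmat \<Rightarrow> 'x"
  assumes p_eq: "p (boost v) = p (boost w) \<longleftrightarrow> (\<exists>g\<in>\<Lambda>. w = act g v)"
begin

definition q :: "real ^ 'd \<Rightarrow> 'x" where
  "q = p \<circ> boost"

lemma q_eq: "q v = q w \<longleftrightarrow> (\<exists>g\<in>\<Lambda>. w = act g v)"
  by (simp add: q_def p_eq)

lemma q_act: "g \<in> \<Lambda> \<Longrightarrow> q (act g v) = q v"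
  using q_eq by metis

lemma inj_cover:
  "\<exists>\<B>. finite \<B> \<and> (\<forall>B\<in>\<B>. open B \<and> bounded B \<and> inj_on q B) \<and> cball 0 \<rho> \<subseteq> \<Union>\<B>"
proof -
  obtain r where r: "\<And>v0. r v0 > 0" "\<And>v0 v g. v \<in> ball v0 (r v0) \<Longrightarrow> g \<in> \<Lambda> \<Longrightarrow> act g v \<in> ball v0 (r v0) \<Longrightarrow> g = mat 1"
    using local_injective by metis
  have inj: "inj_on q (ball v0 (r v0))" for v0
  proof (rule inj_onI)
    fix v w assume *: "v \<in> ball v0 (r v0)" "w \<in> ball v0 (r v0)" "q v = q w"
    then obtain g where "g \<in> \<Lambda>" "w = act g v" using q_eq by blast
    then show "v = w" using r(2)[of v v0 g] * by simp
  qed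
  have cov: "cball 0 \<rho> \<subseteq> (\<Union>v0\<in>cball 0 \<rho>. ball v0 (r v0))" using r(1) by auto
  obtain C where C: "C \<subseteq> cball 0 \<rho>" "finite C" "cball 0 \<rho> \<subseteq> (\<Union>v0\<in>C. ball v0 (r v0))"
    by (rule compactE_image[OF compact_cball _ cov]) auto
  then show ?thesis using inj by (intro exI[of _ "(\<lambda>v0. ball v0 (r v0)) ` C"]) auto
qed

lemma saturation_open:
  assumes "open B"
  shows "open (q -` q ` B)"
proof -
  have "q -` q ` B = (\<Union>g\<in>\<Lambda>. act g -` B)"
  proof (intro equalityI subsetI)
    fix v assume "v \<in> q -` q ` B"
    then obtain w where "w \<in> B" "q v = q w" by auto
    then show "v \<in> (\<Union>g\<in>\<Lambda>. act g -` B)" using q_eq by auto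
  next
    fix v assume "v \<in> (\<Union>g\<in>\<Lambda>. act g -` B)"
    then obtain g where "g \<in> \<Lambda>" "act g v \<in> B" by auto
    then show "v \<in> q -` q ` B" using q_act by (metis imageI vimageI)
  qed
  moreover have "open (act g -` B)" if "g \<in> \<Lambda>" for g
    by (rule open_vimage[OF assms continuous_on_act[OF O1[OF that]]])
  ultimately show ?thesis by auto
qed

text \<open>A finite cover of a compact set by injective open sets is made disjoint downstairs: each
  set is added only outside the saturation of what has been covered so far.\<close>

lemma fundamental_domain_exists:
  assumes cocompact: "\<And>v. \<exists>g\<in>\<Lambda>. act g v \<in> cball 0 \<rho>"
  shows "\<exists>B\<in>sets borel. bounded B \<and> inj_on q B \<and> q ` B = range q"
proof -
  obtain \<B> where \<B>: "finite \<B>" "\<And>B. B \<in> \<B> \<Longrightarrow> open B \<and> bounded B \<and> inj_on q B" "cball 0 \<rho> \<subseteq> \<Union>\<B>"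
    using inj_cover by metis
  \<comment> \<open>The induction carries along that the saturation of \<open>B\<close> is Borel,
    since the next set is cut with it; saturations of open sets are open.\<close>
  have "\<exists>B\<in>sets borel. bounded B \<and> inj_on q B \<and> q ` B = q ` \<Union>\<C> \<and> q -` q ` B \<in> sets borel"
    if "finite \<C>" "\<C> \<subseteq> \<B>" for \<C>
    using that
  proof (induction \<C> rule: finite_induct)
    case empty
    show ?case by (rule bexI[of _ "{}"]) auto
  next
    case (insert C \<C>)
    then obtain B where B: "B \<in> sets borel" "bounded B" "inj_on q B" "q ` B = q ` \<Union>\<C>" "q -` q ` B \<in> sets borel"
      by auto
    have C: "open C" "bounded C" "inj_on q C" using insert.prems \<B>(2)[of C] by auto
    let ?B = "B \<union> (C - q -` q ` B)"
    have im: "q ` ?B = q ` B \<union> q ` C" by auto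
    have "inj_on q ?B"
    proof (rule inj_onI)
      fix x y assume xy: "x \<in> ?B" "y \<in> ?B" "q x = q y"
      have iff: "z \<in> B \<longleftrightarrow> q z \<in> q ` B" if "z \<in> ?B" for z using that by auto
      show "x = y"
      proof (cases "x \<in> B")
        case True
        then have "y \<in> B" using iff[OF xy(1)] iff[OF xy(2)] xy(3) by simp
        show ?thesis by (rule inj_onD[OF B(3) xy(3) True \<open>y \<in> B\<close>])
      next
        case False
        then have "y \<notin> B" using iff[OF xy(1)] iff[OF xy(2)] xy(3) by simp
        then have "x \<in> C" "y \<in> C" using False xy by auto
        then show ?thesis by (rule inj_onD[OF C(3) xy(3)])
      qed
    qed
    moreover have "?B \<in> sets borel" using B C by auto
    moreover have "bounded ?B" using B C by (auto intro: bounded_subset[of C])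
    moreover have "q ` ?B = q ` \<Union>(insert C \<C>)"
    proof -
      have "q ` \<Union>(insert C \<C>) = q ` \<Union>\<C> \<union> q ` C" by auto
      also have "\<dots> = q ` B \<union> q ` C" by (simp only: B(4))
      also have "\<dots> = q ` ?B" by (simp only: im)
      finally show ?thesis by (rule sym)
    qed
    moreover have "q -` q ` ?B \<in> sets borel"
      unfolding im vimage_Un using B(5) saturation_open[OF C(1)] by auto
    ultimately show ?case by blast
  qed
  from this[OF \<B>(1) subset_refl] obtain B where B: "B \<in> sets borel" "bounded B" "inj_on q B" "q ` B = q ` \<Union>\<B>" by auto
  have "range q \<subseteq> q ` \<Union>\<B>"
  proof
    fix x assume "x \<in> range q"
    then obtain v where "x = q v" by auto
    moreover obtain g where "g \<in> \<Lambda>" "act g v \<in> cball 0 \<rho>" using cocompact by blast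
    ultimately show "x \<in> q ` \<Union>\<B>" using q_act[of g v] \<B>(3) by (metis imageI subsetD)
  qed
  then have "q ` B = range q" unfolding B(4) by (intro equalityI) auto
  then show ?thesis by (intro bexI[OF _ B(1)] conjI B(2) B(3))
qed

lemma space_quotient: "space (quotient_measure p) = range q"
  by (simp add: space_quotient_measure q_def)

lemma sets_quotient: "sets (quotient_measure p) = {A. A \<subseteq> range q \<and> q -` A \<in> sets borel}"
  by (simp add: sets_quotient_measure q_def)

lemma emeasure_quotient:
  assumes "A \<in> sets (quotient_measure p)"
  shows "emeasure (quotient_measure p) A =
    (SUP B \<in> {B \<in> sets borel. inj_on q B \<and> q ` B \<subseteq> A}. emeasure hyperbolic_measure B)"
  using assms unfolding sets_quotient q_def by (intro emeasure_quotient_measure) auto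

lemma q_measurable [measurable]: "q \<in> measurable hyperbolic_measure (quotient_measure p)"
  by (rule measurableI) (auto simp: space_quotient sets_quotient)

lemma measurable_on_quotient:
  assumes "(\<lambda>v. f (q v)) \<in> measurable borel N"
  shows "f \<in> measurable (quotient_measure p) N"
proof (rule measurableI)
  fix x assume "x \<in> space (quotient_measure p)"
  then show "f x \<in> space N" using measurable_space[OF assms] by (auto simp: space_quotient)
next
  fix A assume A: "A \<in> sets N"
  have "q -` (f -` A \<inter> range q) = (\<lambda>v. f (q v)) -` A" by auto
  then show "f -` A \<inter> space (quotient_measure p) \<in> sets (quotient_measure p)"
    using measurable_sets[OF assms A] by (auto simp: space_quotient sets_quotient)
qed

text \<open>As a supremum, the quotient measure dominates the image of hyperbolic measure under any
  injective Borel piece. For \<open>X\<close> this takes the place of a fundamental domain.\<close>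

lemma nn_integral_inj_le:
  assumes B: "B \<in> sets borel" "inj_on q B" and f: "(\<lambda>v. f (q v)) \<in> borel_measurable borel"
  shows "(\<integral>\<^sup>+v. f (q v) * indicator B v \<partial>hyperbolic_measure) \<le> (\<integral>\<^sup>+x. f x \<partial>quotient_measure p)"
proof -
  let ?Q = "quotient_measure p"
  let ?D = "distr (density hyperbolic_measure (indicator B)) ?Q q"
  have qm: "q \<in> measurable (density hyperbolic_measure (indicator B)) ?Q" by simp
  have fm: "f \<in> borel_measurable ?Q" by (rule measurable_on_quotient[OF f])
  have le: "emeasure ?D A \<le> emeasure ?Q A" if A: "A \<in> sets ?Q" for A
  proof -
    have qA: "q -` A \<in> sets borel" using A by (simp add: sets_quotient)
    have "emeasure ?D A = (\<integral>\<^sup>+v. indicator B v * indicator (q -` A) v \<partial>hyperbolic_measure)"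
      using A qA B qm by (subst emeasure_distr) (auto simp: emeasure_density)
    also have "\<dots> = (\<integral>\<^sup>+v. indicator (B \<inter> q -` A) v \<partial>hyperbolic_measure)"
      by (intro nn_integral_cong) (auto simp: indicator_def)
    also have "\<dots> = emeasure hyperbolic_measure (B \<inter> q -` A)" using B qA by simp
    also have "\<dots> \<le> emeasure ?Q A"
      unfolding emeasure_quotient[OF A] using B qA by (intro SUP_upper) (auto simp: inj_on_def)
    finally show ?thesis .
  qed
  have "(\<integral>\<^sup>+v. f (q v) * indicator B v \<partial>hyperbolic_measure) = (\<integral>\<^sup>+v. f (q v) \<partial>density hyperbolic_measure (indicator B))"
    using B f by (subst nn_integral_density) (auto simp: mult.commute)
  also have "\<dots> = (\<integral>\<^sup>+x. f x \<partial>?D)" by (rule nn_integral_distr[OF qm, symmetric]) (simp add: fm)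
  also have "\<dots> \<le> (\<integral>\<^sup>+x. f x \<partial>?Q)"
    by (rule nn_integral_mono_measure) (auto simp: le_measure le)
  finally show ?thesis .
qed

context
  fixes B0
  assumes B0: "B0 \<in> sets borel" "inj_on q B0" "q ` B0 = range q"
begin

lemma tile_ex: "\<exists>g\<in>\<Lambda>. act g v \<in> B0"
proof -
  obtain w where "w \<in> B0" "q v = q w" using B0(3) by (metis imageE rangeI)
  then show ?thesis using q_eq by auto
qed

lemma tile_unique: "act g v \<in> B0 \<Longrightarrow> act h v \<in> B0 \<Longrightarrow> g \<in> \<Lambda> \<Longrightarrow> h \<in> \<Lambda> \<Longrightarrow> g = h"
  using B0(2) act_eq_imp_eq q_act by (metis inj_onD)

text \<open>Any injective set \<open>B\<close> over \<open>A\<close> can be cut along the translates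
  of \<open>B0\<close> and moved piecewise into \<open>B0\<close>. The moved pieces are disjoint
  because \<open>B\<close> is injective, and isometries preserve their measure, so \<open>B0\<close>
  attains the supremum.\<close>

lemma emeasure_quotient_fundamental:
  assumes A: "A \<in> sets (quotient_measure p)"
  shows "emeasure (quotient_measure p) A = emeasure hyperbolic_measure (B0 \<inter> q -` A)"
proof (rule antisym)
  have qA: "A \<subseteq> range q" "q -` A \<in> sets borel" using A by (auto simp: sets_quotient)
  show "emeasure hyperbolic_measure (B0 \<inter> q -` A) \<le> emeasure (quotient_measure p) A"
    unfolding emeasure_quotient[OF A] using B0 qA by (intro SUP_upper) (auto simp: inj_on_def)
  show "emeasure (quotient_measure p) A \<le> emeasure hyperbolic_measure (B0 \<inter> q -` A)"
    unfolding emeasure_quotient[OF A]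
  proof (rule SUP_least)
    fix B assume "B \<in> {B \<in> sets borel. inj_on q B \<and> q ` B \<subseteq> A}"
    then have B: "B \<in> sets borel" "inj_on q B" "q ` B \<subseteq> A" by auto
    \<comment> \<open>\<open>X g\<close> is the part of \<open>B\<close> that \<open>g\<close> moves
      into \<open>B0\<close>, and \<open>Z g\<close> is its image there.\<close>
    define X where "X g = B \<inter> act g -` B0" for g
    define Z where "Z g = B0 \<inter> act (lorentz_inv g) -` B" for g
    have pre: "act g -` S \<in> sets borel" if "g \<in> O1" "S \<in> sets borel" for g S
      using measurable_sets[OF act_measurable[OF that(1)] that(2)] by simp
    have Xs: "X g \<in> sets hyperbolic_measure" if "g \<in> \<Lambda>" for g
      using pre[OF O1[OF that] B0(1)] B by (simp add: X_def)
    have Zs: "Z g \<in> sets hyperbolic_measure" if "g \<in> \<Lambda>" for g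
      using pre[OF lorentz_inv_in_O1[OF O1[OF that]] B(1)] B0 by (simp add: Z_def)
    have XZ: "emeasure hyperbolic_measure (X g) = emeasure hyperbolic_measure (Z g)" if g: "g \<in> \<Lambda>" for g
    proof -
      have "act g -` Z g = X g" using O1[OF g] by (auto simp: X_def Z_def)
      then have "emeasure (distr hyperbolic_measure borel (act g)) (Z g) = emeasure hyperbolic_measure (X g)"
        using Zs[OF g] O1[OF g] by (subst emeasure_distr) auto
      then show ?thesis by (simp add: distr_hyperbolic_act[OF O1[OF g]])
    qed
    have "(\<Union>g\<in>\<Lambda>. X g) = B" using tile_ex by (fastforce simp: X_def)
    then have "emeasure hyperbolic_measure B = emeasure hyperbolic_measure (\<Union>g\<in>\<Lambda>. X g)" by simp
    also have "\<dots> = (\<integral>\<^sup>+g. emeasure hyperbolic_measure (X g) \<partial>count_space \<Lambda>)"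
      using tile_unique Xs by (intro emeasure_UN_countable countable) (auto simp: disjoint_family_on_def X_def)
    also have "\<dots> = (\<integral>\<^sup>+g. emeasure hyperbolic_measure (Z g) \<partial>count_space \<Lambda>)"
      by (intro nn_integral_cong) (simp add: XZ)
    also have "\<dots> = emeasure hyperbolic_measure (\<Union>g\<in>\<Lambda>. Z g)"
    proof (rule emeasure_UN_countable[symmetric, OF _ countable])
      show "disjoint_family_on Z \<Lambda>"
        unfolding disjoint_family_on_def
      proof (intro ballI impI)
        fix g h assume gh: "g \<in> \<Lambda>" "h \<in> \<Lambda>" "g \<noteq> h"
        show "Z g \<inter> Z h = {}"
        proof (rule ccontr)
          assume "Z g \<inter> Z h \<noteq> {}"
          then obtain v where v: "act (lorentz_inv g) v \<in> B" "act (lorentz_inv h) v \<in> B" by (auto simp: Z_def)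
          have "q (act (lorentz_inv g) v) = q (act (lorentz_inv h) v)" using gh inv q_act by metis
          then have e: "act (lorentz_inv g) v = act (lorentz_inv h) v" using B(2) v by (meson inj_onD)
          have "act g (act (lorentz_inv g) v) = act h (act (lorentz_inv g) v)"
            using gh O1 e by (simp add: e[symmetric] del: act_lorentz_inv) (metis act_lorentz_inv(2) O1 e gh(1) gh(2))
          then show False using act_eq_imp_eq gh by blast
        qed
      qed
    qed (use Zs in auto)
    also have "\<dots> \<le> emeasure hyperbolic_measure (B0 \<inter> q -` A)"
    proof (rule emeasure_mono)
      show "(\<Union>g\<in>\<Lambda>. Z g) \<subseteq> B0 \<inter> q -` A"
      proof
        fix v assume "v \<in> (\<Union>g\<in>\<Lambda>. Z g)"
        then obtain g where g: "g \<in> \<Lambda>" "v \<in> B0" "act (lorentz_inv g) v \<in> B" by (auto simp: Z_def)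
        then have "q v \<in> q ` B" using q_act[OF inv[OF g(1)], of v] by (metis imageI)
        then show "v \<in> B0 \<inter> q -` A" using B(3) g by auto
      qed
    qed (use B0 qA in auto)
    finally show "emeasure hyperbolic_measure B \<le> emeasure hyperbolic_measure (B0 \<inter> q -` A)" .
  qed
qed

lemma quotient_measure_eq_distr:
  "quotient_measure p = distr (density hyperbolic_measure (\<lambda>v. ennreal (indicator B0 v))) (quotient_measure p) q"
proof (rule measure_eqI)
  fix A assume A: "A \<in> sets (quotient_measure p)"
  have qA: "q -` A \<in> sets borel" using A by (simp add: sets_quotient)
  have qm: "q \<in> measurable (density hyperbolic_measure (\<lambda>v. ennreal (indicator B0 v))) (quotient_measure p)" by simp
  have "emeasure (distr (density hyperbolic_measure (\<lambda>v. ennreal (indicator B0 v))) (quotient_measure p) q) A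
      = (\<integral>\<^sup>+v. ennreal (indicator B0 v) * indicator (q -` A) v \<partial>hyperbolic_measure)"
    using A qA B0 qm by (subst emeasure_distr) (auto simp: emeasure_density)
  also have "\<dots> = (\<integral>\<^sup>+v. indicator (B0 \<inter> q -` A) v \<partial>hyperbolic_measure)"
    by (intro nn_integral_cong) (auto simp: indicator_def)
  also have "\<dots> = emeasure hyperbolic_measure (B0 \<inter> q -` A)" using B0 qA by simp
  finally show "emeasure (quotient_measure p) A =
     emeasure (distr (density hyperbolic_measure (\<lambda>v. ennreal (indicator B0 v))) (quotient_measure p) q) A"
    using emeasure_quotient_fundamental[OF A] by simp
qed simp

lemma integral_quotient_fundamental:
  fixes f :: "'x \<Rightarrow> 'b::{banach, second_countable_topology}"
  assumes f: "(\<lambda>v. f (q v)) \<in> borel_measurable borel"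
  shows "(LINT x|quotient_measure p. f x) = (LINT v|hyperbolic_measure. indicator B0 v *\<^sub>R f (q v))"
proof -
  have "(LINT x|quotient_measure p. f x) = (LINT x|distr (density hyperbolic_measure (\<lambda>v. ennreal (indicator B0 v))) (quotient_measure p) q. f x)"
    using quotient_measure_eq_distr by simp
  also have "\<dots> = (LINT v|density hyperbolic_measure (\<lambda>v. ennreal (indicator B0 v)). f (q v))"
    by (rule integral_distr) (auto intro: measurable_on_quotient[OF f])
  also have "\<dots> = (LINT v|hyperbolic_measure. indicator B0 v *\<^sub>R f (q v))"
    using f B0 by (intro integral_density) auto
  finally show ?thesis .
qed

end

end

section \<open>Twice continuously differentiable functions\<close>

definition D1 :: "('a::euclidean_space \<Rightarrow> 'b::real_normed_vector) \<Rightarrow> 'a \<Rightarrow> 'a \<Rightarrow> 'b" where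
  "D1 F x u = frechet_derivative F (at x) u"

definition D2 :: "('a::euclidean_space \<Rightarrow> 'b::real_normed_vector) \<Rightarrow> 'a \<Rightarrow> 'a \<Rightarrow> 'a \<Rightarrow> 'b" where
  "D2 F x u v = frechet_derivative (\<lambda>y. D1 F y v) (at x) u"

text \<open>Shaped after \<open>smooth\<close>, which is recursive in directional derivatives:
  unfolding it twice gives exactly these three conditions.\<close>

definition C2 :: "('a::euclidean_space \<Rightarrow> 'b::real_normed_vector) \<Rightarrow> bool" where
  "C2 F \<longleftrightarrow> (\<forall>x. F differentiable at x) \<and> (\<forall>v x. (\<lambda>y. D1 F y v) differentiable at x)
     \<and> (\<forall>u v. continuous_on UNIV (\<lambda>x. D2 F x u v))"

lemma smooth_imp_C2:
  assumes "smooth F"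
  shows "C2 F"
proof -
  have "differentiable_upto (Suc (Suc 0)) F" using assms by (simp only: smooth_def)
  then show ?thesis unfolding C2_def D2_def D1_def by simp
qed

lemma hyperbola_derivs:
  fixes P Q :: "'a::real_normed_vector"
  shows "((\<lambda>s. cosh s *\<^sub>R P + sinh s *\<^sub>R Q) has_vector_derivative sinh t *\<^sub>R P + cosh t *\<^sub>R Q) (at t)"
    and "((\<lambda>s. sinh s *\<^sub>R P + cosh s *\<^sub>R Q) has_vector_derivative cosh t *\<^sub>R P + sinh t *\<^sub>R Q) (at t)"
  by (auto intro!: derivative_eq_intros)

context
  fixes F :: "'a::euclidean_space \<Rightarrow> 'b::real_normed_vector"
  assumes C2: "C2 F"
begin

lemma C2_D1: "(F has_derivative D1 F x) (at x)"
  using C2 unfolding C2_def D1_def[abs_def] by (simp add: frechet_derivative_works[symmetric])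

lemma C2_D2: "((\<lambda>y. D1 F y v) has_derivative (\<lambda>u. D2 F x u v)) (at x)"
  using C2 unfolding C2_def D2_def by (simp add: frechet_derivative_works[symmetric])

lemma linear_D1: "linear (D1 F x)"
  using C2_D1 has_derivative_linear by blast

lemma D1_Basis: "D1 F x v = (\<Sum>b\<in>Basis. (v \<bullet> b) *\<^sub>R D1 F x b)"
  by (subst (1) euclidean_representation[symmetric, of v])
    (simp add: linear_sum[OF linear_D1] linear_scale[OF linear_D1])

lemma D2_linear_left: "linear (\<lambda>u. D2 F x u v)"
  using C2_D2 has_derivative_linear by blast

text \<open>Linearity in the second direction is not built into \<open>D2\<close>; it comes from
  differentiating the basis expansion of \<open>D1\<close> and uniqueness of the derivative.\<close>

lemma D2_Basis_right: "D2 F x u v = (\<Sum>c\<in>Basis. (v \<bullet> c) *\<^sub>R D2 F x u c)"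
proof -
  have "((\<lambda>y. \<Sum>c\<in>Basis. (v \<bullet> c) *\<^sub>R D1 F y c) has_derivative (\<lambda>u. \<Sum>c\<in>Basis. (v \<bullet> c) *\<^sub>R D2 F x u c)) (at x)"
    by (intro has_derivative_sum has_derivative_scaleR_right C2_D2)
  then have "((\<lambda>y. D1 F y v) has_derivative (\<lambda>u. \<Sum>c\<in>Basis. (v \<bullet> c) *\<^sub>R D2 F x u c)) (at x)"
    by (simp only: D1_Basis[symmetric])
  from has_derivative_unique[OF C2_D2 this] show ?thesis by (rule fun_cong)
qed

lemma D2_linear_right: "linear (\<lambda>v. D2 F x u v)"
proof (rule linearI)
  show "D2 F x u (v + w) = D2 F x u v + D2 F x u w" for v w
    unfolding D2_Basis_right[of x u "v + w"] D2_Basis_right[of x u v] D2_Basis_right[of x u w]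
    by (simp add: inner_add_left scaleR_add_left sum.distrib)
  show "D2 F x u (r *\<^sub>R v) = r *\<^sub>R D2 F x u v" for r v
    unfolding D2_Basis_right[of x u "r *\<^sub>R v"] D2_Basis_right[of x u v]
    by (simp add: scaleR_sum_right)
qed

lemma D2_Basis: "D2 F x u v = (\<Sum>b\<in>Basis. \<Sum>c\<in>Basis. ((u \<bullet> b) * (v \<bullet> c)) *\<^sub>R D2 F x b c)"
proof -
  have "D2 F x u v = (\<Sum>b\<in>Basis. (u \<bullet> b) *\<^sub>R D2 F x b v)"
    by (subst (1) euclidean_representation[symmetric, of u])
      (simp add: linear_sum[OF D2_linear_left] linear_scale[OF D2_linear_left])
  also have "\<dots> = (\<Sum>b\<in>Basis. (u \<bullet> b) *\<^sub>R (\<Sum>c\<in>Basis. (v \<bullet> c) *\<^sub>R D2 F x b c))"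
    by (intro sum.cong refl arg_cong2[where f = scaleR] D2_Basis_right)
  finally show ?thesis by (simp add: scaleR_sum_right)
qed

lemma C2_continuous: "continuous_on S F"
  using C2_D1 by (meson continuous_at_imp_continuous_on has_derivative_continuous)

lemma D1_continuous: "continuous_on S (\<lambda>x. D1 F x v)"
  using C2_D2 by (meson continuous_at_imp_continuous_on has_derivative_continuous)

lemma C2_continuous_compose:
  "continuous_on S a \<Longrightarrow> continuous_on S (\<lambda>s. F (a s))"
  by (rule continuous_on_compose2[OF C2_continuous[of UNIV]]) auto

lemma D1_continuous_compose:
  assumes "continuous_on S a" "continuous_on S u"
  shows "continuous_on S (\<lambda>s. D1 F (a s) (u s))"
proof -
  have "continuous_on S (\<lambda>s. \<Sum>b\<in>Basis. (u s \<bullet> b) *\<^sub>R D1 F (a s) b)"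
    using assms by (intro continuous_intros continuous_on_compose2[OF D1_continuous[of UNIV]]) auto
  then show ?thesis by (simp only: D1_Basis[symmetric])
qed

text \<open>\<open>C2\<close> provides continuity for fixed directions only. Bilinearity reduces the
  joint statement to the finitely many functions \<open>D2 F x b c\<close> with basis vectors
  \<open>b\<close>, \<open>c\<close>.\<close>

lemma D2_continuous_compose:
  assumes "continuous_on S a" "continuous_on S u" "continuous_on S v"
  shows "continuous_on S (\<lambda>s. D2 F (a s) (u s) (v s))"
proof -
  have "continuous_on UNIV (\<lambda>x. D2 F x b c)" for b c using C2 by (simp add: C2_def)
  then have c: "continuous_on S (\<lambda>s. D2 F (a s) b c)" for b c
    by (rule continuous_on_compose2[OF _ assms(1) subset_UNIV])
  have "continuous_on S (\<lambda>s. \<Sum>b\<in>Basis. \<Sum>c\<in>Basis. ((u s \<bullet> b) * (v s \<bullet> c)) *\<^sub>R D2 F (a s) b c)"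
    by (intro continuous_on_sum continuous_on_scaleR continuous_on_mult continuous_on_inner continuous_on_const assms c)
  then show ?thesis by (simp only: D2_Basis[symmetric])
qed

lemma D1_chain:
  assumes "(\<gamma> has_vector_derivative \<gamma>') (at t)"
  shows "((\<lambda>s. F (\<gamma> s)) has_vector_derivative D1 F (\<gamma> t) \<gamma>') (at t)"
proof -
  have "((\<lambda>s. F (\<gamma> s)) has_derivative (\<lambda>x. D1 F (\<gamma> t) (x *\<^sub>R \<gamma>'))) (at t)"
    using has_derivative_compose[OF assms[unfolded has_vector_derivative_def] C2_D1] .
  then show ?thesis by (simp add: has_vector_derivative_def linear_scale[OF linear_D1])
qed

lemma D2_chain:
  assumes \<gamma>: "(\<gamma> has_vector_derivative \<gamma>') (at t)" and \<delta>: "(\<delta> has_vector_derivative \<delta>') (at t)"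
  shows "((\<lambda>s. D1 F (\<gamma> s) (\<delta> s)) has_vector_derivative D2 F (\<gamma> t) \<gamma>' (\<delta> t) + D1 F (\<gamma> t) \<delta>') (at t)"
proof -
  have g: "((\<lambda>s. D1 F (\<gamma> s) b) has_vector_derivative D2 F (\<gamma> t) \<gamma>' b) (at t)" for b
  proof -
    have "((\<lambda>s. D1 F (\<gamma> s) b) has_derivative (\<lambda>x. D2 F (\<gamma> t) (x *\<^sub>R \<gamma>') b)) (at t)"
      using has_derivative_compose[OF \<gamma>[unfolded has_vector_derivative_def] C2_D2] .
    then show ?thesis by (simp add: has_vector_derivative_def linear_scale[OF D2_linear_left])
  qed
  have d: "((\<lambda>s. \<delta> s \<bullet> b) has_real_derivative \<delta>' \<bullet> b) (at t)" for b
    using bounded_linear.has_vector_derivative[OF bounded_linear_inner_left \<delta>]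
    by (simp add: has_real_derivative_iff_has_vector_derivative)
  have "((\<lambda>s. \<Sum>b\<in>Basis. (\<delta> s \<bullet> b) *\<^sub>R D1 F (\<gamma> s) b) has_vector_derivative
      (\<Sum>b\<in>Basis. (\<delta> t \<bullet> b) *\<^sub>R D2 F (\<gamma> t) \<gamma>' b + (\<delta>' \<bullet> b) *\<^sub>R D1 F (\<gamma> t) b)) (at t)"
    by (intro has_vector_derivative_sum has_vector_derivative_scaleR g d)
  then show ?thesis
    by (simp only: D1_Basis[symmetric] D2_Basis_right[symmetric] sum.distrib)
qed

lemma second_derivative_along_curve:
  assumes "\<And>t. (\<gamma> has_vector_derivative \<gamma>' t) (at t)" "(\<gamma>' has_vector_derivative \<gamma>'') (at 0)"
  shows "vector_derivative (\<lambda>s. vector_derivative (\<lambda>t. F (\<gamma> t)) (at s)) (at 0)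
    = D2 F (\<gamma> 0) (\<gamma>' 0) (\<gamma>' 0) + D1 F (\<gamma> 0) \<gamma>''"
proof -
  have "vector_derivative (\<lambda>t. F (\<gamma> t)) (at s) = D1 F (\<gamma> s) (\<gamma>' s)" for s
    by (rule vector_derivative_at[OF D1_chain[OF assms(1)]])
  then show ?thesis
    using vector_derivative_at[OF D2_chain[OF assms(1) assms(2)]] by simp
qed

text \<open>Geodesics of the hyperboloid have the form \<open>cosh t * P + sinh t * Q\<close>, and
  keep it under the chart, which is a linear projection. Their acceleration equals their position,
  hence the first-order term \<open>D1 F P P\<close>.\<close>

lemma second_derivative_along_hyperbola:
  "vector_derivative (\<lambda>s. vector_derivative (\<lambda>t. F (cosh t *\<^sub>R P + sinh t *\<^sub>R Q)) (at s)) (at 0)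
    = D2 F P Q Q + D1 F P P"
  using second_derivative_along_curve[OF hyperbola_derivs(1)[of P Q] hyperbola_derivs(2)[of P Q 0]] by simp

end

lemma D1_eqI: "(F has_derivative F') (at x) \<Longrightarrow> D1 F x = F'"
  unfolding D1_def[abs_def] using frechet_derivative_at by metis

lemma D2_eqI: "((\<lambda>y. D1 F y v) has_derivative F') (at x) \<Longrightarrow> D2 F x u v = F' u"
  unfolding D2_def using frechet_derivative_at by metis

lemma C2_I:
  assumes "\<And>x. (F has_derivative F' x) (at x)"
    and "\<And>x v. ((\<lambda>y. F' y v) has_derivative (\<lambda>u. F'' x u v)) (at x)"
    and "\<And>u v. continuous_on UNIV (\<lambda>x. F'' x u v)"
  shows "C2 F" and "D1 F x u = F' x u" and "D2 F x u v = F'' x u v"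
proof -
  have d1: "D1 F x = F' x" for x by (rule D1_eqI[OF assms(1)])
  have d2: "D2 F x u v = F'' x u v" for x u v by (rule D2_eqI) (simp only: d1 assms(2))
  show "D1 F x u = F' x u" "D2 F x u v = F'' x u v" by (simp_all only: d1 d2)
  show "C2 F" unfolding C2_def d1 d2
    using assms unfolding differentiable_def by blast
qed

lemma C2_affine:
  fixes F :: "'b::euclidean_space \<Rightarrow> 'c::real_normed_vector" and A :: "'a::euclidean_space \<Rightarrow> 'b"
  assumes F: "C2 F" and A: "bounded_linear A"
  shows "C2 (\<lambda>w. F (A w + b))"
    and "D1 (\<lambda>w. F (A w + b)) w u = D1 F (A w + b) (A u)"
    and "D2 (\<lambda>w. F (A w + b)) w u v = D2 F (A w + b) (A u) (A v)"
proof -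
  have a: "((\<lambda>w. A w + b) has_derivative A) (at w)" for w
    using bounded_linear_imp_has_derivative[OF A] by (auto intro!: derivative_eq_intros)
  have 1: "((\<lambda>w. F (A w + b)) has_derivative (\<lambda>u. D1 F (A w + b) (A u))) (at w)" for w
    by (rule has_derivative_compose[OF a C2_D1[OF F]])
  have 2: "((\<lambda>w. D1 F (A w + b) (A v)) has_derivative (\<lambda>u. D2 F (A w + b) (A u) (A v))) (at w)" for w v
    by (rule has_derivative_compose[OF a C2_D2[OF F]])
  have 3: "continuous_on UNIV (\<lambda>w. D2 F (A w + b) (A u) (A v))" for u v
    by (intro D2_continuous_compose[OF F] continuous_intros linear_continuous_on A)
  note * = C2_I[of "\<lambda>w. F (A w + b)" "\<lambda>w u. D1 F (A w + b) (A u)" "\<lambda>w u v. D2 F (A w + b) (A u) (A v)", OF 1 2 3]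
  show "C2 (\<lambda>w. F (A w + b))" by (rule *(1))
  show "D1 (\<lambda>w. F (A w + b)) w u = D1 F (A w + b) (A u)" by (rule *(2))
  show "D2 (\<lambda>w. F (A w + b)) w u v = D2 F (A w + b) (A u) (A v)" by (rule *(3))
qed

lemma C2_half_sum:
  fixes F G :: "'a::euclidean_space \<Rightarrow> 'b::real_normed_vector"
  assumes F: "C2 F" and G: "C2 G"
  shows "C2 (\<lambda>w. (1/2) *\<^sub>R (F w + G w))"
    and "D1 (\<lambda>w. (1/2) *\<^sub>R (F w + G w)) w u = (1/2) *\<^sub>R (D1 F w u + D1 G w u)"
    and "D2 (\<lambda>w. (1/2) *\<^sub>R (F w + G w)) w u v = (1/2) *\<^sub>R (D2 F w u v + D2 G w u v)"
proof -
  have 1: "((\<lambda>w. (1/2) *\<^sub>R (F w + G w)) has_derivative (\<lambda>u. (1/2) *\<^sub>R (D1 F w u + D1 G w u))) (at w)" for w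
    by (intro has_derivative_scaleR_right has_derivative_add C2_D1 F G)
  have 2: "((\<lambda>w. (1/2) *\<^sub>R (D1 F w v + D1 G w v)) has_derivative (\<lambda>u. (1/2) *\<^sub>R (D2 F w u v + D2 G w u v))) (at w)" for w v
    by (intro has_derivative_scaleR_right has_derivative_add C2_D2 F G)
  have 3: "continuous_on UNIV (\<lambda>w. (1/2) *\<^sub>R (D2 F w u v + D2 G w u v))" for u v
    by (intro continuous_on_scaleR continuous_on_const continuous_on_add D2_continuous_compose F G continuous_on_id)
  note * = C2_I[of "\<lambda>w. (1/2) *\<^sub>R (F w + G w)" "\<lambda>w u. (1/2) *\<^sub>R (D1 F w u + D1 G w u)"
      "\<lambda>w u v. (1/2) *\<^sub>R (D2 F w u v + D2 G w u v)", OF 1 2 3]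
  show "C2 (\<lambda>w. (1/2) *\<^sub>R (F w + G w))" by (rule *(1))
  show "D1 (\<lambda>w. (1/2) *\<^sub>R (F w + G w)) w u = (1/2) *\<^sub>R (D1 F w u + D1 G w u)" by (rule *(2))
  show "D2 (\<lambda>w. (1/2) *\<^sub>R (F w + G w)) w u v = (1/2) *\<^sub>R (D2 F w u v + D2 G w u v)" by (rule *(3))
qed

section \<open>The Laplacian in the boost chart and in Fermi coordinates\<close>

text \<open>The spatial block of \<open>boost w\<close>. Applied to the standard basis it gives, in
  the chart, the orthonormal frame at \<open>w\<close> that the boost carries over from the
  origin.\<close>

definition boost_space :: "real ^ 'd \<Rightarrow> real ^ 'd \<Rightarrow> real ^ 'd::finite" where
  "boost_space w u = u + ((w \<bullet> u) / (1 + sqrt (1 + (norm w)\<^sup>2))) *\<^sub>R w"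

text \<open>The Laplace-Beltrami operator with its usual sign, the trace of the Hessian; the
  nonnegative \<open>laplacian\<close> is its negative.\<close>

definition chart_laplacian :: "(real ^ 'd::finite \<Rightarrow> complex) \<Rightarrow> real ^ 'd \<Rightarrow> complex" where
  "chart_laplacian f w = (\<Sum>a\<in>UNIV. D2 f w (boost_space w (axis a 1)) (boost_space w (axis a 1)) + D1 f w w)"

lemma boost_space_scaleR: "boost_space w (c *\<^sub>R u) = c *\<^sub>R boost_space w u"
  by (simp add: boost_space_def algebra_simps)

lemma act_boost: "act (boost w) u = sqrt (1 + (norm u)\<^sup>2) *\<^sub>R w + boost_space w u"
proof -
  have "boost w *v pt u = pt (act (boost w) u)" using mult_pt[OF boost_in_O1, of w u] by simp
  then have "act (boost w) u = space_part (boost w *v pt u)" by simp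
  then show ?thesis by (simp add: boost_mult_space boost_space_def)
qed

lemma norm_sinh_axis: "sqrt (1 + (norm (sinh s *\<^sub>R axis a (1::real)))\<^sup>2) = cosh s"
proof -
  have "1 + (norm (sinh s *\<^sub>R axis a (1::real)))\<^sup>2 = (cosh s)\<^sup>2"
    by (simp add: cosh_square_eq)
  then show ?thesis by simp
qed

lemma laplacian_chart:
  assumes f: "C2 f" and p: "\<And>g. g \<in> O1 \<Longrightarrow> u g = f (act g 0)"
  shows "laplacian u (boost w) = - chart_laplacian f w"
proof -
  have "u (boost w ** boost (sinh t *\<^sub>R axis a 1)) = f (cosh t *\<^sub>R w + sinh t *\<^sub>R boost_space w (axis a 1))" for t a
  proof -
    have "act (boost w) (sinh t *\<^sub>R axis a 1) = cosh t *\<^sub>R w + sinh t *\<^sub>R boost_space w (axis a 1)"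
      by (simp only: act_boost norm_sinh_axis boost_space_scaleR)
    then show ?thesis
      using p[OF mult_in_O1[OF boost_in_O1 boost_in_O1]] by (simp add: act_mult boost_in_O1)
  qed
  then show ?thesis
    unfolding laplacian_def chart_laplacian_def
    by (simp add: second_derivative_along_hyperbola[OF f])
qed

section \<open>Separation of variables in Fermi coordinates\<close>

definition fermi' :: "real ^ 'n \<Rightarrow> real \<Rightarrow> real ^ 'n::finite option" where
  "fermi' w t = cons_vec (cosh t) (sinh t *\<^sub>R w)"

lemma cons_vec_add: "cons_vec x w + cons_vec y z = cons_vec (x + y) (w + z)"
  by (rule vec_option_eqI) auto

lemma cons_vec_scaleR: "c *\<^sub>R cons_vec x w = cons_vec (c * x) (c *\<^sub>R w)"
  by (rule vec_option_eqI) auto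

lemma fermi_shift: "fermi w (t + s) = cosh s *\<^sub>R fermi w t + sinh s *\<^sub>R fermi' w t"
  by (simp add: fermi_def fermi'_def cons_vec_add cons_vec_scaleR sinh_add cosh_add algebra_simps)

lemma fermi_derivs:
  "(fermi w has_vector_derivative fermi' w t) (at t)"
  "(fermi' w has_vector_derivative fermi w t) (at t)"
proof -
  have 1: "fermi w = (\<lambda>s. cosh s *\<^sub>R cons_vec 0 w + sinh s *\<^sub>R cons_vec 1 0)"
    by (simp add: fun_eq_iff fermi_def cons_vec_add cons_vec_scaleR)
  have 2: "fermi' w = (\<lambda>s. sinh s *\<^sub>R cons_vec 0 w + cosh s *\<^sub>R cons_vec 1 0)"
    by (simp add: fun_eq_iff fermi'_def cons_vec_add cons_vec_scaleR)
  show "(fermi w has_vector_derivative fermi' w t) (at t)"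
    "(fermi' w has_vector_derivative fermi w t) (at t)"
    unfolding 1 2 by (rule hyperbola_derivs)+
qed

lemma act_boost_last:
  fixes u :: "real ^ 'n::finite option"
  shows "act (boost (sinh t *\<^sub>R axis None 1)) u
     = u + (sqrt (1 + (norm u)\<^sup>2) * sinh t + (cosh t - 1) * u $ None) *\<^sub>R axis None 1"
proof -
  have k: "(sinh t)\<^sup>2 / (1 + cosh t) = cosh t - 1"
  proof -
    have "1 + cosh t > 0" by (simp add: add_pos_pos)
    moreover have "(sinh t)\<^sup>2 = (cosh t - 1) * (1 + cosh t)"
      using cosh_square_eq[of t] by (simp add: algebra_simps power2_eq_square)
    ultimately show ?thesis by simp
  qed
  have "boost_space (sinh t *\<^sub>R axis None 1) u = u + ((sinh t)\<^sup>2 / (1 + cosh t) * u $ None) *\<^sub>R axis None 1"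
    unfolding boost_space_def norm_sinh_axis by (simp add: inner_axis' power2_eq_square algebra_simps)
  then show ?thesis unfolding act_boost k by (simp add: algebra_simps)
qed

lemma time_sign_block_diag_boost: "time_sign (block_diag (boost w) 1) = 1"
  by (rule time_sign_eqI[of _ "fermi 0 0"])
    (use block_diag_mult_pt_fermi[OF boost_in_O1, of 1 w 0 0] in \<open>auto simp: block_diag_in_O1 boost_in_O1\<close>)

lemma act_block_diag_boost:
  "act (block_diag (boost w) 1) (cons_vec x y) = cons_vec x (sqrt (1 + x\<^sup>2 + (norm y)\<^sup>2) *\<^sub>R w + boost_space w y)"
proof -
  let ?g = "block_diag (boost w) 1"
  let ?z = "cons_vec (sqrt (1 + x\<^sup>2 + (norm y)\<^sup>2)) y"
  have O: "?g \<in> O1" by (simp add: block_diag_in_O1 boost_in_O1)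
  have ptz: "pt (cons_vec x y) = snoc_vec ?z x"
  proof (rule vec_option_eqI)
    show "pt (cons_vec x y) $ Some a = snoc_vec ?z x $ Some a" for a by (cases a) auto
  qed (simp add: norm_cons_vec add.assoc)
  have "act ?g (cons_vec x y) = space_part (?g *v pt (cons_vec x y))"
    using mult_pt[OF O, of "cons_vec x y"] by (simp add: time_sign_block_diag_boost)
  also have "\<dots> = space_part (snoc_vec (boost w *v ?z) x)" unfolding ptz block_diag_mult by simp
  also have "\<dots> = cons_vec x (space_part (boost w *v ?z))"
  proof (rule vec_option_eqI)
    show "space_part (snoc_vec (boost w *v ?z) x) $ Some a = cons_vec x (space_part (boost w *v ?z)) $ Some a" for a
      by simp
  qed simp
  also have "space_part ?z = y" by (simp add: vec_eq_iff)
  then have "space_part (boost w *v ?z) = sqrt (1 + x\<^sup>2 + (norm y)\<^sup>2) *\<^sub>R w + boost_space w y"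
    by (simp add: boost_mult_space boost_space_def)
  finally show ?thesis .
qed

text \<open>The group element carries the standard frame to \<open>fermi w t\<close>. Its direction
  \<open>None\<close> runs along the perpendicular geodesic and gives
  \<open>F (fermi w (t + s))\<close>; the other directions are tangent to the equidistant
  hypersurface.\<close>

lemma laplacian_fermi:
  fixes F :: "real ^ 'n::finite option \<Rightarrow> complex"
  assumes F: "C2 F" and p: "\<And>g. g \<in> O1 \<Longrightarrow> u g = F (act g 0)"
  shows "laplacian u (block_diag (boost w) 1 ** boost (sinh t *\<^sub>R axis None 1))
    = - (D2 F (fermi w t) (fermi' w t) (fermi' w t) + D1 F (fermi w t) (fermi w t)
      + (\<Sum>b\<in>UNIV. D2 F (fermi w t) (cons_vec 0 (boost_space w (axis b 1))) (cons_vec 0 (boost_space w (axis b 1)))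
          + D1 F (fermi w t) (fermi w t)))"
proof -
  let ?g = "block_diag (boost w) 1 ** boost (sinh t *\<^sub>R axis None 1)"
  have O: "block_diag (boost w) 1 \<in> O1" by (simp add: block_diag_in_O1 boost_in_O1)
  have u: "u (?g ** boost v) = F (act (block_diag (boost w) 1) (act (boost (sinh t *\<^sub>R axis None 1)) v))" for v
    by (subst p) (auto simp: act_mult mult_in_O1 O boost_in_O1)
  have 1: "u (?g ** boost (sinh s *\<^sub>R axis None 1)) = F (cosh s *\<^sub>R fermi w t + sinh s *\<^sub>R fermi' w t)" for s
  proof -
    have "act (boost (sinh t *\<^sub>R axis None 1)) (sinh s *\<^sub>R axis None 1) = fermi (0 :: real ^ 'n) (t + s)"
      unfolding act_boost_last norm_sinh_axis
      by (rule vec_option_eqI) (auto simp: fermi_def axis_def sinh_add algebra_simps)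
    then show ?thesis
      unfolding u using act_block_diag_fermi[OF boost_in_O1, of 1 w 0 "t + s"] by (simp add: fermi_shift)
  qed
  have 2: "u (?g ** boost (sinh s *\<^sub>R axis (Some b) 1))
      = F (cosh s *\<^sub>R fermi w t + sinh s *\<^sub>R cons_vec 0 (boost_space w (axis b 1)))" for s b
  proof -
    have "act (boost (sinh t *\<^sub>R axis None 1)) (sinh s *\<^sub>R axis (Some b) 1) = cons_vec (cosh s * sinh t) (sinh s *\<^sub>R axis b 1)"
      unfolding act_boost_last norm_sinh_axis
      by (rule vec_option_eqI) (auto simp: axis_def)
    moreover have "sqrt (1 + (cosh s * sinh t)\<^sup>2 + (norm (sinh s *\<^sub>R axis b (1::real)))\<^sup>2) = cosh s * cosh t"
    proof (rule real_sqrt_unique)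
      show "(cosh s * cosh t)\<^sup>2 = 1 + (cosh s * sinh t)\<^sup>2 + (norm (sinh s *\<^sub>R axis b (1::real)))\<^sup>2"
        by (simp add: power_mult_distrib cosh_square_eq algebra_simps)
    qed simp
    ultimately show ?thesis
      unfolding u by (simp add: act_block_diag_boost fermi_def cons_vec_add cons_vec_scaleR boost_space_scaleR)
  qed
  show ?thesis
    unfolding laplacian_def sum_UNIV_option 1 2
    by (simp add: second_derivative_along_hyperbola[OF F])
qed

lemma fermi_affine: "fermi w t = cons_vec 0 (cosh t *\<^sub>R w) + cons_vec (sinh t) 0"
  by (simp add: fermi_def cons_vec_add)

lemma bounded_linear_cons_vec: "bounded_linear (\<lambda>w. cons_vec 0 (c *\<^sub>R w))"
  by (intro linear_conv_bounded_linear[THEN iffD1] linearI)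
    (auto simp: cons_vec_add cons_vec_scaleR algebra_simps)

text \<open>At fixed \<open>t\<close> the map \<open>w \<mapsto> fermi w t\<close> is affine, so
  each derivative contributes a factor \<open>cosh t\<close>.\<close>

lemma fermi_slice:
  assumes "C2 F"
  shows "C2 (\<lambda>w. F (fermi w t))"
    and "D1 (\<lambda>w. F (fermi w t)) w u = cosh t *\<^sub>R D1 F (fermi w t) (cons_vec 0 u)"
    and "D2 (\<lambda>w. F (fermi w t)) w u v = (cosh t)\<^sup>2 *\<^sub>R D2 F (fermi w t) (cons_vec 0 u) (cons_vec 0 v)"
proof -
  have c: "cons_vec 0 (cosh t *\<^sub>R z) = cosh t *\<^sub>R cons_vec 0 z" for z :: "real ^ 'a"
    by (simp add: cons_vec_scaleR)
  note * = C2_affine[OF assms bounded_linear_cons_vec[of "cosh t"], of "cons_vec (sinh t) 0", folded fermi_affine]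
  show "C2 (\<lambda>w. F (fermi w t))" by (rule *)
  show "D1 (\<lambda>w. F (fermi w t)) w u = cosh t *\<^sub>R D1 F (fermi w t) (cons_vec 0 u)"
    unfolding *(2) c by (rule linear_scale[OF linear_D1[OF assms]])
  show "D2 (\<lambda>w. F (fermi w t)) w u v = (cosh t)\<^sup>2 *\<^sub>R D2 F (fermi w t) (cons_vec 0 u) (cons_vec 0 v)"
    unfolding *(3) c linear_scale[OF D2_linear_left[OF assms]] linear_scale[OF D2_linear_right[OF assms]]
    by (simp add: power2_eq_square)
qed

text \<open>Geodesics tangent to an equidistant hypersurface leave it. The identity
  \<open>cosh t * fermi w t = (0, w) + sinh t * fermi' w t\<close> splits their acceleration into
  the part that belongs to the Laplacian of the slice and a normal part; the \<open>n\<close> normal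
  parts add up to the mean curvature term with \<open>n * cosh t * sinh t\<close>. As
  \<open>fermi\<close> is its own second derivative in \<open>t\<close>, the first bracket is the
  second derivative of \<open>F (fermi w t)\<close> in \<open>t\<close>.\<close>

lemma fermi_separation:
  fixes F :: "real ^ 'n::finite option \<Rightarrow> complex"
  assumes F: "C2 F" and p: "\<And>g. g \<in> O1 \<Longrightarrow> u g = F (act g 0)"
    and eig: "\<And>g. g \<in> O1 \<Longrightarrow> laplacian u g = ev * u g"
  shows "(cosh t)\<^sup>2 *\<^sub>R (D2 F (fermi w t) (fermi' w t) (fermi' w t) + D1 F (fermi w t) (fermi w t))
    + (real CARD('n) * (cosh t * sinh t)) *\<^sub>R D1 F (fermi w t) (fermi' w t)
    + chart_laplacian (\<lambda>w. F (fermi w t)) w = - (ev * (cosh t)\<^sup>2 *\<^sub>R F (fermi w t))"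
proof -
  let ?P = "fermi w t" and ?Q = "fermi' w t" and ?n = "real CARD('n)"
  let ?e = "\<lambda>b. cons_vec 0 (boost_space w (axis b 1)) :: real ^ 'n option"
  let ?g = "block_diag (boost w) 1 ** boost (sinh t *\<^sub>R axis None 1)"
  have O: "?g \<in> O1" by (simp add: block_diag_in_O1 boost_in_O1 mult_in_O1)
  have e: "sinh t *\<^sub>R axis None 1 = fermi (0 :: real ^ 'n) t"
    by (rule vec_option_eqI) (auto simp: fermi_def axis_def)
  have "act ?g 0 = act (block_diag (boost w) 1) (sinh t *\<^sub>R axis None 1)"
    by (simp add: act_mult block_diag_in_O1 boost_in_O1)
  also have "\<dots> = fermi (act (boost w) 0) (time_sign (boost w) * 1 * t)"
    unfolding e by (rule act_block_diag_fermi[OF boost_in_O1]) simp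
  finally have "act ?g 0 = ?P" by simp
  then have "laplacian u ?g = ev * F ?P" using eig[OF O] p[OF O] by simp
  then have neg: "- (D2 F ?P ?Q ?Q + D1 F ?P ?P + (\<Sum>b\<in>UNIV. D2 F ?P (?e b) (?e b) + D1 F ?P ?P)) = ev * F ?P"
    by (simp only: laplacian_fermi[OF F p])
  have sums: "(\<Sum>b\<in>(UNIV :: 'n set). D2 F ?P (?e b) (?e b) + D1 F ?P ?P) = (\<Sum>b\<in>UNIV. D2 F ?P (?e b) (?e b)) + ?n *\<^sub>R D1 F ?P ?P"
    by (simp add: sum.distrib scaleR_conv_of_real)
  have E: "D2 F ?P ?Q ?Q + D1 F ?P ?P + ((\<Sum>b\<in>UNIV. D2 F ?P (?e b) (?e b)) + ?n *\<^sub>R D1 F ?P ?P) = - (ev * F ?P)"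
    unfolding neg[unfolded sums, symmetric] by (simp only: minus_minus)
  have CL: "chart_laplacian (\<lambda>w. F (fermi w t)) w
      = (cosh t)\<^sup>2 *\<^sub>R (\<Sum>b\<in>UNIV. D2 F ?P (?e b) (?e b)) + ?n *\<^sub>R (cosh t *\<^sub>R D1 F ?P (cons_vec 0 w))"
    unfolding chart_laplacian_def fermi_slice(2,3)[OF F]
    by (simp add: sum.distrib scaleR_conv_of_real sum_distrib_left)
  have "cosh t *\<^sub>R ?P = cons_vec 0 w + sinh t *\<^sub>R ?Q"
  proof (rule vec_option_eqI)
    show "(cosh t *\<^sub>R ?P) $ Some a = (cons_vec 0 w + sinh t *\<^sub>R ?Q) $ Some a" for a
      using arg_cong[OF cosh_square_eq[of t], of "\<lambda>y. y * w $ a"]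
      by (simp add: fermi_def fermi'_def power2_eq_square algebra_simps)
  qed (simp add: fermi_def fermi'_def)
  then have "D1 F ?P (cosh t *\<^sub>R ?P) = D1 F ?P (cons_vec 0 w + sinh t *\<^sub>R ?Q)" by (simp only:)
  then have L: "cosh t *\<^sub>R D1 F ?P ?P = D1 F ?P (cons_vec 0 w) + sinh t *\<^sub>R D1 F ?P ?Q"
    by (simp only: linear_scale[OF linear_D1[OF F]] linear_add[OF linear_D1[OF F]])
  have alg: "c\<^sup>2 *\<^sub>R (A + B) + (n * (c * s)) *\<^sub>R Q + (c\<^sup>2 *\<^sub>R S + n *\<^sub>R (c *\<^sub>R X)) = c\<^sup>2 *\<^sub>R (A + B + (S + n *\<^sub>R B))"
    if "c *\<^sub>R B = X + s *\<^sub>R Q" for A B Q S X :: complex and c s n :: real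
  proof -
    have X: "X = c *\<^sub>R B - s *\<^sub>R Q" using that by simp
    show ?thesis unfolding X by (simp add: scaleR_conv_of_real algebra_simps power2_eq_square)
  qed
  show ?thesis
    unfolding CL alg[OF L] E by (simp add: scaleR_conv_of_real mult.left_commute)
qed

section \<open>Averages over small balls\<close>

lemma vector_derivative_bound:
  fixes k :: "real \<Rightarrow> 'a::real_normed_vector"
  assumes t: "0 \<le> t" and k: "\<And>s. 0 \<le> s \<Longrightarrow> s \<le> t \<Longrightarrow> (k has_vector_derivative k' s) (at s)"
    and b: "\<And>s. 0 \<le> s \<Longrightarrow> s \<le> t \<Longrightarrow> norm (k' s) \<le> B"
  shows "norm (k t - k 0) \<le> B * t"
proof -
  have "norm (k t - k 0) \<le> B * norm (t - 0)"
  proof (rule differentiable_bound[where S = "{0..t}" and f' = "\<lambda>s x. x *\<^sub>R k' s"])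
    show "(k has_derivative (\<lambda>x. x *\<^sub>R k' s)) (at s within {0..t})" if "s \<in> {0..t}" for s
      using has_vector_derivative_at_within[OF k[of s]] that by (simp add: has_vector_derivative_def)
    show "onorm (\<lambda>x. x *\<^sub>R k' s) \<le> B" if "s \<in> {0..t}" for s
    proof (rule onorm_le)
      fix x :: real
      have "norm (k' s) * \<bar>x\<bar> \<le> B * \<bar>x\<bar>" using b[of s] that by (intro mult_right_mono) auto
      then show "norm (x *\<^sub>R k' s) \<le> B * norm x" by (simp add: mult.commute)
    qed
  qed (use t in auto)
  then show ?thesis using t by simp
qed

lemma second_order_bound:
  fixes k :: "real \<Rightarrow> 'a::real_normed_vector"
  assumes t: "0 \<le> t" and k: "\<And>s. (k has_vector_derivative k' s) (at s)"
    and k': "\<And>s. (k' has_vector_derivative k'' s) (at s)"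
    and 0: "k 0 = 0" "k' 0 = 0"
    and b: "\<And>s. 0 \<le> s \<Longrightarrow> s \<le> t \<Longrightarrow> norm (k'' s) \<le> B"
  shows "norm (k t) \<le> B * t\<^sup>2"
proof -
  have B: "B \<ge> 0" using b[of 0] t order_trans[OF norm_ge_zero] by auto
  have "norm (k' s) \<le> B * t" if "0 \<le> s" "s \<le> t" for s
  proof -
    have "norm (k' s - k' 0) \<le> B * s" by (rule vector_derivative_bound[OF that(1) k']) (use b that in auto)
    also have "\<dots> \<le> B * t" using that B by (intro mult_left_mono) auto
    finally show ?thesis using 0 by simp
  qed
  then have "norm (k t - k 0) \<le> (B * t) * t" by (intro vector_derivative_bound[OF t k]) auto
  then show ?thesis using 0 by (simp add: power2_eq_square mult.assoc)
qed

lemma second_order_limit: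
  fixes k :: "real \<Rightarrow> 'a::real_normed_vector"
  assumes k: "\<And>s. (k has_vector_derivative k' s) (at s)"
    and k': "\<And>s. (k' has_vector_derivative k'' s) (at s)"
    and 0: "k 0 = 0" "k' 0 = 0" and c: "isCont k'' 0"
  shows "((\<lambda>e. (1 / e\<^sup>2) *\<^sub>R k e) \<longlongrightarrow> (1/2) *\<^sub>R k'' 0) (at_right 0)"
proof (rule tendstoI)
  fix \<eta> :: real assume \<eta>: "\<eta> > 0"
  obtain d where d: "d > 0" "\<And>s. dist s 0 < d \<Longrightarrow> dist (k'' s) (k'' 0) < \<eta> / 2"
    using c \<eta> unfolding continuous_at_eps_delta by (metis half_gt_zero)
  have "dist ((1 / e\<^sup>2) *\<^sub>R k e) ((1/2) *\<^sub>R k'' 0) < \<eta>" if e: "0 < e" "e < d" for e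
  proof -
    define m where "m s = k s - (s\<^sup>2 / 2) *\<^sub>R k'' 0" for s
    have "norm (m e) \<le> \<eta> / 2 * e\<^sup>2"
    proof (rule second_order_bound[where k' = "\<lambda>s. k' s - s *\<^sub>R k'' 0" and k'' = "\<lambda>s. k'' s - k'' 0"])
      show "(m has_vector_derivative k' s - s *\<^sub>R k'' 0) (at s)" for s
        unfolding m_def by (auto intro!: derivative_eq_intros k)
      show "((\<lambda>s. k' s - s *\<^sub>R k'' 0) has_vector_derivative k'' s - k'' 0) (at s)" for s
        by (auto intro!: derivative_eq_intros k')
      show "norm (k'' s - k'' 0) \<le> \<eta> / 2" if "0 \<le> s" "s \<le> e" for s
        using d(2)[of s] that e by (simp add: dist_norm)
    qed (use e 0 in \<open>auto simp: m_def\<close>)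
    then have "norm ((1 / e\<^sup>2) *\<^sub>R m e) \<le> \<eta> / 2" using e by (simp add: field_simps)
    moreover have "(1 / e\<^sup>2) *\<^sub>R m e = (1 / e\<^sup>2) *\<^sub>R k e - (1/2) *\<^sub>R k'' 0"
      using e by (simp add: m_def scaleR_diff_right)
    ultimately show ?thesis using \<eta> by (simp add: dist_norm)
  qed
  then show "\<forall>\<^sub>F e in at_right 0. dist ((1 / e\<^sup>2) *\<^sub>R k e) ((1/2) *\<^sub>R k'' 0) < \<eta>"
    using d(1) unfolding eventually_at_right_field by blast
qed

section \<open>Second differences along rays of the chart at a point\<close>

definition ray :: "real ^ 'd \<Rightarrow> real ^ 'd \<Rightarrow> real \<Rightarrow> real ^ 'd::finite" where
  "ray w z s = sqrt (1 + (s * norm z)\<^sup>2) *\<^sub>R w + s *\<^sub>R boost_space w z"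

definition ray' :: "real ^ 'd \<Rightarrow> real ^ 'd \<Rightarrow> real \<Rightarrow> real ^ 'd::finite" where
  "ray' w z s = (s * (norm z)\<^sup>2 / sqrt (1 + (s * norm z)\<^sup>2)) *\<^sub>R w + boost_space w z"

definition ray'' :: "real ^ 'd \<Rightarrow> real ^ 'd \<Rightarrow> real \<Rightarrow> real ^ 'd::finite" where
  "ray'' w z s = ((norm z)\<^sup>2 / sqrt (1 + (s * norm z)\<^sup>2) ^ 3) *\<^sub>R w"

lemma act_boost_ray: "act (boost w) (s *\<^sub>R z) = ray w z s"
  unfolding act_boost ray_def by (simp add: boost_space_scaleR power_mult_distrib)

lemma one_plus_square_pos: "(0::real) < 1 + x\<^sup>2"
  by (simp add: add_pos_nonneg)

lemma ray_derivs:
  "(ray w z has_vector_derivative ray' w z s) (at s)"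
  "(ray' w z has_vector_derivative ray'' w z s) (at s)"
proof -
  let ?c = "\<lambda>s. sqrt (1 + (s * norm z)\<^sup>2)"
  have c0: "?c s > 0" and c2: "(?c s)\<^sup>2 = 1 + (s * norm z)\<^sup>2" for s
    using one_plus_square_pos[of "s * norm z"] by simp_all
  have c: "(?c has_real_derivative s * (norm z)\<^sup>2 / ?c s) (at s)" for s
    using one_plus_square_pos[of "s * norm z"]
    by (auto intro!: derivative_eq_intros simp: field_simps power2_eq_square)
  have "((\<lambda>s. s * (norm z)\<^sup>2 / ?c s) has_real_derivative
      ((norm z)\<^sup>2 * ?c s - s * (norm z)\<^sup>2 * (s * (norm z)\<^sup>2 / ?c s)) / (?c s * ?c s)) (at s)"
    using c0[of s] by (intro DERIV_divide c) (auto intro!: derivative_eq_intros)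
  moreover have "((norm z)\<^sup>2 * ?c s - s * (norm z)\<^sup>2 * (s * (norm z)\<^sup>2 / ?c s)) / (?c s * ?c s)
      = (norm z)\<^sup>2 * ((?c s)\<^sup>2 - (s * norm z)\<^sup>2) / ?c s ^ 3"
    using c0[of s] by (simp add: field_simps eval_nat_numeral)
  moreover have "(?c s)\<^sup>2 - (s * norm z)\<^sup>2 = 1" unfolding c2 by simp
  ultimately have c': "((\<lambda>s. s * (norm z)\<^sup>2 / ?c s) has_real_derivative (norm z)\<^sup>2 / ?c s ^ 3) (at s)" by simp
  have id: "((\<lambda>s. s) has_real_derivative 1) (at s)" by simp
  show "(ray w z has_vector_derivative ray' w z s) (at s)"
    using has_vector_derivative_add[OF has_vector_derivative_scaleR[OF c has_vector_derivative_const, of w]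
        has_vector_derivative_scaleR[OF id has_vector_derivative_const, of "boost_space w z"]]
    by (simp add: ray_def[abs_def] ray'_def)
  show "(ray' w z has_vector_derivative ray'' w z s) (at s)"
    using has_vector_derivative_add[OF has_vector_derivative_scaleR[OF c' has_vector_derivative_const, of w]
        has_vector_derivative_const[of "boost_space w z"]]
    by (simp add: ray'_def[abs_def] ray''_def)
qed

lemma continuous_on_boost_space [continuous_intros]:
  assumes "continuous_on S w" "continuous_on S u"
  shows "continuous_on S (\<lambda>x. boost_space (w x) (u x))"
proof -
  have "1 + sqrt (1 + (norm v)\<^sup>2) \<noteq> 0" for v :: "real ^ 'b"
    using real_sqrt_ge_zero[of "1 + (norm v)\<^sup>2"] by (simp add: add_nonneg_eq_0_iff)
  then show ?thesis unfolding boost_space_def using assms by (intro continuous_intros) auto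
qed

lemma continuous_on_ray:
  assumes "continuous_on S w" "continuous_on S z" "continuous_on S s"
  shows "continuous_on S (\<lambda>x. ray (w x) (z x) (s x))" "continuous_on S (\<lambda>x. ray' (w x) (z x) (s x))"
    "continuous_on S (\<lambda>x. ray'' (w x) (z x) (s x))"
proof -
  have "sqrt (1 + a\<^sup>2) \<noteq> 0" for a :: real using one_plus_square_pos[of a] by simp
  then show "continuous_on S (\<lambda>x. ray (w x) (z x) (s x))" "continuous_on S (\<lambda>x. ray' (w x) (z x) (s x))"
    "continuous_on S (\<lambda>x. ray'' (w x) (z x) (s x))"
    unfolding ray_def ray'_def ray''_def using assms by (auto intro!: continuous_intros)
qed

definition ray_hessian :: "(real ^ 'd::finite \<Rightarrow> complex) \<Rightarrow> real ^ 'd \<Rightarrow> real ^ 'd \<Rightarrow> real \<Rightarrow> complex" where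
  "ray_hessian f w z s = D2 f (ray w z s) (ray' w z s) (ray' w z s) + D1 f (ray w z s) (ray'' w z s)"

definition second_difference :: "(real ^ 'd::finite \<Rightarrow> complex) \<Rightarrow> real ^ 'd \<Rightarrow> real ^ 'd \<Rightarrow> real \<Rightarrow> complex" where
  "second_difference f w z s = f (ray w z s) + f (ray w z (- s)) - 2 * f w"

lemma ray_0: "ray w z 0 = w"
  by (simp add: ray_def)

context
  fixes f :: "real ^ 'd::finite \<Rightarrow> complex"
  assumes f: "C2 f"
begin

lemma continuous_on_ray_hessian:
  assumes "continuous_on S w" "continuous_on S z" "continuous_on S s"
  shows "continuous_on S (\<lambda>x. ray_hessian f (w x) (z x) (s x))"
  unfolding ray_hessian_def
  by (intro continuous_on_add D2_continuous_compose[OF f] D1_continuous_compose[OF f] continuous_on_ray assms)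

lemma continuous_on_second_difference:
  assumes "continuous_on S w" "continuous_on S z" "continuous_on S s"
  shows "continuous_on S (\<lambda>x. second_difference f (w x) (z x) (s x))"
  unfolding second_difference_def
  by (intro continuous_on_add continuous_on_diff continuous_on_mult continuous_on_const
      C2_continuous_compose[OF f] continuous_on_ray continuous_on_minus assms)

lemma second_difference_derivs:
  "(second_difference f w z has_vector_derivative
     D1 f (ray w z s) (ray' w z s) - D1 f (ray w z (- s)) (ray' w z (- s))) (at s)"
  "((\<lambda>s. D1 f (ray w z s) (ray' w z s) - D1 f (ray w z (- s)) (ray' w z (- s))) has_vector_derivative
     ray_hessian f w z s + ray_hessian f w z (- s)) (at s)"
proof -
  have 1: "((\<lambda>s. f (ray w z s)) has_vector_derivative D1 f (ray w z s) (ray' w z s)) (at s)" for s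
    by (rule D1_chain[OF f ray_derivs(1)])
  have 2: "((\<lambda>s. D1 f (ray w z s) (ray' w z s)) has_vector_derivative ray_hessian f w z s) (at s)" for s
    unfolding ray_hessian_def by (rule D2_chain[OF f ray_derivs(1) ray_derivs(2)])
  have m: "(uminus has_vector_derivative - 1) (at s)" for s :: real
    by (auto intro!: derivative_eq_intros simp: has_real_derivative_iff_has_vector_derivative[symmetric])
  have d1': "((\<lambda>s. f (ray w z (- s))) has_vector_derivative - D1 f (ray w z (- s)) (ray' w z (- s))) (at s)"
    using vector_diff_chain_at[OF m, OF 1] by (simp add: o_def)
  have d2': "((\<lambda>s. D1 f (ray w z (- s)) (ray' w z (- s))) has_vector_derivative - ray_hessian f w z (- s)) (at s)"
    using vector_diff_chain_at[OF m, OF 2] by (simp add: o_def)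
  show "(second_difference f w z has_vector_derivative
     D1 f (ray w z s) (ray' w z s) - D1 f (ray w z (- s)) (ray' w z (- s))) (at s)"
    using has_vector_derivative_diff[OF has_vector_derivative_add[OF 1 d1'] has_vector_derivative_const[of "2 * f w"]]
    by (simp add: second_difference_def[abs_def])
  show "((\<lambda>s. D1 f (ray w z s) (ray' w z s) - D1 f (ray w z (- s)) (ray' w z (- s))) has_vector_derivative
     ray_hessian f w z s + ray_hessian f w z (- s)) (at s)"
    using has_vector_derivative_diff[OF 2 d2'] by simp
qed

text \<open>Compactness makes the constant uniform in \<open>w\<close>, \<open>z\<close> and
  \<open>s\<close>. This is the domination for two passages to the limit, under the integral over
  \<open>z\<close> and later under the integral over the fundamental domain.\<close>

lemma second_difference_bound:
  "\<exists>B\<ge>0. \<forall>w\<in>cball 0 \<rho>. \<forall>z\<in>cball 0 1. \<forall>s\<in>{0..1}. norm (second_difference f w z s) \<le> B * s\<^sup>2"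
proof -
  let ?K = "cball 0 \<rho> \<times> (cball 0 1 \<times> {- 1..1}) :: ((real ^ 'd) \<times> (real ^ 'd) \<times> real) set"
  have "compact ?K" by (intro compact_Times) auto
  moreover have "continuous_on ?K (\<lambda>p. ray_hessian f (fst p) (fst (snd p)) (snd (snd p)))"
    by (intro continuous_on_ray_hessian continuous_intros)
  ultimately have "bounded ((\<lambda>p. ray_hessian f (fst p) (fst (snd p)) (snd (snd p))) ` ?K)"
    by (intro compact_imp_bounded compact_continuous_image)
  then obtain B where B: "B > 0" "\<And>p. p \<in> ?K \<Longrightarrow> norm (ray_hessian f (fst p) (fst (snd p)) (snd (snd p))) \<le> B"
    unfolding bounded_pos by auto
  have "norm (second_difference f w z s) \<le> (2 * B) * s\<^sup>2" if w: "w \<in> cball 0 \<rho>" "z \<in> cball 0 1" "s \<in> {0..1}" for w z s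
  proof (rule second_order_bound[OF _ second_difference_derivs(1) second_difference_derivs(2)])
    show "norm (ray_hessian f w z r + ray_hessian f w z (- r)) \<le> 2 * B" if "0 \<le> r" "r \<le> s" for r
      using B(2)[of "(w, z, r)"] B(2)[of "(w, z, - r)"] that w norm_triangle_ineq[of "ray_hessian f w z r" "ray_hessian f w z (- r)"]
      by auto
  qed (use w in \<open>auto simp: second_difference_def ray_0\<close>)
  then show ?thesis using B(1) by (intro exI[of _ "2 * B"]) auto
qed

lemma second_difference_limit:
  "((\<lambda>s. (1 / s\<^sup>2) *\<^sub>R second_difference f w z s) \<longlongrightarrow> D2 f w (boost_space w z) (boost_space w z) + (norm z)\<^sup>2 *\<^sub>R D1 f w w) (at_right 0)"
proof -
  have c: "continuous_on UNIV (\<lambda>s. ray_hessian f w z s + ray_hessian f w z (- s))"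
    by (intro continuous_on_add continuous_on_ray_hessian continuous_intros)
  have "((\<lambda>s. (1 / s\<^sup>2) *\<^sub>R second_difference f w z s) \<longlongrightarrow> (1/2) *\<^sub>R (ray_hessian f w z 0 + ray_hessian f w z (- 0))) (at_right 0)"
    by (rule second_order_limit[OF second_difference_derivs(1) second_difference_derivs(2)])
      (use c in \<open>auto simp: second_difference_def ray_0 continuous_on_eq_continuous_at\<close>)
  moreover have "ray_hessian f w z 0 = D2 f w (boost_space w z) (boost_space w z) + (norm z)\<^sup>2 *\<^sub>R D1 f w w"
    unfolding ray_hessian_def by (simp add: ray_def ray'_def ray''_def linear_scale[OF linear_D1[OF f]])
  ultimately show ?thesis by (simp add: scaleR_2[symmetric])
qed

end

lemma integral_lborel_scale:
  fixes f :: "real ^ 'd::finite \<Rightarrow> complex"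
  assumes f [measurable]: "f \<in> borel_measurable borel" and c: "c \<noteq> 0"
  shows "(LINT x|lborel. f x) = \<bar>c\<bar> ^ CARD('d) *\<^sub>R (LINT x|lborel. f (c *\<^sub>R x))"
proof -
  have "(LINT x|lborel. f x) = (LINT x|density (distr lborel borel (\<lambda>x. 0 + c *\<^sub>R x)) (\<lambda>_. ennreal (\<bar>c\<bar> ^ CARD('d))). f x)"
    using lborel_affine[OF c, of "0 :: real ^ 'd"] by simp
  also have "\<dots> = (LINT x|distr lborel borel (\<lambda>x. 0 + c *\<^sub>R x). \<bar>c\<bar> ^ CARD('d) *\<^sub>R f x)"
    by (rule integral_density) auto
  also have "\<dots> = (LINT x|lborel. \<bar>c\<bar> ^ CARD('d) *\<^sub>R f (0 + c *\<^sub>R x))"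
    by (rule integral_distr) auto
  finally show ?thesis by simp
qed

lemma integral_hyperbolic:
  fixes f :: "real ^ 'd::finite \<Rightarrow> complex"
  assumes [measurable]: "f \<in> borel_measurable borel"
  shows "(LINT v|hyperbolic_measure. f v) = (LINT v|lborel. (1 / sqrt (1 + (norm v)\<^sup>2)) *\<^sub>R f v)"
  unfolding hyperbolic_measure_def by (rule integral_density) auto

lemma integral_hyperbolic_act:
  fixes f :: "real ^ 'd::finite \<Rightarrow> complex"
  assumes "f \<in> borel_measurable borel" "g \<in> O1"
  shows "(LINT v|hyperbolic_measure. f (act g v)) = (LINT v|hyperbolic_measure. f v)"
proof -
  have "(LINT v|hyperbolic_measure. f v) = (LINT v|distr hyperbolic_measure borel (act g). f v)"
    using distr_hyperbolic_act[OF assms(2)] by simp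
  also have "\<dots> = (LINT v|hyperbolic_measure. f (act g v))"
    using assms by (intro integral_distr) auto
  finally show ?thesis ..
qed

section \<open>Second moments of the unit ball\<close>

definition ball_moment :: "'d::finite \<Rightarrow> 'd \<Rightarrow> real" where
  "ball_moment i j = (LINT z|lborel. indicator (ball 0 1) (z :: real ^ 'd) * (z $ i * z $ j))"

lemma integrable_ball_mult:
  fixes h :: "real ^ 'd::finite \<Rightarrow> 'b::{banach, second_countable_topology}"
  assumes h: "continuous_on UNIV h"
  shows "integrable lborel (\<lambda>z. indicator (ball 0 1) z *\<^sub>R h z)"
proof -
  have "bounded (h ` cball 0 1)"
    using h by (intro compact_imp_bounded compact_continuous_image) (auto intro: continuous_on_subset)
  then have "\<exists>B. \<forall>z\<in>cball 0 1. norm (h z) \<le> B" unfolding bounded_iff by auto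
  then obtain B where B: "\<And>z. z \<in> cball 0 1 \<Longrightarrow> norm (h z) \<le> B" by blast
  have [measurable]: "h \<in> borel_measurable borel" using h by (rule borel_measurable_continuous_onI)
  show ?thesis
  proof (rule integrableI_bounded_set_indicator[where B = B])
    show "emeasure lborel (ball 0 1 :: (real ^ 'd) set) < \<infinity>" using emeasure_bounded_finite[of "ball 0 1"] by auto
  qed (use B in auto)
qed

text \<open>The reflection in coordinate \<open>i\<close> preserves the ball and Lebesgue measure
  and reverses the sign of the integrand.\<close>

lemma ball_moment_offdiag:
  assumes "i \<noteq> j"
  shows "ball_moment i j = 0"
proof -
  let ?A = "(\<chi> k l. if k = l then (if k = i then - 1 else 1) else 0) :: real ^ 'a ^ 'a"
  have A: "(?A *v z) $ k = (if k = i then - z $ k else z $ k)" for z k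
  proof -
    have "(?A *v z) $ k = (\<Sum>l\<in>UNIV. if l = k then (if k = i then - z $ k else z $ k) else 0)"
      unfolding matrix_vector_mult_def vec_lambda_beta by (rule sum.cong[OF refl]) auto
    then show ?thesis by simp
  qed
  have "det ?A = (\<Prod>k\<in>UNIV. ?A $ k $ k)" by (rule det_diagonal) auto
  then have d: "\<bar>det ?A\<bar> = 1" by (simp add: abs_prod)
  have n: "norm (?A *v z) = norm z" for z
    unfolding norm_eq_sqrt_inner inner_vec_def A by (auto intro!: arg_cong[where f = sqrt] sum.cong)
  let ?h = "\<lambda>z :: real ^ 'a. indicator (ball 0 1) z * (z $ i * z $ j) :: real"
  have "(\<lambda>z :: real ^ 'a. z $ i * z $ j) \<in> borel_measurable borel"
    by (intro borel_measurable_continuous_onI continuous_intros)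
  then have hm: "?h \<in> borel_measurable borel"
    by (rule borel_measurable_times[rotated]) (rule borel_measurable_indicator, simp)
  have mA: "(\<lambda>x. ?A *v x) \<in> measurable lborel borel"
    using borel_measurable_continuous_onI[OF matrix_vector_mult_linear_continuous_on[of UNIV ?A]] by simp
  have "(LINT z|lborel. ?h z) = (LINT z|distr lborel borel (\<lambda>x. ?A *v x). ?h z)"
    using distr_lborel_unimodular[OF d] by simp
  also have "\<dots> = (LINT z|lborel. ?h (?A *v z))"
    by (rule integral_distr[OF mA hm])
  also have "\<dots> = (LINT z|lborel. - ?h z)"
    using assms by (intro Bochner_Integration.integral_cong refl) (auto simp: A n indicator_def)
  finally show ?thesis unfolding ball_moment_def by simp
qed

lemma ball_moment_diag:
  fixes i j :: "'d::finite"
  shows "ball_moment i i = ball_moment j j"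
proof -
  let ?p = "Transposition.transpose i j"
  have p: "?p permutes (UNIV :: 'd set)" by (rule permutes_swap_id) auto
  let ?h = "\<lambda>i (z :: real ^ 'd). indicator (ball 0 1) z * (z $ i * z $ i) :: real"
  have "(\<lambda>z :: real ^ 'd. z $ i * z $ i) \<in> borel_measurable borel" for i
    by (intro borel_measurable_continuous_onI continuous_intros)
  then have hm: "?h i \<in> borel_measurable borel" for i
    by (rule borel_measurable_times[rotated]) (rule borel_measurable_indicator, simp)
  have n: "norm (\<chi> k. z $ ?p k) = norm z" for z :: "real ^ 'd"
    unfolding norm_eq_sqrt_inner inner_vec_def
    using sum.permute[OF p, of "\<lambda>k. z $ k \<bullet> z $ k"] by (simp add: o_def)
  have e: "?h i (\<chi> k. z $ ?p k) = ?h j z" for z by (simp add: n indicator_def)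
  have "(\<integral>\<^sup>+z. ennreal (?h i (\<chi> k. z $ ?p k)) \<partial>lborel) = (\<integral>\<^sup>+z. ennreal (?h i z) \<partial>lborel)"
    by (rule nn_integral_lborel_permute[OF _ p]) (use hm[of i] in measurable)
  then have "(\<integral>\<^sup>+z. ennreal (?h j z) \<partial>lborel) = (\<integral>\<^sup>+z. ennreal (?h i z) \<partial>lborel)" unfolding e .
  then show ?thesis
    unfolding ball_moment_def using hm by (subst (1 2) integral_eq_nn_integral) auto
qed

lemma ball_moment_pos: "ball_moment i i > 0"
proof -
  let ?h = "\<lambda>z :: real ^ 'a. indicator (ball 0 1) z * (z $ i * z $ i) :: real"
  have "continuous_on UNIV (\<lambda>z :: real ^ 'a. z $ i * z $ i)" by (intro continuous_intros)
  from integrable_ball_mult[OF this] have int: "integrable lborel ?h" by simp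
  have "ball_moment i i \<noteq> 0"
  proof
    assume "ball_moment i i = 0"
    then have "AE z in lborel. ?h z = 0"
      unfolding ball_moment_def using integral_nonneg_eq_0_iff_AE[OF int] by auto
    let ?S = "ball 0 1 \<inter> {z :: real ^ 'a. z $ i \<noteq> 0}"
    have S: "open ?S" by (intro open_Int open_ball open_Collect_neq continuous_intros)
    have "AE z in lborel. z \<notin> ?S" using \<open>AE z in lborel. ?h z = 0\<close> by (rule AE_mp) (auto simp: indicator_def)
    moreover have "?S \<in> sets lborel" using S by simp
    ultimately have "?S \<in> null_sets lborel" using AE_iff_null_sets by blast
    then have "negligible ?S" by (simp add: negligible_iff_null_sets null_sets_completionI)
    moreover have "(1/2) *\<^sub>R axis i 1 \<in> ?S" by simp
    ultimately show False using open_not_negligible[OF S] by blast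
  qed
  moreover have "ball_moment i i \<ge> 0" unfolding ball_moment_def by (intro integral_nonneg_AE) auto
  ultimately show ?thesis by linarith
qed

text \<open>The choice of index is immaterial: by \<open>ball_moment_diag\<close> all diagonal
  moments agree.\<close>

definition second_moment :: "'d::finite itself \<Rightarrow> real" where
  "second_moment _ = ball_moment (SOME i :: 'd. True) (SOME i. True)"

lemma ball_moment_eq: "ball_moment i j = (if i = j then second_moment TYPE('d) else 0)" for i j :: "'d::finite"
  using ball_moment_offdiag[of i j] ball_moment_diag[of i] by (auto simp: second_moment_def)

lemma second_moment_pos: "second_moment TYPE('d::finite) > 0"
  unfolding second_moment_def by (rule ball_moment_pos)

text \<open>The moment matrix of the ball is a multiple of the identity, so integrating a quadratic
  form in \<open>z\<close> over the ball leaves its trace in the frame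
  \<open>boost_space w (axis i 1)\<close>.\<close>

lemma integral_ball_hessian:
  fixes f :: "real ^ 'd::finite \<Rightarrow> complex"
  assumes f: "C2 f"
  shows "(LINT z|lborel. indicator (ball 0 1) z *\<^sub>R (D2 f w (boost_space w z) (boost_space w z) + (norm z)\<^sup>2 *\<^sub>R D1 f w w))
    = second_moment TYPE('d) *\<^sub>R chart_laplacian f w"
proof -
  let ?e = "\<lambda>i. boost_space w (axis i 1)"
  let ?i = "\<lambda>z :: real ^ 'd. indicator (ball 0 1) z :: real"
  have bs: "boost_space w z = (\<Sum>i\<in>UNIV. (z $ i) *\<^sub>R ?e i)" for z
  proof -
    have lin: "linear (boost_space w)"
      by (rule linearI) (auto simp: boost_space_def inner_add_right add_divide_distrib algebra_simps)
    have "z = (\<Sum>i\<in>UNIV. (z $ i) *\<^sub>R axis i 1)"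
      using basis_expansion[of z] by (simp add: scalar_mult_eq_scaleR)
    then have "boost_space w z = boost_space w (\<Sum>i\<in>UNIV. (z $ i) *\<^sub>R axis i 1)" by simp
    then show ?thesis by (simp add: linear_sum[OF lin] linear_scale[OF lin])
  qed
  have n2: "(norm z)\<^sup>2 = (\<Sum>i\<in>UNIV. z $ i * z $ i)" for z :: "real ^ 'd"
    by (simp add: power2_norm_eq_inner inner_vec_def)
  have quad: "?i z *\<^sub>R (D2 f w (boost_space w z) (boost_space w z) + (norm z)\<^sup>2 *\<^sub>R D1 f w w)
     = (\<Sum>i\<in>UNIV. \<Sum>j\<in>UNIV. (?i z * (z $ i * z $ j)) *\<^sub>R D2 f w (?e i) (?e j))
       + (\<Sum>i\<in>UNIV. (?i z * (z $ i * z $ i)) *\<^sub>R D1 f w w)" for z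
  proof -
    have "D2 f w (boost_space w z) (boost_space w z) = D2 f w (\<Sum>i\<in>UNIV. (z $ i) *\<^sub>R ?e i) (\<Sum>i\<in>UNIV. (z $ i) *\<^sub>R ?e i)"
      by (simp only: bs[of z, symmetric])
    also have "\<dots> = (\<Sum>i\<in>UNIV. (z $ i) *\<^sub>R D2 f w (?e i) (\<Sum>j\<in>UNIV. (z $ j) *\<^sub>R ?e j))"
      by (simp only: linear_sum[OF D2_linear_left[OF f]] linear_scale[OF D2_linear_left[OF f]])
    also have "\<dots> = (\<Sum>i\<in>UNIV. (z $ i) *\<^sub>R (\<Sum>j\<in>UNIV. (z $ j) *\<^sub>R D2 f w (?e i) (?e j)))"
      by (simp only: linear_sum[OF D2_linear_right[OF f]] linear_scale[OF D2_linear_right[OF f]])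
    finally show ?thesis unfolding n2
      by (simp only: scaleR_add_right scaleR_sum_right scaleR_sum_left scaleR_scaleR mult.assoc)
  qed
  have int: "integrable lborel (\<lambda>z. ?i z * (z $ i * z $ j))" for i j
  proof -
    have "continuous_on UNIV (\<lambda>z :: real ^ 'd. z $ i * z $ j)" by (intro continuous_intros)
    from integrable_ball_mult[OF this] show ?thesis by simp
  qed
  have "(LINT z|lborel. ?i z *\<^sub>R (D2 f w (boost_space w z) (boost_space w z) + (norm z)\<^sup>2 *\<^sub>R D1 f w w))
     = (\<Sum>i\<in>UNIV. \<Sum>j\<in>UNIV. ball_moment i j *\<^sub>R D2 f w (?e i) (?e j)) + (\<Sum>i\<in>(UNIV :: 'd set). ball_moment i i *\<^sub>R D1 f w w)"
    unfolding quad ball_moment_def using int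
    by (subst Bochner_Integration.integral_add) (auto simp: Bochner_Integration.integral_sum)
  also have "\<dots> = (\<Sum>i\<in>UNIV. second_moment TYPE('d) *\<^sub>R D2 f w (?e i) (?e i)) + (\<Sum>i\<in>(UNIV :: 'd set). second_moment TYPE('d) *\<^sub>R D1 f w w)"
    by (simp add: ball_moment_eq if_distrib[of "\<lambda>x. x *\<^sub>R _"] cong: if_cong)
  also have "\<dots> = second_moment TYPE('d) *\<^sub>R chart_laplacian f w"
    by (simp only: chart_laplacian_def scaleR_sum_right scaleR_add_right sum.distrib)
  finally show ?thesis .
qed

text \<open>The form that passes to the limit: \<open>z\<close> and \<open>- z\<close> are paired
  into a second difference, which stays bounded after division by \<open>e^2\<close>. The weight is
  the hyperbolic density at \<open>e * z\<close>.\<close>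

definition ball_average :: "(real ^ 'd::finite \<Rightarrow> complex) \<Rightarrow> real \<Rightarrow> real ^ 'd \<Rightarrow> complex" where
  "ball_average f e w = (LINT z|lborel. indicator (ball 0 1) z *\<^sub>R
     ((1 / sqrt (1 + (e * norm z)\<^sup>2)) *\<^sub>R ((1 / e\<^sup>2) *\<^sub>R second_difference f w z e)))"

lemma ball_average_bound:
  fixes f :: "real ^ 'd::finite \<Rightarrow> complex"
  assumes f: "C2 f"
  shows "\<exists>B\<ge>0. \<forall>w\<in>cball 0 \<rho>. \<forall>e. 0 < e \<longrightarrow> e \<le> 1 \<longrightarrow> norm (ball_average f e w) \<le> B"
    and "(\<lambda>k. ball_average f (1 / real (Suc k)) w) \<longlonglongrightarrow> second_moment TYPE('d) *\<^sub>R chart_laplacian f w"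
proof -
  let ?I = "\<lambda>w e z. indicator (ball 0 1) z *\<^sub>R ((1 / sqrt (1 + (e * norm z)\<^sup>2)) *\<^sub>R ((1 / e\<^sup>2) *\<^sub>R second_difference f w z e))"
  let ?V = "measure lborel (ball 0 1 :: (real ^ 'd) set)"
  have fin: "integrable lborel (indicator (ball 0 1) :: real ^ 'd \<Rightarrow> real)"
    using emeasure_bounded_finite[of "ball 0 1 :: (real ^ 'd) set"] by (intro integrable_real_indicator) auto
  have pt_bound: "\<exists>B\<ge>0. \<forall>w\<in>cball 0 \<rho>. \<forall>e z. 0 < e \<longrightarrow> e \<le> 1 \<longrightarrow> norm (?I w e z) \<le> B * indicator (ball 0 1) z" for \<rho>
  proof -
    obtain B where B: "B \<ge> 0" "\<And>w z s. w \<in> cball 0 \<rho> \<Longrightarrow> z \<in> cball 0 1 \<Longrightarrow> s \<in> {0..1} \<Longrightarrow> norm (second_difference f w z s) \<le> B * s\<^sup>2"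
      using second_difference_bound[OF f, of \<rho>] by metis
    have "norm (?I w e z) \<le> B * indicator (ball 0 1) z" if w: "w \<in> cball 0 \<rho>" "0 < e" "e \<le> 1" for w e z
    proof (cases "z \<in> ball 0 1")
      case True
      have "norm ((1 / e\<^sup>2) *\<^sub>R second_difference f w z e) \<le> B"
        using B(2)[of w z e] w True by (auto simp: field_simps)
      moreover have "\<bar>1 / sqrt (1 + (e * norm z)\<^sup>2)\<bar> \<le> 1"
        using frac_le[of 1 1 1 "sqrt (1 + (e * norm z)\<^sup>2)"] by simp
      ultimately have "\<bar>1 / sqrt (1 + (e * norm z)\<^sup>2)\<bar> * norm ((1 / e\<^sup>2) *\<^sub>R second_difference f w z e) \<le> 1 * B"
        by (intro mult_mono) auto
      then show ?thesis using True by simp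
    qed simp
    then show ?thesis using B(1) by blast
  qed
  have cont: "continuous_on UNIV (\<lambda>z. (1 / sqrt (1 + (e * norm z)\<^sup>2)) *\<^sub>R ((1 / e\<^sup>2) *\<^sub>R second_difference f w z e))" for w e
  proof -
    have "sqrt (1 + a\<^sup>2) \<noteq> 0" for a :: real using one_plus_square_pos[of a] by simp
    then show ?thesis by (intro continuous_intros continuous_on_second_difference[OF f]) auto
  qed
  have meas: "?I w e \<in> borel_measurable lborel" for w e
    using borel_measurable_integrable[OF integrable_ball_mult[OF cont[of e w]]] .
  show "\<exists>B\<ge>0. \<forall>w\<in>cball 0 \<rho>. \<forall>e. 0 < e \<longrightarrow> e \<le> 1 \<longrightarrow> norm (ball_average f e w) \<le> B"
  proof -
    obtain B where B: "B \<ge> 0" "\<And>w e z. w \<in> cball 0 \<rho> \<Longrightarrow> 0 < e \<Longrightarrow> e \<le> 1 \<Longrightarrow> norm (?I w e z) \<le> B * indicator (ball 0 1) z"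
      using pt_bound[of \<rho>] by metis
    have "norm (ball_average f e w) \<le> B * ?V" if "w \<in> cball 0 \<rho>" "0 < e" "e \<le> 1" for e w
    proof -
      have "norm (ball_average f e w) \<le> (LINT z|lborel. B * indicator (ball 0 1) (z :: real ^ 'd))"
      proof -
        have i1: "integrable lborel (?I w e)" by (rule integrable_ball_mult[OF cont])
        have i2: "integrable lborel (\<lambda>z :: real ^ 'd. B * indicator (ball 0 1) z)" using fin by simp
        show ?thesis unfolding ball_average_def
          by (rule Bochner_Integration.integral_norm_bound_integral[OF i1 i2 B(2)[OF that]])
      qed
      then show ?thesis by simp
    qed
    then show ?thesis using B(1) by (intro exI[of _ "B * ?V"]) auto
  qed
  obtain B where B: "B \<ge> 0" "\<And>e z. 0 < e \<Longrightarrow> e \<le> 1 \<Longrightarrow> norm (?I w e z) \<le> B * indicator (ball 0 1) z"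
    using pt_bound[of "norm w"] by (metis dist_0_norm mem_cball order_refl)
  \<comment> \<open>Dominated convergence works along sequences, so the radius runs through
    \<open>1 / Suc k\<close>, which also keeps it at most 1.\<close>
  have lim0: "filterlim (\<lambda>k. 1 / real (Suc k)) (at_right 0) sequentially"
    unfolding filterlim_at using LIMSEQ_inverse_real_of_nat by (auto simp: inverse_eq_divide intro!: always_eventually)
  have "(\<lambda>k. LINT z|lborel. ?I w (1 / real (Suc k)) z) \<longlonglongrightarrow>
    (LINT z|lborel. indicator (ball 0 1) z *\<^sub>R (D2 f w (boost_space w z) (boost_space w z) + (norm z)\<^sup>2 *\<^sub>R D1 f w w))"
  proof (rule integral_dominated_convergence[where w = "\<lambda>z. B * indicator (ball 0 1) z"])
    have "continuous_on UNIV (\<lambda>z. D2 f w (boost_space w z) (boost_space w z) + (norm z)\<^sup>2 *\<^sub>R D1 f w w)"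
      by (intro continuous_on_add D2_continuous_compose[OF f] continuous_intros)
    from borel_measurable_integrable[OF integrable_ball_mult[OF this]]
    show "(\<lambda>z. indicator (ball 0 1) z *\<^sub>R (D2 f w (boost_space w z) (boost_space w z) + (norm z)\<^sup>2 *\<^sub>R D1 f w w)) \<in> borel_measurable lborel" .
    show "AE z in lborel. (\<lambda>k. ?I w (1 / real (Suc k)) z) \<longlonglongrightarrow>
      indicator (ball 0 1) z *\<^sub>R (D2 f w (boost_space w z) (boost_space w z) + (norm z)\<^sup>2 *\<^sub>R D1 f w w)"
    proof (rule AE_I2)
      fix z :: "real ^ 'd"
      have a: "((\<lambda>e. 1 / sqrt (1 + (e * norm z)\<^sup>2)) \<longlongrightarrow> 1 / sqrt (1 + (0 * norm z)\<^sup>2)) (at_right 0)"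
        by (intro tendsto_intros) auto
      show "(\<lambda>k. ?I w (1 / real (Suc k)) z) \<longlonglongrightarrow>
        indicator (ball 0 1) z *\<^sub>R (D2 f w (boost_space w z) (boost_space w z) + (norm z)\<^sup>2 *\<^sub>R D1 f w w)"
        using tendsto_scaleR[OF tendsto_const[of "indicator (ball 0 1) z"] tendsto_scaleR[OF filterlim_compose[OF a lim0]
            filterlim_compose[OF second_difference_limit[OF f, of w z] lim0]]] by simp
    qed
    show "(\<lambda>z. ?I w (1 / real (Suc k)) z) \<in> borel_measurable lborel" for k by (rule meas)
    show "AE z in lborel. norm (?I w (1 / real (Suc k)) z) \<le> B * indicator (ball 0 1) z" for k
      by (intro AE_I2 B(2)) auto
  qed (use fin in auto)
  then show "(\<lambda>k. ball_average f (1 / real (Suc k)) w) \<longlonglongrightarrow> second_moment TYPE('d) *\<^sub>R chart_laplacian f w"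
    unfolding ball_average_def integral_ball_hessian[OF f] .
qed

lemma ball_average_measurable:
  fixes f :: "real ^ 'd::finite \<Rightarrow> complex"
  assumes f: "C2 f"
  shows "ball_average f e \<in> borel_measurable borel"
proof -
  have "sqrt (1 + a\<^sup>2) \<noteq> 0" for a :: real using one_plus_square_pos[of a] by simp
  then have "continuous_on UNIV (\<lambda>p :: (real ^ 'd) \<times> (real ^ 'd).
     (1 / sqrt (1 + (e * norm (snd p))\<^sup>2)) *\<^sub>R ((1 / e\<^sup>2) *\<^sub>R second_difference f (fst p) (snd p) e))"
    by (intro continuous_intros continuous_on_second_difference[OF f]) auto
  then have m: "(\<lambda>p :: (real ^ 'd) \<times> (real ^ 'd). (1 / sqrt (1 + (e * norm (snd p))\<^sup>2)) *\<^sub>R ((1 / e\<^sup>2) *\<^sub>R second_difference f (fst p) (snd p) e))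
     \<in> borel_measurable borel" by (rule borel_measurable_continuous_onI)
  have sets: "sets (borel \<Otimes>\<^sub>M lborel) = sets (borel :: ((real ^ 'd) \<times> (real ^ 'd)) measure)"
    unfolding borel_prod[symmetric] by (rule sets_pair_measure_cong) auto
  have m': "(\<lambda>p :: (real ^ 'd) \<times> (real ^ 'd). (1 / sqrt (1 + (e * norm (snd p))\<^sup>2)) *\<^sub>R ((1 / e\<^sup>2) *\<^sub>R second_difference f (fst p) (snd p) e))
     \<in> borel_measurable (borel \<Otimes>\<^sub>M lborel)"
    using m by (subst measurable_cong_sets[OF sets refl])
  have "(\<lambda>p :: (real ^ 'd) \<times> (real ^ 'd). indicator (ball 0 1) (snd p) :: real) \<in> borel_measurable (borel \<Otimes>\<^sub>M lborel)"
    by (rule measurable_compose[OF measurable_snd borel_measurable_indicator]) simp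
  from borel_measurable_scaleR[OF this m']
  have "(\<lambda>w. LINT z|lborel. indicator (ball 0 1) z *\<^sub>R
      ((1 / sqrt (1 + (e * norm z)\<^sup>2)) *\<^sub>R ((1 / e\<^sup>2) *\<^sub>R second_difference f w z e))) \<in> borel_measurable borel"
    by (intro lborel.borel_measurable_lebesgue_integral) (simp add: case_prod_beta)
  then show ?thesis by (simp only: ball_average_def[abs_def])
qed

text \<open>\<open>mdot (pt w) (pt x)\<close> is the hyperbolic cosine of the distance, so the
  domain is the hyperbolic ball of radius \<open>arsinh e\<close> around \<open>w\<close>. In this
  form the kernel is visibly symmetric and invariant under the group.\<close>

definition ball_integral :: "(real ^ 'd::finite \<Rightarrow> complex) \<Rightarrow> real \<Rightarrow> real ^ 'd \<Rightarrow> complex" where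
  "ball_integral f e w = (LINT x|hyperbolic_measure. indicator {x. mdot (pt w) (pt x) < sqrt (1 + e\<^sup>2)} x *\<^sub>R f x)"

lemma mdot_pt_continuous: "continuous_on S (\<lambda>p. mdot (pt (fst p)) (pt (snd p)))"
  unfolding mdot_def space_part_pt pt_nth by (intro continuous_intros)

text \<open>Moving \<open>w\<close> to the origin turns the hyperbolic ball into the Euclidean ball
  of radius \<open>e\<close> in the chart. Scaling to the unit ball gives \<open>e^d\<close>, the
  second difference gives \<open>e^2\<close>, and 1/2 comes from averaging the integrand over
  \<open>z\<close> and \<open>- z\<close>.\<close>

lemma ball_integral_eq:
  fixes f :: "real ^ 'd::finite \<Rightarrow> complex"
  assumes f: "C2 f" and e: "e > 0"
  shows "ball_integral f e w - of_real (measure hyperbolic_measure (ball (0 :: real ^ 'd) e)) * f w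
    = (e ^ (CARD('d) + 2) / 2) *\<^sub>R ball_average f e w"
proof -
  let ?B = "{x. mdot (pt w) (pt x) < sqrt (1 + e\<^sup>2)}"
  have fm [measurable]: "f \<in> borel_measurable borel"
    by (intro borel_measurable_continuous_onI C2_continuous[OF f])
  have "continuous_on UNIV (\<lambda>x. (w, x))" by (intro continuous_intros)
  from continuous_on_compose2[OF mdot_pt_continuous this subset_UNIV]
  have "continuous_on UNIV (\<lambda>x. mdot (pt w) (pt x))" by simp
  then have "open ?B" by (intro open_Collect_less continuous_intros)
  then have [measurable]: "?B \<in> sets borel" by simp
  have mem: "act (boost w) u \<in> ?B \<longleftrightarrow> u \<in> ball 0 e" for u
  proof -
    have "mdot (pt w) (pt (act (boost w) u)) = mdot (pt 0) (pt u)"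
      using mdot_act[OF boost_in_O1, of w 0 u] by simp
    also have "\<dots> = sqrt (1 + (norm u)\<^sup>2)" by (simp add: mdot_def)
    finally show ?thesis using e by (auto simp: abs_le_square_iff[symmetric] power2_less_eq_zero_iff dest: power2_less_imp_less intro: power_strict_mono)
  qed
  let ?h = "\<lambda>u. indicator (ball 0 e) u *\<^sub>R (f (act (boost w) u) - f w)"
  have [measurable]: "act (boost w) \<in> borel_measurable borel" by (rule act_measurable[OF boost_in_O1])
  have fa [measurable]: "(\<lambda>u. f (act (boost w) u)) \<in> borel_measurable borel" by measurable
  have fin: "emeasure hyperbolic_measure (ball (0 :: real ^ 'd) e) < \<infinity>" by (rule emeasure_hyperbolic_bounded) auto
  have bd: "\<exists>B. \<forall>u\<in>ball 0 e. norm (f (act (boost w) u)) \<le> B"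
  proof -
    have "continuous_on UNIV (\<lambda>u. f (act (boost w) u))"
      by (rule C2_continuous_compose[OF f continuous_on_act[OF boost_in_O1]])
    then have "bounded ((\<lambda>u. f (act (boost w) u)) ` cball 0 e)"
      by (intro compact_imp_bounded compact_continuous_image compact_cball) (auto intro: continuous_on_subset)
    then obtain a where "\<forall>x\<in>cball 0 e. norm (f (act (boost w) x)) \<le> a" unfolding bounded_iff by auto
    then show ?thesis by (intro exI[of _ a]) auto
  qed
  then obtain B where B: "\<And>u. u \<in> ball 0 e \<Longrightarrow> norm (f (act (boost w) u)) \<le> B" by blast
  have i1: "integrable hyperbolic_measure (\<lambda>u. indicator (ball 0 e) u *\<^sub>R f (act (boost w) u))"
    by (rule integrableI_bounded_set_indicator[where B = B]) (use fin B in auto)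
  have i2: "integrable hyperbolic_measure (\<lambda>u :: real ^ 'd. indicator (ball 0 e) u *\<^sub>R f w)"
    by (rule integrableI_bounded_set_indicator[where B = "norm (f w)"]) (use fin in auto)
  have "ball_integral f e w = (LINT u|hyperbolic_measure. indicator ?B (act (boost w) u) *\<^sub>R f (act (boost w) u))"
    unfolding ball_integral_def by (rule integral_hyperbolic_act[OF _ boost_in_O1, symmetric]) measurable
  also have "\<dots> = (LINT u|hyperbolic_measure. indicator (ball 0 e) u *\<^sub>R f (act (boost w) u))"
    by (intro Bochner_Integration.integral_cong refl) (simp add: indicator_def mem del: mem_Collect_eq)
  finally have "ball_integral f e w - of_real (measure hyperbolic_measure (ball (0 :: real ^ 'd) e)) * f w
     = (LINT u|hyperbolic_measure. indicator (ball 0 e) u *\<^sub>R f (act (boost w) u)) - (LINT u|hyperbolic_measure. indicator (ball 0 e) (u :: real ^ 'd) *\<^sub>R f w)"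
    using fin by (simp add: scaleR_conv_of_real)
  also have "\<dots> = (LINT u|hyperbolic_measure. ?h u)"
    using i1 i2 by (subst Bochner_Integration.integral_diff[symmetric]) (auto simp: scaleR_diff_right)
  also have "\<dots> = (LINT u|lborel. (1 / sqrt (1 + (norm u)\<^sup>2)) *\<^sub>R ?h u)"
    by (intro integral_hyperbolic borel_measurable_scaleR borel_measurable_diff borel_measurable_indicator fa borel_measurable_const) simp
  also have "\<dots> = e ^ CARD('d) *\<^sub>R (LINT z|lborel. (1 / sqrt (1 + (norm (e *\<^sub>R z))\<^sup>2)) *\<^sub>R ?h (e *\<^sub>R z))"
  proof -
    have "sqrt (1 + (norm u)\<^sup>2) \<noteq> 0" for u :: "real ^ 'd" using one_plus_square_pos[of "norm u"] by simp
    then have c: "(\<lambda>u :: real ^ 'd. 1 / sqrt (1 + (norm u)\<^sup>2)) \<in> borel_measurable borel"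
      by (intro borel_measurable_continuous_onI continuous_intros) auto
    have h: "?h \<in> borel_measurable borel"
      by (intro borel_measurable_scaleR borel_measurable_diff borel_measurable_indicator fa borel_measurable_const) simp
    show ?thesis
      using integral_lborel_scale[OF borel_measurable_scaleR[OF c h], of e] e by (simp only: abs_of_pos less_imp_neq[symmetric] not_False_eq_True)
  qed
  finally have 1: "ball_integral f e w - of_real (measure hyperbolic_measure (ball (0 :: real ^ 'd) e)) * f w
     = e ^ CARD('d) *\<^sub>R (LINT z|lborel. (1 / sqrt (1 + (norm (e *\<^sub>R z))\<^sup>2)) *\<^sub>R ?h (e *\<^sub>R z))" .
  let ?k = "\<lambda>z. indicator (ball 0 1) z *\<^sub>R ((1 / sqrt (1 + (e * norm z)\<^sup>2)) *\<^sub>R (f (ray w z e) - f w))"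
  have hk: "(1 / sqrt (1 + (norm (e *\<^sub>R z))\<^sup>2)) *\<^sub>R ?h (e *\<^sub>R z) = ?k z" for z
    using e by (auto simp: act_boost_ray indicator_def)
  have ray_neg: "ray w (- z) e = ray w z (- e)" for z :: "real ^ 'd"
    by (simp add: ray_def boost_space_def scaleR_add_right scaleR_diff_right)
  have sq: "sqrt (1 + a\<^sup>2) \<noteq> 0" for a :: real using one_plus_square_pos[of a] by simp
  have contk: "continuous_on UNIV (\<lambda>z. (1 / sqrt (1 + (e * norm z)\<^sup>2)) *\<^sub>R (f (ray w z (c * e)) - f w))" for c
    using sq by (intro continuous_intros C2_continuous_compose[OF f] continuous_on_ray) auto
  have ik: "integrable lborel ?k" using integrable_ball_mult[OF contk[of 1]] by simp
  have ik': "integrable lborel (\<lambda>z. ?k (- z))"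
    using integrable_ball_mult[OF contk[of "- 1"]] by (simp add: ray_neg indicator_def)
  have km: "?k \<in> borel_measurable borel" using borel_measurable_integrable[OF ik] by simp
  have "(LINT z|lborel. ?k z) = (LINT z|lborel. ?k (- z))"
    using integral_lborel_scale[OF km, of "- 1"] by simp
  then have "2 * (LINT z|lborel. ?k z) = (LINT z|lborel. ?k z) + (LINT z|lborel. ?k (- z))" by simp
  also have "\<dots> = (LINT z|lborel. ?k z + ?k (- z))"
    by (rule Bochner_Integration.integral_add[symmetric, OF ik ik'])
  also have "\<dots> = (LINT z|lborel. e\<^sup>2 *\<^sub>R (indicator (ball 0 1) z *\<^sub>R
     ((1 / sqrt (1 + (e * norm z)\<^sup>2)) *\<^sub>R ((1 / e\<^sup>2) *\<^sub>R second_difference f w z e))))"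
  proof (intro Bochner_Integration.integral_cong refl)
    fix z :: "real ^ 'd"
    have "?k z + ?k (- z) = indicator (ball 0 1) z *\<^sub>R ((1 / sqrt (1 + (e * norm z)\<^sup>2)) *\<^sub>R second_difference f w z e)"
      unfolding second_difference_def ray_neg by (simp add: indicator_def scaleR_add_right[symmetric])
    also have "\<dots> = e\<^sup>2 *\<^sub>R (indicator (ball 0 1) z *\<^sub>R
     ((1 / sqrt (1 + (e * norm z)\<^sup>2)) *\<^sub>R ((1 / e\<^sup>2) *\<^sub>R second_difference f w z e)))"
      using e by simp
    finally show "?k z + ?k (- z) = e\<^sup>2 *\<^sub>R (indicator (ball 0 1) z *\<^sub>R
     ((1 / sqrt (1 + (e * norm z)\<^sup>2)) *\<^sub>R ((1 / e\<^sup>2) *\<^sub>R second_difference f w z e)))" .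
  qed
  also have "\<dots> = e\<^sup>2 *\<^sub>R ball_average f e w" unfolding ball_average_def by (rule integral_scaleR_right)
  finally have 2: "2 * (LINT z|lborel. ?k z) = e\<^sup>2 *\<^sub>R ball_average f e w" .
  have "(LINT z|lborel. ?k z) = (e\<^sup>2 / 2) *\<^sub>R ball_average f e w"
    using arg_cong[OF 2, of "\<lambda>x. (1/2) *\<^sub>R x"] by (simp add: scaleR_conv_of_real)
  then show ?thesis unfolding 1 hk by (auto simp: power_add) (simp add: power2_eq_square)?
qed

section \<open>Self-adjointness of the Laplacian on the quotient\<close>

lemma sigma_finite_hyperbolic: "sigma_finite_measure (hyperbolic_measure :: (real ^ 'd::finite) measure)"
proof
  let ?C = "range (\<lambda>n :: nat. cball (0 :: real ^ 'd) (real n))"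
  have "\<Union>?C = UNIV"
  proof (intro equalityI subsetI UNIV_I)
    fix x :: "real ^ 'd"
    obtain n :: nat where "norm x \<le> real n" using real_arch_simple by blast
    then show "x \<in> \<Union>?C" by auto
  qed
  moreover have "emeasure hyperbolic_measure (cball (0 :: real ^ 'd) (real n)) \<noteq> \<infinity>" for n :: nat
    using emeasure_hyperbolic_bounded[of "cball (0 :: real ^ 'd) (real n)"] by auto
  ultimately show "\<exists>A. countable A \<and> A \<subseteq> sets (hyperbolic_measure :: (real ^ 'd) measure) \<and> \<Union>A = space hyperbolic_measure
      \<and> (\<forall>a\<in>A. emeasure hyperbolic_measure a \<noteq> \<infinity>)"
    by (intro exI[of _ ?C]) auto
qed

text \<open>By Cauchy-Schwarz \<open>mdot (pt w) (pt x)\<close> is at least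
  \<open>(c - |w|) * sqrt (1 + |x|^2)\<close> with \<open>c = sqrt (1 + |w|^2)\<close>, and
  \<open>(c - |w|) * (c + |w|) = 1\<close> controls the first factor. It confines the support of the
  kernel to a ball.\<close>

lemma norm_le_of_mdot_le:
  assumes "mdot (pt w) (pt x) \<le> k" "norm w \<le> \<rho>" "0 \<le> k"
  shows "norm x \<le> k * (1 + 2 * \<rho>)"
proof -
  let ?c = "sqrt (1 + (norm w)\<^sup>2)" and ?d = "sqrt (1 + (norm x)\<^sup>2)"
  have c: "?c > norm w" "?c\<^sup>2 = 1 + (norm w)\<^sup>2" "?c \<le> 1 + norm w"
    by (auto intro!: real_less_rsqrt real_le_lsqrt simp: power2_eq_square algebra_simps)
  have d: "?d \<ge> norm x" by (rule real_le_rsqrt) simp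
  have cs: "w \<bullet> x \<le> norm w * norm x" by (rule norm_cauchy_schwarz)
  have "norm w * norm x \<le> norm w * ?d" using d by (intro mult_left_mono) auto
  then have "(?c - norm w) * ?d \<le> k" using assms(1) cs by (simp add: mdot_def algebra_simps)
  then have "(?c - norm w) * ?d * (?c + norm w) \<le> k * (?c + norm w)"
    using c(1) norm_ge_zero[of w] by (intro mult_right_mono) auto
  moreover have "(a - b) * d * (a + b) = (a\<^sup>2 - b\<^sup>2) * d" for a b d :: real by (simp add: power2_eq_square algebra_simps)
  ultimately have "(?c\<^sup>2 - (norm w)\<^sup>2) * ?d \<le> k * (?c + norm w)" by metis
  then have "?d \<le> k * (?c + norm w)" unfolding c(2) by simp
  also have "\<dots> \<le> k * (1 + 2 * \<rho>)" using c(3) assms by (intro mult_left_mono) auto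
  finally show ?thesis using d by linarith
qed

context quotient_by_action
begin

context
  fixes B0
  assumes B0: "B0 \<in> sets borel" "inj_on q B0" "q ` B0 = range q" and B0_bounded: "bounded B0"
begin

lemma integrable_fundamental:
  fixes h :: "real ^ 'd \<Rightarrow> 'b::{banach, second_countable_topology}"
  assumes h: "h \<in> borel_measurable borel" and B: "\<And>w. w \<in> B0 \<Longrightarrow> norm (h w) \<le> B"
  shows "integrable hyperbolic_measure (\<lambda>w. indicator B0 w *\<^sub>R h w)"
proof (rule integrableI_bounded_set_indicator[where B = B])
  show "emeasure hyperbolic_measure B0 < \<infinity>" by (rule emeasure_hyperbolic_bounded[OF B0_bounded B0(1)])
qed (use B0 h B in auto)

lemma bounded_on_fundamental:
  fixes h :: "real ^ 'd \<Rightarrow> 'b::real_normed_vector"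
  assumes "continuous_on UNIV h"
  shows "\<exists>B\<ge>0. \<forall>w\<in>B0. norm (h w) \<le> B"
proof -
  have "bounded (h ` closure B0)"
    using assms B0_bounded by (intro compact_imp_bounded compact_continuous_image)
      (auto intro: continuous_on_subset simp: compact_closure)
  then obtain B where "B > 0" "\<forall>y\<in>h ` closure B0. norm y \<le> B" unfolding bounded_pos by blast
  then show ?thesis using closure_subset[of B0] by (intro exI[of _ B]) auto
qed

lemma integrable_fundamental_continuous:
  fixes h :: "real ^ 'd \<Rightarrow> 'b::{banach, second_countable_topology}"
  assumes "continuous_on UNIV h"
  shows "integrable hyperbolic_measure (\<lambda>w. indicator B0 w *\<^sub>R h w)"
proof -
  obtain B where "\<forall>w\<in>B0. norm (h w) \<le> B" using bounded_on_fundamental[OF assms] by blast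
  then show ?thesis
    by (intro integrable_fundamental[where B = B] borel_measurable_continuous_onI assms) auto
qed

text \<open>
  Unfolding: the integral over all of space is a finite sum of integrals over tiles, and the kernel
  is a point-pair invariant.
\<close>

lemma ball_integral_symmetric:
  fixes f1 f2 :: "real ^ 'd \<Rightarrow> complex"
  assumes f1: "continuous_on UNIV f1" and f2: "continuous_on UNIV f2"
    and inv1: "\<And>g w. g \<in> \<Lambda> \<Longrightarrow> f1 (act g w) = f1 w" and inv2: "\<And>g w. g \<in> \<Lambda> \<Longrightarrow> f2 (act g w) = f2 w"
  shows "(LINT w|hyperbolic_measure. indicator B0 w *\<^sub>R (ball_integral f1 e w * f2 w))
    = (LINT w|hyperbolic_measure. indicator B0 w *\<^sub>R (f1 w * ball_integral f2 e w))"
proof -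
  interpret H: sigma_finite_measure "hyperbolic_measure :: (real ^ 'd) measure" by (rule sigma_finite_hyperbolic)
  interpret HH: pair_sigma_finite "hyperbolic_measure :: (real ^ 'd) measure" "hyperbolic_measure :: (real ^ 'd) measure" ..
  let ?\<mu> = "hyperbolic_measure :: (real ^ 'd) measure"
  define k where "k = sqrt (1 + e\<^sup>2)"
  have k0: "k \<ge> 0" by (simp add: k_def)
  define E :: "real ^ 'd \<Rightarrow> real ^ 'd \<Rightarrow> real" where "E w x = indicator {p. mdot (pt (fst p)) (pt (snd p)) < k} (w, x)" for w x
  have E_act: "E (act g w) (act g x) = E w x" if "g \<in> \<Lambda>" for g w x
    by (simp add: E_def indicator_def mdot_act[OF O1[OF that]])
  have E_sym: "E w x = E x w" for w x by (simp add: E_def indicator_def mdot_commute)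
  have E01: "0 \<le> E w x" "E w x \<le> 1" for w x by (auto simp: E_def indicator_def)
  obtain \<rho>0 where \<rho>0: "\<rho>0 > 0" "\<And>w. w \<in> B0 \<Longrightarrow> norm w \<le> \<rho>0" using B0_bounded unfolding bounded_pos by blast
  define \<rho> where "\<rho> = max \<rho>0 (k * (1 + 2 * \<rho>0))"
  have B\<rho>: "w \<in> B0 \<Longrightarrow> w \<in> cball 0 \<rho>" for w using \<rho>0(2)[of w] by (auto simp: \<rho>_def)
  have E\<rho>: "x \<in> cball 0 \<rho>" if "w \<in> B0" "E w x \<noteq> 0" for w x
  proof -
    have "mdot (pt w) (pt x) \<le> k" using that(2) by (auto simp: E_def indicator_def split: if_splits)
    from norm_le_of_mdot_le[OF this \<rho>0(2)[OF that(1)] k0] show ?thesis by (simp add: \<rho>_def)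
  qed
  \<comment> \<open>For \<open>w\<close> in \<open>B0\<close> the kernel sees only points of the
    ball of radius \<open>\<rho>\<close>, so these finitely many group elements cover all tiles that
    count. The set is closed under inversion, which the final reindexing needs.\<close>
  define J where "J = {g \<in> \<Lambda>. \<exists>v\<in>cball 0 \<rho>. act g v \<in> cball 0 \<rho>}"
  have J: "finite J" "J \<subseteq> \<Lambda>" unfolding J_def using proper by auto
  have Jinv: "lorentz_inv g \<in> J" if gJ: "g \<in> J" for g
  proof -
    obtain v where v: "v \<in> cball 0 \<rho>" "act g v \<in> cball 0 \<rho>" using gJ unfolding J_def by blast
    have g: "g \<in> \<Lambda>" using gJ by (simp add: J_def)
    have "act (lorentz_inv g) (act g v) \<in> cball 0 \<rho>" using v O1[OF g] by simp
    then show ?thesis using v inv[OF g] unfolding J_def by blast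
  qed
  have lorentz_inv2: "lorentz_inv (lorentz_inv g) = g" if "g \<in> \<Lambda>" for g
  proof (rule act_eq_imp_eq[of _ _ 0])
    have "act (lorentz_inv (lorentz_inv g)) (act (lorentz_inv g) (act g 0)) = act g 0"
      using lorentz_inv_in_O1[OF O1[OF that]] by simp
    then show "act (lorentz_inv (lorentz_inv g)) 0 = act g 0" using O1[OF that] by simp
  qed (use inv that in auto)
  have Jbij: "bij_betw lorentz_inv J J"
    by (rule bij_betw_byWitness[where f' = lorentz_inv]) (use Jinv J lorentz_inv2 in auto)
  let ?b = "\<lambda>w. indicator B0 w :: real"
  have sumJ: "(\<Sum>h\<in>J. ?b (act h x)) = 1" if x: "x \<in> cball 0 \<rho>" for x
  proof -
    obtain g where g: "g \<in> \<Lambda>" "act g x \<in> B0" using tile_ex[OF B0] by blast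
    have "\<exists>v\<in>cball 0 \<rho>. act g v \<in> cball 0 \<rho>" by (rule bexI[of _ x], rule B\<rho>[OF g(2)], rule x)
    then have gJ: "g \<in> J" unfolding J_def mem_Collect_eq by (rule conjI[OF g(1)])
    have b1: "?b (act h x) = (if h = g then 1 else 0)" if h: "h \<in> J" for h
    proof (cases "h = g")
      case False
      have "act h x \<notin> B0"
        using tile_unique[OF B0 g(2) _ g(1) subsetD[OF J(2) h]] False by metis
      then show ?thesis using False by simp
    qed (simp add: g(2))
    have "(\<Sum>h\<in>J. ?b (act h x)) = (\<Sum>h\<in>J. if h = g then 1 else 0)" by (rule sum.cong[OF refl b1])
    also have "\<dots> = 1" using gJ J(1) by simp
    finally show ?thesis .
  qed
  have fm: "F \<in> borel_measurable borel" if "continuous_on UNIV F" for F :: "real ^ 'd \<Rightarrow> complex"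
    using that by (rule borel_measurable_continuous_onI)
  have "open {p :: (real ^ 'd) \<times> (real ^ 'd). mdot (pt (fst p)) (pt (snd p)) < k}"
    by (intro open_Collect_less mdot_pt_continuous continuous_intros)
  then have Em0: "(\<lambda>p. E (fst p) (snd p)) \<in> borel_measurable borel" unfolding E_def by simp
  have sets2: "sets (?\<mu> \<Otimes>\<^sub>M ?\<mu>) = sets (borel :: ((real ^ 'd) \<times> (real ^ 'd)) measure)"
    unfolding borel_prod[symmetric] by (rule sets_pair_measure_cong) auto
  have Em: "(\<lambda>p. E (fst p) (snd p)) \<in> borel_measurable (?\<mu> \<Otimes>\<^sub>M ?\<mu>)"
    using Em0 by (subst measurable_cong_sets[OF sets2 refl])
  have Ehm: "(\<lambda>p. E (act h (fst p)) (snd p)) \<in> borel_measurable (?\<mu> \<Otimes>\<^sub>M ?\<mu>)" if "h \<in> \<Lambda>" for h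
  proof -
    have "(\<lambda>p. (act h (fst p), snd p)) \<in> (?\<mu> \<Otimes>\<^sub>M ?\<mu>) \<rightarrow>\<^sub>M (?\<mu> \<Otimes>\<^sub>M ?\<mu>)"
    proof (rule measurable_Pair)
      show "(\<lambda>p. act h (fst p)) \<in> ?\<mu> \<Otimes>\<^sub>M ?\<mu> \<rightarrow>\<^sub>M ?\<mu>"
        using measurable_compose[OF measurable_fst, of "act h" ?\<mu> ?\<mu> ?\<mu>] act_measurable[OF O1[OF that]]
        by (simp cong: measurable_cong_sets)
    qed simp
    from measurable_compose[OF this Em] show ?thesis by simp
  qed
  have E1: "(\<lambda>x. E w x) \<in> borel_measurable borel" for w
    using measurable_Pair2[OF Em, of w] by simp
  \<comment> \<open>The contribution of one tile: after the substitution \<open>y = act h x\<close>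
    both variables run over \<open>B0\<close>.\<close>
  define C where "C F G h = (LINT w|?\<mu>. LINT y|?\<mu>. (?b w * ?b y * E (act h w) y) *\<^sub>R (F y * G w))" for F G :: "real ^ 'd \<Rightarrow> complex" and h
  have int2: "integrable (?\<mu> \<Otimes>\<^sub>M ?\<mu>) (\<lambda>p. (?b (fst p) * ?b (snd p) * E (act h (fst p)) (snd p)) *\<^sub>R (F (snd p) * G (fst p)))"
    if F: "continuous_on UNIV F" and G: "continuous_on UNIV G" and h: "h \<in> \<Lambda>" for F G :: "real ^ 'd \<Rightarrow> complex" and h
  proof -
    obtain A where A: "A \<ge> 0" "\<forall>w\<in>B0. norm (F w) \<le> A" using bounded_on_fundamental[OF F] by blast
    obtain B where B: "B \<ge> 0" "\<forall>w\<in>B0. norm (G w) \<le> B" using bounded_on_fundamental[OF G] by blast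
    have fin: "emeasure (?\<mu> \<Otimes>\<^sub>M ?\<mu>) (B0 \<times> B0) < \<infinity>"
      using B0 emeasure_hyperbolic_bounded[OF B0_bounded B0(1)]
      by (subst H.emeasure_pair_measure_Times) (auto simp: ennreal_mult_less_top)
    have "(\<lambda>p. E (act h (fst p)) (snd p) *\<^sub>R (F (snd p) * G (fst p))) \<in> borel_measurable (?\<mu> \<Otimes>\<^sub>M ?\<mu>)"
      by (intro borel_measurable_scaleR Ehm[OF h] borel_measurable_times measurable_compose[OF measurable_snd]
          measurable_compose[OF measurable_fst])
        (simp_all add: fm F G measurable_cong_sets[OF sets_hyperbolic refl])
    moreover have "norm (E (act h (fst p)) (snd p) *\<^sub>R (F (snd p) * G (fst p))) \<le> A * B" if "p \<in> B0 \<times> B0" for p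
    proof -
      have "norm (F (snd p) * G (fst p)) \<le> A * B"
        unfolding norm_mult using that A B by (intro mult_mono) auto
      moreover have "E (act h (fst p)) (snd p) * norm (F (snd p) * G (fst p)) \<le> 1 * norm (F (snd p) * G (fst p))"
        using E01 by (intro mult_right_mono) auto
      ultimately show ?thesis using E01 by simp
    qed
    ultimately have "integrable (?\<mu> \<Otimes>\<^sub>M ?\<mu>) (\<lambda>p. indicator (B0 \<times> B0) p *\<^sub>R (E (act h (fst p)) (snd p) *\<^sub>R (F (snd p) * G (fst p))))"
      using fin B0(1) by (intro integrableI_bounded_set_indicator[where B = "A * B"]) auto
    then show ?thesis by (simp add: indicator_times mult.assoc)
  qed
  have unfold: "(LINT w|?\<mu>. ?b w *\<^sub>R (ball_integral F e w * G w)) = (\<Sum>h\<in>J. C F G h)"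
    if F: "continuous_on UNIV F" and G: "continuous_on UNIV G" and Finv: "\<And>g w. g \<in> \<Lambda> \<Longrightarrow> F (act g w) = F w"
    for F G :: "real ^ 'd \<Rightarrow> complex"
  proof -
    have tile: "?b w *\<^sub>R (ball_integral F e w * G w) = (\<Sum>h\<in>J. LINT y|?\<mu>. (?b w * ?b y * E (act h w) y) *\<^sub>R (F y * G w))" for w
    proof (cases "w \<in> B0")
      case True
      have iy: "integrable ?\<mu> (\<lambda>y. (?b y * E (act h w) y) *\<^sub>R F y)" for h
      proof -
        obtain A where A: "A \<ge> 0" "\<forall>w\<in>B0. norm (F w) \<le> A" using bounded_on_fundamental[OF F] by blast
        have "integrable ?\<mu> (\<lambda>y. ?b y *\<^sub>R (E (act h w) y *\<^sub>R F y))"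
        proof (rule integrable_fundamental[where B = A])
          show "(\<lambda>y. E (act h w) y *\<^sub>R F y) \<in> borel_measurable borel" by (intro borel_measurable_scaleR E1 fm[OF F])
          show "norm (E (act h w) y *\<^sub>R F y) \<le> A" if "y \<in> B0" for y
            using mult_mono[of "E (act h w) y" 1 "norm (F y)" A] E01 A that by auto
        qed
        then show ?thesis by simp
      qed
      have sub: "(LINT x|?\<mu>. (?b (act h x) * E w x) *\<^sub>R F x) = (LINT y|?\<mu>. (?b y * E (act h w) y) *\<^sub>R F y)"
        and subi: "integrable ?\<mu> (\<lambda>x. (?b (act h x) * E w x) *\<^sub>R F x)" if h: "h \<in> \<Lambda>" for h
      proof -
        have eq: "(?b (act h x) * E w x) *\<^sub>R F x = (\<lambda>y. (?b y * E (act h w) y) *\<^sub>R F y) (act h x)" for x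
          using E_act[OF h, of w x] Finv[OF h, of x] by simp
        have m: "(\<lambda>y. (?b y * E (act h w) y) *\<^sub>R F y) \<in> borel_measurable borel"
          using borel_measurable_integrable[OF iy[of h]] by simp
        show "(LINT x|?\<mu>. (?b (act h x) * E w x) *\<^sub>R F x) = (LINT y|?\<mu>. (?b y * E (act h w) y) *\<^sub>R F y)"
          unfolding eq by (rule integral_hyperbolic_act[OF m O1[OF h]])
        have "integrable (distr ?\<mu> borel (act h)) (\<lambda>y. (?b y * E (act h w) y) *\<^sub>R F y)"
          unfolding distr_hyperbolic_act[OF O1[OF h]] by (rule iy)
        then show "integrable ?\<mu> (\<lambda>x. (?b (act h x) * E w x) *\<^sub>R F x)"
          unfolding eq using act_measurable[OF O1[OF h]] by (subst (asm) integrable_distr_eq) (use m in auto)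
      qed
      have "ball_integral F e w = (LINT x|?\<mu>. E w x *\<^sub>R F x)"
        unfolding ball_integral_def E_def k_def by (simp add: indicator_def)
      also have "\<dots> = (LINT x|?\<mu>. (\<Sum>h\<in>J. (?b (act h x) * E w x) *\<^sub>R F x))"
      proof (intro Bochner_Integration.integral_cong refl)
        fix x
        have "E w x = (\<Sum>h\<in>J. ?b (act h x)) * E w x"
          using sumJ[of x] E\<rho>[OF True, of x] by (cases "E w x = 0") auto
        then have "E w x *\<^sub>R F x = ((\<Sum>h\<in>J. ?b (act h x)) * E w x) *\<^sub>R F x" by simp
        then show "E w x *\<^sub>R F x = (\<Sum>h\<in>J. (?b (act h x) * E w x) *\<^sub>R F x)"
          by (simp only: sum_distrib_right scaleR_sum_left)
      qed
      also have "\<dots> = (\<Sum>h\<in>J. LINT x|?\<mu>. (?b (act h x) * E w x) *\<^sub>R F x)"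
        using J subi by (intro Bochner_Integration.integral_sum) auto
      also have "\<dots> = (\<Sum>h\<in>J. LINT y|?\<mu>. (?b y * E (act h w) y) *\<^sub>R F y)"
        using J sub by (intro sum.cong) auto
      finally have "ball_integral F e w * G w = (\<Sum>h\<in>J. (LINT y|?\<mu>. (?b y * E (act h w) y) *\<^sub>R F y) * G w)"
        by (simp only: sum_distrib_right)
      also have "\<dots> = (\<Sum>h\<in>J. LINT y|?\<mu>. ((?b y * E (act h w) y) *\<^sub>R F y) * G w)"
        by (intro sum.cong refl Bochner_Integration.integral_mult_left[symmetric] iy)
      finally show ?thesis using True by simp
    qed simp
    have ih: "integrable ?\<mu> (\<lambda>w. LINT y|?\<mu>. (?b w * ?b y * E (act h w) y) *\<^sub>R (F y * G w))" if "h \<in> J" for h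
      using HH.integrable_fst'[OF int2[OF F G, of h]] J that by auto
    show ?thesis unfolding tile C_def
      using ih by (rule Bochner_Integration.integral_sum)
  qed
  \<comment> \<open>Exchanging the variables turns the kernel of \<open>h\<close> into that of its
    inverse, by invariance and symmetry of \<open>E\<close>.\<close>
  have C_sym: "C F G h = C G F (lorentz_inv h)"
    if F: "continuous_on UNIV F" and G: "continuous_on UNIV G" and h: "h \<in> \<Lambda>" for F G :: "real ^ 'd \<Rightarrow> complex" and h
  proof -
    have "C F G h = (LINT y|?\<mu>. LINT w|?\<mu>. (?b w * ?b y * E (act h w) y) *\<^sub>R (F y * G w))"
      unfolding C_def using HH.Fubini_integral[of "\<lambda>w y. (?b w * ?b y * E (act h w) y) *\<^sub>R (F y * G w)"] int2[OF F G h]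
      by (simp add: case_prod_beta')
    also have "\<dots> = C G F (lorentz_inv h)"
      unfolding C_def
    proof (intro Bochner_Integration.integral_cong refl)
      fix y w
      have "E (act h w) y = E (act (lorentz_inv h) y) w"
        using E_act[OF inv[OF h], of "act h w" y] O1[OF h] E_sym by simp
      then show "(?b w * ?b y * E (act h w) y) *\<^sub>R (F y * G w) = (?b y * ?b w * E (act (lorentz_inv h) y) w) *\<^sub>R (G w * F y)"
        by (simp add: mult.commute)
    qed
    finally show ?thesis .
  qed
  have "(LINT w|?\<mu>. ?b w *\<^sub>R (ball_integral f1 e w * f2 w)) = (\<Sum>h\<in>J. C f1 f2 h)"
    by (rule unfold[OF f1 f2]) (rule inv1)
  also have "\<dots> = (\<Sum>h\<in>J. C f2 f1 (lorentz_inv h))"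
    by (intro sum.cong refl C_sym[OF f1 f2]) (use J in auto)
  also have "\<dots> = (\<Sum>h\<in>J. C f2 f1 h)" by (rule sum.reindex_bij_betw[OF Jbij])
  also have "\<dots> = (LINT w|?\<mu>. ?b w *\<^sub>R (ball_integral f2 e w * f1 w))"
    by (rule unfold[OF f2 f1, symmetric]) (rule inv2)
  finally show ?thesis by (simp add: mult.commute)
qed

text \<open>\<open>ball_integral\<close> is a constant times the function plus a positive multiple
  of \<open>ball_average\<close>. The first part is symmetric for trivial reasons, so symmetry
  passes to the averages at each radius, and in the limit of radius 0 to the Laplacian, after
  division by the positive second moment.\<close>

lemma laplacian_self_adjoint:
  fixes f1 f2 :: "real ^ 'd \<Rightarrow> complex"
  assumes f1: "C2 f1" and f2: "C2 f2"
    and inv1: "\<And>g w. g \<in> \<Lambda> \<Longrightarrow> f1 (act g w) = f1 w" and inv2: "\<And>g w. g \<in> \<Lambda> \<Longrightarrow> f2 (act g w) = f2 w"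
  shows "(LINT w|hyperbolic_measure. indicator B0 w *\<^sub>R (chart_laplacian f1 w * f2 w))
    = (LINT w|hyperbolic_measure. indicator B0 w *\<^sub>R (f1 w * chart_laplacian f2 w))"
proof -
  let ?\<mu> = "hyperbolic_measure :: (real ^ 'd) measure"
  let ?e = "\<lambda>k. 1 / real (Suc k)"
  let ?\<kappa> = "second_moment TYPE('d)"
  obtain \<rho> where \<rho>: "\<And>w. w \<in> B0 \<Longrightarrow> w \<in> cball 0 \<rho>" using B0_bounded unfolding bounded_iff by auto
  have intA: "integrable ?\<mu> (\<lambda>w. indicator B0 w *\<^sub>R (ball_average f e w * g w))"
    and intI: "integrable ?\<mu> (\<lambda>w. indicator B0 w *\<^sub>R (f w * g w))"
    and dom: "\<exists>B\<ge>0. \<forall>w\<in>B0. \<forall>e. 0 < e \<longrightarrow> e \<le> 1 \<longrightarrow> norm (ball_average f e w * g w) \<le> B"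
    if f: "C2 f" and g: "C2 g" and e: "0 < e" "e \<le> 1" for f g and e :: real
  proof -
    obtain A where A: "A \<ge> 0" "\<And>w e. w \<in> B0 \<Longrightarrow> 0 < e \<Longrightarrow> e \<le> 1 \<Longrightarrow> norm (ball_average f e w) \<le> A"
      using ball_average_bound(1)[OF f, of \<rho>] \<rho> by metis
    obtain B where B: "B \<ge> 0" "\<And>w. w \<in> B0 \<Longrightarrow> norm (g w) \<le> B"
      using bounded_on_fundamental[OF C2_continuous[OF g]] by metis
    have AB: "norm (ball_average f e w * g w) \<le> A * B" if "w \<in> B0" "0 < e" "e \<le> 1" for w e
      unfolding norm_mult using A B that by (intro mult_mono) auto
    show "integrable ?\<mu> (\<lambda>w. indicator B0 w *\<^sub>R (ball_average f e w * g w))"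
      using AB e
      by (intro integrable_fundamental[where B = "A * B"] borel_measurable_times ball_average_measurable[OF f]
          borel_measurable_continuous_onI[OF C2_continuous[OF g]]) auto
    show "\<exists>B\<ge>0. \<forall>w\<in>B0. \<forall>e. 0 < e \<longrightarrow> e \<le> 1 \<longrightarrow> norm (ball_average f e w * g w) \<le> B"
      using AB A(1) B(1) by (intro exI[of _ "A * B"]) auto
    show "integrable ?\<mu> (\<lambda>w. indicator B0 w *\<^sub>R (f w * g w))"
      by (intro integrable_fundamental_continuous continuous_on_mult C2_continuous f g)
  qed
  have lim: "(\<lambda>k. LINT w|?\<mu>. indicator B0 w *\<^sub>R (ball_average f (?e k) w * g w)) \<longlonglongrightarrow>
      (LINT w|?\<mu>. indicator B0 w *\<^sub>R ((?\<kappa> *\<^sub>R chart_laplacian f w) * g w))"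
    if f: "C2 f" and g: "C2 g" for f g
  proof -
    obtain B where B: "B \<ge> 0" "\<And>w e. w \<in> B0 \<Longrightarrow> 0 < e \<Longrightarrow> e \<le> 1 \<Longrightarrow> norm (ball_average f e w * g w) \<le> B"
      using dom[OF f g zero_less_one order_refl] by metis
    have ib: "integrable ?\<mu> (\<lambda>w. B * indicator B0 w)"
      using B0(1) emeasure_hyperbolic_bounded[OF B0_bounded B0(1)] by (intro integrable_mult_right integrable_real_indicator) auto
    have pw: "(\<lambda>k. indicator B0 w *\<^sub>R (ball_average f (?e k) w * g w)) \<longlonglongrightarrow> indicator B0 w *\<^sub>R ((?\<kappa> *\<^sub>R chart_laplacian f w) * g w)" for w
      by (intro tendsto_scaleR tendsto_mult tendsto_const ball_average_bound(2)[OF f])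
    have mk: "(\<lambda>w. indicator B0 w *\<^sub>R (ball_average f (?e k) w * g w)) \<in> borel_measurable ?\<mu>" for k
      by (rule borel_measurable_integrable[OF intA[OF f g]]) auto
    show ?thesis
    proof (rule integral_dominated_convergence[where w = "\<lambda>w. B * indicator B0 w"])
      show "(\<lambda>w. indicator B0 w *\<^sub>R ((?\<kappa> *\<^sub>R chart_laplacian f w) * g w)) \<in> borel_measurable ?\<mu>"
        by (rule borel_measurable_LIMSEQ_metric[OF mk pw])
      show "AE w in ?\<mu>. norm (indicator B0 w *\<^sub>R (ball_average f (?e k) w * g w)) \<le> B * indicator B0 w" for k
      proof (rule AE_I2)
        fix w show "norm (indicator B0 w *\<^sub>R (ball_average f (?e k) w * g w)) \<le> B * indicator B0 w"
          using B(2)[of w "?e k"] B(1) by (auto simp: indicator_def)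
      qed
    qed (use mk ib pw in auto)
  qed
  have sym: "(LINT w|?\<mu>. indicator B0 w *\<^sub>R (ball_average f1 e w * f2 w)) = (LINT w|?\<mu>. indicator B0 w *\<^sub>R (ball_average f2 e w * f1 w))"
    if e: "0 < e" "e \<le> 1" for e :: real
  proof -
    define c where "c = e ^ (CARD('d) + 2) / 2"
    have c: "c > 0" using e by (simp add: c_def)
    define m where "m = complex_of_real (measure ?\<mu> (ball (0 :: real ^ 'd) e))"
    have bi: "ball_integral f e w * g w = c *\<^sub>R (ball_average f e w * g w) + m * (f w * g w)" if "C2 f" for f g :: "real ^ 'd \<Rightarrow> complex" and w
    proof -
      have "ball_integral f e w = c *\<^sub>R ball_average f e w + m * f w"
        using ball_integral_eq[OF that e(1), of w] unfolding c_def m_def by (simp add: diff_eq_eq)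
      then show ?thesis by (simp add: algebra_simps)
    qed
    have I: "(LINT w|?\<mu>. indicator B0 w *\<^sub>R (ball_integral f e w * g w)) =
       c *\<^sub>R (LINT w|?\<mu>. indicator B0 w *\<^sub>R (ball_average f e w * g w)) + m * (LINT w|?\<mu>. indicator B0 w *\<^sub>R (f w * g w))"
      if f: "C2 f" and g: "C2 g" for f g
    proof -
      have "(LINT w|?\<mu>. indicator B0 w *\<^sub>R (ball_integral f e w * g w))
        = (LINT w|?\<mu>. c *\<^sub>R (indicator B0 w *\<^sub>R (ball_average f e w * g w)) + m * (indicator B0 w *\<^sub>R (f w * g w)))"
        unfolding bi[OF f] by (simp add: scaleR_add_right mult_ac)
      also have "\<dots> = (LINT w|?\<mu>. c *\<^sub>R (indicator B0 w *\<^sub>R (ball_average f e w * g w))) + (LINT w|?\<mu>. m * (indicator B0 w *\<^sub>R (f w * g w)))"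
        by (intro Bochner_Integration.integral_add integrable_scaleR_right integrable_mult_right intA[OF f g e] intI[OF f g e])
      finally show ?thesis by (simp only: integral_scaleR_right integral_mult_right_zero)
    qed
    have "(LINT w|?\<mu>. indicator B0 w *\<^sub>R (ball_integral f1 e w * f2 w)) = (LINT w|?\<mu>. indicator B0 w *\<^sub>R (ball_integral f2 e w * f1 w))"
      using ball_integral_symmetric[OF C2_continuous[OF f1] C2_continuous[OF f2] inv1 inv2, of e] by (simp add: mult.commute)
    moreover have "(LINT w|?\<mu>. indicator B0 w *\<^sub>R (f2 w * f1 w)) = (LINT w|?\<mu>. indicator B0 w *\<^sub>R (f1 w * f2 w))"
      by (simp add: mult.commute)
    ultimately have "c *\<^sub>R (LINT w|?\<mu>. indicator B0 w *\<^sub>R (ball_average f1 e w * f2 w)) = c *\<^sub>R (LINT w|?\<mu>. indicator B0 w *\<^sub>R (ball_average f2 e w * f1 w))"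
      unfolding I[OF f1 f2] I[OF f2 f1] by simp
    then show ?thesis using c by simp
  qed
  have "(\<lambda>k. LINT w|?\<mu>. indicator B0 w *\<^sub>R (ball_average f1 (?e k) w * f2 w)) \<longlonglongrightarrow>
      (LINT w|?\<mu>. indicator B0 w *\<^sub>R ((?\<kappa> *\<^sub>R chart_laplacian f2 w) * f1 w))"
    using lim[OF f2 f1] sym by simp
  then have "(LINT w|?\<mu>. indicator B0 w *\<^sub>R ((?\<kappa> *\<^sub>R chart_laplacian f1 w) * f2 w))
     = (LINT w|?\<mu>. indicator B0 w *\<^sub>R ((?\<kappa> *\<^sub>R chart_laplacian f2 w) * f1 w))"
    using lim[OF f1 f2] LIMSEQ_unique by blast
  moreover have sc: "(LINT w|?\<mu>. indicator B0 w *\<^sub>R ((?\<kappa> *\<^sub>R a w) * b w)) = ?\<kappa> *\<^sub>R (LINT w|?\<mu>. indicator B0 w *\<^sub>R (a w * b w))"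
    for a b :: "real ^ 'd \<Rightarrow> complex"
  proof -
    have *: "indicator B0 w *\<^sub>R ((?\<kappa> *\<^sub>R a w) * b w) = ?\<kappa> *\<^sub>R (indicator B0 w *\<^sub>R (a w * b w))" for w by simp
    show ?thesis unfolding * by (rule integral_scaleR_right)
  qed
  ultimately have "?\<kappa> *\<^sub>R (LINT w|?\<mu>. indicator B0 w *\<^sub>R (chart_laplacian f1 w * f2 w)) = ?\<kappa> *\<^sub>R (LINT w|?\<mu>. indicator B0 w *\<^sub>R (chart_laplacian f2 w * f1 w))"
    by (simp only: sc)
  then have "(LINT w|?\<mu>. indicator B0 w *\<^sub>R (chart_laplacian f1 w * f2 w)) = (LINT w|?\<mu>. indicator B0 w *\<^sub>R (chart_laplacian f2 w * f1 w))"
    using second_moment_pos[where 'd = 'd] by simp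
  then show ?thesis by (simp add: mult.commute)
qed

end

end

section \<open>The two quotients\<close>

definition lorentz_subgroup :: "'d::finite lmat set \<Rightarrow> bool" where
  "lorentz_subgroup \<Lambda> \<longleftrightarrow> \<Lambda> \<subseteq> O1 \<and> mat 1 \<in> \<Lambda> \<and> (\<forall>g\<in>\<Lambda>. \<forall>h\<in>\<Lambda>. g ** h \<in> \<Lambda>) \<and> (\<forall>g\<in>\<Lambda>. lorentz_inv g \<in> \<Lambda>)"

lemma lorentz_subgroupD:
  assumes "lorentz_subgroup \<Lambda>"
  shows "\<Lambda> \<subseteq> O1" "mat 1 \<in> \<Lambda>" "g \<in> \<Lambda> \<Longrightarrow> h \<in> \<Lambda> \<Longrightarrow> g ** h \<in> \<Lambda>" "g \<in> \<Lambda> \<Longrightarrow> lorentz_inv g \<in> \<Lambda>" "g \<in> \<Lambda> \<Longrightarrow> g \<in> O1"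
  using assms unfolding lorentz_subgroup_def by blast+

lemma lorentz_subgroup_Int: "lorentz_subgroup A \<Longrightarrow> lorentz_subgroup B \<Longrightarrow> lorentz_subgroup (A \<inter> B)"
  unfolding lorentz_subgroup_def by blast

lemma lorentz_subgroup_K1: "lorentz_subgroup K1"
  unfolding lorentz_subgroup_def using mat_1_in_K1 K1_subset_O1 mult_in_K1 lorentz_inv_in_K1 by blast

lemma lorentz_inv_unique:
  assumes "g \<in> O1" "h ** g = mat 1"
  shows "lorentz_inv g = h"
proof -
  have "h ** g ** lorentz_inv g = h" unfolding matrix_mul_assoc[symmetric] lorentz_inv_right[OF assms(1)] by simp
  then show ?thesis using assms(2) by simp
qed

text \<open>In \<open>subgroup\<close> the inverse is the one described by the monoid record;
  uniqueness of inverses identifies it with \<open>lorentz_inv\<close>.\<close>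

lemma subgroup_imp_lorentz_subgroup:
  assumes "subgroup \<Gamma> (matrix_group O1)"
  shows "lorentz_subgroup \<Gamma>"
proof -
  interpret subgroup \<Gamma> "matrix_group O1" by (rule assms)
  have sub: "\<Gamma> \<subseteq> O1" using subset by (simp add: matrix_group_def)
  have "m_inv (matrix_group O1) g = lorentz_inv g" if "g \<in> \<Gamma>" for g
    unfolding m_inv_def
  proof (rule the_equality)
    have g: "g \<in> O1" using sub that by blast
    show "lorentz_inv g \<in> carrier (matrix_group O1) \<and> g \<otimes>\<^bsub>matrix_group O1\<^esub> lorentz_inv g = \<one>\<^bsub>matrix_group O1\<^esub>
        \<and> lorentz_inv g \<otimes>\<^bsub>matrix_group O1\<^esub> g = \<one>\<^bsub>matrix_group O1\<^esub>"
      using lorentz_inv_in_O1[OF g] lorentz_inv_left[OF g] lorentz_inv_right[OF g] by (simp add: matrix_group_def)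
    fix y assume "y \<in> carrier (matrix_group O1) \<and> g \<otimes>\<^bsub>matrix_group O1\<^esub> y = \<one>\<^bsub>matrix_group O1\<^esub>
        \<and> y \<otimes>\<^bsub>matrix_group O1\<^esub> g = \<one>\<^bsub>matrix_group O1\<^esub>"
    then show "y = lorentz_inv g" using lorentz_inv_unique[OF g, of y] by (simp add: matrix_group_def)
  qed
  then show ?thesis
    using sub m_closed one_closed m_inv_closed by (auto simp: lorentz_subgroup_def matrix_group_def)
qed

section \<open>Double cosets as orbits in the boost chart\<close>

lemma dcoset_iff: "x \<in> dcoset \<Gamma> K g \<longleftrightarrow> (\<exists>\<gamma>\<in>\<Gamma>. \<exists>k\<in>K. x = \<gamma> ** g ** k)"
  by (auto simp: dcoset_def r_coset_def set_mult_def matrix_group_def)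

lemma dcoset_eq_iff:
  assumes \<Gamma>: "lorentz_subgroup \<Gamma>" and K: "lorentz_subgroup K"
  shows "dcoset \<Gamma> K g = dcoset \<Gamma> K h \<longleftrightarrow> (\<exists>\<gamma>\<in>\<Gamma>. \<exists>k\<in>K. h = \<gamma> ** g ** k)"
proof
  assume "dcoset \<Gamma> K g = dcoset \<Gamma> K h"
  moreover have "h \<in> dcoset \<Gamma> K h"
    unfolding dcoset_iff using lorentz_subgroupD(2)[OF \<Gamma>] lorentz_subgroupD(2)[OF K]
    by (intro bexI[of _ "mat 1"]) auto
  ultimately have "h \<in> dcoset \<Gamma> K g" by simp
  then show "\<exists>\<gamma>\<in>\<Gamma>. \<exists>k\<in>K. h = \<gamma> ** g ** k" unfolding dcoset_iff .
next
  have sub: "dcoset \<Gamma> K (\<gamma> ** g ** k) \<subseteq> dcoset \<Gamma> K g" if "\<gamma> \<in> \<Gamma>" "k \<in> K" for \<gamma> k g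
  proof
    fix x assume "x \<in> dcoset \<Gamma> K (\<gamma> ** g ** k)"
    then obtain \<delta> l where dl: "\<delta> \<in> \<Gamma>" "l \<in> K" "x = \<delta> ** (\<gamma> ** g ** k) ** l" unfolding dcoset_iff by blast
    have "x = (\<delta> ** \<gamma>) ** g ** (k ** l)" unfolding dl by (simp add: matrix_mul_assoc)
    then show "x \<in> dcoset \<Gamma> K g"
      unfolding dcoset_iff using lorentz_subgroupD(3)[OF \<Gamma> dl(1) that(1)] lorentz_subgroupD(3)[OF K that(2) dl(2)] by blast
  qed
  assume "\<exists>\<gamma>\<in>\<Gamma>. \<exists>k\<in>K. h = \<gamma> ** g ** k"
  then obtain \<gamma> k where gk: "\<gamma> \<in> \<Gamma>" "k \<in> K" "h = \<gamma> ** g ** k" by blast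
  have "lorentz_inv \<gamma> ** h ** lorentz_inv k = (lorentz_inv \<gamma> ** \<gamma>) ** g ** (k ** lorentz_inv k)"
    unfolding gk(3) by (simp add: matrix_mul_assoc)
  also have "\<dots> = g"
    by (simp add: lorentz_inv_left[OF lorentz_subgroupD(5)[OF \<Gamma> gk(1)]] lorentz_inv_right[OF lorentz_subgroupD(5)[OF K gk(2)]])
  finally have "g = lorentz_inv \<gamma> ** h ** lorentz_inv k" by simp
  then have "dcoset \<Gamma> K g \<subseteq> dcoset \<Gamma> K h"
    using sub[OF lorentz_subgroupD(4)[OF \<Gamma> gk(1)] lorentz_subgroupD(4)[OF K gk(2)], of h] by simp
  moreover have "dcoset \<Gamma> K h \<subseteq> dcoset \<Gamma> K g" using sub[OF gk(1,2), of g] gk(3) by simp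
  ultimately show "dcoset \<Gamma> K g = dcoset \<Gamma> K h" by blast
qed

lemma act_mult_boost_K1:
  assumes "\<gamma> \<in> O1" "k \<in> K1"
  shows "act (\<gamma> ** boost v ** k) 0 = act \<gamma> v"
proof -
  have k: "k \<in> O1" "act k 0 = 0" using assms(2) unfolding K1_eq by auto
  show ?thesis
    unfolding act_mult[OF mult_in_O1[OF assms(1) boost_in_O1] k(1)] k(2) act_mult[OF assms(1) boost_in_O1] by simp
qed

lemma boost_act_ex:
  assumes "\<gamma> \<in> O1"
  shows "\<exists>k\<in>K1. boost (act \<gamma> v) = \<gamma> ** boost v ** k"
proof -
  have O: "\<gamma> ** boost v \<in> O1" by (rule mult_in_O1[OF assms boost_in_O1])
  obtain k where k: "k \<in> K1" "\<gamma> ** boost v = boost (act (\<gamma> ** boost v) 0) ** k" using cartan[OF O] by blast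
  have a: "act (\<gamma> ** boost v) 0 = act \<gamma> v" unfolding act_mult[OF assms boost_in_O1] by simp
  have "\<gamma> ** boost v ** lorentz_inv k = boost (act \<gamma> v)"
    unfolding k(2)[unfolded a] matrix_mul_assoc[symmetric] lorentz_inv_right[OF K1_subset_O1[OF k(1)]] by simp
  then show ?thesis using lorentz_inv_in_K1[OF k(1)] by metis
qed

lemma X_proj_boost_act:
  assumes \<Gamma>: "lorentz_subgroup \<Gamma>" and g: "g \<in> O1"
  shows "X_proj \<Gamma> g = X_proj \<Gamma> (boost (act g 0))"
proof -
  obtain k where k: "k \<in> K1" "g = boost (act g 0) ** k" using cartan[OF g] by blast
  have "g = mat 1 ** boost (act g 0) ** k" using k(2) by simp
  then have "X_proj \<Gamma> (boost (act g 0)) = X_proj \<Gamma> g"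
    unfolding X_proj_def dcoset_eq_iff[OF \<Gamma> lorentz_subgroup_K1] using k(1) lorentz_subgroupD(2)[OF \<Gamma>] by blast
  then show ?thesis by simp
qed

lemma X_proj_eq_iff:
  assumes \<Gamma>: "lorentz_subgroup \<Gamma>"
  shows "X_proj \<Gamma> (boost v) = X_proj \<Gamma> (boost w) \<longleftrightarrow> (\<exists>g\<in>\<Gamma>. w = act g v)"
  unfolding X_proj_def dcoset_eq_iff[OF \<Gamma> lorentz_subgroup_K1]
proof
  assume "\<exists>\<gamma>\<in>\<Gamma>. \<exists>k\<in>K1. boost w = \<gamma> ** boost v ** k"
  then obtain \<gamma> k where gk: "\<gamma> \<in> \<Gamma>" "k \<in> K1" "boost w = \<gamma> ** boost v ** k" by blast
  have "w = act \<gamma> v"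
    using act_mult_boost_K1[OF lorentz_subgroupD(5)[OF \<Gamma> gk(1)] gk(2), of v] unfolding gk(3)[symmetric] by simp
  then show "\<exists>g\<in>\<Gamma>. w = act g v" using gk by blast
next
  assume "\<exists>g\<in>\<Gamma>. w = act g v"
  then show "\<exists>\<gamma>\<in>\<Gamma>. \<exists>k\<in>K1. boost w = \<gamma> ** boost v ** k"
    using boost_act_ex lorentz_subgroupD(5)[OF \<Gamma>] by blast
qed

lemma discrete_subgroup_proper:
  fixes \<Gamma> :: "'d::finite lmat set"
  assumes \<Gamma>: "lorentz_subgroup \<Gamma>" and "discrete \<Gamma>"
  shows "finite {g \<in> \<Gamma>. \<exists>v\<in>cball 0 \<rho>. act g v \<in> cball 0 \<rho>}"
proof (rule finite_subset[OF _ finite_discrete_bounded[OF lorentz_subgroupD(1)[OF \<Gamma>] assms(2) lorentz_subgroupD(2)[OF \<Gamma>]]])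
  let ?M = "real CARD('d option) * ((real CARD('d option) * ((2 + \<rho> + \<rho>\<^sup>2) * 1)) * (2 + \<rho> + \<rho>\<^sup>2))"
  show "{g \<in> \<Gamma>. \<exists>v\<in>cball 0 \<rho>. act g v \<in> cball 0 \<rho>} \<subseteq> {g \<in> \<Gamma>. \<forall>i j. \<bar>g $ i $ j\<bar> \<le> ?M}"
  proof
    fix g assume "g \<in> {g \<in> \<Gamma>. \<exists>v\<in>cball 0 \<rho>. act g v \<in> cball 0 \<rho>}"
    then obtain v where g: "g \<in> \<Gamma>" and v: "norm v \<le> \<rho>" "norm (act g v) \<le> \<rho>" by auto
    have "\<bar>g $ i $ j\<bar> \<le> ?M" for i j by (rule act_bounded_entries[OF lorentz_subgroupD(5)[OF \<Gamma> g] v])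
    then show "g \<in> {g \<in> \<Gamma>. \<forall>i j. \<bar>g $ i $ j\<bar> \<le> ?M}" using g by blast
  qed
qed (use lorentz_subgroupD[OF \<Gamma>] in blast)+

text \<open>All powers of an element that fixes a point fix it too, so they lie in a finite set by
  proper discontinuity. Two of them coincide, and the element has finite order.\<close>

lemma torsion_free_imp_free:
  fixes \<Gamma> :: "'d::finite lmat set"
  assumes \<Gamma>: "lorentz_subgroup \<Gamma>" and disc: "discrete \<Gamma>" and tf: "torsion_free (matrix_group O1) \<Gamma>"
    and g: "g \<in> \<Gamma>" "act g v = v"
  shows "g = mat 1"
proof -
  define P where "P n = g [^]\<^bsub>matrix_group O1\<^esub> n" for n :: nat
  have P: "P 0 = mat 1" "\<And>n. P (Suc n) = P n ** g" by (simp_all add: P_def nat_pow_def matrix_group_def)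
  have PG: "P n \<in> \<Gamma>" for n by (induction n) (use P lorentz_subgroupD[OF \<Gamma>] g in auto)
  have Pv: "act (P n) v = v" for n
    by (induction n) (simp_all add: P act_mult[OF lorentz_subgroupD(5)[OF \<Gamma> PG] lorentz_subgroupD(5)[OF \<Gamma> g(1)]] g(2))
  have Padd: "P (i + k) = P i ** P k" for i k by (induction k) (auto simp: P matrix_mul_assoc)
  have "range P \<subseteq> {g \<in> \<Gamma>. \<exists>u\<in>cball 0 (norm v). act g u \<in> cball 0 (norm v)}"
    using PG Pv by (auto intro!: bexI[of _ v])
  then have "finite (range P)" using discrete_subgroup_proper[OF \<Gamma> disc] finite_subset by blast
  then have "\<not> inj P" using finite_imageD infinite_UNIV_nat by blast
  then obtain i j where "i < j" "P i = P j" unfolding inj_def by (metis linorder_neqE_nat)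
  then have "P i = P i ** P (j - i)" using Padd[of i "j - i"] by simp
  then have "lorentz_inv (P i) ** P i = lorentz_inv (P i) ** P i ** P (j - i)" by (metis matrix_mul_assoc)
  then have "P (j - i) = mat 1" using lorentz_inv_left[OF lorentz_subgroupD(5)[OF \<Gamma> PG]] by simp
  then show ?thesis using tf g(1) \<open>i < j\<close> unfolding torsion_free_def P_def
    by (auto simp: matrix_group_def dest!: bspec[where x = g] spec[where x = "j - i"])
qed

lemma quotient_by_lattice:
  fixes \<Gamma> :: "'d::finite lmat set"
  assumes \<Gamma>: "lorentz_subgroup \<Gamma>" and disc: "discrete \<Gamma>" and tf: "torsion_free (matrix_group O1) \<Gamma>"
  shows "quotient_by_action \<Gamma> (X_proj \<Gamma>)"
proof
  show "g = mat 1" if "g \<in> \<Gamma>" "act g v = v" for g v by (rule torsion_free_imp_free[OF \<Gamma> disc tf that])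
  show "finite {g \<in> \<Gamma>. \<exists>v\<in>cball 0 \<rho>. act g v \<in> cball 0 \<rho>}" for \<rho> by (rule discrete_subgroup_proper[OF \<Gamma> disc])
  show "(X_proj \<Gamma> (boost v) = X_proj \<Gamma> (boost w)) = (\<exists>g\<in>\<Gamma>. w = act g v)" for v w by (rule X_proj_eq_iff[OF \<Gamma>])
qed (use lorentz_subgroupD[OF \<Gamma>] in blast)+

text \<open>The image of \<open>\<Gamma> \<inter> cycle_group\<close> in \<open>O(1, d - 1)\<close>.
  The sign \<open>e\<close> is dropped because it acts trivially on the hyperplane covering
  \<open>Y\<close>, which becomes a quotient of hyperbolic space of dimension \<open>d - 1\<close>
  by this group.\<close>

definition cycle_lattice :: "'n::finite option lmat set \<Rightarrow> 'n lmat set" where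
  "cycle_lattice \<Gamma> = {h \<in> O1. \<exists>e. (e = 1 \<or> e = - 1) \<and> block_diag h e \<in> \<Gamma>}"

lemma lorentz_inv_block_diag:
  assumes "g \<in> O1" "e = 1 \<or> e = - 1"
  shows "lorentz_inv (block_diag g e) = block_diag (lorentz_inv g) e"
proof (rule lorentz_inv_unique[OF block_diag_in_O1[OF assms]])
  have "e * e = 1" using assms(2) by auto
  then show "block_diag (lorentz_inv g) e ** block_diag g e = mat 1"
    unfolding block_diag_mult_block_diag lorentz_inv_left[OF assms(1)] by (simp add: block_diag_mat_1)
qed

lemma sign_mult: "(e = 1 \<or> e = - 1) \<Longrightarrow> (f = 1 \<or> f = - 1) \<Longrightarrow> e * f = 1 \<or> e * f = (- 1 :: real)"
  by auto

lemma lorentz_subgroup_cycle_group: "lorentz_subgroup cycle_group"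
  unfolding lorentz_subgroup_def
proof (intro conjI ballI subsetI)
  show "mat 1 \<in> cycle_group"
    unfolding cycle_group_def mem_Collect_eq
    by (rule exI[of _ "mat 1"], rule exI[of _ 1]) (simp add: block_diag_mat_1 mat_1_in_O1)
  fix g :: "'a option lmat" assume "g \<in> cycle_group"
  then obtain g0 e where g: "g = block_diag g0 e" "g0 \<in> O1" "e = 1 \<or> e = - 1" unfolding cycle_group_def by blast
  show "g \<in> O1" unfolding g(1) by (rule block_diag_in_O1[OF g(2,3)])
  show "lorentz_inv g \<in> cycle_group"
    unfolding g(1) lorentz_inv_block_diag[OF g(2,3)] cycle_group_def using lorentz_inv_in_O1[OF g(2)] g(3) by blast
  fix h :: "'a option lmat" assume "h \<in> cycle_group"
  then obtain h0 f where h: "h = block_diag h0 f" "h0 \<in> O1" "f = 1 \<or> f = - 1" unfolding cycle_group_def by blast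
  show "g ** h \<in> cycle_group"
    unfolding g(1) h(1) block_diag_mult_block_diag cycle_group_def using mult_in_O1[OF g(2) h(2)] sign_mult[OF g(3) h(3)] by blast
qed

lemma fermi_0: "fermi w 0 = cons_vec 0 w"
  by (simp add: fermi_def)

lemma norm_fermi_0: "norm (fermi w 0) = norm w"
  using norm_cons_vec[of 0 w] by (simp add: fermi_0)

lemma act_block_diag_0:
  assumes "h \<in> O1" "e = 1 \<or> e = - 1"
  shows "act (block_diag h e) (fermi w 0) = fermi (act h w) 0" "act (block_diag h e) 0 = fermi (act h 0) 0"
  using act_block_diag_fermi[OF assms, of w 0] act_block_diag_fermi[OF assms, of 0 0] by (simp_all add: fermi_0_0)

lemma block_diag_in_K1:
  assumes "h \<in> O1" "e = 1 \<or> e = - 1"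
  shows "block_diag h e \<in> K1 \<longleftrightarrow> h \<in> K1"
proof -
  have "fermi (act h 0) 0 = 0 \<longleftrightarrow> act h 0 = 0"
    using norm_fermi_0[of "act h 0"] by (metis norm_eq_zero)
  then show ?thesis unfolding K1_eq using assms block_diag_in_O1[OF assms] act_block_diag_0(2)[OF assms] by simp
qed

text \<open>The compact factor may carry the sign of the lattice element as well:
  \<open>block_diag k e\<close> cancels the \<open>e\<close> of \<open>block_diag h e\<close>, since
  \<open>e * e = 1\<close>.\<close>

lemma Y_proj_eq_iff:
  fixes \<Gamma> :: "'n::finite option lmat set"
  assumes \<Gamma>: "lorentz_subgroup \<Gamma>"
  shows "Y_proj \<Gamma> (boost v) = Y_proj \<Gamma> (boost w) \<longleftrightarrow> (\<exists>g\<in>cycle_lattice \<Gamma>. w = act g v)"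
  unfolding Y_proj_def dcoset_eq_iff[OF lorentz_subgroup_Int[OF \<Gamma> lorentz_subgroup_cycle_group]
      lorentz_subgroup_Int[OF lorentz_subgroup_K1 lorentz_subgroup_cycle_group]]
proof
  assume "\<exists>\<gamma>\<in>\<Gamma> \<inter> cycle_group. \<exists>k\<in>K1 \<inter> cycle_group. block_diag (boost w) 1 = \<gamma> ** block_diag (boost v) 1 ** k"
  then obtain \<gamma> k where \<gamma>: "\<gamma> \<in> \<Gamma>" "\<gamma> \<in> cycle_group" and k: "k \<in> K1" "k \<in> cycle_group"
    and eq: "block_diag (boost w) 1 = \<gamma> ** block_diag (boost v) 1 ** k" by blast
  obtain h e where h: "\<gamma> = block_diag h e" "h \<in> O1" "e = 1 \<or> e = - 1" using \<gamma>(2) unfolding cycle_group_def by blast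
  obtain l f where l: "k = block_diag l f" "l \<in> O1" "f = 1 \<or> f = - 1" using k(2) unfolding cycle_group_def by blast
  have lK: "l \<in> K1" using k(1) block_diag_in_K1[OF l(2,3)] unfolding l(1) by simp
  have "boost w = h ** boost v ** l"
    using eq unfolding h(1) l(1) block_diag_mult_block_diag by (blast dest: block_diag_inject)
  then have "w = act h v" using act_mult_boost_K1[OF h(2) lK, of v] by (metis act_boost_0)
  then show "\<exists>g\<in>cycle_lattice \<Gamma>. w = act g v" using h \<gamma> unfolding cycle_lattice_def by blast
next
  assume "\<exists>g\<in>cycle_lattice \<Gamma>. w = act g v"
  then obtain h e where h: "h \<in> O1" "e = 1 \<or> e = - 1" "block_diag h e \<in> \<Gamma>" "w = act h v" unfolding cycle_lattice_def by blast
  obtain k where k: "k \<in> K1" "boost w = h ** boost v ** k" using boost_act_ex[OF h(1), of v] h(4) by blast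
  have ee: "e * 1 * e = 1" using h(2) by auto
  have kO: "k \<in> O1" by (rule K1_subset_O1[OF k(1)])
  have "block_diag (boost w) 1 = block_diag h e ** block_diag (boost v) 1 ** block_diag k e"
    unfolding block_diag_mult_block_diag ee k(2) ..
  moreover have "block_diag h e \<in> \<Gamma> \<inter> cycle_group" using h unfolding cycle_group_def by blast
  moreover have "block_diag k e \<in> K1 \<inter> cycle_group"
    using block_diag_in_K1[OF kO h(2)] k(1) kO h(2) unfolding cycle_group_def by blast
  ultimately show "\<exists>\<gamma>\<in>\<Gamma> \<inter> cycle_group. \<exists>k\<in>K1 \<inter> cycle_group. block_diag (boost w) 1 = \<gamma> ** block_diag (boost v) 1 ** k"
    by blast
qed

lemma Y_proj_boost_act:
  fixes \<Gamma> :: "'n::finite option lmat set"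
  assumes \<Gamma>: "lorentz_subgroup \<Gamma>" and g: "g \<in> O1"
  shows "Y_proj \<Gamma> g = Y_proj \<Gamma> (boost (act g 0))"
proof -
  obtain k where k: "k \<in> K1" "g = boost (act g 0) ** k" using cartan[OF g] by blast
  have kO: "k \<in> O1" by (rule K1_subset_O1[OF k(1)])
  have "block_diag g 1 = mat 1 ** block_diag (boost (act g 0)) 1 ** block_diag k 1"
    using k(2) by (simp add: block_diag_mult_block_diag)
  moreover have "block_diag k 1 \<in> K1 \<inter> cycle_group"
    using block_diag_in_K1[OF kO, of 1] k(1) kO unfolding cycle_group_def by blast
  ultimately have "Y_proj \<Gamma> (boost (act g 0)) = Y_proj \<Gamma> g"
    unfolding Y_proj_def dcoset_eq_iff[OF lorentz_subgroup_Int[OF \<Gamma> lorentz_subgroup_cycle_group]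
      lorentz_subgroup_Int[OF lorentz_subgroup_K1 lorentz_subgroup_cycle_group]]
    using lorentz_subgroupD(2)[OF lorentz_subgroup_Int[OF \<Gamma> lorentz_subgroup_cycle_group]] by blast
  then show ?thesis by simp
qed

text \<open>The factors from \<open>\<Gamma> \<inter> cycle_group\<close> and
  \<open>K1 \<inter> cycle_group\<close> are absorbed by \<open>\<Gamma>\<close> and
  \<open>K1\<close>. In Fermi coordinates the cycle therefore lies at \<open>t = 0\<close>.\<close>

lemma natural_map_Y_proj:
  fixes \<Gamma> :: "'n::finite option lmat set"
  assumes \<Gamma>: "lorentz_subgroup \<Gamma>"
  shows "natural_map \<Gamma> (Y_proj \<Gamma> (boost w)) = X_proj \<Gamma> (boost (fermi w 0))"
proof -
  let ?g = "block_diag (boost w) 1"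
  have nm: "x \<in> natural_map \<Gamma> y \<longleftrightarrow> (\<exists>\<gamma>\<in>\<Gamma>. \<exists>z\<in>y. \<exists>k\<in>K1. x = \<gamma> ** z ** k)" for x and y :: "'n option lmat set"
    by (auto simp: natural_map_def set_mult_def matrix_group_def)
  have "natural_map \<Gamma> (Y_proj \<Gamma> (boost w)) = dcoset \<Gamma> K1 ?g"
  proof (intro equalityI subsetI)
    fix x assume "x \<in> natural_map \<Gamma> (Y_proj \<Gamma> (boost w))"
    then obtain \<gamma> z k where z: "\<gamma> \<in> \<Gamma>" "z \<in> Y_proj \<Gamma> (boost w)" "k \<in> K1" "x = \<gamma> ** z ** k" unfolding nm by blast
    from z(2) obtain \<delta> l where dl: "\<delta> \<in> \<Gamma>" "l \<in> K1" "z = \<delta> ** ?g ** l"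
      unfolding Y_proj_def dcoset_iff by blast
    have *: "\<gamma> \<in> \<Gamma>" "\<delta> \<in> \<Gamma>" "k \<in> K1" "l \<in> K1" "x = \<gamma> ** (\<delta> ** ?g ** l) ** k" using z dl by simp_all
    have "x = (\<gamma> ** \<delta>) ** ?g ** (l ** k)" unfolding *(5) by (simp add: matrix_mul_assoc)
    then show "x \<in> dcoset \<Gamma> K1 ?g" unfolding dcoset_iff using lorentz_subgroupD(3)[OF \<Gamma> *(1,2)] mult_in_K1[OF *(4,3)] by blast
  next
    fix x assume "x \<in> dcoset \<Gamma> K1 ?g"
    then obtain \<gamma> k where *: "\<gamma> \<in> \<Gamma>" "k \<in> K1" "x = \<gamma> ** ?g ** k" unfolding dcoset_iff by blast
    have "?g = mat 1 ** ?g ** mat 1" by simp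
    then have "?g \<in> Y_proj \<Gamma> (boost w)"
      unfolding Y_proj_def dcoset_iff
      using lorentz_subgroupD(2)[OF lorentz_subgroup_Int[OF \<Gamma> lorentz_subgroup_cycle_group]]
        lorentz_subgroupD(2)[OF lorentz_subgroup_Int[OF lorentz_subgroup_K1 lorentz_subgroup_cycle_group]] by blast
    then show "x \<in> natural_map \<Gamma> (Y_proj \<Gamma> (boost w))" unfolding nm using * by blast
  qed
  also have "\<dots> = X_proj \<Gamma> (boost (act ?g 0))"
    using X_proj_boost_act[OF \<Gamma> block_diag_in_O1[OF boost_in_O1]] unfolding X_proj_def by simp
  also have "act ?g 0 = fermi w 0"
    using act_block_diag_0(2)[OF boost_in_O1, of 1 w] by simp
  finally show ?thesis .
qed

text \<open>Freeness and properness are inherited from \<open>\<Gamma>\<close>: if \<open>g\<close>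
  fixes \<open>v\<close>, then \<open>block_diag g e\<close> fixes \<open>fermi v 0\<close> and is
  the identity. In particular the reflection \<open>block_diag (mat 1) (- 1)\<close> cannot occur in
  \<open>\<Gamma>\<close>.\<close>

lemma quotient_by_cycle_lattice:
  fixes \<Gamma> :: "'n::finite option lmat set"
  assumes \<Gamma>: "lorentz_subgroup \<Gamma>" and disc: "discrete \<Gamma>" and tf: "torsion_free (matrix_group O1) \<Gamma>"
  shows "quotient_by_action (cycle_lattice \<Gamma>) (Y_proj \<Gamma>)"
proof
  show "cycle_lattice \<Gamma> \<subseteq> O1" unfolding cycle_lattice_def by blast
  show "mat 1 \<in> cycle_lattice \<Gamma>"
    unfolding cycle_lattice_def using mat_1_in_O1 lorentz_subgroupD(2)[OF \<Gamma>] by (auto intro!: exI[of _ 1] simp: block_diag_mat_1)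
  fix g assume "g \<in> cycle_lattice \<Gamma>"
  then obtain e where g: "g \<in> O1" "e = 1 \<or> e = - 1" "block_diag g e \<in> \<Gamma>" unfolding cycle_lattice_def by blast
  show "lorentz_inv g \<in> cycle_lattice \<Gamma>"
    using lorentz_subgroupD(4)[OF \<Gamma> g(3)] lorentz_inv_in_O1[OF g(1)] g(2)
    unfolding lorentz_inv_block_diag[OF g(1,2)] cycle_lattice_def by blast
  show "g = mat 1" if "act g v = v" for v
  proof -
    have "block_diag g e = mat 1"
      using torsion_free_imp_free[OF \<Gamma> disc tf g(3), of "fermi v 0"] act_block_diag_0(1)[OF g(1,2), of v] that by simp
    then show ?thesis using block_diag_inject[of g e "mat 1" 1] by (simp add: block_diag_mat_1)
  qed
  fix h assume "h \<in> cycle_lattice \<Gamma>"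
  then obtain f where h: "h \<in> O1" "f = 1 \<or> f = - 1" "block_diag h f \<in> \<Gamma>" unfolding cycle_lattice_def by blast
  show "g ** h \<in> cycle_lattice \<Gamma>"
    using lorentz_subgroupD(3)[OF \<Gamma> g(3) h(3)] mult_in_O1[OF g(1) h(1)] sign_mult[OF g(2) h(2)]
    unfolding block_diag_mult_block_diag cycle_lattice_def by blast
next
  fix \<rho> :: real
  let ?S = "{g \<in> \<Gamma>. \<exists>v\<in>cball 0 \<rho>. act g v \<in> cball 0 \<rho>}"
  have inj: "inj (\<lambda>h. block_diag h e)" for e by (rule injI) (blast dest: block_diag_inject)
  have "{g \<in> cycle_lattice \<Gamma>. \<exists>v\<in>cball 0 \<rho>. act g v \<in> cball 0 \<rho>} \<subseteq> (\<Union>e\<in>{1, - 1}. (\<lambda>h. block_diag h e) -` ?S)"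
  proof
    fix g assume "g \<in> {g \<in> cycle_lattice \<Gamma>. \<exists>v\<in>cball 0 \<rho>. act g v \<in> cball 0 \<rho>}"
    then obtain v where gL: "g \<in> cycle_lattice \<Gamma>" and v: "norm v \<le> \<rho>" "norm (act g v) \<le> \<rho>" by auto
    from gL obtain e where g: "g \<in> O1" "e = 1 \<or> e = - 1" "block_diag g e \<in> \<Gamma>"
      unfolding cycle_lattice_def by blast
    have "block_diag g e \<in> ?S"
      using g(3) v act_block_diag_0(1)[OF g(1,2), of v] by (auto simp: norm_fermi_0 intro!: bexI[of _ "fermi v 0"])
    then show "g \<in> (\<Union>e\<in>{1, - 1}. (\<lambda>h. block_diag h e) -` ?S)" using g(2) by blast
  qed
  moreover have "finite (\<Union>e\<in>{1, - 1}. (\<lambda>h. block_diag h e) -` ?S)"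
    by (intro finite_UN_I finite_vimageI discrete_subgroup_proper[OF \<Gamma> disc] inj) auto
  ultimately show "finite {g \<in> cycle_lattice \<Gamma>. \<exists>v\<in>cball 0 \<rho>. act g v \<in> cball 0 \<rho>}" by (rule finite_subset)
next
  show "(Y_proj \<Gamma> (boost v) = Y_proj \<Gamma> (boost w)) = (\<exists>g\<in>cycle_lattice \<Gamma>. w = act g v)" for v w
    by (rule Y_proj_eq_iff[OF \<Gamma>])
qed

lemma norm_act_0_le: "norm (act g 0) \<le> norm (g *v pt 0)"
proof -
  let ?x = "g *v pt 0"
  have "norm (act g 0) = \<bar>sgn (?x $ None)\<bar> * norm (space_part ?x)" by (simp add: act_def)
  also have "\<dots> \<le> 1 * norm (space_part ?x)" by (intro mult_right_mono) (auto simp: sgn_if)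
  also have "\<dots> \<le> norm ?x" unfolding norm_eq_sqrt_inner inner_option[of ?x ?x] by simp
  finally show ?thesis .
qed

text \<open>Every \<open>v\<close> is the image of the origin under \<open>boost v\<close>, and a
  compact set of representatives moves the origin by a bounded amount only.\<close>

lemma cycle_lattice_cocompact:
  fixes \<Gamma> :: "'n::finite option lmat set"
  assumes "uniform_lattice_in cycle_group (\<Gamma> \<inter> cycle_group)"
  shows "\<exists>\<rho>. \<forall>v. \<exists>g\<in>cycle_lattice \<Gamma>. act (lorentz_inv g) v \<in> cball 0 \<rho>"
proof -
  obtain C where C: "compact C" "C \<subseteq> cycle_group" "(\<Gamma> \<inter> cycle_group) <#>\<^bsub>matrix_group cycle_group\<^esub> C = cycle_group"
    using assms unfolding uniform_lattice_in_def by blast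
  have "continuous_on C (\<lambda>g. g *v pt 0)"
    unfolding matrix_vector_mult_def by (intro continuous_intros)
  then have "bounded ((\<lambda>g. g *v pt 0) ` C)" by (rule compact_imp_bounded[OF compact_continuous_image[OF _ C(1)]])
  then obtain \<rho> where \<rho>: "\<And>g. g \<in> C \<Longrightarrow> norm (g *v pt 0) \<le> \<rho>" unfolding bounded_iff by auto
  have "\<exists>g\<in>cycle_lattice \<Gamma>. act (lorentz_inv g) v \<in> cball 0 \<rho>" for v
  proof -
    have "block_diag (boost v) 1 \<in> cycle_group" unfolding cycle_group_def using boost_in_O1 by blast
    then have "block_diag (boost v) 1 \<in> (\<Gamma> \<inter> cycle_group) <#>\<^bsub>matrix_group cycle_group\<^esub> C" by (simp only: C(3))
    then obtain \<gamma> c where *: "\<gamma> \<in> \<Gamma>" "\<gamma> \<in> cycle_group" "c \<in> C" "block_diag (boost v) 1 = \<gamma> ** c"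
      unfolding set_mult_def matrix_group_def by auto
    obtain h e where h: "\<gamma> = block_diag h e" "h \<in> O1" "e = 1 \<or> e = - 1" using *(2) unfolding cycle_group_def by blast
    obtain l f where l: "c = block_diag l f" "l \<in> O1" "f = 1 \<or> f = - 1" using *(3) C(2) unfolding cycle_group_def by blast
    have "boost v = h ** l"
      using block_diag_inject[OF *(4)[unfolded h(1) l(1) block_diag_mult_block_diag]] by simp
    then have "act (boost v) 0 = act h (act l 0)" by (simp only: act_mult[OF h(2) l(2)])
    then have "act (lorentz_inv h) v = act l 0" using act_lorentz_inv(1)[OF h(2), of "act l 0"] by simp
    moreover have "norm (act l 0) \<le> \<rho>"
      using norm_fermi_0[of "act l 0"] act_block_diag_0(2)[OF l(2,3)] norm_act_0_le[of c] \<rho>[OF *(3)] unfolding l(1) by simp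
    moreover have "h \<in> cycle_lattice \<Gamma>" unfolding cycle_lattice_def using h *(1) by blast
    ultimately show ?thesis by (intro bexI[of _ h]) simp_all
  qed
  then show ?thesis by blast
qed

section \<open>Reduction to an ordinary differential equation\<close>

lemma chart_laplacian_half_sum:
  assumes "C2 F" "C2 G"
  shows "chart_laplacian (\<lambda>w. (1/2) *\<^sub>R (F w + G w)) w = (1/2) *\<^sub>R (chart_laplacian F w + chart_laplacian G w)"
  unfolding chart_laplacian_def C2_half_sum(2,3)[OF assms] scaleR_sum_right sum.distrib[symmetric]
  by (intro sum.cong refl) (simp add: algebra_simps)

lemma has_vector_derivative_reflect:
  assumes "(f has_vector_derivative f') (at (- t))"
  shows "((\<lambda>s. f (- s)) has_vector_derivative - f') (at (t :: real))"
proof -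
  have "(uminus has_vector_derivative - 1) (at t)"
    by (auto intro!: derivative_eq_intros)
  from vector_diff_chain_at[OF this, of f f'] assms show ?thesis by (simp add: o_def)
qed

lemma continuous_on_fermi': "continuous_on S (\<lambda>p. fermi' (fst p) (snd p))"
proof -
  have "continuous_on S (\<lambda>p. fermi' (fst p) (snd p) $ i)" for i :: "'a::finite option"
    by (cases i) (auto simp: fermi'_def intro!: continuous_intros)
  then have "continuous_on S (\<lambda>p. \<chi> i. fermi' (fst p) (snd p) $ i)" by (rule continuous_on_vec_lambda)
  then show ?thesis by simp
qed

text \<open>The factor \<open>cosh t powr m\<close>, used with \<open>m = n / 2\<close>, removes the
  first-order term. For eigenvalues \<open>m^2 + r^2\<close> and \<open>(m - 1/2)^2 + s^2\<close>
  the terms in \<open>m\<close> cancel: with \<open>T = tanh t\<close>, \<open>m^2 * T^2 + m * (1 -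
  T^2) + (m - 1/2)^2 * (1 - T^2) - m^2 = (1 - T^2) / 4\<close>. This is the origin of the 1/4 in the
  potential.\<close>

lemma liouville_transform:
  fixes u u1 u2 :: "real \<Rightarrow> real"
  assumes u: "\<And>t. (u has_real_derivative u1 t) (at t)" and u1: "\<And>t. (u1 has_real_derivative u2 t) (at t)"
    and eq: "\<And>t. (cosh t)\<^sup>2 * u2 t + (2 * m * (cosh t * sinh t)) * u1 t
      = ((m - 1/2)\<^sup>2 + s\<^sup>2 - (m\<^sup>2 + r\<^sup>2) * (cosh t)\<^sup>2) * u t"
  shows "((\<lambda>t. cosh t powr m * u t) has_real_derivative cosh t powr m * (u1 t + m * tanh t * u t)) (at t)"
    and "((\<lambda>t. cosh t powr m * (u1 t + m * tanh t * u t)) has_real_derivative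
       ((s\<^sup>2 + 1/4) * (1 - (tanh t)\<^sup>2) - r\<^sup>2) * (cosh t powr m * u t)) (at t)"
proof -
  have c: "cosh t > 0" by (rule cosh_real_pos)
  have "((\<lambda>t. cosh t powr m) has_real_derivative (m * cosh t powr (m - 1)) * sinh t) (at t)"
    by (rule DERIV_chain2[where f = "\<lambda>z. z powr m" and g = cosh, OF has_real_derivative_powr[OF c]]) (auto intro!: derivative_eq_intros)
  moreover have "(m * cosh t powr (m - 1)) * sinh t = m * tanh t * cosh t powr m"
    using c by (simp add: powr_diff tanh_def)
  ultimately have dc: "((\<lambda>t. cosh t powr m) has_real_derivative m * tanh t * cosh t powr m) (at t)" by simp
  have dt: "(tanh has_real_derivative 1 - (tanh t)\<^sup>2) (at t)"
    using c by (auto intro!: derivative_eq_intros)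
  show "((\<lambda>t. cosh t powr m * u t) has_real_derivative cosh t powr m * (u1 t + m * tanh t * u t)) (at t)"
    by (rule DERIV_cong[OF DERIV_mult[OF dc u]]) (simp add: algebra_simps)
  define T where "T = tanh t"
  have sh: "sinh t = T * cosh t" using c by (simp add: T_def tanh_def)
  then have "(cosh t)\<^sup>2 * (1 - T\<^sup>2) = (cosh t)\<^sup>2 - (sinh t)\<^sup>2" by (simp add: power2_eq_square algebra_simps)
  then have cs: "(cosh t)\<^sup>2 * (1 - T\<^sup>2) = 1" "sinh t = T * cosh t"
    using cosh_square_eq[of t] sh by simp_all
  have "(cosh t)\<^sup>2 * (u2 t + 2 * m * T * u1 t) = (cosh t)\<^sup>2 * u2 t + (2 * m * (cosh t * sinh t)) * u1 t"
    unfolding cs(2) by (simp add: power2_eq_square algebra_simps)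
  also have "\<dots> = (((m - 1/2)\<^sup>2 + s\<^sup>2) * ((cosh t)\<^sup>2 * (1 - T\<^sup>2)) - (m\<^sup>2 + r\<^sup>2) * (cosh t)\<^sup>2) * u t"
    unfolding cs(1) eq by simp
  also have "\<dots> = (cosh t)\<^sup>2 * ((((m - 1/2)\<^sup>2 + s\<^sup>2) * (1 - T\<^sup>2) - (m\<^sup>2 + r\<^sup>2)) * u t)"
    by (simp add: algebra_simps)
  finally have X: "u2 t + 2 * m * T * u1 t = (((m - 1/2)\<^sup>2 + s\<^sup>2) * (1 - T\<^sup>2) - (m\<^sup>2 + r\<^sup>2)) * u t"
    using c by simp
  have "((\<lambda>t. cosh t powr m * (u1 t + m * tanh t * u t)) has_real_derivative
      m * tanh t * cosh t powr m * (u1 t + m * tanh t * u t)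
      + (u2 t + (m * (1 - (tanh t)\<^sup>2) * u t + u1 t * (m * tanh t))) * cosh t powr m) (at t)"
    by (intro DERIV_mult[OF dc] DERIV_add[OF u1] DERIV_mult[OF _ u] DERIV_cmult[OF dt])
  moreover have "m * T * P * (a + m * T * y) + (b + (m * (1 - T\<^sup>2) * y + a * (m * T))) * P
      = ((b + 2 * m * T * a) + (m\<^sup>2 * T\<^sup>2 + m * (1 - T\<^sup>2)) * y) * P" for P a b y
    by (simp add: power2_eq_square algebra_simps)
  moreover have "((((m - 1/2)\<^sup>2 + s\<^sup>2) * (1 - T\<^sup>2) - (m\<^sup>2 + r\<^sup>2)) * y + (m\<^sup>2 * T\<^sup>2 + m * (1 - T\<^sup>2)) * y) * P
      = ((s\<^sup>2 + 1/4) * (1 - T\<^sup>2) - r\<^sup>2) * (P * y)" for P y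
    by (simp add: power2_eq_square algebra_simps)
  ultimately show "((\<lambda>t. cosh t powr m * (u1 t + m * tanh t * u t)) has_real_derivative
       ((s\<^sup>2 + 1/4) * (1 - (tanh t)\<^sup>2) - r\<^sup>2) * (cosh t powr m * u t)) (at t)"
    using X unfolding T_def by (simp only:)
qed

text \<open>Bridge between the gauge integral of the estimates for the equation and the nonnegative
  Lebesgue integral in which the mass of the profile is bounded.\<close>

lemma integral_square_le:
  fixes v g :: "real \<Rightarrow> real"
  assumes v: "continuous_on UNIV v" and le: "\<And>t. (v t)\<^sup>2 \<le> g t"
    and N: "(\<integral>\<^sup>+t. ennreal (g t) * indicator {0..T} t \<partial>lborel) \<le> ennreal N" "0 \<le> N"
  shows "integral {0..T} (\<lambda>t. (v t)\<^sup>2) \<le> N"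
proof -
  have "(\<lambda>t. (v t)\<^sup>2) integrable_on {0..T}"
    by (intro integrable_continuous_interval continuous_intros continuous_on_subset[OF v subset_UNIV])
  from nn_integral_has_integral_lebesgue'[OF _ integrable_integral[OF this]]
  have "ennreal (integral {0..T} (\<lambda>t. (v t)\<^sup>2)) = (\<integral>\<^sup>+t. ennreal ((v t)\<^sup>2) * indicator {0..T} t \<partial>lborel)" by simp
  also have "\<dots> \<le> (\<integral>\<^sup>+t. ennreal (g t) * indicator {0..T} t \<partial>lborel)"
    using le by (intro nn_integral_mono mult_right_mono ennreal_leI) auto
  also have "\<dots> \<le> ennreal N" by (rule N)
  finally show ?thesis using N(2) by simp
qed

context quotient_by_action
begin

context
  fixes B0
  assumes B0: "B0 \<in> sets borel" "inj_on q B0" "q ` B0 = range q" and B0_bounded: "bounded B0"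
begin

lemma integral_fundamental_linear:
  fixes a b :: "real ^ 'd \<Rightarrow> complex"
  assumes "continuous_on UNIV a" "continuous_on UNIV b"
  shows "(LINT w|hyperbolic_measure. indicator B0 w *\<^sub>R (a w + b w))
    = (LINT w|hyperbolic_measure. indicator B0 w *\<^sub>R a w) + (LINT w|hyperbolic_measure. indicator B0 w *\<^sub>R b w)"
    and "(LINT w|hyperbolic_measure. indicator B0 w *\<^sub>R (c *\<^sub>R a w)) = c *\<^sub>R (LINT w|hyperbolic_measure. indicator B0 w *\<^sub>R a w)"
proof -
  show "(LINT w|hyperbolic_measure. indicator B0 w *\<^sub>R (a w + b w))
    = (LINT w|hyperbolic_measure. indicator B0 w *\<^sub>R a w) + (LINT w|hyperbolic_measure. indicator B0 w *\<^sub>R b w)"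
    unfolding scaleR_add_right
    by (intro Bochner_Integration.integral_add integrable_fundamental_continuous[OF B0 B0_bounded] assms)
  have "indicator B0 w *\<^sub>R (c *\<^sub>R a w) = c *\<^sub>R (indicator B0 w *\<^sub>R a w)" for w by simp
  then show "(LINT w|hyperbolic_measure. indicator B0 w *\<^sub>R (c *\<^sub>R a w)) = c *\<^sub>R (LINT w|hyperbolic_measure. indicator B0 w *\<^sub>R a w)"
    by (simp only: integral_scaleR_right)
qed

text \<open>The fundamental domain is bounded, so \<open>h'\<close> is uniformly continuous on the
  compact set that matters, and the linearisation error is uniform in \<open>w\<close>.\<close>

lemma has_vector_derivative_integral_fundamental:
  fixes h h' :: "real \<Rightarrow> real ^ 'd \<Rightarrow> complex"
  assumes hd: "\<And>t w. ((\<lambda>t. h t w) has_vector_derivative h' t w) (at t)"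
    and ch: "\<And>t. continuous_on UNIV (h t)" and ch': "continuous_on UNIV (\<lambda>p. h' (fst p) (snd p))"
  shows "((\<lambda>t. LINT w|hyperbolic_measure. indicator B0 w *\<^sub>R h t w) has_vector_derivative
    (LINT w|hyperbolic_measure. indicator B0 w *\<^sub>R h' t w)) (at t)"
proof -
  let ?\<mu> = "hyperbolic_measure :: (real ^ 'd) measure"
  let ?I = "\<lambda>k. LINT w|?\<mu>. indicator B0 w *\<^sub>R (k w :: complex)"
  have "continuous_on UNIV (\<lambda>w. (\<lambda>p. h' (fst p) (snd p)) (s, w))" for s
    by (rule continuous_on_compose2[OF ch']) (auto intro!: continuous_intros)
  then have ch't: "continuous_on UNIV (h' s)" for s by simp
  note int = integrable_fundamental_continuous[OF B0 B0_bounded]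
  \<comment> \<open>The summand 1 keeps \<open>e / M\<close> meaningful when \<open>B0\<close> is a
    null set.\<close>
  define M where "M = measure ?\<mu> B0 + 1"
  have M: "M > 0" "measure ?\<mu> B0 \<le> M" by (simp_all add: M_def add_nonneg_pos)
  show ?thesis unfolding has_vector_derivative_def has_derivative_at_alt
  proof (intro conjI allI impI)
    show "bounded_linear (\<lambda>x. x *\<^sub>R ?I (h' t))" by (rule bounded_linear_scaleR_left)
    fix e :: real assume e: "e > 0"
    let ?K = "cball t 1 \<times> closure B0"
    have K: "compact ?K" by (intro compact_Times compact_cball) (use B0_bounded in \<open>simp add: compact_closure\<close>)
    have "uniformly_continuous_on ?K (\<lambda>p. h' (fst p) (snd p))"
      by (rule compact_uniformly_continuous[OF continuous_on_subset[OF ch' subset_UNIV] K])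
    moreover have "e / M > 0" using e M by simp
    ultimately obtain \<delta> where \<delta>: "\<delta> > 0"
      "\<forall>p\<in>?K. \<forall>p'\<in>?K. dist p' p < \<delta> \<longrightarrow> dist (h' (fst p') (snd p')) (h' (fst p) (snd p)) < e / M"
      unfolding uniformly_continuous_on_def by blast
    show "\<exists>d>0. \<forall>y. norm (y - t) < d \<longrightarrow> norm (?I (h y) - ?I (h t) - (y - t) *\<^sub>R ?I (h' t)) \<le> e * norm (y - t)"
    proof (intro exI[of _ "min \<delta> 1"] conjI allI impI)
      fix y assume y: "norm (y - t) < min \<delta> 1"
      have pt: "norm (h y w - h t w - (y - t) *\<^sub>R h' t w) \<le> norm (y - t) * (e / M)" if w: "w \<in> B0" for w
      proof (rule vector_differentiable_bound_linearization[where S = "closed_segment t y" and f = "\<lambda>t. h t w" and f' = "\<lambda>t. h' t w"])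
        fix x assume x: "x \<in> closed_segment t y"
        show "((\<lambda>t. h t w) has_vector_derivative h' x w) (at x within closed_segment t y)"
          by (rule has_vector_derivative_at_within[OF hd])
        have d: "dist x t \<le> norm (y - t)" using dist_in_closed_segment[OF x] by (simp add: dist_real_def) linarith
        have "(x, w) \<in> ?K" "(t, w) \<in> ?K" using d y w closure_subset[of B0] by (auto simp: dist_commute)
        moreover have "dist (x, w) (t, w) < \<delta>" using d y by (simp add: dist_Pair_Pair)
        ultimately have "dist (h' x w) (h' t w) < e / M" using \<delta>(2) by fastforce
        then show "norm (h' x w - h' t w) \<le> e / M" by (simp add: dist_norm)
      qed auto
      let ?r = "\<lambda>w. h y w - h t w - (y - t) *\<^sub>R h' t w"
      have cr: "continuous_on UNIV ?r" by (intro continuous_intros ch ch't)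
      have i3: "integrable ?\<mu> (\<lambda>w. (y - t) *\<^sub>R (indicator B0 w *\<^sub>R h' t w))"
        by (intro integrable_scaleR_right int ch't)
      have "?I ?r = (LINT w|?\<mu>. (indicator B0 w *\<^sub>R h y w - indicator B0 w *\<^sub>R h t w) - (y - t) *\<^sub>R (indicator B0 w *\<^sub>R h' t w))"
        by (simp add: scaleR_diff_right mult.commute)
      also have "\<dots> = ?I (h y) - ?I (h t) - (y - t) *\<^sub>R ?I (h' t)"
        unfolding Bochner_Integration.integral_diff[OF Bochner_Integration.integrable_diff[OF int[OF ch] int[OF ch]] i3]
          Bochner_Integration.integral_diff[OF int[OF ch] int[OF ch]] integral_scaleR_right ..
      finally have "norm (?I (h y) - ?I (h t) - (y - t) *\<^sub>R ?I (h' t)) \<le> (LINT w|?\<mu>. norm (indicator B0 w *\<^sub>R ?r w))"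
        using integral_norm_bound[of ?\<mu> "\<lambda>w. indicator B0 w *\<^sub>R ?r w"] by simp
      also have "\<dots> \<le> (LINT w|?\<mu>. norm (y - t) * (e / M) * indicator B0 w)"
      proof (rule integral_mono)
        show "integrable ?\<mu> (\<lambda>w. norm (indicator B0 w *\<^sub>R ?r w))" by (intro integrable_norm int cr)
        show "integrable ?\<mu> (\<lambda>w. norm (y - t) * (e / M) * indicator B0 w)"
          using B0(1) emeasure_hyperbolic_bounded[OF B0_bounded B0(1)] by (intro integrable_mult_right integrable_real_indicator) auto
        fix w show "norm (indicator B0 w *\<^sub>R ?r w) \<le> norm (y - t) * (e / M) * indicator B0 w"
          using pt[of w] by (auto simp: indicator_def)
      qed
      also have "\<dots> = norm (y - t) * (e / M) * measure ?\<mu> B0" using B0(1) by simp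
      also have "\<dots> \<le> norm (y - t) * (e / M) * M" using e M by (intro mult_left_mono) auto
      also have "\<dots> = e * norm (y - t)" using M by simp
      finally show "norm (?I (h y) - ?I (h t) - (y - t) *\<^sub>R ?I (h' t)) \<le> e * norm (y - t)" .
    qed (use \<delta>(1) in simp)
  qed
qed

text \<open>In \<open>F_inv\<close> the sign \<open>e\<close> may depend on the group element.
  According to \<open>time_sign g * e\<close> an element keeps the slices at \<open>t\<close> and
  \<open>- t\<close> or swaps them, and the half sum is invariant either way; this is what lets
  self-adjointness move the slice Laplacian onto the eigenfunction \<open>f\<close>.\<close>

lemma profile_equation:
  fixes F :: "real ^ 'd option \<Rightarrow> complex" and f :: "real ^ 'd \<Rightarrow> complex" and lam mu :: real
  assumes F: "C2 F" and f: "C2 f"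
    and sep: "\<And>w t. (cosh t)\<^sup>2 *\<^sub>R (D2 F (fermi w t) (fermi' w t) (fermi' w t) + D1 F (fermi w t) (fermi w t))
      + (real CARD('d) * (cosh t * sinh t)) *\<^sub>R D1 F (fermi w t) (fermi' w t)
      + chart_laplacian (\<lambda>w. F (fermi w t)) w = - (complex_of_real lam * (cosh t)\<^sup>2 *\<^sub>R F (fermi w t))"
    and eig: "\<And>w. chart_laplacian f w = - (complex_of_real mu * f w)"
    and f_inv: "\<And>g w. g \<in> \<Lambda> \<Longrightarrow> f (act g w) = f w"
    and F_inv: "\<And>g. g \<in> \<Lambda> \<Longrightarrow> \<exists>e. (e = 1 \<or> e = - 1) \<and> (\<forall>z. F (act (block_diag g e) z) = F z)"
  defines "U \<equiv> \<lambda>t. LINT w|hyperbolic_measure. indicator B0 w *\<^sub>R ((1/2) *\<^sub>R (F (fermi w t) + F (fermi w (- t))) * f w)"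
  shows "\<exists>U1 U2. (\<forall>t. (U has_vector_derivative U1 t) (at t)) \<and> (\<forall>t. (U1 has_vector_derivative U2 t) (at t)) \<and> U1 0 = 0 \<and>
    (\<forall>t. (cosh t)\<^sup>2 *\<^sub>R U2 t + (real CARD('d) * (cosh t * sinh t)) *\<^sub>R U1 t = (mu - lam * (cosh t)\<^sup>2) *\<^sub>R U t)"
proof -
  let ?\<mu> = "hyperbolic_measure :: (real ^ 'd) measure"
  let ?I = "\<lambda>k. LINT w|?\<mu>. indicator B0 w *\<^sub>R (k w :: complex)"
  define P where "P s w = D1 F (fermi w s) (fermi' w s)" for s w
  define Q where "Q s w = D2 F (fermi w s) (fermi' w s) (fermi' w s) + D1 F (fermi w s) (fermi w s)" for s w
  have dF: "((\<lambda>s. F (fermi w s)) has_vector_derivative P t w) (at t)" for w t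
    unfolding P_def by (rule D1_chain[OF F fermi_derivs(1)])
  have dP: "((\<lambda>s. P s w) has_vector_derivative Q t w) (at t)" for w t
    unfolding P_def Q_def by (rule D2_chain[OF F fermi_derivs(1,2)])
  have swap: "continuous_on UNIV (\<lambda>p :: real \<times> (real ^ 'd). k (fst p) (snd p)) \<and> continuous_on UNIV (\<lambda>p. k (- fst p) (snd p))
      \<and> (\<forall>s. continuous_on UNIV (k s))"
    if k: "continuous_on UNIV (\<lambda>p. k (snd p) (fst p))" for k :: "real \<Rightarrow> real ^ 'd \<Rightarrow> complex"
  proof (intro conjI allI)
    have "continuous_on UNIV (\<lambda>p :: real \<times> (real ^ 'd). (\<lambda>p. k (snd p) (fst p)) (snd p, fst p))"
      by (rule continuous_on_compose2[OF k]) (auto intro!: continuous_intros)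
    then show "continuous_on UNIV (\<lambda>p :: real \<times> (real ^ 'd). k (fst p) (snd p))" by simp
    have "continuous_on UNIV (\<lambda>p :: real \<times> (real ^ 'd). (\<lambda>p. k (snd p) (fst p)) (snd p, - fst p))"
      by (rule continuous_on_compose2[OF k]) (auto intro!: continuous_intros)
    then show "continuous_on UNIV (\<lambda>p :: real \<times> (real ^ 'd). k (- fst p) (snd p))" by simp
    fix s
    have "continuous_on UNIV (\<lambda>w. (\<lambda>p. k (snd p) (fst p)) (w, s))"
      by (rule continuous_on_compose2[OF k]) (auto intro!: continuous_intros)
    then show "continuous_on UNIV (k s)" by simp
  qed
  have cP: "continuous_on UNIV (\<lambda>p. P (snd p) (fst p))"
    unfolding P_def by (rule D1_continuous_compose[OF F continuous_on_fermi continuous_on_fermi'])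
  have cQ: "continuous_on UNIV (\<lambda>p. Q (snd p) (fst p))"
    unfolding Q_def by (intro continuous_on_add D1_continuous_compose[OF F] D2_continuous_compose[OF F] continuous_on_fermi continuous_on_fermi')
  have cF: "continuous_on UNIV (\<lambda>p. F (fermi (fst p) (snd p)))"
    by (rule C2_continuous_compose[OF F continuous_on_fermi])
  have cF1: "continuous_on UNIV (\<lambda>w. F (fermi w s))" for s
    using swap[of "\<lambda>s w. F (fermi w s)"] cF by simp
  note cf = C2_continuous[OF f]
  have cf2: "continuous_on UNIV (\<lambda>p :: real \<times> (real ^ 'd). f (snd p))"
    by (rule C2_continuous_compose[OF f]) (intro continuous_intros)
  define h where "h t w = (1/2) *\<^sub>R (F (fermi w t) + F (fermi w (- t))) * f w" for t w
  define h1 where "h1 t w = (1/2) *\<^sub>R (P t w - P (- t) w) * f w" for t w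
  define h2 where "h2 t w = (1/2) *\<^sub>R (Q t w + Q (- t) w) * f w" for t w
  have bl: "bounded_linear (\<lambda>x. (1/2 :: real) *\<^sub>R x * f w)" for w
    using bounded_linear_compose[OF bounded_linear_mult_left bounded_linear_scaleR_right] by (simp add: o_def)
  have dh: "((\<lambda>t. h t w) has_vector_derivative h1 t w) (at t)" for t w
    unfolding h_def h1_def
    using bounded_linear.has_vector_derivative[OF bl has_vector_derivative_add[OF dF has_vector_derivative_reflect[OF dF]]] by simp
  have dh1: "((\<lambda>t. h1 t w) has_vector_derivative h2 t w) (at t)" for t w
    unfolding h1_def h2_def
    using bounded_linear.has_vector_derivative[OF bl has_vector_derivative_diff[OF dP has_vector_derivative_reflect[OF dP]]] by simp
  have ch: "continuous_on UNIV (h t)" for t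
    unfolding h_def by (intro continuous_intros cF1 cf)
  have ch1: "continuous_on UNIV (h1 t)" for t
    using swap[OF cP] unfolding h1_def by (intro continuous_intros cf) auto
  have ch2: "continuous_on UNIV (h2 t)" for t
    using swap[OF cQ] unfolding h2_def by (intro continuous_intros cf) auto
  have jh1: "continuous_on UNIV (\<lambda>p. h1 (fst p) (snd p))"
    using swap[OF cP] unfolding h1_def by (intro continuous_intros cf2) auto
  have jh2: "continuous_on UNIV (\<lambda>p. h2 (fst p) (snd p))"
    using swap[OF cQ] unfolding h2_def by (intro continuous_intros cf2) auto
  have U: "U = (\<lambda>t. ?I (h t))" unfolding U_def h_def ..
  have ode: "(cosh t)\<^sup>2 *\<^sub>R ?I (h2 t) + (real CARD('d) * (cosh t * sinh t)) *\<^sub>R ?I (h1 t) = (mu - lam * (cosh t)\<^sup>2) *\<^sub>R ?I (h t)" for t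
  proof -
    let ?G = "\<lambda>w. (1/2) *\<^sub>R (F (fermi w t) + F (fermi w (- t)))"
    define c where "c = (cosh t)\<^sup>2"
    define b where "b = real CARD('d) * (cosh t * sinh t)"
    have C2G: "C2 ?G" by (rule C2_half_sum(1)[OF fermi_slice(1)[OF F] fermi_slice(1)[OF F]])
    have G_inv: "?G (act g w) = ?G w" if g: "g \<in> \<Lambda>" for g w
    proof -
      obtain e where e: "e = 1 \<or> e = - 1" "\<And>z. F (act (block_diag g e) z) = F z" using F_inv[OF g] by blast
      have *: "F (fermi (act g w) (time_sign g * e * s)) = F (fermi w s)" for s
        using e(2)[of "fermi w s"] unfolding act_block_diag_fermi[OF O1[OF g] e(1)] .
      have "time_sign g * e = 1 \<or> time_sign g * e = - 1" using e(1) time_sign_cases[OF O1[OF g]] by auto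
      then show ?thesis using *[of t] *[of "- t"] by (auto simp: add.commute)
    qed
    have LG: "chart_laplacian ?G w * f w = (- c) *\<^sub>R h2 t w + ((- b) *\<^sub>R h1 t w + (- lam * c) *\<^sub>R h t w)" for w
    proof -
      have L: "chart_laplacian ?G w = (1/2) *\<^sub>R (chart_laplacian (\<lambda>w. F (fermi w t)) w + chart_laplacian (\<lambda>w. F (fermi w (- t))) w)"
        by (rule chart_laplacian_half_sum[OF fermi_slice(1)[OF F] fermi_slice(1)[OF F]])
      have L1: "chart_laplacian (\<lambda>w. F (fermi w t)) w = - (of_real lam * (of_real c * F (fermi w t))) - of_real c * Q t w - of_real b * P t w"
        using sep[where t = t and w = w] unfolding c_def[symmetric] b_def[symmetric] P_def[symmetric] Q_def[symmetric] scaleR_conv_of_real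
        by (simp add: algebra_simps)
      \<comment> \<open>At \<open>- t\<close> the coefficient of the first derivative changes sign,
        which matches the minus sign in \<open>h1\<close>.\<close>
      have bm: "real CARD('d) * (cosh (- t) * sinh (- t)) = - b" "(cosh (- t))\<^sup>2 = c" by (simp_all add: b_def c_def)
      have L2: "chart_laplacian (\<lambda>w. F (fermi w (- t))) w = - (of_real lam * (of_real c * F (fermi w (- t)))) - of_real c * Q (- t) w + of_real b * P (- t) w"
        using sep[where t = "- t" and w = w] unfolding bm P_def[symmetric] Q_def[symmetric] scaleR_conv_of_real
        by (simp add: algebra_simps)
      show ?thesis unfolding L unfolding L1 L2 h_def h1_def h2_def scaleR_conv_of_real by (simp add: algebra_simps)
    qed
    have "?I (\<lambda>w. chart_laplacian ?G w * f w) = ?I (\<lambda>w. ?G w * chart_laplacian f w)"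
      by (rule laplacian_self_adjoint[OF B0 B0_bounded C2G f]) (use G_inv f_inv in auto)
    also have "\<dots> = ?I (\<lambda>w. (- mu) *\<^sub>R h t w)"
      unfolding eig h_def scaleR_conv_of_real by (simp add: algebra_simps)
    also have "\<dots> = (- mu) *\<^sub>R ?I (h t)" by (rule integral_fundamental_linear(2)[OF ch ch])
    finally have "?I (\<lambda>w. chart_laplacian ?G w * f w) = (- mu) *\<^sub>R ?I (h t)" .
    moreover have "?I (\<lambda>w. chart_laplacian ?G w * f w) = (- c) *\<^sub>R ?I (h2 t) + ((- b) *\<^sub>R ?I (h1 t) + (- lam * c) *\<^sub>R ?I (h t))"
      unfolding LG
      by (subst integral_fundamental_linear(1), intro continuous_intros ch2, intro continuous_intros ch1 ch,
          subst integral_fundamental_linear(1), intro continuous_intros ch1, intro continuous_intros ch)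
        (simp only: integral_fundamental_linear(2)[OF ch ch] integral_fundamental_linear(2)[OF ch1 ch] integral_fundamental_linear(2)[OF ch2 ch])
    ultimately have "c *\<^sub>R ?I (h2 t) + b *\<^sub>R ?I (h1 t) = (mu - lam * c) *\<^sub>R ?I (h t)"
      unfolding scaleR_conv_of_real by (simp add: algebra_simps)
    then show ?thesis unfolding c_def b_def .
  qed
  show ?thesis
  proof (rule exI[of _ "\<lambda>t. ?I (h1 t)"], rule exI[of _ "\<lambda>t. ?I (h2 t)"], intro conjI allI)
    show "(U has_vector_derivative ?I (h1 t)) (at t)" for t
      unfolding U by (rule has_vector_derivative_integral_fundamental[OF dh ch jh1])
    show "((\<lambda>t. ?I (h1 t)) has_vector_derivative ?I (h2 t)) (at t)" for t
      by (rule has_vector_derivative_integral_fundamental[OF dh1 ch1 jh2])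
    show "?I (h1 0) = 0" by (simp add: h1_def)
    show "(cosh t)\<^sup>2 *\<^sub>R ?I (h2 t) + (real CARD('d) * (cosh t * sinh t)) *\<^sub>R ?I (h1 t) = (mu - lam * (cosh t)\<^sup>2) *\<^sub>R U t" for t
      unfolding U by (rule ode)
  qed
qed

text \<open>Cauchy-Schwarz in \<open>w\<close> against the normalized \<open>f\<close> bounds
  \<open>(cmod (U t))^2\<close> by the mean of the slice masses at \<open>t\<close> and
  \<open>- t\<close>. The weight \<open>cosh t ^ n\<close> is the Jacobian of Fermi coordinates, so
  integration over \<open>t\<close> yields at most the mass of \<open>F\<close> in the ball.\<close>

lemma profile_mass:
  fixes F :: "real ^ 'd option \<Rightarrow> complex" and f :: "real ^ 'd \<Rightarrow> complex"
  assumes cF: "continuous_on UNIV F" and cf: "continuous_on UNIV f"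
    and norm1: "(LINT w|hyperbolic_measure. indicator B0 w *\<^sub>R (cmod (f w))\<^sup>2) = 1"
    and tube: "\<And>w t. w \<in> B0 \<Longrightarrow> \<bar>t\<bar> \<le> T \<Longrightarrow> fermi w t \<in> cball 0 \<rho>"
    and N: "(\<integral>\<^sup>+z. ennreal ((cmod (F z))\<^sup>2) * indicator (cball 0 \<rho>) z \<partial>hyperbolic_measure) \<le> ennreal N" "0 \<le> N"
    and T: "T > 0"
  defines "U \<equiv> \<lambda>t. LINT w|hyperbolic_measure. indicator B0 w *\<^sub>R ((1/2) *\<^sub>R (F (fermi w t) + F (fermi w (- t))) * f w)"
  shows "(\<integral>\<^sup>+t. ennreal (cosh t ^ CARD('d) * (cmod (U t))\<^sup>2) * indicator {0..T} t \<partial>lborel) \<le> ennreal N"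
proof -
  let ?\<mu> = "hyperbolic_measure :: (real ^ 'd) measure"
  interpret H: sigma_finite_measure ?\<mu> by (rule sigma_finite_hyperbolic)
  \<comment> \<open>With the cutoff built into the integrand the slices can be integrated over all
    \<open>w\<close> instead of \<open>B0\<close>, and \<open>nn_integral_fermi\<close> applies as
    it stands.\<close>
  define ff where "ff z = ennreal ((cmod (F z))\<^sup>2) * indicator (cball 0 \<rho>) z" for z
  have ffm: "ff \<in> borel_measurable borel"
    unfolding ff_def
    by (intro borel_measurable_times_ennreal measurable_compose[OF borel_measurable_continuous_onI measurable_ennreal]
        continuous_intros cF borel_measurable_indicator) simp
  define J where "J t = (\<integral>\<^sup>+w. ff (fermi w t) \<partial>?\<mu>)" for t
  have fm: "(\<lambda>w. ff (fermi w t)) \<in> borel_measurable ?\<mu>" for t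
  proof -
    have "continuous_on UNIV (\<lambda>w. (\<lambda>p. fermi (fst p) (snd p)) (w, t))"
      by (rule continuous_on_compose2[OF continuous_on_fermi]) (auto intro!: continuous_intros)
    then have "(\<lambda>w. fermi w t) \<in> borel_measurable borel" by (intro borel_measurable_continuous_onI) simp
    from measurable_compose[OF this ffm] show ?thesis by (simp add: measurable_cong_sets[OF sets_hyperbolic refl])
  qed
  have Jm: "J \<in> borel_measurable borel"
  proof -
    have "continuous_on UNIV (\<lambda>p :: real \<times> (real ^ 'd). (\<lambda>p. fermi (fst p) (snd p)) (snd p, fst p))"
      by (rule continuous_on_compose2[OF continuous_on_fermi]) (auto intro!: continuous_intros)
    then have "(\<lambda>p :: real \<times> (real ^ 'd). fermi (snd p) (fst p)) \<in> borel_measurable borel"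
      by (intro borel_measurable_continuous_onI) simp
    from measurable_compose[OF this ffm] have m: "(\<lambda>p. ff (fermi (snd p) (fst p))) \<in> borel_measurable borel" .
    have s: "sets ((borel :: real measure) \<Otimes>\<^sub>M ?\<mu>) = sets (borel :: (real \<times> (real ^ 'd)) measure)"
      unfolding borel_prod[symmetric] by (rule sets_pair_measure_cong) auto
    have "case_prod (\<lambda>t w. ff (fermi w t)) \<in> borel_measurable ((borel :: real measure) \<Otimes>\<^sub>M ?\<mu>)"
      using m unfolding measurable_cong_sets[OF s refl] by (simp add: case_prod_beta')
    then show ?thesis unfolding J_def by (rule H.borel_measurable_nn_integral)
  qed
  have fn: "(\<integral>\<^sup>+w. (ennreal (indicator B0 w * cmod (f w)))\<^sup>2 \<partial>?\<mu>) = 1"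
  proof -
    have "integrable ?\<mu> (\<lambda>w. indicator B0 w *\<^sub>R (cmod (f w))\<^sup>2)"
      by (intro integrable_fundamental_continuous[OF B0 B0_bounded] continuous_intros cf)
    from nn_integral_eq_integral[OF this] have "(\<integral>\<^sup>+w. ennreal (indicator B0 w *\<^sub>R (cmod (f w))\<^sup>2) \<partial>?\<mu>) = 1"
      using norm1 by simp
    moreover have "(ennreal (indicator B0 w * cmod (f w)))\<^sup>2 = ennreal (indicator B0 w *\<^sub>R (cmod (f w))\<^sup>2)" for w
      by (auto simp: indicator_def ennreal_power)
    ultimately show ?thesis by simp
  qed
  have UJ: "ennreal ((cmod (U t))\<^sup>2) \<le> ennreal (1/2) * (J t + J (- t))" if t: "\<bar>t\<bar> \<le> T" for t
  proof -
    let ?G = "\<lambda>w. (1/2) *\<^sub>R (F (fermi w t) + F (fermi w (- t)))"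
    have cFf: "continuous_on UNIV (\<lambda>w. F (fermi w s))" for s
    proof -
      have "continuous_on UNIV (\<lambda>w. (\<lambda>p. fermi (fst p) (snd p)) (w, s))"
        by (rule continuous_on_compose2[OF continuous_on_fermi]) (auto intro!: continuous_intros)
      then have "continuous_on UNIV (\<lambda>w. fermi w s)" by simp
      from continuous_on_compose2[OF cF this] show ?thesis by simp
    qed
    have cG: "continuous_on UNIV ?G" by (intro continuous_intros cFf)
    have Bm: "(\<lambda>w. indicator B0 w * cmod (k w)) \<in> borel_measurable ?\<mu>" if "continuous_on UNIV k" for k :: "real ^ 'd \<Rightarrow> complex"
    proof -
      have "(\<lambda>w. indicator B0 w * cmod (k w) :: real) \<in> borel_measurable borel"
        by (intro borel_measurable_times borel_measurable_indicator B0(1) borel_measurable_continuous_onI continuous_intros that)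
      then show ?thesis by (simp add: measurable_cong_sets[OF sets_hyperbolic refl])
    qed
    have "ennreal (cmod (U t)) \<le> (\<integral>\<^sup>+w. norm (indicator B0 w *\<^sub>R (?G w * f w)) \<partial>?\<mu>)"
      unfolding U_def
      by (rule integral_norm_bound_ennreal[OF integrable_fundamental_continuous[OF B0 B0_bounded]]) (intro continuous_intros cFf cf)
    also have "\<dots> = (\<integral>\<^sup>+w. ennreal (indicator B0 w * cmod (?G w)) * ennreal (indicator B0 w * cmod (f w)) \<partial>?\<mu>)"
    proof (rule nn_integral_cong)
      fix w
      have "norm (indicator B0 w *\<^sub>R (?G w * f w)) = (indicator B0 w * cmod (?G w)) * (indicator B0 w * cmod (f w))"
        by (simp only: norm_scaleR norm_mult) (simp add: indicator_def)
      then show "ennreal (norm (indicator B0 w *\<^sub>R (?G w * f w))) = ennreal (indicator B0 w * cmod (?G w)) * ennreal (indicator B0 w * cmod (f w))"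
        by (simp only: ennreal_mult' indicator_pos_le norm_ge_zero zero_le_mult_iff simp_thms ennreal_mult)
    qed
    finally have "(ennreal (cmod (U t)))\<^sup>2 \<le> (\<integral>\<^sup>+w. ennreal (indicator B0 w * cmod (?G w)) * ennreal (indicator B0 w * cmod (f w)) \<partial>?\<mu>)\<^sup>2"
      by (rule power_mono) simp
    also have "\<dots> \<le> (\<integral>\<^sup>+w. (ennreal (indicator B0 w * cmod (?G w)))\<^sup>2 \<partial>?\<mu>) * (\<integral>\<^sup>+w. (ennreal (indicator B0 w * cmod (f w)))\<^sup>2 \<partial>?\<mu>)"
      by (intro Cauchy_Schwarz_nn_integral measurable_compose[OF Bm measurable_ennreal] cG cf)
    also have "\<dots> = (\<integral>\<^sup>+w. (ennreal (indicator B0 w * cmod (?G w)))\<^sup>2 \<partial>?\<mu>)" unfolding fn by simp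
    also have "\<dots> \<le> (\<integral>\<^sup>+w. ennreal (1/2) * (ff (fermi w t) + ff (fermi w (- t))) \<partial>?\<mu>)"
    proof (rule nn_integral_mono)
      fix w
      show "(ennreal (indicator B0 w * cmod (?G w)))\<^sup>2 \<le> ennreal (1/2) * (ff (fermi w t) + ff (fermi w (- t)))"
      proof (cases "w \<in> B0")
        case True
        let ?a = "cmod (F (fermi w t))" and ?b = "cmod (F (fermi w (- t)))"
        have "fermi w t \<in> cball 0 \<rho>" "fermi w (- t) \<in> cball 0 \<rho>" using tube[OF True, of t] tube[OF True, of "- t"] t by auto
        then have "ennreal (1/2) * (ff (fermi w t) + ff (fermi w (- t))) = ennreal (1/2) * ennreal (?a\<^sup>2 + ?b\<^sup>2)"
          by (simp only: ff_def indicator_simps mult_1_right ennreal_plus zero_le_power2)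
        also have "\<dots> = ennreal ((1/2) * (?a\<^sup>2 + ?b\<^sup>2))" by (rule ennreal_mult[symmetric]) auto
        finally have r: "ennreal (1/2) * (ff (fermi w t) + ff (fermi w (- t))) = ennreal ((1/2) * (?a\<^sup>2 + ?b\<^sup>2))" .
        have "cmod (?G w) \<le> (1/2) * (?a + ?b)" unfolding norm_scaleR using norm_triangle_ineq[of "F (fermi w t)" "F (fermi w (- t))"] by simp
        then have "(cmod (?G w))\<^sup>2 \<le> ((1/2) * (?a + ?b))\<^sup>2" by (intro power_mono) auto
        also have "\<dots> \<le> (1/2) * (?a\<^sup>2 + ?b\<^sup>2)" using sum_squares_bound[of ?a ?b] by (simp add: power2_eq_square algebra_simps)
        finally have l: "(cmod (?G w))\<^sup>2 \<le> (1/2) * (?a\<^sup>2 + ?b\<^sup>2)" .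
        have "(ennreal (indicator B0 w * cmod (?G w)))\<^sup>2 = ennreal ((cmod (?G w))\<^sup>2)"
          using True by (simp only: indicator_simps mult_1 ennreal_power norm_ge_zero)
        then show ?thesis unfolding r using l by (simp only: ennreal_leI)
      qed simp
    qed
    also have "\<dots> = ennreal (1/2) * (J t + J (- t))"
      unfolding J_def by (subst nn_integral_cmult, intro borel_measurable_add fm) (simp only: nn_integral_add[OF fm fm])
    finally show ?thesis by (simp add: ennreal_power)
  qed
  define K where "K t = J t * ennreal (cosh t ^ CARD('d)) * indicator {- T..T} t" for t
  have Km: "K \<in> borel_measurable borel"
    unfolding K_def
    by (intro borel_measurable_times_ennreal Jm measurable_compose[OF borel_measurable_continuous_onI measurable_ennreal]
        continuous_intros borel_measurable_indicator) simp
  have KN: "(\<integral>\<^sup>+t. K t \<partial>lborel) \<le> ennreal N"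
  proof -
    have "(\<integral>\<^sup>+t. K t \<partial>lborel) = (\<integral>\<^sup>+z. ff z * indicator {z. \<bar>z $ None\<bar> \<le> sinh T} z \<partial>hyperbolic_measure)"
      unfolding K_def J_def by (rule nn_integral_fermi[OF ffm T, symmetric])
    also have "\<dots> \<le> (\<integral>\<^sup>+z. ff z \<partial>hyperbolic_measure)"
      by (rule nn_integral_mono) (simp add: indicator_def)
    also have "\<dots> \<le> ennreal N" unfolding ff_def by (rule N(1))
    finally show ?thesis .
  qed
  have "(\<integral>\<^sup>+t. ennreal (cosh t ^ CARD('d) * (cmod (U t))\<^sup>2) * indicator {0..T} t \<partial>lborel)
      \<le> (\<integral>\<^sup>+t. ennreal (1/2) * (K t + K (- t)) \<partial>lborel)"
  proof (rule nn_integral_mono)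
    fix t :: real
    show "ennreal (cosh t ^ CARD('d) * (cmod (U t))\<^sup>2) * indicator {0..T} t \<le> ennreal (1/2) * (K t + K (- t))"
    proof (cases "t \<in> {0..T}")
      case True
      have c: "0 \<le> cosh t ^ CARD('d)" by (simp add: cosh_real_nonneg)
      have "ennreal (cosh t ^ CARD('d) * (cmod (U t))\<^sup>2) = ennreal (cosh t ^ CARD('d)) * ennreal ((cmod (U t))\<^sup>2)"
        by (rule ennreal_mult[OF c]) simp
      also have "\<dots> \<le> ennreal (cosh t ^ CARD('d)) * (ennreal (1/2) * (J t + J (- t)))"
        by (intro mult_left_mono UJ) (use True in auto)
      also have "\<dots> = ennreal (1/2) * (K t + K (- t))"
        using True by (simp add: K_def distrib_left mult_ac)
      finally show ?thesis using True by simp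
    qed simp
  qed
  also have "\<dots> = ennreal (1/2) * ((\<integral>\<^sup>+t. K t \<partial>lborel) + (\<integral>\<^sup>+t. K (- t) \<partial>lborel))"
  proof -
    have Km': "(\<lambda>t. K (- t)) \<in> borel_measurable borel"
      by (rule measurable_compose[OF _ Km]) simp
    show ?thesis using Km Km' by (simp add: nn_integral_cmult nn_integral_add)
  qed
  also have "(\<integral>\<^sup>+t. K (- t) \<partial>lborel) = (\<integral>\<^sup>+t. K t \<partial>lborel)"
    using nn_integral_real_affine[OF Km, of "- 1" 0] by simp
  also have "ennreal (1/2) * ((\<integral>\<^sup>+t. K t \<partial>lborel) + (\<integral>\<^sup>+t. K t \<partial>lborel)) \<le> ennreal (1/2) * (ennreal N + ennreal N)"
    by (intro mult_left_mono add_mono KN) simp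
  also have "\<dots> = ennreal ((1/2) * (N + N))" unfolding ennreal_plus[OF N(2) N(2), symmetric] by (rule ennreal_mult[symmetric]) (use N(2) in auto)
  also have "\<dots> = ennreal N" by simp
  finally show ?thesis .
qed

end

end

section \<open>The period as a value of the solution\<close>

definition profile_ode :: "real \<Rightarrow> real \<Rightarrow> (real \<Rightarrow> real) \<Rightarrow> (real \<Rightarrow> real) \<Rightarrow> bool" where
  "profile_ode r s v w \<longleftrightarrow> (\<forall>t. (v has_real_derivative w t) (at t)) \<and>
    (\<forall>t. (w has_real_derivative ((s\<^sup>2 + 1/4) * (1 - (tanh t)\<^sup>2) - r\<^sup>2) * v t) (at t)) \<and> w 0 = 0"

text \<open>The profile is complex but the equation has real coefficients, so its real and its
  imaginary part, the two uses of \<open>L\<close>, solve it separately.\<close>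

lemma profile_ode_component:
  fixes U U1 U2 :: "real \<Rightarrow> complex" and L :: "complex \<Rightarrow> real" and n :: nat
  assumes L: "bounded_linear L" "\<And>z. (L z)\<^sup>2 \<le> (cmod z)\<^sup>2"
    and U: "\<And>t. (U has_vector_derivative U1 t) (at t)" "\<And>t. (U1 has_vector_derivative U2 t) (at t)" "U1 0 = 0"
    and eq: "\<And>t. (cosh t)\<^sup>2 *\<^sub>R U2 t + (real n * (cosh t * sinh t)) *\<^sub>R U1 t
      = (((real n / 2 - 1/2)\<^sup>2 + s\<^sup>2) - ((real n / 2)\<^sup>2 + r\<^sup>2) * (cosh t)\<^sup>2) *\<^sub>R U t"
    and N: "(\<integral>\<^sup>+t. ennreal (cosh t ^ n * (cmod (U t))\<^sup>2) * indicator {0..T} t \<partial>lborel) \<le> ennreal N" "0 \<le> N"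
  shows "\<exists>v w. profile_ode r s v w \<and> v 0 = L (U 0) \<and> integral {0..T} (\<lambda>t. (v t)\<^sup>2) \<le> N"
proof -
  interpret L: bounded_linear L by (rule L(1))
  define m where "m = real n / 2"
  have dU: "((\<lambda>t. L (U t)) has_real_derivative L (U1 t)) (at t)" "((\<lambda>t. L (U1 t)) has_real_derivative L (U2 t)) (at t)" for t
    unfolding has_real_derivative_iff_has_vector_derivative by (rule L.has_vector_derivative[OF U(1)], rule L.has_vector_derivative[OF U(2)])
  have e: "(cosh t)\<^sup>2 * L (U2 t) + (2 * m * (cosh t * sinh t)) * L (U1 t)
      = ((m - 1/2)\<^sup>2 + s\<^sup>2 - (m\<^sup>2 + r\<^sup>2) * (cosh t)\<^sup>2) * L (U t)" for t
    using arg_cong[OF eq[of t], of L] by (simp add: m_def L.add L.scaleR)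
  note lt = liouville_transform[OF dU e]
  let ?v = "\<lambda>t. cosh t powr m * L (U t)" and ?w = "\<lambda>t. cosh t powr m * (L (U1 t) + m * tanh t * L (U t))"
  have cv: "continuous_on UNIV ?v" by (rule DERIV_continuous_on[OF has_field_derivative_at_within[OF lt(1)]])
  have le: "(?v t)\<^sup>2 \<le> cosh t ^ n * (cmod (U t))\<^sup>2" for t
  proof -
    have c: "cosh t > 0" by (rule cosh_real_pos)
    have "(cosh t powr m)\<^sup>2 = cosh t powr (m + m)" by (simp only: powr_add power2_eq_square)
    also have "\<dots> = cosh t ^ n" using c by (simp add: m_def powr_realpow)
    finally have "(?v t)\<^sup>2 = cosh t ^ n * (L (U t))\<^sup>2" by (simp add: power_mult_distrib)
    also have "\<dots> \<le> cosh t ^ n * (cmod (U t))\<^sup>2" using L(2) c by (intro mult_left_mono) auto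
    finally show ?thesis .
  qed
  have "integral {0..T} (\<lambda>t. (?v t)\<^sup>2) \<le> N" by (rule integral_square_le[OF cv le N])
  moreover have "profile_ode r s ?v ?w" unfolding profile_ode_def using lt U(3) by (auto simp: L.zero)
  moreover have "?v 0 = L (U 0)" by simp
  ultimately show ?thesis by (intro exI conjI)
qed

text \<open>The bound \<open>N\<close> has to be independent of the forms. It comes from the number
  of injective open sets that cover a ball containing the tube of half-width \<open>T\<close> over a
  bounded fundamental domain of \<open>Y\<close>; on each of them a normalized form has mass at most
  1.\<close>

lemma period_reduction:
  fixes \<Gamma> :: "'n::finite option lmat set"
  assumes lat: "lattice_in O1 \<Gamma>" and tf: "torsion_free (matrix_group O1) \<Gamma>"
    and uni: "uniform_lattice_in cycle_group (\<Gamma> \<inter> cycle_group)" and T: "T > 0"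
  shows "\<exists>N>0. \<forall>\<phi> \<psi> r s. normalized_maass_form (X_proj \<Gamma>) (complex_of_real ((real CARD('n) / 2)\<^sup>2 + r\<^sup>2)) \<phi> \<longrightarrow>
    normalized_maass_form (Y_proj \<Gamma>) (complex_of_real ((real CARD('n) / 2 - 1/2)\<^sup>2 + s\<^sup>2)) \<psi> \<longrightarrow>
    (\<exists>v1 w1 v2 w2. profile_ode r s v1 w1 \<and> profile_ode r s v2 w2 \<and> (cmod (period \<Gamma> \<phi> \<psi>))\<^sup>2 = (v1 0)\<^sup>2 + (v2 0)\<^sup>2 \<and>
      integral {0..T} (\<lambda>t. (v1 t)\<^sup>2) \<le> N \<and> integral {0..T} (\<lambda>t. (v2 t)\<^sup>2) \<le> N)"
proof -
  have sg: "subgroup \<Gamma> (matrix_group O1)" and disc: "discrete \<Gamma>" using lat unfolding lattice_in_def by auto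
  have \<Gamma>: "lorentz_subgroup \<Gamma>" by (rule subgroup_imp_lorentz_subgroup[OF sg])
  interpret X: quotient_by_action \<Gamma> "X_proj \<Gamma>" by (rule quotient_by_lattice[OF \<Gamma> disc tf])
  interpret Y: quotient_by_action "cycle_lattice \<Gamma>" "Y_proj \<Gamma>" by (rule quotient_by_cycle_lattice[OF \<Gamma> disc tf])
  obtain \<rho>0 where \<rho>0: "\<And>v. \<exists>g\<in>cycle_lattice \<Gamma>. act (lorentz_inv g) v \<in> cball 0 \<rho>0"
    using cycle_lattice_cocompact[OF uni] by blast
  have "\<exists>g\<in>cycle_lattice \<Gamma>. act g v \<in> cball 0 \<rho>0" for v using \<rho>0[of v] Y.inv by blast
  from Y.fundamental_domain_exists[OF this]
  obtain B0 where B0: "B0 \<in> sets borel" "inj_on Y.q B0" "Y.q ` B0 = range Y.q" and bB0: "bounded B0" by blast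
  have "bounded ((\<lambda>p. fermi (fst p) (snd p)) ` (closure B0 \<times> {- T..T}))"
    using bB0 by (intro compact_imp_bounded compact_continuous_image continuous_on_fermi compact_Times) (simp_all add: compact_closure)
  then obtain \<rho> where \<rho>: "\<And>p. p \<in> closure B0 \<times> {- T..T} \<Longrightarrow> norm (fermi (fst p) (snd p)) \<le> \<rho>"
    unfolding bounded_iff by blast
  have tube: "fermi w t \<in> cball 0 \<rho>" if "w \<in> B0" "\<bar>t\<bar> \<le> T" for w t
    using \<rho>[of "(w, t)"] that(2) subsetD[OF closure_subset that(1)] by (simp add: abs_le_iff)
  obtain \<B> where \<B>: "finite \<B>" "\<And>B. B \<in> \<B> \<Longrightarrow> open B \<and> inj_on X.q B" "cball 0 \<rho> \<subseteq> \<Union>\<B>"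
    using X.inj_cover[of \<rho>] by blast
  \<comment> \<open>One more than the size of the cover, so that \<open>N\<close> is positive in
    every case.\<close>
  let ?N = "real (card \<B>) + 1"
  show ?thesis
  proof (intro exI[of _ ?N] conjI allI impI)
    fix \<phi> \<psi> and r s :: real
    assume \<phi>: "normalized_maass_form (X_proj \<Gamma>) (complex_of_real ((real CARD('n) / 2)\<^sup>2 + r\<^sup>2)) \<phi>"
      and \<psi>: "normalized_maass_form (Y_proj \<Gamma>) (complex_of_real ((real CARD('n) / 2 - 1/2)\<^sup>2 + s\<^sup>2)) \<psi>"
    let ?lam = "(real CARD('n) / 2)\<^sup>2 + r\<^sup>2" and ?mu = "(real CARD('n) / 2 - 1/2)\<^sup>2 + s\<^sup>2"
    define F where "F v = \<phi> (X_proj \<Gamma> (boost v))" for v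
    define f where "f v = \<psi> (Y_proj \<Gamma> (boost v))" for v
    have Fq: "\<phi> (X.q v) = F v" for v by (simp add: X.q_def F_def)
    have fq: "\<psi> (Y.q v) = f v" for v by (simp add: Y.q_def f_def)
    have F: "C2 F" using \<phi> unfolding normalized_maass_form_def maass_form_def F_def by (auto intro: smooth_imp_C2)
    have f: "C2 f" using \<psi> unfolding normalized_maass_form_def maass_form_def f_def by (auto intro: smooth_imp_C2)
    note cF = C2_continuous[OF F, of UNIV] and cf = C2_continuous[OF f, of UNIV]
    have Frep: "\<phi> (X_proj \<Gamma> g) = F (act g 0)" if "g \<in> O1" for g
      unfolding F_def by (rule arg_cong[OF X_proj_boost_act[OF \<Gamma> that]])
    have frep: "\<psi> (Y_proj \<Gamma> g) = f (act g 0)" if "g \<in> O1" for g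
      unfolding f_def by (rule arg_cong[OF Y_proj_boost_act[OF \<Gamma> that]])
    have sep: "(cosh t)\<^sup>2 *\<^sub>R (D2 F (fermi w t) (fermi' w t) (fermi' w t) + D1 F (fermi w t) (fermi w t))
      + (real CARD('n) * (cosh t * sinh t)) *\<^sub>R D1 F (fermi w t) (fermi' w t)
      + chart_laplacian (\<lambda>w. F (fermi w t)) w = - (complex_of_real ?lam * (cosh t)\<^sup>2 *\<^sub>R F (fermi w t))" for w t
    proof (rule fermi_separation[OF F, of "\<lambda>g. \<phi> (X_proj \<Gamma> g)"])
      fix g :: "'n option lmat" assume g: "g \<in> O1"
      show "\<phi> (X_proj \<Gamma> g) = F (act g 0)" by (rule Frep[OF g])
      show "laplacian (\<lambda>g. \<phi> (X_proj \<Gamma> g)) g = complex_of_real ?lam * \<phi> (X_proj \<Gamma> g)"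
        using \<phi> g unfolding normalized_maass_form_def maass_form_def by blast
    qed
    have eig: "chart_laplacian f w = - (complex_of_real ?mu * f w)" for w
    proof -
      have "laplacian (\<lambda>g. \<psi> (Y_proj \<Gamma> g)) (boost w) = - chart_laplacian f w"
        by (rule laplacian_chart[OF f frep])
      moreover have "laplacian (\<lambda>g. \<psi> (Y_proj \<Gamma> g)) (boost w) = complex_of_real ?mu * \<psi> (Y_proj \<Gamma> (boost w))"
        using \<psi> boost_in_O1 unfolding normalized_maass_form_def maass_form_def by blast
      ultimately show ?thesis unfolding f_def by (simp add: minus_equation_iff)
    qed
    have f_inv: "f (act g w) = f w" if "g \<in> cycle_lattice \<Gamma>" for g w
      unfolding fq[symmetric] Y.q_act[OF that] ..
    have F_inv: "\<exists>e. (e = 1 \<or> e = - 1) \<and> (\<forall>z. F (act (block_diag g e) z) = F z)" if g: "g \<in> cycle_lattice \<Gamma>" for g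
    proof -
      obtain e where e: "e = 1 \<or> e = - 1" "block_diag g e \<in> \<Gamma>" using g unfolding cycle_lattice_def by blast
      have "F (act (block_diag g e) z) = F z" for z unfolding Fq[symmetric] X.q_act[OF e(2)] ..
      then show ?thesis using e(1) by blast
    qed
    define U where "U t = (LINT w|hyperbolic_measure. indicator B0 w *\<^sub>R ((1/2) *\<^sub>R (F (fermi w t) + F (fermi w (- t))) * f w))" for t
    obtain U1 U2 where U12: "\<And>t. (U has_vector_derivative U1 t) (at t)" "\<And>t. (U1 has_vector_derivative U2 t) (at t)" "U1 0 = 0"
      "\<And>t. (cosh t)\<^sup>2 *\<^sub>R U2 t + (real CARD('n) * (cosh t * sinh t)) *\<^sub>R U1 t = (?mu - ?lam * (cosh t)\<^sup>2) *\<^sub>R U t"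
      using Y.profile_equation[OF B0 bB0 F f sep eig f_inv F_inv] unfolding U_def[abs_def] by blast
    have norm1: "(LINT w|hyperbolic_measure. indicator B0 w *\<^sub>R (cmod (f w))\<^sup>2) = 1"
    proof -
      have "(LINT x|quotient_measure (Y_proj \<Gamma>). (cmod (\<psi> x))\<^sup>2) = 1"
        using \<psi> unfolding normalized_maass_form_def L2_norm_def by simp
      moreover have "(\<lambda>v. (cmod (\<psi> (Y.q v)))\<^sup>2) \<in> borel_measurable borel"
        unfolding fq by (intro borel_measurable_continuous_onI continuous_intros cf)
      ultimately show ?thesis using Y.integral_quotient_fundamental[OF B0, of "\<lambda>x. (cmod (\<psi> x))\<^sup>2"] unfolding fq by simp
    qed
    have N: "(\<integral>\<^sup>+z. ennreal ((cmod (F z))\<^sup>2) * indicator (cball 0 \<rho>) z \<partial>hyperbolic_measure) \<le> ennreal ?N"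
    proof -
      have m: "(\<lambda>z. ennreal ((cmod (F z))\<^sup>2)) \<in> borel_measurable borel"
        by (intro measurable_compose[OF borel_measurable_continuous_onI measurable_ennreal] continuous_intros cF)
      have X1: "(\<integral>\<^sup>+x. ennreal ((cmod (\<phi> x))\<^sup>2) \<partial>quotient_measure (X_proj \<Gamma>)) = 1"
      proof -
        have "integrable (quotient_measure (X_proj \<Gamma>)) (\<lambda>x. (cmod (\<phi> x))\<^sup>2)"
          "(LINT x|quotient_measure (X_proj \<Gamma>). (cmod (\<phi> x))\<^sup>2) = 1"
          using \<phi> unfolding normalized_maass_form_def maass_form_def L2_norm_def by simp_all
        then show ?thesis using nn_integral_eq_integral[of "quotient_measure (X_proj \<Gamma>)" "\<lambda>x. (cmod (\<phi> x))\<^sup>2"] by simp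
      qed
      have B1: "(\<integral>\<^sup>+z. ennreal ((cmod (F z))\<^sup>2) * indicator B z \<partial>hyperbolic_measure) \<le> 1" if B: "B \<in> \<B>" for B
        using X.nn_integral_inj_le[of B "\<lambda>x. ennreal ((cmod (\<phi> x))\<^sup>2)"] \<B>(2)[OF B] m unfolding Fq X1 by simp
      have "(\<integral>\<^sup>+z. ennreal ((cmod (F z))\<^sup>2) * indicator (cball 0 \<rho>) z \<partial>hyperbolic_measure)
        \<le> (\<integral>\<^sup>+z. (\<Sum>B\<in>\<B>. ennreal ((cmod (F z))\<^sup>2) * indicator B z) \<partial>hyperbolic_measure)"
      proof (rule nn_integral_mono)
        fix z
        show "ennreal ((cmod (F z))\<^sup>2) * indicator (cball 0 \<rho>) z \<le> (\<Sum>B\<in>\<B>. ennreal ((cmod (F z))\<^sup>2) * indicator B z)"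
        proof (cases "z \<in> cball 0 \<rho>")
          case True
          then obtain B where B: "B \<in> \<B>" "z \<in> B" using \<B>(3) by blast
          have "ennreal ((cmod (F z))\<^sup>2) * indicator (cball 0 \<rho>) z = ennreal ((cmod (F z))\<^sup>2) * indicator B z" using True B by simp
          also have "\<dots> \<le> (\<Sum>B\<in>\<B>. ennreal ((cmod (F z))\<^sup>2) * indicator B z)"
            by (rule member_le_sum[OF B(1) _ \<B>(1)]) simp
          finally show ?thesis .
        qed simp
      qed
      also have "\<dots> = (\<Sum>B\<in>\<B>. \<integral>\<^sup>+z. ennreal ((cmod (F z))\<^sup>2) * indicator B z \<partial>hyperbolic_measure)"
      proof (rule nn_integral_sum)
        fix B assume "B \<in> \<B>"
        then have "(\<lambda>z. ennreal ((cmod (F z))\<^sup>2) * indicator B z) \<in> borel_measurable borel"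
          using \<B>(2) by (intro borel_measurable_times_ennreal m borel_measurable_indicator) auto
        then show "(\<lambda>z. ennreal ((cmod (F z))\<^sup>2) * indicator B z) \<in> borel_measurable hyperbolic_measure"
          by (simp add: measurable_cong_sets[OF sets_hyperbolic refl])
      qed
      also have "\<dots> \<le> (\<Sum>B\<in>\<B>. 1)" by (rule sum_mono[OF B1])
      also have "\<dots> \<le> ennreal ?N" by (simp add: ennreal_of_nat_eq_real_of_nat)
      finally show ?thesis .
    qed
    have mass: "(\<integral>\<^sup>+t. ennreal (cosh t ^ CARD('n) * (cmod (U t))\<^sup>2) * indicator {0..T} t \<partial>lborel) \<le> ennreal ?N"
      unfolding U_def by (rule Y.profile_mass[OF B0 bB0 cF cf norm1 tube N _ T]) auto
    \<comment> \<open>At \<open>t = 0\<close> both halves of the average are the restriction of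
      \<open>\<phi>\<close> to the cycle.\<close>
    have per: "period \<Gamma> \<phi> \<psi> = U 0"
    proof -
      have k: "\<phi> (natural_map \<Gamma> (Y.q w)) * \<psi> (Y.q w) = F (fermi w 0) * f w" for w
        unfolding Y.q_def o_def natural_map_Y_proj[OF \<Gamma>] F_def f_def ..
      have "continuous_on UNIV (\<lambda>w. F (fermi w 0) * f w)"
        by (intro continuous_on_mult cf C2_continuous[OF fermi_slice(1)[OF F]])
      then have "(\<lambda>w. \<phi> (natural_map \<Gamma> (Y.q w)) * \<psi> (Y.q w)) \<in> borel_measurable borel"
        unfolding k by (rule borel_measurable_continuous_onI)
      from Y.integral_quotient_fundamental[OF B0 this] show ?thesis
        unfolding period_def k U_def by (simp add: scaleR_add_right[symmetric] scaleR_2[symmetric])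
    qed
    have N0: "0 \<le> ?N" by simp
    obtain v1 w1 where 1: "profile_ode r s v1 w1" "v1 0 = Re (U 0)" "integral {0..T} (\<lambda>t. (v1 t)\<^sup>2) \<le> ?N"
      using profile_ode_component[OF bounded_linear_Re _ U12 mass N0] by (auto simp: cmod_power2)
    obtain v2 w2 where 2: "profile_ode r s v2 w2" "v2 0 = Im (U 0)" "integral {0..T} (\<lambda>t. (v2 t)\<^sup>2) \<le> ?N"
      using profile_ode_component[OF bounded_linear_Im _ U12 mass N0] by (auto simp: cmod_power2)
    have "(cmod (period \<Gamma> \<phi> \<psi>))\<^sup>2 = (v1 0)\<^sup>2 + (v2 0)\<^sup>2" unfolding per 1(2) 2(2) cmod_power2 ..
    then show "\<exists>v1 w1 v2 w2. profile_ode r s v1 w1 \<and> profile_ode r s v2 w2 \<and> (cmod (period \<Gamma> \<phi> \<psi>))\<^sup>2 = (v1 0)\<^sup>2 + (v2 0)\<^sup>2 \<and>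
      integral {0..T} (\<lambda>t. (v1 t)\<^sup>2) \<le> ?N \<and> integral {0..T} (\<lambda>t. (v2 t)\<^sup>2) \<le> ?N"
      using 1 2 by blast
  qed simp
qed

text \<open>Taking square roots in a bound for the squared period. The factor
  \<open>b \<ge> 1\<close> is where the power \<open>|\<tau>'| powr ((d - 2) / 2)\<close> of the
  statement comes in, and \<open>E\<close> carries the exponential gain.\<close>

lemma root_bound:
  fixes x y E K r b :: real
  assumes le: "sqrt x * y\<^sup>2 * E\<^sup>2 \<le> K * r" and x: "x > 0" and E: "E > 0" and K: "K \<ge> 0" and r: "r > 0" and b: "b \<ge> 1"
  shows "y \<le> sqrt K * (r powr (1/2) * b / x powr (1/4)) * (1 / E)"
proof -
  have p: "x powr (1/4) > 0" using x by simp
  have q: "(x powr (1/4))\<^sup>2 = sqrt x"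
  proof -
    have "(x powr (1/4))\<^sup>2 = x powr (1/4 + 1/4)" by (simp only: powr_add power2_eq_square)
    then show ?thesis using x by (simp add: powr_half_sqrt)
  qed
  have "(x powr (1/4) * y * E)\<^sup>2 \<le> (sqrt K * sqrt r)\<^sup>2"
    unfolding power_mult_distrib q using le K r by simp
  then have "x powr (1/4) * y * E \<le> sqrt K * sqrt r"
    by (rule power2_le_imp_le) (use K r in auto)
  also have "\<dots> \<le> sqrt K * (sqrt r * b)" using b K r by (intro mult_left_mono) auto
  finally have "x powr (1/4) * y * E \<le> sqrt K * (sqrt r * b)" .
  then have "y \<le> sqrt K * (sqrt r * b) / (x powr (1/4) * E)"
    using p E by (simp add: pos_le_divide_eq mult_ac)
  then show ?thesis using r by (simp add: powr_half_sqrt mult_ac)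
qed

lemma imaginary_square:
  assumes "Re \<tau> = 0"
  shows "\<tau>\<^sup>2 = - complex_of_real ((cmod \<tau>)\<^sup>2)"
  unfolding cmod_power2 using assms by (intro complex_eqI) (simp_all add: power2_eq_square)

text \<open>Each range pairs one lower mass bound with \<open>period_reduction\<close>. Real and
  imaginary part of the profile contribute equally, hence the constant
  \<open>sqrt (2 * A * N)\<close> in all three cases.\<close>

theorem theorem2:
  fixes \<Gamma> :: "'n::finite option lmat set" and d :: nat
  assumes "d = CARD('n) + 1"
    and "lattice_in O1 \<Gamma>"
    and "torsion_free (matrix_group O1) \<Gamma>"
    and "uniform_lattice_in cycle_group (\<Gamma> \<inter> cycle_group)"
    and "embedding_map
           (dcoset_topology (\<Gamma> \<inter> cycle_group) cycle_group (K1 \<inter> cycle_group))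
           (dcoset_topology \<Gamma> O1 K1) (natural_map \<Gamma>)"
  shows "(\<forall>D>0. \<exists>R>0. \<exists>A>0. \<forall>\<phi> \<psi> ev ev' \<tau> \<tau>'.
            normalized_maass_form (X_proj \<Gamma>) ev \<phi> \<and> normalized_maass_form (Y_proj \<Gamma>) ev' \<psi> \<and>
            ev = ((of_nat d - 1) / 2)\<^sup>2 - \<tau>\<^sup>2 \<and> ev' = ((of_nat d - 2) / 2)\<^sup>2 - \<tau>'\<^sup>2 \<and>
            Re \<tau> = 0 \<and> Re \<tau>' = 0 \<and> cmod \<tau> \<ge> R \<and> cmod \<tau>' \<ge> R \<and>
            \<bar>cmod \<tau> - cmod \<tau>'\<bar> < D
            \<longrightarrow> cmod (period \<Gamma> \<phi> \<psi>) \<le> A * cmod \<tau> powr (real d / 2 - 3 / 4))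
       \<and> (\<exists>R>0. \<exists>A>0. \<forall>\<phi> \<psi> ev ev' \<tau> \<tau>'.
            normalized_maass_form (X_proj \<Gamma>) ev \<phi> \<and> normalized_maass_form (Y_proj \<Gamma>) ev' \<psi> \<and>
            ev = ((of_nat d - 1) / 2)\<^sup>2 - \<tau>\<^sup>2 \<and> ev' = ((of_nat d - 2) / 2)\<^sup>2 - \<tau>'\<^sup>2 \<and>
            Re \<tau> = 0 \<and> Re \<tau>' = 0 \<and> cmod \<tau> \<ge> R \<and> cmod \<tau>' \<ge> R \<and>
            cmod \<tau> - cmod \<tau>' \<ge> R
            \<longrightarrow> cmod (period \<Gamma> \<phi> \<psi>) \<le>
                A * (cmod \<tau> powr (1 / 2) * cmod \<tau>' powr ((real d - 2) / 2)
                     / ((cmod \<tau>)\<^sup>2 - (cmod \<tau>')\<^sup>2) powr (1 / 4)))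
       \<and> (\<forall>C>1. \<exists>R>0. \<exists>A>0. \<forall>\<phi> \<psi> ev ev' \<tau> \<tau>'.
            normalized_maass_form (X_proj \<Gamma>) ev \<phi> \<and> normalized_maass_form (Y_proj \<Gamma>) ev' \<psi> \<and>
            ev = ((of_nat d - 1) / 2)\<^sup>2 - \<tau>\<^sup>2 \<and> ev' = ((of_nat d - 2) / 2)\<^sup>2 - \<tau>'\<^sup>2 \<and>
            Re \<tau> = 0 \<and> Re \<tau>' = 0 \<and> cmod \<tau> \<ge> R \<and> cmod \<tau>' \<ge> R \<and>
            cmod \<tau>' - cmod \<tau> \<ge> R \<and> cmod \<tau> < cmod \<tau>' \<and> cmod \<tau>' < C * cmod \<tau>
            \<longrightarrow> cmod (period \<Gamma> \<phi> \<psi>) \<le>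
                A * (cmod \<tau> powr (1 / 2) * cmod \<tau>' powr ((real d - 2) / 2)
                     / ((cmod \<tau>')\<^sup>2 - (cmod \<tau>)\<^sup>2) powr (1 / 4))
                  * exp (- (pi / 2) * (cmod \<tau>' - cmod \<tau>)))"
proof -
  note red = period_reduction[OF assms(2-4)]
  \<comment> \<open>Purely imaginary parameters give real eigenvalues, and with
    \<open>d = n + 1\<close> they take exactly the form that \<open>period_reduction\<close>
    expects.\<close>
  have evs: "((of_nat d - 1) / 2)\<^sup>2 - \<tau>\<^sup>2 = complex_of_real ((real CARD('n) / 2)\<^sup>2 + (cmod \<tau>)\<^sup>2)"
    "((of_nat d - 2) / 2)\<^sup>2 - \<tau>\<^sup>2 = complex_of_real ((real CARD('n) / 2 - 1/2)\<^sup>2 + (cmod \<tau>)\<^sup>2)" if "Re \<tau> = 0" for \<tau>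
    unfolding imaginary_square[OF that] assms(1) by (simp_all add: diff_divide_distrib)
  have d2: "real d \<ge> 2" using assms(1) by (simp add: Suc_leI)
  show ?thesis
  proof (intro conjI allI impI)
    fix D :: real assume D: "D > 0"
    obtain R A where R: "R \<ge> 1" and A: "A > 0" and ode: "\<And>r s v w. r \<ge> R \<Longrightarrow> s \<ge> R \<Longrightarrow> \<bar>r - s\<bar> < D \<Longrightarrow> profile_ode r s v w \<Longrightarrow>
        (v 0)\<^sup>2 \<le> A * sqrt r * integral {0..1} (\<lambda>t. (v t)\<^sup>2)"
      using mass_transition[OF D] unfolding profile_ode_def by blast
    obtain N where N: "N > 0" and per: "\<And>\<phi> \<psi> r s. normalized_maass_form (X_proj \<Gamma>) (complex_of_real ((real CARD('n) / 2)\<^sup>2 + r\<^sup>2)) \<phi> \<Longrightarrow>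
      normalized_maass_form (Y_proj \<Gamma>) (complex_of_real ((real CARD('n) / 2 - 1/2)\<^sup>2 + s\<^sup>2)) \<psi> \<Longrightarrow>
      (\<exists>v1 w1 v2 w2. profile_ode r s v1 w1 \<and> profile_ode r s v2 w2 \<and> (cmod (period \<Gamma> \<phi> \<psi>))\<^sup>2 = (v1 0)\<^sup>2 + (v2 0)\<^sup>2 \<and>
        integral {0..1} (\<lambda>t. (v1 t)\<^sup>2) \<le> N \<and> integral {0..1} (\<lambda>t. (v2 t)\<^sup>2) \<le> N)"
      using red[OF zero_less_one] by blast
    let ?A = "sqrt (2 * A * N)"
    have key: "cmod (period \<Gamma> \<phi> \<psi>) \<le> ?A * cmod \<tau> powr (real d / 2 - 3 / 4)"
      if H: "normalized_maass_form (X_proj \<Gamma>) ev \<phi>" "normalized_maass_form (Y_proj \<Gamma>) ev' \<psi>"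
        "ev = ((of_nat d - 1) / 2)\<^sup>2 - \<tau>\<^sup>2" "ev' = ((of_nat d - 2) / 2)\<^sup>2 - \<tau>'\<^sup>2" "Re \<tau> = 0" "Re \<tau>' = 0"
        and r: "cmod \<tau> \<ge> R" "cmod \<tau>' \<ge> R" "\<bar>cmod \<tau> - cmod \<tau>'\<bar> < D" for \<phi> \<psi> ev ev' \<tau> \<tau>'
    proof -
      let ?r = "cmod \<tau>"
      have r1: "?r \<ge> 1" using r R by simp
      obtain v1 w1 v2 w2 where v: "profile_ode ?r (cmod \<tau>') v1 w1" "profile_ode ?r (cmod \<tau>') v2 w2"
        "(cmod (period \<Gamma> \<phi> \<psi>))\<^sup>2 = (v1 0)\<^sup>2 + (v2 0)\<^sup>2"
        "integral {0..1} (\<lambda>t. (v1 t)\<^sup>2) \<le> N" "integral {0..1} (\<lambda>t. (v2 t)\<^sup>2) \<le> N"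
        using per[OF H(1)[unfolded H(3) evs(1)[OF H(5)]] H(2)[unfolded H(4) evs(2)[OF H(6)]]] by blast
      have b: "(u 0)\<^sup>2 \<le> A * sqrt ?r * N" if "profile_ode ?r (cmod \<tau>') u w" "integral {0..1} (\<lambda>t. (u t)\<^sup>2) \<le> N" for u w
        by (rule order_trans[OF ode[OF r that(1)] mult_left_mono[OF that(2)]]) (use A in simp)
      have "sqrt 1 * (cmod (period \<Gamma> \<phi> \<psi>))\<^sup>2 * 1\<^sup>2 \<le> (2 * A * N) * sqrt ?r"
        unfolding v(3) using b[OF v(1,4)] b[OF v(2,5)] by (simp add: algebra_simps)
      moreover have "\<tau> \<noteq> 0" using r1 by auto
      ultimately have "cmod (period \<Gamma> \<phi> \<psi>) \<le> ?A * sqrt ?r powr (1/2)"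
        using root_bound[of 1 "cmod (period \<Gamma> \<phi> \<psi>)" 1 "2 * A * N" "sqrt ?r" 1] A N by simp
      also have "sqrt ?r powr (1/2) = ?r powr (1/4)"
        using r1 by (simp add: powr_half_sqrt[symmetric] powr_powr)
      \<comment> \<open>\<open>d \<ge> 2\<close> makes \<open>d / 2 - 3 / 4\<close> at least 1/4,
        and the base is at least 1.\<close>
      also have "?A * ?r powr (1/4) \<le> ?A * ?r powr (real d / 2 - 3 / 4)"
        using d2 r1 A N by (intro mult_left_mono powr_mono) auto
      finally show ?thesis .
    qed
    show "\<exists>R>0. \<exists>A>0. \<forall>\<phi> \<psi> ev ev' \<tau> \<tau>'.
            normalized_maass_form (X_proj \<Gamma>) ev \<phi> \<and> normalized_maass_form (Y_proj \<Gamma>) ev' \<psi> \<and>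
            ev = ((of_nat d - 1) / 2)\<^sup>2 - \<tau>\<^sup>2 \<and> ev' = ((of_nat d - 2) / 2)\<^sup>2 - \<tau>'\<^sup>2 \<and>
            Re \<tau> = 0 \<and> Re \<tau>' = 0 \<and> cmod \<tau> \<ge> R \<and> cmod \<tau>' \<ge> R \<and>
            \<bar>cmod \<tau> - cmod \<tau>'\<bar> < D
            \<longrightarrow> cmod (period \<Gamma> \<phi> \<psi>) \<le> A * cmod \<tau> powr (real d / 2 - 3 / 4)"
    proof (rule exI[of _ R], rule conjI[OF _ exI[of _ ?A]], goal_cases)
      case 2
      show ?case
      proof (rule conjI, goal_cases)
        case 2
        show ?case by (intro allI impI, elim conjE) (rule key; assumption)
      qed (use A N in simp)
    qed (use R in simp)
  next
    obtain R A where R: "R \<ge> 1" and A: "A > 0" and ode: "\<And>r s v w. r \<ge> R \<Longrightarrow> s \<ge> R \<Longrightarrow> r - s \<ge> R \<Longrightarrow> profile_ode r s v w \<Longrightarrow>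
        sqrt (r\<^sup>2 - s\<^sup>2) * (v 0)\<^sup>2 \<le> A * r * integral {0..2} (\<lambda>t. (v t)\<^sup>2)"
      using mass_oscillating unfolding profile_ode_def by blast
    obtain N where N: "N > 0" and per: "\<And>\<phi> \<psi> r s. normalized_maass_form (X_proj \<Gamma>) (complex_of_real ((real CARD('n) / 2)\<^sup>2 + r\<^sup>2)) \<phi> \<Longrightarrow>
      normalized_maass_form (Y_proj \<Gamma>) (complex_of_real ((real CARD('n) / 2 - 1/2)\<^sup>2 + s\<^sup>2)) \<psi> \<Longrightarrow>
      (\<exists>v1 w1 v2 w2. profile_ode r s v1 w1 \<and> profile_ode r s v2 w2 \<and> (cmod (period \<Gamma> \<phi> \<psi>))\<^sup>2 = (v1 0)\<^sup>2 + (v2 0)\<^sup>2 \<and>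
        integral {0..2} (\<lambda>t. (v1 t)\<^sup>2) \<le> N \<and> integral {0..2} (\<lambda>t. (v2 t)\<^sup>2) \<le> N)"
      using red[of 2] by auto
    let ?A = "sqrt (2 * A * N)"
    have key: "cmod (period \<Gamma> \<phi> \<psi>) \<le> ?A * (cmod \<tau> powr (1 / 2) * cmod \<tau>' powr ((real d - 2) / 2)
                     / ((cmod \<tau>)\<^sup>2 - (cmod \<tau>')\<^sup>2) powr (1 / 4))"
      if H: "normalized_maass_form (X_proj \<Gamma>) ev \<phi>" "normalized_maass_form (Y_proj \<Gamma>) ev' \<psi>"
        "ev = ((of_nat d - 1) / 2)\<^sup>2 - \<tau>\<^sup>2" "ev' = ((of_nat d - 2) / 2)\<^sup>2 - \<tau>'\<^sup>2" "Re \<tau> = 0" "Re \<tau>' = 0"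
        and r: "cmod \<tau> \<ge> R" "cmod \<tau>' \<ge> R" "cmod \<tau> - cmod \<tau>' \<ge> R" for \<phi> \<psi> ev ev' \<tau> \<tau>'
    proof -
      let ?r = "cmod \<tau>" and ?s = "cmod \<tau>'"
      obtain v1 w1 v2 w2 where v: "profile_ode ?r ?s v1 w1" "profile_ode ?r ?s v2 w2"
        "(cmod (period \<Gamma> \<phi> \<psi>))\<^sup>2 = (v1 0)\<^sup>2 + (v2 0)\<^sup>2"
        "integral {0..2} (\<lambda>t. (v1 t)\<^sup>2) \<le> N" "integral {0..2} (\<lambda>t. (v2 t)\<^sup>2) \<le> N"
        using per[OF H(1)[unfolded H(3) evs(1)[OF H(5)]] H(2)[unfolded H(4) evs(2)[OF H(6)]]] by blast
      have b: "sqrt (?r\<^sup>2 - ?s\<^sup>2) * (u 0)\<^sup>2 \<le> A * ?r * N" if "profile_ode ?r ?s u w" "integral {0..2} (\<lambda>t. (u t)\<^sup>2) \<le> N" for u w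
        by (rule order_trans[OF ode[OF r that(1)] mult_left_mono[OF that(2)]]) (use A in simp)
      have le: "sqrt (?r\<^sup>2 - ?s\<^sup>2) * (cmod (period \<Gamma> \<phi> \<psi>))\<^sup>2 * 1\<^sup>2 \<le> (2 * A * N) * ?r"
        unfolding v(3) distrib_left using b[OF v(1,4)] b[OF v(2,5)] by (simp add: algebra_simps)
      have "?s < ?r" using r R by linarith
      then have pos: "?r\<^sup>2 - ?s\<^sup>2 > 0" by (simp add: power_strict_mono)
      have p: "?r > 0" using r(1) R by linarith
      \<comment> \<open>The exponent is nonnegative and the base at least 1, so this factor can be
        inserted into the bound from the profile.\<close>
      have sp: "?s powr ((real d - 2) / 2) \<ge> 1" using r R d2 by (intro ge_one_powr_ge_zero) auto
      have "cmod (period \<Gamma> \<phi> \<psi>) \<le> ?A * (?r powr (1 / 2) * ?s powr ((real d - 2) / 2) / (?r\<^sup>2 - ?s\<^sup>2) powr (1 / 4)) * (1 / 1)"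
        by (rule root_bound[OF le pos zero_less_one _ p sp]) (use A N in simp)
      then show ?thesis by (simp only: div_by_1 mult_1_right)
    qed
    show "\<exists>R>0. \<exists>A>0. \<forall>\<phi> \<psi> ev ev' \<tau> \<tau>'.
            normalized_maass_form (X_proj \<Gamma>) ev \<phi> \<and> normalized_maass_form (Y_proj \<Gamma>) ev' \<psi> \<and>
            ev = ((of_nat d - 1) / 2)\<^sup>2 - \<tau>\<^sup>2 \<and> ev' = ((of_nat d - 2) / 2)\<^sup>2 - \<tau>'\<^sup>2 \<and>
            Re \<tau> = 0 \<and> Re \<tau>' = 0 \<and> cmod \<tau> \<ge> R \<and> cmod \<tau>' \<ge> R \<and>
            cmod \<tau> - cmod \<tau>' \<ge> R
            \<longrightarrow> cmod (period \<Gamma> \<phi> \<psi>) \<le>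
                A * (cmod \<tau> powr (1 / 2) * cmod \<tau>' powr ((real d - 2) / 2)
                     / ((cmod \<tau>)\<^sup>2 - (cmod \<tau>')\<^sup>2) powr (1 / 4))"
    proof (rule exI[of _ R], rule conjI[OF _ exI[of _ ?A]], goal_cases)
      case 2
      show ?case
      proof (rule conjI, goal_cases)
        case 2
        show ?case by (intro allI impI, elim conjE) (rule key; assumption)
      qed (use A N in simp)
    qed (use R in simp)
  next
    fix C :: real assume C: "C > 1"
    \<comment> \<open>The tube length has to be fixed by \<open>C\<close> first, because the
      multiplicity bound \<open>N\<close> below depends on it.\<close>
    from mass_tunnelling[OF C] obtain R A T where R: "R \<ge> 1" and A: "A > 0" and T: "T > 0"
      and tun: "\<forall>r s v w. r \<ge> R \<longrightarrow> s \<ge> R \<longrightarrow> s - r \<ge> R \<longrightarrow> s < C * r \<longrightarrow>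
        (\<forall>t. (v has_real_derivative w t) (at t)) \<longrightarrow>
        (\<forall>t. (w has_real_derivative ((s\<^sup>2 + 1/4) * (1 - (tanh t)\<^sup>2) - r\<^sup>2) * v t) (at t)) \<longrightarrow> w 0 = 0 \<longrightarrow>
        sqrt (s\<^sup>2 - r\<^sup>2) * (v 0)\<^sup>2 * exp (pi * (s - r)) \<le> A * r * integral {0..T} (\<lambda>t. (v t)\<^sup>2)"
      by (elim exE conjE) (rule that)
    have ode: "sqrt (s\<^sup>2 - r\<^sup>2) * (v 0)\<^sup>2 * exp (pi * (s - r)) \<le> A * r * integral {0..T} (\<lambda>t. (v t)\<^sup>2)"
      if "r \<ge> R" "s \<ge> R" "s - r \<ge> R" "s < C * r" "profile_ode r s v w" for r s v w
      using tun[THEN spec, THEN spec, THEN spec, THEN spec, of r s v w] that unfolding profile_ode_def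
      by (elim conjE) (drule (1) mp)+
    obtain N where N: "N > 0" and per: "\<And>\<phi> \<psi> r s. normalized_maass_form (X_proj \<Gamma>) (complex_of_real ((real CARD('n) / 2)\<^sup>2 + r\<^sup>2)) \<phi> \<Longrightarrow>
      normalized_maass_form (Y_proj \<Gamma>) (complex_of_real ((real CARD('n) / 2 - 1/2)\<^sup>2 + s\<^sup>2)) \<psi> \<Longrightarrow>
      (\<exists>v1 w1 v2 w2. profile_ode r s v1 w1 \<and> profile_ode r s v2 w2 \<and> (cmod (period \<Gamma> \<phi> \<psi>))\<^sup>2 = (v1 0)\<^sup>2 + (v2 0)\<^sup>2 \<and>
        integral {0..T} (\<lambda>t. (v1 t)\<^sup>2) \<le> N \<and> integral {0..T} (\<lambda>t. (v2 t)\<^sup>2) \<le> N)"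
      using red[OF T] by blast
    let ?A = "sqrt (2 * A * N)"
    have key: "cmod (period \<Gamma> \<phi> \<psi>) \<le> ?A * (cmod \<tau> powr (1 / 2) * cmod \<tau>' powr ((real d - 2) / 2)
                     / ((cmod \<tau>')\<^sup>2 - (cmod \<tau>)\<^sup>2) powr (1 / 4)) * exp (- (pi / 2) * (cmod \<tau>' - cmod \<tau>))"
      if H: "normalized_maass_form (X_proj \<Gamma>) ev \<phi>" "normalized_maass_form (Y_proj \<Gamma>) ev' \<psi>"
        "ev = ((of_nat d - 1) / 2)\<^sup>2 - \<tau>\<^sup>2" "ev' = ((of_nat d - 2) / 2)\<^sup>2 - \<tau>'\<^sup>2" "Re \<tau> = 0" "Re \<tau>' = 0"
        and r: "cmod \<tau> \<ge> R" "cmod \<tau>' \<ge> R" "cmod \<tau>' - cmod \<tau> \<ge> R" "cmod \<tau>' < C * cmod \<tau>" for \<phi> \<psi> ev ev' \<tau> \<tau>'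
    proof -
      let ?r = "cmod \<tau>" and ?s = "cmod \<tau>'"
      obtain v1 w1 v2 w2 where v: "profile_ode ?r ?s v1 w1" "profile_ode ?r ?s v2 w2"
        "(cmod (period \<Gamma> \<phi> \<psi>))\<^sup>2 = (v1 0)\<^sup>2 + (v2 0)\<^sup>2"
        "integral {0..T} (\<lambda>t. (v1 t)\<^sup>2) \<le> N" "integral {0..T} (\<lambda>t. (v2 t)\<^sup>2) \<le> N"
        using per[OF H(1)[unfolded H(3) evs(1)[OF H(5)]] H(2)[unfolded H(4) evs(2)[OF H(6)]]] by blast
      have b: "sqrt (?s\<^sup>2 - ?r\<^sup>2) * (u 0)\<^sup>2 * exp (pi * (?s - ?r)) \<le> A * ?r * N"
        if "profile_ode ?r ?s u w" "integral {0..T} (\<lambda>t. (u t)\<^sup>2) \<le> N" for u w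
        by (rule order_trans[OF ode[OF r that(1)] mult_left_mono[OF that(2)]]) (use A in simp)
      \<comment> \<open>Half of the exponent in \<open>ode\<close>, because the period enters
        squared.\<close>
      let ?E = "exp (pi / 2 * (?s - ?r))"
      have E: "?E\<^sup>2 = exp (pi * (?s - ?r))" by (simp add: exp_double[symmetric])
      have le: "sqrt (?s\<^sup>2 - ?r\<^sup>2) * (cmod (period \<Gamma> \<phi> \<psi>))\<^sup>2 * ?E\<^sup>2 \<le> (2 * A * N) * ?r"
        unfolding v(3) E distrib_left distrib_right
        by (rule order_trans[OF add_mono[OF b[OF v(1,4)] b[OF v(2,5)]]]) (simp add: mult_ac)
      have "?r < ?s" using r R by linarith
      then have pos: "?s\<^sup>2 - ?r\<^sup>2 > 0" by (simp add: power_strict_mono)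
      have p: "?r > 0" using r(1) R by linarith
      have sp: "?s powr ((real d - 2) / 2) \<ge> 1" using r R d2 by (intro ge_one_powr_ge_zero) auto
      have "cmod (period \<Gamma> \<phi> \<psi>) \<le> ?A * (?r powr (1 / 2) * ?s powr ((real d - 2) / 2) / (?s\<^sup>2 - ?r\<^sup>2) powr (1 / 4)) * (1 / ?E)"
        by (rule root_bound[OF le pos exp_gt_zero _ p sp]) (use A N in simp)
      moreover have "1 / ?E = exp (- (pi / 2) * (?s - ?r))" by (simp only: exp_minus inverse_eq_divide mult_minus_left)
      ultimately show ?thesis by (simp only:)
    qed
    show "\<exists>R>0. \<exists>A>0. \<forall>\<phi> \<psi> ev ev' \<tau> \<tau>'.
            normalized_maass_form (X_proj \<Gamma>) ev \<phi> \<and> normalized_maass_form (Y_proj \<Gamma>) ev' \<psi> \<and>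
            ev = ((of_nat d - 1) / 2)\<^sup>2 - \<tau>\<^sup>2 \<and> ev' = ((of_nat d - 2) / 2)\<^sup>2 - \<tau>'\<^sup>2 \<and>
            Re \<tau> = 0 \<and> Re \<tau>' = 0 \<and> cmod \<tau> \<ge> R \<and> cmod \<tau>' \<ge> R \<and>
            cmod \<tau>' - cmod \<tau> \<ge> R \<and> cmod \<tau> < cmod \<tau>' \<and> cmod \<tau>' < C * cmod \<tau>
            \<longrightarrow> cmod (period \<Gamma> \<phi> \<psi>) \<le>
                A * (cmod \<tau> powr (1 / 2) * cmod \<tau>' powr ((real d - 2) / 2)
                     / ((cmod \<tau>')\<^sup>2 - (cmod \<tau>)\<^sup>2) powr (1 / 4))
                  * exp (- (pi / 2) * (cmod \<tau>' - cmod \<tau>))"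
    proof (rule exI[of _ R], rule conjI[OF _ exI[of _ ?A]], goal_cases)
      case 2
      show ?case
      proof (rule conjI, goal_cases)
        case 2
        show ?case by (intro allI impI, elim conjE) (rule key; assumption)
      qed (use A N in simp)
    qed (use R in simp)
  qed
qed

end
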